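(* (1) Let $M$ be a simple $B_q(\mathfrak g)$-module belonging to $\mathcal O(B_q)$. Then there exists some $\lambda\in\mathcal P$ such that $M\cong H(\lambda)$. (2) Suppose that $M\in\mathcal O(B_q)$. Then $M$ is semisimple.
   Context: All vector spaces and tensor products are over $\mathbb C$. Let $q\in\mathbb{C}^*$ be not a root of unity; powers $q^r$, $r\in\mathbb Q$, are taken with respect to a fixed homomorphism $\mathbb Q\to\mathbb C^*$, $1\mapsto q$. Let $\mathfrak g$ be a finite dimensional complex semisimple Lie algebra with Cartan subalgebra $\mathfrak h$, $n=\dim\mathfrak h$, simple roots $\alpha_1,\dots,\alpha_n$, root lattice $Q$, weight lattice $\mathcal P$, $\mathcal P_+=\mathcal P\cap(\mathbb Q\otimes_{\mathbb Z}Q)$, $(\cdot,\cdot)$ the inner product on $\mathfrak h^*$ given by the Killing form, $q_i=q^{(\alpha_i,\alpha_i)/2}$. $\widetilde{U_q^+}$ is the Hopf algebra generated by $e_i$ ($1\le i\le n$), $t_\lambda^{\pm1}$ ($\lambda\in\mathcal P_+$) with relations $t_\lambda t_\mu=t_{\lambda+\mu}$, $t_0=1$, $t_\lambda e_it_\lambda^{-1}=q^{(\alpha_i,\lambda)}e_i$, and $\Delta(t_\lambda)=t_\lambda\otimes t_\lambda$, $\Delta(e_i)=e_i\otimes t_i^{-1}+1\otimes e_i$, $\varepsilon(e_i)=0$, $\varepsilon(t_\lambda)=1$, where $t_i=t_{\alpha_i}$. $\widetilde{U_q^-}$ is the Hopf algebra generated by $f_i$, ${t'_\lambda}^{\pm1}$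 with relations $t'_\lambda t'_\mu=t'_{\lambda+\mu}$, $t'_0=1$, $t'_\lambda f_i{t'_\lambda}^{-1}=q^{-(\alpha_i,\lambda)}f_i$, and $\Delta(t'_\lambda)=t'_\lambda\otimes t'_\lambda$, $\Delta(f_i)=f_i\otimes1+t'_i\otimes f_i$, $\varepsilon(f_i)=0$, $\varepsilon(t'_\lambda)=1$, where $t'_i=t'_{\alpha_i}$. The bilinear form $\varphi:\widetilde{U_q^+}\times\widetilde{U_q^-}\to\mathbb C$ is determined by $\varphi(a,bb')=\sum\varphi(a_{(1)},b)\varphi(a_{(2)},b')$, $\varphi(aa',b)=\sum\varphi(a,b_{(2)})\varphi(a',b_{(1)})$, $\varphi(a,1)=\varepsilon(a)$, $\varphi(1,b)=\varepsilon(b)$ and $\varphi(e_i,f_j)=\delta_{ij}/(q_i^{-1}-q_i)$, $\varphi(t_\lambda,t'_\mu)=q^{-(\lambda,\mu)}$, $\varphi(e_i,t'_\lambda)=\varphi(t_\lambda,f_i)=0$. $U_q^+$ and $U_q^-$ are the quotients of $\widetilde{U_q^+},\widetilde{U_q^-}$ by the left and right radicals of $\varphi$; $\varphi$ also denotes the induced nondegenerate pairing. Put $e_i'=(q_i^{-1}-q_i)t_ie_i$, so $\varphi(e_i',f_j)=\delta_{ij}$. The Heisenberg double $H_\varphi(U_q^+,U_q^-)$ is $U_q^-\otimes U_q^+$ (pure tensors $b\sharp a$) with product $(b\sharp a)(b'\sharp a')=\sum\varphi(a_{(1)},b'_{(1)})\,bb'_{(2)}\sharp a_{(2)}a'$.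 The q-Boson algebra is $B_q=B_q(\mathfrak g)=H_\varphi(U_q^+,U_q^-)/(t_\lambda-t'_\lambda:\lambda\in\mathcal P_+)$; in it $t_\lambda e_i't_\lambda^{-1}=q^{(\alpha_i,\lambda)}e_i'$, $t_\lambda f_it_\lambda^{-1}=q^{-(\alpha_i,\lambda)}f_i$, $e_i'f_j=q^{-(\alpha_i,\alpha_j)}f_je_i'+\delta_{ij}$. $\mathcal O(B_q)$ is the full subcategory of left $B_q$-modules $M$ such that: (i) $M=\bigoplus_{\lambda\in\mathcal P}M_\lambda$, $M_\lambda=\{m\in M\mid t_\mu.m=q^{(\mu,\lambda)}m\ \text{for all }\mu\in\mathcal P_+\}$; (ii) for any $m\in M$ there is an integer $l>0$ such that $e_{i_1}'\cdots e_{i_l}'.m=0$ for all $1\le i_1,\dots,i_l\le n$. For $\lambda\in\mathcal P$, $I_\lambda=\sum_iB_qe_i'+\sum_{\alpha\in\mathcal P_+}B_q(t_\alpha-q^{(\lambda,\alpha)})$ is a left ideal of $B_q$ and $H(\lambda)=B_q/I_\lambda$. *)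

theory Defs
  imports
    Complex_Main
    "HOL-Library.Poly_Mapping"
    "HOL-Library.Product_Plus"
    "HOL-Library.Function_Algebras"
    "HOL-Algebra.QuotRing"
    "HOL-Algebra.Module"
    "HOL-Algebra.Generated_Groups"
    "HOL-Algebra.Generated_Rings"
begin

section \<open>Semisimple Lie algebras, roots and weights\<close>

text \<open>The value does not depend on the basis used.\<close>

definition (in vector_space) trace :: "('b \<Rightarrow> 'b) \<Rightarrow> 'a" where
  "trace f = (\<Sum>b\<in>extend_basis {}. representation (extend_basis {}) (f b) b)"

locale lie_algebra = vector_space scale
  for scale :: "complex \<Rightarrow> 'g::ab_group_add \<Rightarrow> 'g" +
  fixes brk :: "'g \<Rightarrow> 'g \<Rightarrow> 'g"
  assumes finite_dim: "\<exists>B. finite B \<and> span B = UNIV"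
    and brk_linear_left: "\<And>y. Vector_Spaces.linear scale scale (\<lambda>x. brk x y)"
    and brk_linear_right: "\<And>x. Vector_Spaces.linear scale scale (brk x)"
    and brk_self: "\<And>x. brk x x = 0"
    and jacobi: "\<And>x y z. brk x (brk y z) + brk y (brk z x) + brk z (brk x y) = 0"
begin

definition killing :: "'g \<Rightarrow> 'g \<Rightarrow> complex" where
  "killing x y = trace (\<lambda>z. brk x (brk y z))"

definition lie_ideal :: "'g set \<Rightarrow> bool" where
  "lie_ideal I \<longleftrightarrow> subspace I \<and> (\<forall>x. \<forall>y\<in>I. brk x y \<in> I)"

definition derived :: "'g set \<Rightarrow> 'g set" where
  "derived I = span {brk x y |x y. x \<in> I \<and> y \<in> I}"

definition solvable :: "'g set \<Rightarrow> bool" where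
  "solvable I \<longleftrightarrow> (\<exists>k. (derived ^^ k) I = {0})"

definition semisimple :: bool where
  "semisimple \<longleftrightarrow> (\<forall>I. lie_ideal I \<and> solvable I \<longrightarrow> I = {0})"

definition abelian :: "'g set \<Rightarrow> bool" where
  "abelian h \<longleftrightarrow> subspace h \<and> (\<forall>x\<in>h. \<forall>y\<in>h. brk x y = 0)"

definition diagonalizable :: "('g \<Rightarrow> 'g) \<Rightarrow> bool" where
  "diagonalizable f \<longleftrightarrow> span {v. \<exists>c. f v = scale c v} = UNIV"

text \<open>A Cartan subalgebra of a complex semisimple Lie algebra is a maximal abelian subalgebra
  whose elements are ad-semisimple.\<close>

definition cartan_subalgebra :: "'g set \<Rightarrow> bool" where
  "cartan_subalgebra h \<longleftrightarrow> abelian h \<and> (\<forall>h'. abelian h' \<and> h \<subseteq> h' \<longrightarrow> h' = h)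
    \<and> (\<forall>x\<in>h. diagonalizable (brk x))"

text \<open>The dual of \<open>h\<close>: linear functionals on \<open>h\<close>, extended by zero outside of \<open>h\<close>, so that
  equality of functionals is equality of functions.\<close>

definition dual :: "'g set \<Rightarrow> ('g \<Rightarrow> complex) set" where
  "dual h = {f. (\<forall>x\<in>h. \<forall>y\<in>h. f (x + y) = f x + f y) \<and>
    (\<forall>c. \<forall>x\<in>h. f (scale c x) = c * f x) \<and> (\<forall>x. x \<notin> h \<longrightarrow> f x = 0)}"

definition roots :: "'g set \<Rightarrow> ('g \<Rightarrow> complex) set" where
  "roots h = {\<beta> \<in> dual h. \<beta> \<noteq> 0 \<and> (\<exists>x. x \<noteq> 0 \<and> (\<forall>y\<in>h. brk y x = scale (\<beta> y) x))}"

text \<open>The element of \<open>h\<close> representing a functional with respect to the Killing form, and the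
  bilinear form on the dual of \<open>h\<close> transported from the Killing form on \<open>h\<close>.\<close>

definition dual_vec :: "'g set \<Rightarrow> ('g \<Rightarrow> complex) \<Rightarrow> 'g" where
  "dual_vec h \<beta> = (THE x. x \<in> h \<and> (\<forall>y\<in>h. killing x y = \<beta> y))"

definition dual_form :: "'g set \<Rightarrow> ('g \<Rightarrow> complex) \<Rightarrow> ('g \<Rightarrow> complex) \<Rightarrow> complex" where
  "dual_form h \<beta> \<gamma> = killing (dual_vec h \<beta>) (dual_vec h \<gamma>)"

definition simple_roots :: "'g set \<Rightarrow> (nat \<Rightarrow> 'g \<Rightarrow> complex) \<Rightarrow> bool" where
  "simple_roots h \<alpha> \<longleftrightarrow>
    (\<forall>i\<in>{1..dim h}. \<alpha> i \<in> roots h) \<and>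
    (\<forall>c :: nat \<Rightarrow> complex. (\<forall>x. (\<Sum>i\<in>{1..dim h}. c i * \<alpha> i x) = 0)
        \<longrightarrow> (\<forall>i\<in>{1..dim h}. c i = 0)) \<and>
    (\<forall>\<beta>\<in>roots h. \<exists>k :: nat \<Rightarrow> int. \<beta> = (\<lambda>x. \<Sum>i\<in>{1..dim h}. of_int (k i) * \<alpha> i x) \<and>
        ((\<forall>i\<in>{1..dim h}. k i \<ge> 0) \<or> (\<forall>i\<in>{1..dim h}. k i \<le> 0)))"

definition weight_lattice :: "'g set \<Rightarrow> ('g \<Rightarrow> complex) set" where
  "weight_lattice h =
    {\<mu> \<in> dual h. \<forall>\<beta>\<in>roots h. 2 * dual_form h \<mu> \<beta> / dual_form h \<beta> \<beta> \<in> \<int>}"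

end


section \<open>Free algebras and their tensor products\<close>

text \<open>The free monoid, written additively, so that \<open>'x word \<Rightarrow>\<^sub>0 complex\<close> with its convolution
  product is the free algebra on \<open>'x\<close>, and \<open>('x word \<times> 'y word) \<Rightarrow>\<^sub>0 complex\<close> with its
  convolution product is the tensor product of two free algebras.\<close>

datatype 'x word = Word (letters: "'x list")

instantiation word :: (type) monoid_add
begin
definition zero_word :: "'a word" where "0 = Word []"
definition plus_word :: "'a word \<Rightarrow> 'a word \<Rightarrow> 'a word" where
  "u + v = Word (letters u @ letters v)"
instance by standard (auto simp: zero_word_def plus_word_def)
end

definition scal :: "complex \<Rightarrow> ('a::monoid_add \<Rightarrow>\<^sub>0 complex)" where
  "scal c = Poly_Mapping.single 0 c"

definition mon :: "'a \<Rightarrow> ('a \<Rightarrow>\<^sub>0 complex)" where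
  "mon w = Poly_Mapping.single w 1"

definition gen :: "'x \<Rightarrow> ('x word \<Rightarrow>\<^sub>0 complex)" where
  "gen x = mon (Word [x])"

definition tens :: "('a \<Rightarrow>\<^sub>0 complex) \<Rightarrow> ('b \<Rightarrow>\<^sub>0 complex) \<Rightarrow> ('a \<times> 'b \<Rightarrow>\<^sub>0 complex)" where
  "tens p r = (\<Sum>u\<in>Poly_Mapping.keys p. \<Sum>v\<in>Poly_Mapping.keys r.
     Poly_Mapping.single (u, v) (Poly_Mapping.lookup p u * Poly_Mapping.lookup r v))"

text \<open>The algebra homomorphism out of the free algebra determined by the images of the letters.\<close>

definition hom_ext :: "('x \<Rightarrow> ('a::monoid_add \<Rightarrow>\<^sub>0 complex)) \<Rightarrow> ('x word \<Rightarrow>\<^sub>0 complex) \<Rightarrow> ('a \<Rightarrow>\<^sub>0 complex)"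
  where "hom_ext g p =
    (\<Sum>w\<in>Poly_Mapping.keys p. scal (Poly_Mapping.lookup p w) * prod_list (map g (letters w)))"

definition char_ext :: "('x \<Rightarrow> complex) \<Rightarrow> ('x word \<Rightarrow>\<^sub>0 complex) \<Rightarrow> complex" where
  "char_ext g p = (\<Sum>w\<in>Poly_Mapping.keys p. Poly_Mapping.lookup p w * prod_list (map g (letters w)))"

definition words_over :: "'x set \<Rightarrow> 'x word set" where
  "words_over X = {w. set (letters w) \<subseteq> X}"

definition free_algebra :: "'x set \<Rightarrow> ('x word \<Rightarrow>\<^sub>0 complex) ring" where
  "free_algebra X = \<lparr>carrier = {p. Poly_Mapping.keys p \<subseteq> words_over X},
     mult = (*), one = 1, zero = 0, add = (+)\<rparr>"


section \<open>Left modules over a not necessarily commutative ring\<close>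

text \<open>The fields \<open>mult\<close> and \<open>one\<close> of a module record carry no meaning.\<close>

definition left_module :: "('b, 'r) ring_scheme \<Rightarrow> ('b, 'm, 's) module_scheme \<Rightarrow> bool" where
  "left_module B M \<longleftrightarrow> abelian_group M \<and>
    (\<forall>b\<in>carrier B. \<forall>x\<in>carrier M. b \<odot>\<^bsub>M\<^esub> x \<in> carrier M) \<and>
    (\<forall>b\<in>carrier B. \<forall>c\<in>carrier B. \<forall>x\<in>carrier M.
        (b \<oplus>\<^bsub>B\<^esub> c) \<odot>\<^bsub>M\<^esub> x = b \<odot>\<^bsub>M\<^esub> x \<oplus>\<^bsub>M\<^esub> c \<odot>\<^bsub>M\<^esub> x \<and>
        (b \<otimes>\<^bsub>B\<^esub> c) \<odot>\<^bsub>M\<^esub> x = b \<odot>\<^bsub>M\<^esub> (c \<odot>\<^bsub>M\<^esub> x)) \<and>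
    (\<forall>b\<in>carrier B. \<forall>x\<in>carrier M. \<forall>y\<in>carrier M.
        b \<odot>\<^bsub>M\<^esub> (x \<oplus>\<^bsub>M\<^esub> y) = b \<odot>\<^bsub>M\<^esub> x \<oplus>\<^bsub>M\<^esub> b \<odot>\<^bsub>M\<^esub> y) \<and>
    (\<forall>x\<in>carrier M. \<one>\<^bsub>B\<^esub> \<odot>\<^bsub>M\<^esub> x = x)"

definition simple_submodule ::
  "('b, 'r) ring_scheme \<Rightarrow> ('b, 'm, 's) module_scheme \<Rightarrow> 'm set \<Rightarrow> bool" where
  "simple_submodule B M N \<longleftrightarrow> submodule N B M \<and> N \<noteq> {\<zero>\<^bsub>M\<^esub>} \<and>
    (\<forall>L. submodule L B M \<and> L \<subseteq> N \<longrightarrow> L = {\<zero>\<^bsub>M\<^esub>} \<or> L = N)"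

definition simple_module :: "('b, 'r) ring_scheme \<Rightarrow> ('b, 'm, 's) module_scheme \<Rightarrow> bool" where
  "simple_module B M \<longleftrightarrow> left_module B M \<and> simple_submodule B M (carrier M)"

text \<open>\<open>M\<close> is the internal direct sum of the additive subgroups \<open>S i\<close>, \<open>i \<in> I\<close>.\<close>

definition direct_sum :: "('m, 's) ring_scheme \<Rightarrow> 'i set \<Rightarrow> ('i \<Rightarrow> 'm set) \<Rightarrow> bool" where
  "direct_sum M I S \<longleftrightarrow> (\<forall>i\<in>I. subgroup (S i) (add_monoid M)) \<and>
    (\<forall>m\<in>carrier M. \<exists>!f. (\<forall>i\<in>I. f i \<in> S i) \<and> (\<forall>i. i \<notin> I \<longrightarrow> f i = \<zero>\<^bsub>M\<^esub>) \<and>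
        finite {i. f i \<noteq> \<zero>\<^bsub>M\<^esub>} \<and> m = finsum M f {i. f i \<noteq> \<zero>\<^bsub>M\<^esub>})"

definition semisimple_module :: "('b, 'r) ring_scheme \<Rightarrow> ('b, 'm, 's) module_scheme \<Rightarrow> bool" where
  "semisimple_module B M \<longleftrightarrow> left_module B M \<and>
    (\<exists>S. (\<forall>N\<in>S. simple_submodule B M N) \<and> direct_sum M S (\<lambda>N. N))"

definition module_iso ::
  "('b, 'r) ring_scheme \<Rightarrow> ('b, 'm, 's) module_scheme \<Rightarrow> ('b, 'n, 't) module_scheme \<Rightarrow> bool" where
  "module_iso B M N \<longleftrightarrow> (\<exists>f. bij_betw f (carrier M) (carrier N) \<and>
    (\<forall>x\<in>carrier M. \<forall>y\<in>carrier M. f (x \<oplus>\<^bsub>M\<^esub> y) = f x \<oplus>\<^bsub>N\<^esub> f y) \<and>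
    (\<forall>b\<in>carrier B. \<forall>x\<in>carrier M. f (b \<odot>\<^bsub>M\<^esub> x) = b \<odot>\<^bsub>N\<^esub> f x))"

text \<open>The module \<open>B/I\<close> for a left ideal \<open>I\<close>.\<close>

definition quotient_module :: "('b, 'r) ring_scheme \<Rightarrow> 'b set \<Rightarrow> ('b, 'b set) module" where
  "quotient_module B I = \<lparr>carrier = a_rcosets\<^bsub>B\<^esub> I, mult = undefined, one = undefined,
     zero = I, add = set_add B, smult = (\<lambda>b X. \<Union>x\<in>X. I +>\<^bsub>B\<^esub> (b \<otimes>\<^bsub>B\<^esub> x))\<rparr>"


section \<open>The algebras \<open>U\<^sub>q\<^sup>+\<close> and \<open>U\<^sub>q\<^sup>-\<close>, the Heisenberg double and the q-Boson algebra\<close>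

text \<open>Letters \<open>e\<^sub>i\<close>, \<open>t\<^sub>\<lambda>\<close> and \<open>f\<^sub>i\<close>, \<open>t'\<^sub>\<lambda>\<close>. The inverse of \<open>t\<^sub>\<lambda>\<close> is \<open>t\<^sub>-\<^sub>\<lambda>\<close>.\<close>

datatype 'w lplus = Le nat | Lt 'w
datatype 'w lminus = Lf nat | Lt' 'w

type_synonym 'w fplus = "'w lplus word \<Rightarrow>\<^sub>0 complex"
type_synonym 'w fminus = "'w lminus word \<Rightarrow>\<^sub>0 complex"
type_synonym 'w heis = "'w lminus word \<times> 'w lplus word \<Rightarrow>\<^sub>0 complex"
type_synonym 'w form = "'w fplus set \<Rightarrow> 'w fminus set \<Rightarrow> complex"

text \<open>A ring with a structure map \<open>scalar\<close> from the complex numbers and distinguished elements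
  \<open>e\<^sub>i'\<close> and \<open>t\<^sub>\<lambda>\<close>.\<close>

record ('b, 'w) boson_algebra = "'b ring" +
  scalar :: "complex \<Rightarrow> 'b"
  eprime :: "nat \<Rightarrow> 'b"
  torus :: "'w \<Rightarrow> 'b"

text \<open>\<open>qp\<close> is the fixed homomorphism from the rationals to the nonzero complex numbers,
  with \<open>q = qp 1\<close>.\<close>

locale quantum_datum = lie_algebra scale brk
  for scale :: "complex \<Rightarrow> 'g::ab_group_add \<Rightarrow> 'g" and brk :: "'g \<Rightarrow> 'g \<Rightarrow> 'g" +
  fixes \<hh> :: "'g set" and \<alpha> :: "nat \<Rightarrow> 'g \<Rightarrow> complex" and qp :: "rat \<Rightarrow> complex"
  assumes semisimple: semisimple
    and cartan: "cartan_subalgebra \<hh>"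
    and simple_roots: "simple_roots \<hh> \<alpha>"
    and qp_nonzero: "\<And>r. qp r \<noteq> 0"
    and qp_add: "\<And>r s. qp (r + s) = qp r * qp s"
    and not_root_of_unity: "\<And>k::nat. k > 0 \<Longrightarrow> qp 1 ^ k \<noteq> 1"
begin

definition Ind :: "nat set" where "Ind = {1..dim \<hh>}"

definition form :: "('g \<Rightarrow> complex) \<Rightarrow> ('g \<Rightarrow> complex) \<Rightarrow> complex" where
  "form = dual_form \<hh>"

definition P :: "('g \<Rightarrow> complex) set" where "P = weight_lattice \<hh>"

definition P_plus :: "('g \<Rightarrow> complex) set" where
  "P_plus = {\<mu> \<in> P. \<exists>r :: nat \<Rightarrow> rat. \<mu> = (\<lambda>x. \<Sum>i\<in>Ind. of_rat (r i) * \<alpha> i x)}"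

text \<open>\<open>q\<^sup>c\<close> for a complex number \<open>c\<close> that is rational.\<close>

definition qpow :: "complex \<Rightarrow> complex" where
  "qpow c = qp (THE r. of_rat r = c)"

definition q_i :: "nat \<Rightarrow> complex" where "q_i i = qpow (form (\<alpha> i) (\<alpha> i) / 2)"

definition Fplus :: "('g \<Rightarrow> complex) fplus ring" where
  "Fplus = free_algebra (Le ` Ind \<union> Lt ` P_plus)"

definition Fminus :: "('g \<Rightarrow> complex) fminus ring" where
  "Fminus = free_algebra (Lf ` Ind \<union> Lt' ` P_plus)"

abbreviation e :: "nat \<Rightarrow> ('g \<Rightarrow> complex) fplus" where "e i \<equiv> gen (Le i)"
abbreviation t :: "('g \<Rightarrow> complex) \<Rightarrow> ('g \<Rightarrow> complex) fplus" where "t \<mu> \<equiv> gen (Lt \<mu>)"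
abbreviation f :: "nat \<Rightarrow> ('g \<Rightarrow> complex) fminus" where "f i \<equiv> gen (Lf i)"
abbreviation t' :: "('g \<Rightarrow> complex) \<Rightarrow> ('g \<Rightarrow> complex) fminus" where "t' \<mu> \<equiv> gen (Lt' \<mu>)"

definition rel_plus :: "('g \<Rightarrow> complex) fplus set" where
  "rel_plus = {t \<mu> * t \<nu> - t (\<mu> + \<nu>) |\<mu> \<nu>. \<mu> \<in> P_plus \<and> \<nu> \<in> P_plus} \<union> {t 0 - 1} \<union>
    {t \<mu> * e i * t (- \<mu>) - scal (qpow (form (\<alpha> i) \<mu>)) * e i |\<mu> i. \<mu> \<in> P_plus \<and> i \<in> Ind}"

definition rel_minus :: "('g \<Rightarrow> complex) fminus set" where
  "rel_minus = {t' \<mu> * t' \<nu> - t' (\<mu> + \<nu>) |\<mu> \<nu>. \<mu> \<in> P_plus \<and> \<nu> \<in> P_plus} \<union> {t' 0 - 1} \<union>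
    {t' \<mu> * f i * t' (- \<mu>) - scal (qpow (- form (\<alpha> i) \<mu>)) * f i |\<mu> i. \<mu> \<in> P_plus \<and> i \<in> Ind}"

definition Ut_plus :: "('g \<Rightarrow> complex) fplus set ring" where
  "Ut_plus = Fplus Quot (genideal Fplus rel_plus)"

definition Ut_minus :: "('g \<Rightarrow> complex) fminus set ring" where
  "Ut_minus = Fminus Quot (genideal Fminus rel_minus)"

definition cl_plus :: "('g \<Rightarrow> complex) fplus \<Rightarrow> ('g \<Rightarrow> complex) fplus set" where
  "cl_plus a = genideal Fplus rel_plus +>\<^bsub>Fplus\<^esub> a"

definition cl_minus :: "('g \<Rightarrow> complex) fminus \<Rightarrow> ('g \<Rightarrow> complex) fminus set" where
  "cl_minus b = genideal Fminus rel_minus +>\<^bsub>Fminus\<^esub> b"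

text \<open>Comultiplications and counits are written on the free algebras; they respect the defining
  relations.\<close>

definition \<Delta>_plus ::
  "('g \<Rightarrow> complex) fplus \<Rightarrow> (('g \<Rightarrow> complex) lplus word \<times> ('g \<Rightarrow> complex) lplus word \<Rightarrow>\<^sub>0 complex)"
  where "\<Delta>_plus = hom_ext (\<lambda>x. case x of
      Le i \<Rightarrow> tens (e i) (t (- \<alpha> i)) + tens 1 (e i)
    | Lt \<mu> \<Rightarrow> tens (t \<mu>) (t \<mu>))"

definition \<Delta>_minus ::
  "('g \<Rightarrow> complex) fminus \<Rightarrow> (('g \<Rightarrow> complex) lminus word \<times> ('g \<Rightarrow> complex) lminus word \<Rightarrow>\<^sub>0 complex)"
  where "\<Delta>_minus = hom_ext (\<lambda>x. case x of
      Lf i \<Rightarrow> tens (f i) 1 + tens (t' (\<alpha> i)) (f i)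
    | Lt' \<mu> \<Rightarrow> tens (t' \<mu>) (t' \<mu>))"

definition \<epsilon>_plus :: "('g \<Rightarrow> complex) fplus \<Rightarrow> complex" where
  "\<epsilon>_plus = char_ext (\<lambda>x. case x of Le i \<Rightarrow> 0 | Lt \<mu> \<Rightarrow> 1)"

definition \<epsilon>_minus :: "('g \<Rightarrow> complex) fminus \<Rightarrow> complex" where
  "\<epsilon>_minus = char_ext (\<lambda>x. case x of Lf i \<Rightarrow> 0 | Lt' \<mu> \<Rightarrow> 1)"

text \<open>\<open>\<phi>\<close> is a bilinear form on the product of the quotient algebras \<open>Ut_plus\<close> and \<open>Ut_minus\<close>.
  These conditions determine it uniquely.\<close>

definition hopf_pairing :: "('g \<Rightarrow> complex) form \<Rightarrow> bool" where
  "hopf_pairing \<phi> \<longleftrightarrow>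
    (\<forall>a\<in>carrier Fplus. \<forall>a'\<in>carrier Fplus. \<forall>b\<in>carrier Fminus. \<forall>c.
      \<phi> (cl_plus (a + a')) (cl_minus b) =
        \<phi> (cl_plus a) (cl_minus b) + \<phi> (cl_plus a') (cl_minus b) \<and>
      \<phi> (cl_plus (scal c * a)) (cl_minus b) = c * \<phi> (cl_plus a) (cl_minus b)) \<and>
    (\<forall>a\<in>carrier Fplus. \<forall>b\<in>carrier Fminus. \<forall>b'\<in>carrier Fminus. \<forall>c.
      \<phi> (cl_plus a) (cl_minus (b + b')) =
        \<phi> (cl_plus a) (cl_minus b) + \<phi> (cl_plus a) (cl_minus b') \<and>
      \<phi> (cl_plus a) (cl_minus (scal c * b)) = c * \<phi> (cl_plus a) (cl_minus b)) \<and>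
    (\<forall>a\<in>carrier Fplus. \<forall>b\<in>carrier Fminus. \<forall>b'\<in>carrier Fminus.
      \<phi> (cl_plus a) (cl_minus (b * b')) =
        (\<Sum>(a1, a2)\<in>Poly_Mapping.keys (\<Delta>_plus a). Poly_Mapping.lookup (\<Delta>_plus a) (a1, a2) *
           \<phi> (cl_plus (mon a1)) (cl_minus b) * \<phi> (cl_plus (mon a2)) (cl_minus b'))) \<and>
    (\<forall>a\<in>carrier Fplus. \<forall>a'\<in>carrier Fplus. \<forall>b\<in>carrier Fminus.
      \<phi> (cl_plus (a * a')) (cl_minus b) =
        (\<Sum>(b1, b2)\<in>Poly_Mapping.keys (\<Delta>_minus b). Poly_Mapping.lookup (\<Delta>_minus b) (b1, b2) *
           \<phi> (cl_plus a) (cl_minus (mon b2)) * \<phi> (cl_plus a') (cl_minus (mon b1)))) \<and>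
    (\<forall>a\<in>carrier Fplus. \<phi> (cl_plus a) (cl_minus 1) = \<epsilon>_plus a) \<and>
    (\<forall>b\<in>carrier Fminus. \<phi> (cl_plus 1) (cl_minus b) = \<epsilon>_minus b) \<and>
    (\<forall>i\<in>Ind. \<forall>j\<in>Ind. \<phi> (cl_plus (e i)) (cl_minus (f j)) =
        (if i = j then 1 / (inverse (q_i i) - q_i i) else 0)) \<and>
    (\<forall>\<mu>\<in>P_plus. \<forall>\<nu>\<in>P_plus. \<phi> (cl_plus (t \<mu>)) (cl_minus (t' \<nu>)) = qpow (- form \<mu> \<nu>)) \<and>
    (\<forall>i\<in>Ind. \<forall>\<mu>\<in>P_plus. \<phi> (cl_plus (e i)) (cl_minus (t' \<mu>)) = 0 \<and>
        \<phi> (cl_plus (t \<mu>)) (cl_minus (f i)) = 0)"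

end

locale qboson = quantum_datum scale brk \<hh> \<alpha> qp
  for scale :: "complex \<Rightarrow> 'g::ab_group_add \<Rightarrow> 'g" and brk \<hh> \<alpha> qp +
  fixes \<phi> :: "('g \<Rightarrow> complex) form"
  assumes pairing: "hopf_pairing \<phi>"
begin

definition rad_plus :: "('g \<Rightarrow> complex) fplus set set" where
  "rad_plus = {x \<in> carrier Ut_plus. \<forall>y\<in>carrier Ut_minus. \<phi> x y = 0}"

definition rad_minus :: "('g \<Rightarrow> complex) fminus set set" where
  "rad_minus = {y \<in> carrier Ut_minus. \<forall>x\<in>carrier Ut_plus. \<phi> x y = 0}"

definition Uq_plus :: "('g \<Rightarrow> complex) fplus set set ring" where
  "Uq_plus = Ut_plus Quot rad_plus"

definition Uq_minus :: "('g \<Rightarrow> complex) fminus set set ring" where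
  "Uq_minus = Ut_minus Quot rad_minus"

text \<open>The Heisenberg product on the tensor product \<open>Fminus \<otimes> Fplus\<close> of the free algebras.\<close>

definition heis_mult ::
  "('g \<Rightarrow> complex) heis \<Rightarrow> ('g \<Rightarrow> complex) heis \<Rightarrow> ('g \<Rightarrow> complex) heis" where
  "heis_mult x y =
    (\<Sum>(b, a)\<in>Poly_Mapping.keys x. \<Sum>(b', a')\<in>Poly_Mapping.keys y.
     \<Sum>(a1, a2)\<in>Poly_Mapping.keys (\<Delta>_plus (mon a)).
     \<Sum>(b1, b2)\<in>Poly_Mapping.keys (\<Delta>_minus (mon b')).
       Poly_Mapping.single (b + b2, a2 + a')
         (Poly_Mapping.lookup x (b, a) * Poly_Mapping.lookup y (b', a') *
          Poly_Mapping.lookup (\<Delta>_plus (mon a)) (a1, a2) * Poly_Mapping.lookup (\<Delta>_minus (mon b')) (b1, b2) *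
          \<phi> (cl_plus (mon a1)) (cl_minus (mon b1))))"

definition heis_free :: "('g \<Rightarrow> complex) heis ring" where
  "heis_free = \<lparr>carrier = {x. Poly_Mapping.keys x \<subseteq>
       words_over (Lf ` Ind \<union> Lt' ` P_plus) \<times> words_over (Le ` Ind \<union> Lt ` P_plus)},
     mult = heis_mult, one = 1, zero = 0, add = (+)\<rparr>"

text \<open>The kernel of the surjection \<open>Fminus \<otimes> Fplus \<rightarrow> Uq_minus \<otimes> Uq_plus\<close>: it is generated by
  the pure tensors one of whose factors vanishes in \<open>Uq_minus\<close> or \<open>Uq_plus\<close>. Hence the
  quotient by it is the vector space \<open>Uq_minus \<otimes> Uq_plus\<close> with the Heisenberg product.\<close>

definition heis_ker :: "('g \<Rightarrow> complex) heis set" where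
  "heis_ker = generate (add_monoid heis_free)
    {tens b a |b a. b \<in> carrier Fminus \<and> a \<in> carrier Fplus \<and>
      (rad_minus +>\<^bsub>Ut_minus\<^esub> cl_minus b = \<zero>\<^bsub>Uq_minus\<^esub> \<or>
       rad_plus +>\<^bsub>Ut_plus\<^esub> cl_plus a = \<zero>\<^bsub>Uq_plus\<^esub>)}"

definition Heis :: "('g \<Rightarrow> complex) heis set ring" where
  "Heis = heis_free Quot heis_ker"

text \<open>The class of the pure tensor with factors \<open>b\<close> and \<open>a\<close>.\<close>

definition sharp :: "('g \<Rightarrow> complex) fminus \<Rightarrow> ('g \<Rightarrow> complex) fplus \<Rightarrow> ('g \<Rightarrow> complex) heis set" where
  "sharp b a = heis_ker +>\<^bsub>heis_free\<^esub> tens b a"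

definition heis_scalar :: "complex \<Rightarrow> ('g \<Rightarrow> complex) heis set" where
  "heis_scalar c = sharp (scal c) 1"

definition heis_eprime :: "nat \<Rightarrow> ('g \<Rightarrow> complex) heis set" where
  "heis_eprime i = sharp 1 (scal (inverse (q_i i) - q_i i) * t (\<alpha> i) * e i)"

definition boson_ideal :: "('g \<Rightarrow> complex) heis set set" where
  "boson_ideal = genideal Heis {sharp 1 (t \<mu>) \<ominus>\<^bsub>Heis\<^esub> sharp (t' \<mu>) 1 |\<mu>. \<mu> \<in> P_plus}"

definition Bq :: "(('g \<Rightarrow> complex) heis set set, 'g \<Rightarrow> complex) boson_algebra" where
  "Bq = ring.extend (Heis Quot boson_ideal) (boson_algebra.fields
     (\<lambda>c. boson_ideal +>\<^bsub>Heis\<^esub> heis_scalar c)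
     (\<lambda>i. boson_ideal +>\<^bsub>Heis\<^esub> heis_eprime i)
     (\<lambda>\<mu>. boson_ideal +>\<^bsub>Heis\<^esub> sharp 1 (t \<mu>)))"

text \<open>In \<open>Heis\<close> one has \<open>t\<^sub>\<lambda> t'\<^sub>\<mu> = q\<^sup>-\<^sup>(\<^sup>\<lambda>\<^sup>,\<^sup>\<mu>\<^sup>) t'\<^sub>\<mu> t\<^sub>\<lambda>\<close>. Therefore the two-sided ideal
  \<open>boson_ideal\<close> contains \<open>1 - q\<^sup>-\<^sup>(\<^sup>\<lambda>\<^sup>,\<^sup>\<mu>\<^sup>)\<close> for all \<open>\<lambda>\<close>, \<open>\<mu>\<close>, and the quotient \<open>Bq\<close> collapses to
  the zero ring as soon as the Lie algebra is nonzero. The algebra in which the relations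
  \<open>t\<^sub>\<lambda> e\<^sub>i' t\<^sub>\<lambda>\<^sup>-\<^sup>1 = q\<^sup>(\<^sup>\<alpha>\<^sub>i\<^sup>,\<^sup>\<lambda>\<^sup>) e\<^sub>i'\<close>, \<open>t\<^sub>\<lambda> f\<^sub>i t\<^sub>\<lambda>\<^sup>-\<^sup>1 = q\<^sup>-\<^sup>(\<^sup>\<alpha>\<^sub>i\<^sup>,\<^sup>\<lambda>\<^sup>) f\<^sub>i\<close>,
  \<open>e\<^sub>i' f\<^sub>j = q\<^sup>-\<^sup>(\<^sup>\<alpha>\<^sub>i\<^sup>,\<^sup>\<alpha>\<^sub>j\<^sup>) f\<^sub>j e\<^sub>i' + \<delta>\<^sub>i\<^sub>j\<close> hold without collapse, with a single torus, is the subalgebra of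
  \<open>Heis\<close> generated by the \<open>e\<^sub>i'\<close>, \<open>f\<^sub>i\<close> and \<open>t'\<^sub>\<lambda>\<close>.\<close>

definition Bq_sub :: "(('g \<Rightarrow> complex) heis set, 'g \<Rightarrow> complex) boson_algebra" where
  "Bq_sub = ring.extend
     (Heis\<lparr>carrier := generate_ring Heis
        (range heis_scalar \<union> heis_eprime ` Ind \<union> (\<lambda>i. sharp (f i) 1) ` Ind \<union>
         (\<lambda>\<mu>. sharp (t' \<mu>) 1) ` P_plus)\<rparr>)
     (boson_algebra.fields heis_scalar heis_eprime (\<lambda>\<mu>. sharp (t' \<mu>) 1))"


section \<open>The category \<open>O\<close> and the modules \<open>H(\<lambda>)\<close>\<close>

definition weight_space :: "('b, 'g \<Rightarrow> complex, 'r) boson_algebra_scheme \<Rightarrow>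
    ('b, 'm, 's) module_scheme \<Rightarrow> ('g \<Rightarrow> complex) \<Rightarrow> 'm set" where
  "weight_space B M \<mu> = {m \<in> carrier M. \<forall>\<nu>\<in>P_plus.
     torus B \<nu> \<odot>\<^bsub>M\<^esub> m = scalar B (qpow (form \<nu> \<mu>)) \<odot>\<^bsub>M\<^esub> m}"

definition in_O :: "('b, 'g \<Rightarrow> complex, 'r) boson_algebra_scheme \<Rightarrow>
    ('b, 'm, 's) module_scheme \<Rightarrow> bool" where
  "in_O B M \<longleftrightarrow> left_module B M \<and> direct_sum M P (weight_space B M) \<and>
    (\<forall>m\<in>carrier M. \<exists>l>0. \<forall>js. length js = l \<and> set js \<subseteq> Ind \<longrightarrow>
       foldr (\<lambda>i x. eprime B i \<odot>\<^bsub>M\<^esub> x) js m = \<zero>\<^bsub>M\<^esub>)"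

definition I_lambda :: "('b, 'g \<Rightarrow> complex, 'r) boson_algebra_scheme \<Rightarrow>
    ('g \<Rightarrow> complex) \<Rightarrow> 'b set" where
  "I_lambda B \<mu> = generate (add_monoid B)
    ({b \<otimes>\<^bsub>B\<^esub> eprime B i |b i. b \<in> carrier B \<and> i \<in> Ind} \<union>
     {b \<otimes>\<^bsub>B\<^esub> (torus B \<nu> \<ominus>\<^bsub>B\<^esub> scalar B (qpow (form \<mu> \<nu>))) |b \<nu>.
        b \<in> carrier B \<and> \<nu> \<in> P_plus})"

definition H :: "('b, 'g \<Rightarrow> complex, 'r) boson_algebra_scheme \<Rightarrow>
    ('g \<Rightarrow> complex) \<Rightarrow> ('b, 'b set) module" where
  "H B \<mu> = quotient_module B (I_lambda B \<mu>)"

end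

end

theory Submission
  imports Defs
begin

text \<open>The q-boson algebra behaves like a Weyl algebra. Moving \<open>e\<^sub>i'\<close> to the right through \<open>f\<^sub>j\<close> produces a factor
  and, if \<open>i = j\<close>, a contraction. So, modulo the left ideal generated by the \<open>e\<^sub>i'\<close>, a word in the \<open>e\<^sub>i'\<close> followed
  by a word of the same length in the \<open>f\<^sub>j\<close> is a scalar, its vacuum expectation value. The matrix of these
  scalars is the Gram matrix of the Hopf pairing (\<open>pe_vev\<close>). Because the radicals of the pairing are divided
  out, a combination of \<open>e'\<close>-words or of \<open>f\<close>-words in the radical of the Gram matrix is zero. The theorem
  follows from this property and the commutation relations, which make up the locale \<open>boson_algebra\<close>.

  It has two consequences. The first concerns a left ideal that contains all \<open>e\<^sub>i'\<close> and in whose quotient the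
  torus acts on the class of one by scalars. Each element is congruent to a combination of \<open>f\<close>-words, and if
  it is not in the ideal then a suitable \<open>e'\<close>-word takes it to a nonzero scalar (\<open>maximal_left_ideal\<close>). Hence a
  nonzero vector of weight \<open>\<lambda>\<close> killed by all \<open>e\<^sub>i'\<close> has annihilator \<open>I\<^sub>\<lambda>\<close> and generates a simple module isomorphic
  to \<open>H(\<lambda>)\<close>.

  The second is a resolution of the identity. With a generalized inverse \<open>Q\<close> of the Gram matrices one obtains
  elements \<open>\<Gamma>\<^sub>l\<close>, the extremal projectors \<open>gam\<close>, such that one is the sum of \<open>Q\<^sub>u\<^sub>w f\<^sub>u \<Gamma>\<^sub>l\<^sub>-\<^sub>k e\<^sub>w'\<close> over all words \<open>u\<close>, \<open>w\<close>
  of length \<open>k \<le> l\<close>, and such that \<open>e\<^sub>i' \<Gamma>\<^sub>l\<close> kills every vector on which all \<open>e'\<close>-words longer than \<open>l\<close> vanish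
  (\<open>layers_sum\<close>, \<open>E_gam\<close>). In a module of the category O each vector is of this kind for some \<open>l\<close>, so the module
  is generated by the vectors killed by all \<open>e\<^sub>i'\<close>. The weight components of such vectors are again killed by all
  \<open>e\<^sub>i'\<close>. So the module is generated by simple submodules, and by Zorn's lemma it is a direct sum of some of
  them. A simple module is generated by one such weight vector, so it is \<open>H(\<lambda>)\<close>.

  Three things are needed about the algebra. The Heisenberg product on the tensor product of the free algebras
  is associative, and the tensors that vanish in the double form an ideal; both follow from coassociativity and
  the rules for pairing with products (\<open>heis_mult_assoc\<close>, \<open>heis_ker_ideal\<close>). The radical of the Gram matrix
  on words in the \<open>e\<^sub>i'\<close> and \<open>f\<^sub>j\<close> lies in the radical of the pairing on all words, because torus letters can be
  moved to one end and do not matter there (\<open>radP_combination\<close>, \<open>radM_combination\<close>). Finally, the exponents of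
  \<open>q\<close> that occur are rational and \<open>q\<^sub>i\<close> differs from its inverse. This comes from the structure theory of
  semisimple Lie algebras: the Killing form is nondegenerate on the Cartan subalgebra, roots are weights, and
  the form takes nonzero rational values on roots.

  The algebra with identified tori and the subalgebra of the double generated by \<open>e\<^sub>i'\<close>, \<open>f\<^sub>i\<close>, \<open>t'\<^sub>\<lambda>\<close> are treated
  together as images of the free Heisenberg algebra (\<open>boson_image\<close>).\<close>

section \<open>Simultaneous eigenvectors, traces and the Killing form\<close>

context lie_algebra begin

lemma brk_hom_left: "module_hom scale scale (\<lambda>x. brk x y)"
  using brk_linear_left by (simp add: linear_iff_module_hom)

lemma brk_hom_right: "module_hom scale scale (brk x)"
  using brk_linear_right by (simp add: linear_iff_module_hom)

lemmas brk_left_simps = module_hom.add[OF brk_hom_left] module_hom.scale[OF brk_hom_left]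
  module_hom.zero[OF brk_hom_left] module_hom.neg[OF brk_hom_left] module_hom.diff[OF brk_hom_left]
lemmas brk_right_simps = module_hom.add[OF brk_hom_right] module_hom.scale[OF brk_hom_right]
  module_hom.zero[OF brk_hom_right] module_hom.neg[OF brk_hom_right]
  module_hom.diff[OF brk_hom_right]
lemmas brk_simps = brk_left_simps brk_right_simps
lemmas brk_sum_right = module_hom.sum[OF brk_hom_right]
lemmas brk_sum_left = module_hom.sum[OF brk_hom_left]

lemma brk_antisym: "brk y x = - brk x y"
proof -
  have "brk (x + y) (x + y) = 0" by (rule brk_self)
  then have "brk y x + brk x y = 0"
    unfolding brk_left_simps(1) brk_right_simps(1) by (simp add: brk_self add.commute)
  then show ?thesis by (simp add: eq_neg_iff_add_eq_0)
qed

text \<open>Ad is a representation; this is the form in which the Jacobi identity is used throughout.\<close>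

lemma brk_brk: "brk (brk x y) z = brk x (brk y z) - brk y (brk x z)"
proof -
  have "brk x (brk y z) + brk y (brk z x) + brk z (brk x y) = 0" by (rule jacobi)
  moreover have "brk y (brk z x) = - brk y (brk x z)"
    by (subst brk_antisym) (simp add: brk_simps)
  moreover have "brk z (brk x y) = - brk (brk x y) z" by (rule brk_antisym)
  ultimately have "brk x (brk y z) - brk y (brk x z) - brk (brk x y) z = 0" by simp
  then show ?thesis by simp
qed

text \<open>If the weights of two summands differ at \<open>y\<close>, subtracting from ad of \<open>y\<close> one of the eigenvalues
  removes one summand and rescales the others, so the sum becomes shorter inside \<open>U\<close>.\<close>

lemma eigen_component:
  assumes "finite \<Gamma>" and U: "subspace U" and stable: "\<And>y x. y \<in> Y \<Longrightarrow> x \<in> U \<Longrightarrow> brk y x \<in> U"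
    and "\<And>\<gamma> \<delta>. \<gamma> \<in> \<Gamma> \<Longrightarrow> \<delta> \<in> \<Gamma> \<Longrightarrow> \<gamma> \<noteq> \<delta> \<Longrightarrow> \<exists>y\<in>Y. \<gamma> y \<noteq> \<delta> y"
    and "\<And>\<gamma> y. \<gamma> \<in> \<Gamma> \<Longrightarrow> y \<in> Y \<Longrightarrow> brk y (v \<gamma>) = scale (\<gamma> y) (v \<gamma>)"
    and "sum v \<Gamma> \<in> U"
  shows "\<forall>\<gamma>\<in>\<Gamma>. v \<gamma> \<in> U"
  using assms(1,4,5,6)
proof (induction \<Gamma> arbitrary: v rule: finite_induct)
  case empty
  then show ?case by simp
next
  case (insert \<nu> \<Gamma>)
  have A: "v \<gamma> \<in> U" if g: "\<gamma> \<in> \<Gamma>" for \<gamma>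
  proof -
    have "\<gamma> \<noteq> \<nu>" using g insert.hyps by auto
    then obtain y where y: "y \<in> Y" "\<gamma> y \<noteq> \<nu> y" using insert.prems(1) g by blast
    define w where "w \<delta> = scale (\<delta> y - \<nu> y) (v \<delta>)" for \<delta>
    have "brk y (sum v (insert \<nu> \<Gamma>)) = (\<Sum>\<delta>\<in>insert \<nu> \<Gamma>. scale (\<delta> y) (v \<delta>))"
      unfolding brk_sum_right using insert.prems(2) y by (intro sum.cong) auto
    moreover have "scale (\<nu> y) (sum v (insert \<nu> \<Gamma>)) = (\<Sum>\<delta>\<in>insert \<nu> \<Gamma>. scale (\<nu> y) (v \<delta>))"
      by (rule scale_sum_right)
    ultimately have "brk y (sum v (insert \<nu> \<Gamma>)) - scale (\<nu> y) (sum v (insert \<nu> \<Gamma>)) =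
        sum w (insert \<nu> \<Gamma>)"
      unfolding w_def scale_left_diff_distrib by (simp only: sum_subtractf)
    also have "\<dots> = sum w \<Gamma>" using insert.hyps by (simp add: w_def)
    finally have "sum w \<Gamma> \<in> U"
      using stable[OF y(1) insert.prems(3)] insert.prems(3) U
      by (metis subspace_diff subspace_scale)
    moreover have "brk z (w \<delta>) = scale (\<delta> z) (w \<delta>)" if "\<delta> \<in> \<Gamma>" "z \<in> Y" for \<delta> z
      using insert.prems(2)[of \<delta> z] that by (simp add: w_def brk_simps mult.commute)
    ultimately have "w \<gamma> \<in> U" using insert.IH[of w] insert.prems(1) g by blast
    then have "scale (1 / (\<gamma> y - \<nu> y)) (w \<gamma>) \<in> U" using U subspace_scale by blast
    then show ?thesis using y by (simp add: w_def)
  qed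
  have "v \<nu> = sum v (insert \<nu> \<Gamma>) - sum v \<Gamma>" using insert.hyps by simp
  also have "\<dots> \<in> U"
    by (rule subspace_diff[OF U insert.prems(3) subspace_sum[OF U A]])
  finally have "v \<nu> \<in> U" .
  then show ?case using A by simp
qed

lemma span_Union_decomp:
  assumes "x \<in> span (\<Union>\<gamma>\<in>I. G \<gamma>)" and G: "\<And>\<gamma>. \<gamma> \<in> I \<Longrightarrow> subspace (G \<gamma>)"
  shows "\<exists>\<Gamma> w. finite \<Gamma> \<and> \<Gamma> \<subseteq> I \<and> (\<forall>\<gamma>\<in>\<Gamma>. w \<gamma> \<in> G \<gamma>) \<and> x = sum w \<Gamma>"
  using assms(1)
proof (induction rule: span_induct_alt)
  case base
  show ?case by (intro exI[of _ "{}"]) auto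
next
  case (step c x y)
  then obtain \<Gamma> w where w: "finite \<Gamma>" "\<Gamma> \<subseteq> I" "\<forall>\<gamma>\<in>\<Gamma>. w \<gamma> \<in> G \<gamma>" "y = sum w \<Gamma>" by blast
  from step obtain \<delta> where d: "\<delta> \<in> I" "x \<in> G \<delta>" by blast
  define w0 where "w0 \<gamma> = (if \<gamma> \<in> \<Gamma> then w \<gamma> else 0)" for \<gamma>
  define w' where "w' = w0(\<delta> := w0 \<delta> + scale c x)"
  have w0: "w0 \<gamma> \<in> G \<gamma>" if "\<gamma> \<in> I" for \<gamma>
    using w that G[OF that] by (auto simp: w0_def subspace_0)
  have "sum w' (insert \<delta> \<Gamma>) = w0 \<delta> + scale c x + sum w0 (\<Gamma> - {\<delta>})"
    using w by (simp add: w'_def sum.insert_remove)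
  also have "w0 \<delta> + sum w0 (\<Gamma> - {\<delta>}) = sum w0 \<Gamma>"
    using w(1) by (cases "\<delta> \<in> \<Gamma>") (auto simp: sum.remove w0_def)
  then have "w0 \<delta> + scale c x + sum w0 (\<Gamma> - {\<delta>}) = scale c x + sum w0 \<Gamma>"
    by (metis add.commute add.left_commute)
  also have "sum w0 \<Gamma> = y" using w by (auto simp: w0_def)
  finally have "scale c x + y = sum w' (insert \<delta> \<Gamma>)" by simp
  moreover have "\<forall>\<gamma>\<in>insert \<delta> \<Gamma>. w' \<gamma> \<in> G \<gamma>"
    using w w0 d G by (auto simp: w'_def subset_iff intro!: subspace_add subspace_scale)
  ultimately show ?case using w d by (intro exI[of _ "insert \<delta> \<Gamma>"] exI[of _ w']) auto
qed

lemma subspace_eigenspace: "subspace {v. \<forall>y\<in>X. brk y v = scale (\<gamma> y) v}"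
  by (rule subspaceI) (auto simp: brk_simps scale_right_distrib mult.commute)

text \<open>Commuting diagonalizable operators are simultaneously diagonalizable: the next operator preserves
  the joint eigenspaces of the previous ones, which therefore contain its eigencomponents.\<close>

lemma common_eigenvectors_span:
  assumes "finite X" "\<And>x y. x \<in> X \<Longrightarrow> y \<in> X \<Longrightarrow> brk x y = 0" "\<And>x. x \<in> X \<Longrightarrow> diagonalizable (brk x)"
  shows "span {v. \<forall>x\<in>X. \<exists>c. brk x v = scale c v} = UNIV"
  using assms
proof (induction X rule: finite_induct)
  case empty
  then show ?case by simp
next
  case (insert x X)
  let ?E = "{v. \<forall>x\<in>X. \<exists>c. brk x v = scale c v}"
  let ?E' = "{v. \<forall>x\<in>insert x X. \<exists>c. brk x v = scale c v}"
  have IH: "span ?E = UNIV" by (rule insert.IH) (use insert.prems in auto)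
  have "v \<in> span ?E'" if "v \<in> ?E" for v
  proof -
    from that obtain c where c: "\<And>y. y \<in> X \<Longrightarrow> brk y v = scale (c y) v" by (auto dest!: bchoice)
    define U where "U = {u. \<forall>y\<in>X. brk y u = scale (c y) u}"
    define I where "I = range (\<lambda>\<mu> (y::'g). \<mu> :: complex)"
    have "{v. \<exists>c. brk x v = scale c v} = (\<Union>\<gamma>\<in>I. {u. brk x u = scale (\<gamma> x) u})"
      by (auto simp: I_def)
    then have "v \<in> span (\<Union>\<gamma>\<in>I. {u. brk x u = scale (\<gamma> x) u})"
      using insert.prems(2)[of x] by (simp add: diagonalizable_def)
    moreover have "subspace {u. brk x u = scale (\<gamma> x) u}" for \<gamma>
      using subspace_eigenspace[of "{x}"] by simp
    ultimately obtain \<Gamma> w where w: "finite \<Gamma>" "\<Gamma> \<subseteq> I"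
        "\<forall>\<gamma>\<in>\<Gamma>. w \<gamma> \<in> {u. brk x u = scale (\<gamma> x) u}" "v = sum w \<Gamma>"
      using span_Union_decomp[of v "\<lambda>\<gamma>. {u. brk x u = scale (\<gamma> x) u}" I] by blast
    have sub: "subspace U" unfolding U_def by (rule subspace_eigenspace)
    have st: "brk x u \<in> U" if u: "u \<in> U" for u
    proof -
      have "brk y (brk x u) = scale (c y) (brk x u)" if "y \<in> X" for y
      proof -
        have "brk y x = 0" using insert.prems(1)[of y x] that by simp
        then have "brk y (brk x u) = brk x (brk y u)"
          using brk_brk[of y x u] by (simp add: brk_simps)
        then show ?thesis using u that by (simp add: U_def brk_simps)
      qed
      then show ?thesis by (simp add: U_def)
    qed
    have "\<forall>\<gamma>\<in>\<Gamma>. w \<gamma> \<in> U"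
    proof (rule eigen_component[of _ _ "{x}"])
      show "sum w \<Gamma> \<in> U" using w c by (auto simp: U_def)
      show "\<exists>y\<in>{x}. \<gamma> y \<noteq> \<delta> y" if "\<gamma> \<in> \<Gamma>" "\<delta> \<in> \<Gamma>" "\<gamma> \<noteq> \<delta>" for \<gamma> \<delta>
        using that w(2) by (auto simp: I_def)
    qed (use w sub st in auto)
    then have "\<forall>\<gamma>\<in>\<Gamma>. w \<gamma> \<in> ?E'" using w(3) by (auto simp: U_def)
    then show ?thesis unfolding w(4) by (intro span_sum span_base) blast
  qed
  then have "span ?E \<subseteq> span ?E'" by (intro span_minimal) auto
  then show ?case using IH by auto
qed

lemma independent_finite: "independent X \<Longrightarrow> finite X"
proof -
  assume X: "independent X"
  obtain T where "finite T" "span T = UNIV" using finite_dim by auto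
  then show ?thesis using independent_span_bound[of T X] X by simp
qed

lemma finite_subspace_basis:
  obtains X where "finite X" "X \<subseteq> V" "V \<subseteq> span X" "independent X"
proof -
  obtain X where X: "X \<subseteq> V" "independent X" "V \<subseteq> span X"
    by (rule maximal_independent_subset[of V])
  show thesis by (rule that[of X]) (use X independent_finite in auto)
qed

text \<open>Makes the dimension theory of finite-dimensional spaces available for the basis that enters the
  definition of the trace.\<close>

sublocale fd: finite_dimensional_vector_space scale "extend_basis {}"
proof
  have "independent {}" by (simp add: dependent_def)
  then show "independent (extend_basis {})" "span (extend_basis {}) = UNIV"
    using independent_extend_basis span_extend_basis by auto
  then show "finite (extend_basis {})" by (intro independent_finite)
qed

lemma sum_representation:
  assumes "independent B" "span B = UNIV"
  shows "(\<Sum>b\<in>B. scale (representation B x b) b) = x"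
proof -
  have fin: "finite B" using assms independent_finite by blast
  have "(\<Sum>b | representation B x b \<noteq> 0. scale (representation B x b) b) = x"
    using sum_nonzero_representation_eq[of B x] assms by simp
  moreover have "(\<Sum>b | representation B x b \<noteq> 0. scale (representation B x b) b) =
      (\<Sum>b\<in>B. scale (representation B x b) b)"
    by (rule sum.mono_neutral_left) (use fin representation_ne_zero in auto)
  ultimately show ?thesis by simp
qed

lemma representation_hom:
  assumes "independent B" "span B = UNIV"
  shows "module_hom scale (*) (\<lambda>v. representation B v b)"
  using linear_representation[OF assms] by (simp add: linear_iff_module_hom)

text \<open>Expanding in two bases at once gives both the independence of the trace of the basis and its
  invariance under exchanging the factors of a product.\<close>

lemma trace_swap:
  assumes B: "independent B" "span B = UNIV" and C: "independent C" "span C = UNIV"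
    and g: "module_hom scale scale g" and k: "module_hom scale scale k"
  shows "(\<Sum>b\<in>B. representation B (g (k b)) b) = (\<Sum>c\<in>C. representation C (k (g c)) c)"
proof -
  have "(\<Sum>b\<in>B. representation B (g (k b)) b) =
      (\<Sum>b\<in>B. \<Sum>c\<in>C. representation C (k b) c * representation B (g c) b)"
  proof (rule sum.cong)
    fix b
    have "g (k b) = g (\<Sum>c\<in>C. scale (representation C (k b) c) c)"
      by (simp add: sum_representation[OF C])
    also have "\<dots> = (\<Sum>c\<in>C. scale (representation C (k b) c) (g c))"
      by (simp add: module_hom.sum[OF g] module_hom.scale[OF g])
    finally show "representation B (g (k b)) b =
        (\<Sum>c\<in>C. representation C (k b) c * representation B (g c) b)"
      by (simp add: module_hom.sum[OF representation_hom[OF B]]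
          module_hom.scale[OF representation_hom[OF B]])
  qed simp
  also have "\<dots> = (\<Sum>c\<in>C. \<Sum>b\<in>B. representation B (g c) b * representation C (k b) c)"
    by (subst sum.swap) (simp add: mult.commute)
  also have "\<dots> = (\<Sum>c\<in>C. representation C (k (g c)) c)"
  proof (rule sum.cong)
    fix c
    have "k (g c) = k (\<Sum>b\<in>B. scale (representation B (g c) b) b)"
      by (simp add: sum_representation[OF B])
    also have "\<dots> = (\<Sum>b\<in>B. scale (representation B (g c) b) (k b))"
      by (simp add: module_hom.sum[OF k] module_hom.scale[OF k])
    finally show "(\<Sum>b\<in>B. representation B (g c) b * representation C (k b) c) =
        representation C (k (g c)) c"
      by (simp add: module_hom.sum[OF representation_hom[OF C]]
          module_hom.scale[OF representation_hom[OF C]])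
  qed simp
  finally show ?thesis .
qed

lemma trace_basis:
  assumes B: "independent B" "span B = UNIV" and g: "module_hom scale scale g"
  shows "trace g = (\<Sum>b\<in>B. representation B (g b) b)"
proof -
  have "module_hom scale scale (\<lambda>x. x)" by (simp add: module_hom_iff module_axioms)
  from trace_swap[OF fd.independent_Basis fd.span_Basis B g this]
  show ?thesis unfolding trace_def .
qed

lemma trace_comm:
  assumes "module_hom scale scale g" "module_hom scale scale k"
  shows "trace (\<lambda>x. g (k x)) = trace (\<lambda>x. k (g x))"
  using trace_swap[OF fd.independent_Basis fd.span_Basis fd.independent_Basis fd.span_Basis assms]
  unfolding trace_def .

lemma trace_add: "trace (\<lambda>x. g x + k x) = trace g + trace k"
  using fd.independent_Basis fd.span_Basis
  by (simp add: trace_def representation_add sum.distrib)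

lemma trace_scale: "trace (\<lambda>x. scale c (g x)) = c * trace g"
  using fd.independent_Basis fd.span_Basis
  by (simp add: trace_def representation_scale sum_distrib_left)

lemma trace_diff: "trace (\<lambda>x. g x - k x) = trace g - trace k"
  using fd.independent_Basis fd.span_Basis
  by (simp add: trace_def representation_diff sum_subtractf)

lemma brk2_hom: "module_hom scale scale (\<lambda>z. brk x (brk y z))"
  using module_hom_compose[OF brk_hom_right[of y] brk_hom_right[of x]] by (simp add: comp_def)

lemma killing_sym: "killing x y = killing y x"
  unfolding killing_def by (rule trace_comm[OF brk_hom_right brk_hom_right])

lemma killing_add_left: "killing (x + y) z = killing x z + killing y z"
  by (simp add: killing_def brk_simps trace_add)

lemma killing_scale_left: "killing (scale c x) z = c * killing x z"
  by (simp add: killing_def brk_simps trace_scale)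

lemma killing_hom_left: "module_hom scale (*) (\<lambda>x. killing x z)"
proof -
  have "Modules.module ((*) :: complex \<Rightarrow> complex \<Rightarrow> complex)" by unfold_locales (auto simp: algebra_simps)
  then show ?thesis
    by (simp add: module_hom_iff module_axioms killing_add_left killing_scale_left)
qed

lemma killing_hom_right: "module_hom scale (*) (killing z)"
  using killing_hom_left[of z] unfolding killing_sym[of _ z] .

lemmas killing_simps = module_hom.add[OF killing_hom_left] module_hom.scale[OF killing_hom_left]
  module_hom.zero[OF killing_hom_left] module_hom.neg[OF killing_hom_left]
  module_hom.diff[OF killing_hom_left] module_hom.add[OF killing_hom_right]
  module_hom.scale[OF killing_hom_right] module_hom.zero[OF killing_hom_right]
  module_hom.neg[OF killing_hom_right] module_hom.diff[OF killing_hom_right]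

lemma killing_invariant: "killing (brk x y) z = killing x (brk y z)"
proof -
  have "killing (brk x y) z = trace (\<lambda>u. brk x (brk y (brk z u))) - trace (\<lambda>u. brk y (brk x (brk z u)))"
    by (simp add: killing_def brk_brk trace_diff)
  also have "trace (\<lambda>u. brk y (brk x (brk z u))) = trace (\<lambda>u. brk x (brk z (brk y u)))"
    by (rule trace_comm[OF brk_hom_right brk2_hom])
  also have "trace (\<lambda>u. brk x (brk y (brk z u))) - \<dots> = killing x (brk y z)"
    by (simp add: killing_def brk_brk brk_simps trace_diff)
  finally show ?thesis .
qed

end

section \<open>Weights of a Cartan subalgebra\<close>

locale cartan_pair = lie_algebra scale brk
  for scale :: "complex \<Rightarrow> 'g::ab_group_add \<Rightarrow> 'g" and brk :: "'g \<Rightarrow> 'g \<Rightarrow> 'g" +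
  fixes h :: "'g set"
  assumes semisimple: semisimple and cartan: "cartan_subalgebra h"
begin

lemma h_subspace: "subspace h"
  using cartan by (simp add: cartan_subalgebra_def abelian_def)

lemma h_commute: "x \<in> h \<Longrightarrow> y \<in> h \<Longrightarrow> brk x y = 0"
  using cartan by (simp add: cartan_subalgebra_def abelian_def)

text \<open>Adjoining such an element to \<open>h\<close> gives an abelian subspace, which is \<open>h\<close> by maximality.\<close>

lemma h_self_centralizing:
  assumes "\<And>y. y \<in> h \<Longrightarrow> brk y x = 0"
  shows "x \<in> h"
proof -
  \<comment> \<open>the candidate for a larger abelian subspace\<close>
  define k where "k = {scale c x + y |c y. y \<in> h}"
  have mem: "scale c x + y \<in> k" if "y \<in> h" for c y using that k_def by blast
  have yx: "brk x y = 0" if "y \<in> h" for y using assms[OF that] brk_antisym[of x y] by simp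
  have "subspace k"
  proof (rule subspaceI)
    show "0 \<in> k" using mem[of 0 0] subspace_0[OF h_subspace] by simp
    fix u v assume "u \<in> k" "v \<in> k"
    then obtain c y d z where *: "u = scale c x + y" "v = scale d x + z" "y \<in> h" "z \<in> h"
      unfolding k_def by blast
    have eq: "u + v = scale (c + d) x + (y + z)" by (simp add: * scale_left_distrib algebra_simps)
    show "u + v \<in> k" unfolding eq by (intro mem subspace_add[OF h_subspace] *)
  next
    fix a u assume "u \<in> k"
    then obtain c y where *: "u = scale c x + y" "y \<in> h" unfolding k_def by blast
    have "scale a u = scale (a * c) x + scale a y" by (simp add: * scale_right_distrib)
    then show "scale a u \<in> k" using mem * subspace_scale[OF h_subspace] by simp
  qed
  moreover have "brk u v = 0" if "u \<in> k" "v \<in> k" for u v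
    using that assms yx h_commute by (auto simp: k_def brk_simps brk_self)
  ultimately have "abelian k" by (simp add: abelian_def)
  moreover have "h \<subseteq> k" using mem[of _ 0] by auto
  ultimately have "k = h" using cartan by (simp add: cartan_subalgebra_def)
  then show ?thesis using mem[of 0 1] subspace_0[OF h_subspace] by simp
qed

text \<open>Weights are first found vector by vector, as functions on \<open>h\<close> that are not known to be linear.
  Linearity follows for those that occur, by \<open>wsp_dual\<close>.\<close>

definition hfun :: "('g \<Rightarrow> complex) set" where "hfun = {\<gamma>. \<forall>x. x \<notin> h \<longrightarrow> \<gamma> x = 0}"

definition wsp :: "('g \<Rightarrow> complex) \<Rightarrow> 'g set" where
  "wsp \<gamma> = {x. \<forall>y\<in>h. brk y x = scale (\<gamma> y) x}"

lemma hfun_add: "\<gamma> \<in> hfun \<Longrightarrow> \<delta> \<in> hfun \<Longrightarrow> \<gamma> + \<delta> \<in> hfun"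
  and hfun_uminus: "\<gamma> \<in> hfun \<Longrightarrow> - \<gamma> \<in> hfun"
  and hfun_zero: "0 \<in> hfun"
  by (auto simp: hfun_def)

lemma hfun_eqI: "\<gamma> \<in> hfun \<Longrightarrow> \<delta> \<in> hfun \<Longrightarrow> (\<And>y. y \<in> h \<Longrightarrow> \<gamma> y = \<delta> y) \<Longrightarrow> \<gamma> = \<delta>"
  by (rule ext) (metis (mono_tags, lifting) hfun_def mem_Collect_eq)

lemma dual_subset_hfun: "dual h \<subseteq> hfun"
  by (auto simp: dual_def hfun_def)

lemma wsp_subspace: "subspace (wsp \<gamma>)"
  unfolding wsp_def by (rule subspace_eigenspace)

lemma wsp_zero: "wsp 0 = h"
  using h_self_centralizing h_commute by (auto simp: wsp_def)

lemma wsp_brk: "x \<in> wsp \<gamma> \<Longrightarrow> y \<in> wsp \<delta> \<Longrightarrow> brk x y \<in> wsp (\<gamma> + \<delta>)"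
proof -
  assume *: "x \<in> wsp \<gamma>" "y \<in> wsp \<delta>"
  have "brk u (brk x y) = scale ((\<gamma> + \<delta>) u) (brk x y)" if "u \<in> h" for u
  proof -
    have "brk u (brk x y) = brk (brk u x) y + brk x (brk u y)" by (simp add: brk_brk)
    then show ?thesis using * that by (simp add: wsp_def brk_simps scale_left_distrib)
  qed
  then show ?thesis by (simp add: wsp_def)
qed

lemma weight_vectors_span: "span (\<Union>\<gamma>\<in>hfun. wsp \<gamma>) = UNIV"
proof -
  obtain X where X: "finite X" "X \<subseteq> h" "h \<subseteq> span X" by (rule finite_subspace_basis[of h])
  have "span {v. \<forall>x\<in>X. \<exists>c. brk x v = scale c v} = UNIV"
    using X(2) cartan
    by (intro common_eigenvectors_span X(1))
      (auto simp: cartan_subalgebra_def intro!: h_commute)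
  moreover have "v \<in> (\<Union>\<gamma>\<in>hfun. wsp \<gamma>)" if v: "\<forall>x\<in>X. \<exists>c. brk x v = scale c v" for v
  proof -
    have "\<exists>c. brk y v = scale c v" if "y \<in> span X" for y
      using that
    proof (induction rule: span_induct_alt)
      case base
      show ?case by (intro exI[of _ 0]) (simp add: brk_simps)
    next
      case (step c x y)
      then obtain d d' where "brk x v = scale d v" "brk y v = scale d' v" using v by blast
      then show ?case
        by (intro exI[of _ "c * d + d'"]) (simp add: brk_simps scale_left_distrib)
    qed
    then have "\<forall>y. \<exists>c. y \<in> h \<longrightarrow> brk y v = scale c v" using X by blast
    then obtain c where c: "\<And>y. y \<in> h \<Longrightarrow> brk y v = scale (c y) v" by metis
    define \<gamma> where "\<gamma> y = (if y \<in> h then c y else 0)" for y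
    have "\<gamma> \<in> hfun" "v \<in> wsp \<gamma>" using c by (auto simp: hfun_def wsp_def \<gamma>_def)
    then show ?thesis by blast
  qed
  then have "span {v. \<forall>x\<in>X. \<exists>c. brk x v = scale c v} \<subseteq> span (\<Union>\<gamma>\<in>hfun. wsp \<gamma>)"
    by (intro span_mono subsetI) simp
  ultimately show ?thesis by blast
qed

text \<open>A basis of weight vectors; traces are computed in it.\<close>

definition wb :: "'g set" where
  "wb = (SOME B. B \<subseteq> (\<Union>\<gamma>\<in>hfun. wsp \<gamma>) \<and> independent B \<and> span B = UNIV)"

lemma wb: "wb \<subseteq> (\<Union>\<gamma>\<in>hfun. wsp \<gamma>)" "independent wb" "span wb = UNIV"
proof -
  let ?S = "\<Union>\<gamma>\<in>hfun. wsp \<gamma>"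
  obtain B where "B \<subseteq> ?S" "independent B" "?S \<subseteq> span B"
    by (rule maximal_independent_subset[of ?S])
  moreover from this have "span B = UNIV"
    using weight_vectors_span span_minimal[of ?S "span B"] by auto
  ultimately have "\<exists>B. B \<subseteq> ?S \<and> independent B \<and> span B = UNIV" by blast
  from someI_ex[OF this] show "wb \<subseteq> ?S" "independent wb" "span wb = UNIV"
    unfolding wb_def by blast+
qed

lemma finite_wb: "finite wb" using wb(2) by (rule independent_finite)

definition wt :: "'g \<Rightarrow> 'g \<Rightarrow> complex" where
  "wt b = (SOME \<gamma>. \<gamma> \<in> hfun \<and> b \<in> wsp \<gamma>)"

lemma wt: assumes "b \<in> wb" shows "wt b \<in> hfun" "b \<in> wsp (wt b)"
proof -
  have "\<exists>\<gamma>. \<gamma> \<in> hfun \<and> b \<in> wsp \<gamma>" using assms wb(1) by blast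
  from someI_ex[OF this] show "wt b \<in> hfun" "b \<in> wsp (wt b)" unfolding wt_def by blast+
qed

lemma wb_nonzero: "b \<in> wb \<Longrightarrow> b \<noteq> 0" using wb(2) dependent_zero by blast

abbreviation rp :: "'g \<Rightarrow> 'g \<Rightarrow> complex" where "rp \<equiv> representation wb"

lemmas rp_hom = representation_hom[OF wb(2,3)]
lemmas rp_simps = module_hom.add[OF rp_hom] module_hom.scale[OF rp_hom]
  module_hom.zero[OF rp_hom] module_hom.neg[OF rp_hom] module_hom.diff[OF rp_hom]
lemmas rp_sum = sum_representation[OF wb(2,3)]

lemma rp_basis: "b \<in> wb \<Longrightarrow> rp b c = (if c = b then 1 else 0)"
  by (simp add: representation_basis[OF wb(2)])

lemma rp_lincomb: "b \<in> wb \<Longrightarrow> rp (\<Sum>c\<in>wb. scale (g c) c) b = g b"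
  by (simp add: module_hom.sum[OF rp_hom] rp_simps rp_basis finite_wb
      if_distrib[of "(*) _"] cong: if_cong)

lemma eq_rpI: "(\<And>b. b \<in> wb \<Longrightarrow> rp x b = rp y b) \<Longrightarrow> x = y"
proof -
  assume *: "\<And>b. b \<in> wb \<Longrightarrow> rp x b = rp y b"
  have "(\<Sum>b\<in>wb. scale (rp x b) b) = (\<Sum>b\<in>wb. scale (rp y b) b)"
    by (rule sum.cong) (auto simp: *)
  then show "x = y" by (simp add: rp_sum)
qed

lemma hom_eqI:
  assumes g: "module_hom scale scale g" and k: "module_hom scale scale k"
    and "\<And>b. b \<in> wb \<Longrightarrow> g b = k b"
  shows "g x = k x"
proof -
  have "g (\<Sum>b\<in>wb. scale (rp x b) b) = k (\<Sum>b\<in>wb. scale (rp x b) b)"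
    unfolding module_hom.sum[OF g] module_hom.scale[OF g] module_hom.sum[OF k] module_hom.scale[OF k]
    by (rule sum.cong) (auto simp: assms(3))
  then show ?thesis by (simp add: rp_sum)
qed

lemma rp_brk: "y \<in> h \<Longrightarrow> b \<in> wb \<Longrightarrow> rp (brk y x) b = wt b y * rp x b"
proof -
  assume y: "y \<in> h" and b: "b \<in> wb"
  have "brk y x = brk y (\<Sum>c\<in>wb. scale (rp x c) c)" by (simp add: rp_sum)
  also have "\<dots> = (\<Sum>c\<in>wb. scale (rp x c * wt c y) c)"
    unfolding brk_sum_right brk_simps using wt(2) y by (intro sum.cong) (auto simp: wsp_def)
  finally show ?thesis using b by (simp add: rp_lincomb)
qed

lemma wsp_iff:
  assumes "\<gamma> \<in> hfun"
  shows "x \<in> wsp \<gamma> \<longleftrightarrow> (\<forall>b\<in>wb. rp x b \<noteq> 0 \<longrightarrow> wt b = \<gamma>)"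
proof
  assume x: "x \<in> wsp \<gamma>"
  show "\<forall>b\<in>wb. rp x b \<noteq> 0 \<longrightarrow> wt b = \<gamma>"
  proof (intro ballI impI)
    fix b assume b: "b \<in> wb" "rp x b \<noteq> 0"
    show "wt b = \<gamma>"
    proof (rule hfun_eqI[OF wt(1)[OF b(1)] assms])
      fix y assume "y \<in> h"
      then have "rp (scale (\<gamma> y) x) b = wt b y * rp x b"
        using x rp_brk[of y b x] b by (simp add: wsp_def)
      then show "wt b y = \<gamma> y" using b by (simp add: rp_simps)
    qed
  qed
next
  assume *: "\<forall>b\<in>wb. rp x b \<noteq> 0 \<longrightarrow> wt b = \<gamma>"
  have "brk y x = scale (\<gamma> y) x" if "y \<in> h" for y
  proof (rule eq_rpI)
    fix b assume "b \<in> wb"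
    then show "rp (brk y x) b = rp (scale (\<gamma> y) x) b"
      using * that rp_brk[of y b x] by (cases "rp x b = 0") (auto simp: rp_simps)
  qed
  then show "x \<in> wsp \<gamma>" by (simp add: wsp_def)
qed

lemma wsp_weight:
  assumes "\<gamma> \<in> hfun" "x \<in> wsp \<gamma>" "x \<noteq> 0"
  shows "\<exists>b\<in>wb. wt b = \<gamma>"
proof (rule ccontr)
  assume "\<not> ?thesis"
  then have "\<forall>b\<in>wb. rp x b = rp 0 b" using assms wsp_iff by (auto simp: rp_simps)
  then show False using eq_rpI assms(3) by blast
qed

lemma wsp_dual:
  assumes "\<gamma> \<in> hfun" "x \<in> wsp \<gamma>" "x \<noteq> 0"
  shows "\<gamma> \<in> dual h"
proof -
  have inj: "c = d" if "scale c x = scale d x" for c d using that assms(3) by simp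
  have "\<gamma> (y + z) = \<gamma> y + \<gamma> z" if "y \<in> h" "z \<in> h" for y z
  proof (rule inj)
    have "scale (\<gamma> (y + z)) x = brk (y + z) x"
      using assms(2) subspace_add[OF h_subspace that] by (simp add: wsp_def)
    then show "scale (\<gamma> (y + z)) x = scale (\<gamma> y + \<gamma> z) x"
      using assms(2) that by (simp add: wsp_def brk_simps scale_left_distrib)
  qed
  moreover have "\<gamma> (scale c y) = c * \<gamma> y" if "y \<in> h" for c y
  proof (rule inj)
    have "scale (\<gamma> (scale c y)) x = brk (scale c y) x"
      using assms(2) subspace_scale[OF h_subspace that] by (simp add: wsp_def)
    then show "scale (\<gamma> (scale c y)) x = scale (c * \<gamma> y) x"
      using assms(2) that by (simp add: wsp_def brk_simps)
  qed
  ultimately show ?thesis using assms(1) by (auto simp: dual_def hfun_def)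
qed

lemma wt_dual: "b \<in> wb \<Longrightarrow> wt b \<in> dual h"
  using wsp_dual wt wb_nonzero by blast

lemma roots_eq: "roots h = wt ` wb - {0}"
proof
  show "roots h \<subseteq> wt ` wb - {0}"
  proof
    fix \<beta> assume "\<beta> \<in> roots h"
    then obtain x where "\<beta> \<in> hfun" "\<beta> \<noteq> 0" "x \<noteq> 0" "x \<in> wsp \<beta>"
      using dual_subset_hfun by (auto simp: roots_def wsp_def)
    then show "\<beta> \<in> wt ` wb - {0}" using wsp_weight by blast
  qed
  show "wt ` wb - {0} \<subseteq> roots h"
    using wt_dual wt wb_nonzero by (fastforce simp: roots_def wsp_def)
qed

lemma trace_wb: "module_hom scale scale g \<Longrightarrow> trace g = (\<Sum>b\<in>wb. rp (g b) b)"
  by (rule trace_basis[OF wb(2,3)])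

lemma killing_h: "y \<in> h \<Longrightarrow> z \<in> h \<Longrightarrow> killing y z = (\<Sum>b\<in>wb. wt b y * wt b z)"
  unfolding killing_def trace_wb[OF brk2_hom] by (rule sum.cong) (auto simp: rp_brk rp_basis)

lemma iterate_wsp:
  assumes "x \<in> wsp \<gamma>" "v \<in> wsp \<delta>"
  shows "(brk x ^^ k) v \<in> wsp (\<lambda>y. \<delta> y + of_nat k * \<gamma> y)"
proof (induction k)
  case 0
  then show ?case using assms by simp
next
  case (Suc k)
  from wsp_brk[OF assms(1) this]
  have "(brk x ^^ Suc k) v \<in> wsp (\<gamma> + (\<lambda>y. \<delta> y + of_nat k * \<gamma> y))" by simp
  also have "\<gamma> + (\<lambda>y. \<delta> y + of_nat k * \<gamma> y) = (\<lambda>y. \<delta> y + of_nat (Suc k) * \<gamma> y)"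
    by (auto simp: algebra_simps)
  finally show ?case .
qed

lemma funpow_hom: "module_hom scale scale g \<Longrightarrow> module_hom scale scale (g ^^ k)"
  by (induction k) (auto simp: module_hom_iff module_axioms)

text \<open>The iterates have pairwise different weights, and only finitely many weights occur.\<close>

lemma iterate_vanishes:
  assumes "x \<in> wsp \<gamma>" "\<gamma> \<in> hfun" "\<gamma> \<noteq> 0" "v \<in> wsp \<delta>" "\<delta> \<in> hfun"
  shows "\<exists>k. (brk x ^^ k) v = 0"
proof (rule ccontr)
  assume *: "\<nexists>k. (brk x ^^ k) v = 0"
  define w where "w k = (\<lambda>y. \<delta> y + of_nat k * \<gamma> y)" for k :: nat
  have "w k \<in> hfun" for k using assms by (auto simp: hfun_def w_def)
  then have "w k \<in> wt ` wb" for k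
  proof -
    have "(brk x ^^ k) v \<in> wsp (w k)" using iterate_wsp[OF assms(1,4)] by (simp add: w_def)
    moreover have "(brk x ^^ k) v \<noteq> 0" using * by blast
    ultimately show ?thesis using wsp_weight[OF \<open>w k \<in> hfun\<close>] by (metis image_eqI)
  qed
  then have "range w \<subseteq> wt ` wb" by blast
  moreover have "inj w"
  proof (rule injI)
    fix k l assume kl: "w k = w l"
    obtain y where y: "\<gamma> y \<noteq> 0" using assms(3) by (auto simp: fun_eq_iff)
    from fun_cong[OF kl, of y] y show "k = l" by (simp add: w_def)
  qed
  ultimately show False
    using finite_wb by (metis finite_imageI finite_subset infinite_UNIV_nat range_inj_infinite)
qed

lemma ad_nilpotent:
  assumes "x \<in> wsp \<gamma>" "\<gamma> \<in> hfun" "\<gamma> \<noteq> 0"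
  shows "\<exists>k. \<forall>v. (brk x ^^ k) v = 0"
proof -
  have "\<forall>b\<in>wb. \<exists>k. (brk x ^^ k) b = 0" using iterate_vanishes[OF assms] wt by blast
  then obtain k where k: "\<And>b. b \<in> wb \<Longrightarrow> (brk x ^^ k b) b = 0" by metis
  define n where "n = sum k wb"
  have "(brk x ^^ n) b = 0" if b: "b \<in> wb" for b
  proof -
    have "n = (n - k b) + k b" using b finite_wb by (simp add: n_def member_le_sum)
    then have "(brk x ^^ n) b = (brk x ^^ (n - k b)) ((brk x ^^ k b) b)"
      by (metis comp_apply funpow_add)
    then show ?thesis using k[OF b] module_hom.zero[OF funpow_hom[OF brk_hom_right]] by simp
  qed
  moreover have "module_hom scale scale (\<lambda>v. 0)" by (simp add: module_hom_iff module_axioms)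
  ultimately have "\<forall>v. (brk x ^^ n) v = 0"
    using hom_eqI[OF funpow_hom[OF brk_hom_right], of "\<lambda>v. 0"] by blast
  then show ?thesis by blast
qed

lemma stable_decomposition:
  assumes U: "subspace U" and st: "\<And>y x. y \<in> h \<Longrightarrow> x \<in> U \<Longrightarrow> brk y x \<in> U" and x: "x \<in> U"
  shows "\<exists>\<Gamma> w. finite \<Gamma> \<and> \<Gamma> \<subseteq> hfun \<and> (\<forall>\<gamma>\<in>\<Gamma>. w \<gamma> \<in> wsp \<gamma> \<and> w \<gamma> \<in> U) \<and> x = sum w \<Gamma>"
proof -
  obtain \<Gamma> w where *: "finite \<Gamma>" "\<Gamma> \<subseteq> hfun" "\<forall>\<gamma>\<in>\<Gamma>. w \<gamma> \<in> wsp \<gamma>" "x = sum w \<Gamma>"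
    using span_Union_decomp[of x wsp hfun] weight_vectors_span wsp_subspace by auto
  have "\<forall>\<gamma>\<in>\<Gamma>. w \<gamma> \<in> U"
  proof (rule eigen_component[OF *(1) U, of h])
    show "\<exists>y\<in>h. \<gamma> y \<noteq> \<delta> y" if "\<gamma> \<in> \<Gamma>" "\<delta> \<in> \<Gamma>" "\<gamma> \<noteq> \<delta>" for \<gamma> \<delta>
      using that *(2) hfun_eqI[of \<gamma> \<delta>] by blast
  qed (use * st x in \<open>auto simp: wsp_def\<close>)
  then show ?thesis using * by blast
qed

section \<open>Engel's theorem\<close>

text \<open>The subalgebras to which Engel's theorem applies: they are sums of subspaces of root spaces, and
  root vectors are ad-nilpotent by \<open>ad_nilpotent\<close>.\<close>

definition hsub :: "'g set \<Rightarrow> bool" where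
  "hsub K \<longleftrightarrow> subspace K \<and> (\<forall>y\<in>h. \<forall>x\<in>K. brk y x \<in> K) \<and>
     (\<forall>x\<in>K. \<forall>y\<in>K. brk x y \<in> K) \<and> K \<inter> h \<subseteq> {0}"

text \<open>Engel's theorem for the action of \<open>K\<close> on the quotient of \<open>V\<close> by \<open>W\<close>. A maximal proper \<open>h\<close>-stable
  subalgebra \<open>K'\<close> has codimension one: by induction some weight vector \<open>x1\<close> outside \<open>K'\<close> normalizes it,
  and \<open>K'\<close> together with \<open>x1\<close> spans a larger \<open>h\<close>-stable subalgebra. The vectors that \<open>K'\<close> maps into \<open>W\<close>
  are stable under \<open>x1\<close>, and since \<open>x1\<close> is nilpotent its iterates reach \<open>W\<close>; the one just before is the vector sought.\<close>

lemma engel: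
  assumes "hsub K" "subspace V" "subspace W" "W \<subset> V"
    "\<And>x v. x \<in> K \<Longrightarrow> v \<in> V \<Longrightarrow> brk x v \<in> V" "\<And>x v. x \<in> K \<Longrightarrow> v \<in> W \<Longrightarrow> brk x v \<in> W"
  shows "\<exists>v\<in>V - W. \<forall>x\<in>K. brk x v \<in> W"
  using assms
proof (induction "dim K" arbitrary: K V W rule: less_induct)
  case less
  note K = less.prems(1)
  have Ks: "subspace K" and Kh: "\<And>y x. y \<in> h \<Longrightarrow> x \<in> K \<Longrightarrow> brk y x \<in> K"
    and Kb: "\<And>x y. x \<in> K \<Longrightarrow> y \<in> K \<Longrightarrow> brk x y \<in> K" and K0: "K \<inter> h \<subseteq> {0}"
    using K by (auto simp: hsub_def)
  show ?case
  proof (cases "K = {0}")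
    case True
    obtain v where "v \<in> V - W" using less.prems(4) by blast
    then show ?thesis using True subspace_0[OF less.prems(3)] by (intro bexI[of _ v]) (auto simp: brk_simps)
  next
    case False
    have "hsub {0}" by (auto simp: hsub_def brk_simps)
    moreover have "{0} \<subset> K" using False subspace_0[OF Ks] by blast
    ultimately have "\<exists>K'. (hsub K' \<and> K' \<subset> K) \<and> (\<forall>L. hsub L \<and> L \<subset> K \<longrightarrow> dim L \<le> dim K')"
      using ex_has_greatest_nat[of "\<lambda>L. hsub L \<and> L \<subset> K" "{0}" dim "Suc fd.dimension"]
        fd.dim_subset_UNIV by (simp add: less_Suc_eq_le)
    then obtain K' where K': "hsub K'" "K' \<subset> K"
      and max: "\<And>L. hsub L \<Longrightarrow> L \<subset> K \<Longrightarrow> dim L \<le> dim K'" by blast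
    have K's: "subspace K'" and K'h: "\<And>y x. y \<in> h \<Longrightarrow> x \<in> K' \<Longrightarrow> brk y x \<in> K'"
      and K'b: "\<And>x y. x \<in> K' \<Longrightarrow> y \<in> K' \<Longrightarrow> brk x y \<in> K'"
      using K' by (auto simp: hsub_def)
    have dim: "dim L < dim L'" if "subspace L" "subspace L'" "L \<subset> L'" for L L'
    proof -
      have eq: "span L = L" "span L' = L'" using that by simp_all
      show ?thesis using fd.dim_psubset[of L L'] that(3) unfolding eq .
    qed
    have lt: "dim K' < dim K" using dim K's Ks K'(2) by blast
    define V0 where "V0 = {x \<in> K. \<forall>k\<in>K'. brk k x \<in> K'}"
    have V0s: "subspace V0"
      by (rule subspaceI) (auto simp: V0_def brk_simps subspace_add[OF Ks] subspace_add[OF K's]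
          subspace_scale[OF Ks] subspace_scale[OF K's] subspace_0[OF Ks] subspace_0[OF K's])
    have V0h: "brk y x \<in> V0" if "y \<in> h" "x \<in> V0" for y x
    proof -
      have "brk k (brk y x) \<in> K'" if k: "k \<in> K'" for k
      proof -
        have "brk k (brk y x) = brk y (brk k x) - brk (brk y k) x" by (simp add: brk_brk)
        moreover have "brk y (brk k x) \<in> K'" "brk (brk y k) x \<in> K'"
          using \<open>x \<in> V0\<close> K'h[OF \<open>y \<in> h\<close>] k by (auto simp: V0_def)
        ultimately show ?thesis using subspace_diff[OF K's] by simp
      qed
      then show ?thesis using that Kh by (auto simp: V0_def)
    qed
    \<comment> \<open>the induction hypothesis for \<open>K'\<close> acting on the quotient of \<open>K\<close> by \<open>K'\<close>\<close>
    have "\<exists>x\<in>K - K'. \<forall>k\<in>K'. brk k x \<in> K'"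
      by (rule less.hyps[OF lt K'(1) Ks K's K'(2)]) (use K'(2) Kb K'b in auto)
    then obtain x where x: "x \<in> V0" "x \<notin> K'" by (auto simp: V0_def)
    obtain \<Gamma> w where w: "\<Gamma> \<subseteq> hfun" "\<forall>\<gamma>\<in>\<Gamma>. w \<gamma> \<in> wsp \<gamma> \<and> w \<gamma> \<in> V0" "x = sum w \<Gamma>"
      using stable_decomposition[OF V0s V0h x(1)] by blast
    obtain \<gamma> where g: "\<gamma> \<in> \<Gamma>" "w \<gamma> \<notin> K'"
      using x(2) w(3) subspace_sum[OF K's, of \<Gamma> w] by blast
    define x1 where "x1 = w \<gamma>"
    have x1: "x1 \<in> V0" "x1 \<notin> K'" "x1 \<in> wsp \<gamma>" "\<gamma> \<in> hfun" using g w by (auto simp: x1_def)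
    have g0: "\<gamma> \<noteq> 0"
    proof
      assume "\<gamma> = 0"
      then have "x1 \<in> K \<inter> h" using x1 wsp_zero by (auto simp: V0_def)
      then show False using K0 x1(2) subspace_0[OF K's] by auto
    qed
    define L where "L = {scale c x1 + k |c k. k \<in> K'}"
    have Lm: "scale c x1 + k \<in> L" if "k \<in> K'" for c k using that L_def by blast
    have x1L: "x1 \<in> L" using Lm[of 0 1] subspace_0[OF K's] by simp
    have K'L: "K' \<subseteq> L" using Lm[of _ 0] by auto
    have LK: "L \<subseteq> K"
      using x1(1) K'(2) Ks by (auto simp: L_def V0_def intro!: subspace_add subspace_scale)
    have Ls: "subspace L"
    proof (rule subspaceI)
      show "0 \<in> L" using K'L subspace_0[OF K's] by blast
      fix u v assume "u \<in> L" "v \<in> L"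
      then obtain c y d z where *: "u = scale c x1 + y" "v = scale d x1 + z" "y \<in> K'" "z \<in> K'"
        unfolding L_def by blast
      have eq: "u + v = scale (c + d) x1 + (y + z)"
        by (simp add: * scale_left_distrib algebra_simps)
      show "u + v \<in> L" unfolding eq by (intro Lm subspace_add[OF K's] *)
    next
      fix a u assume "u \<in> L"
      then obtain c y where *: "u = scale c x1 + y" "y \<in> K'" unfolding L_def by blast
      have "scale a u = scale (a * c) x1 + scale a y" by (simp add: * scale_right_distrib)
      then show "scale a u \<in> L" using Lm * subspace_scale[OF K's] by simp
    qed
    have bk: "brk k x1 \<in> K'" "brk x1 k \<in> K'" if "k \<in> K'" for k
    proof -
      show 1: "brk k x1 \<in> K'" using x1(1) that by (auto simp: V0_def)
      then show "brk x1 k \<in> K'" using brk_antisym[of x1 k] subspace_neg[OF K's] by simp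
    qed
    have "hsub L"
      unfolding hsub_def
    proof (intro conjI ballI)
      fix y u assume y: "y \<in> h" and u: "u \<in> L"
      then obtain c k where *: "u = scale c x1 + k" "k \<in> K'" unfolding L_def by blast
      have "brk y u = scale (c * \<gamma> y) x1 + brk y k" using x1(3) y by (simp add: * brk_simps wsp_def)
      then show "brk y u \<in> L" using Lm K'h[OF y *(2)] by simp
    next
      fix u v assume "u \<in> L" "v \<in> L"
      then obtain c y d z where *: "u = scale c x1 + y" "v = scale d x1 + z" "y \<in> K'" "z \<in> K'"
        unfolding L_def by blast
      have "brk u v = scale c (brk x1 z) + scale d (brk y x1) + brk y z"
        by (simp add: * brk_simps brk_self scale_right_distrib)
      also have "\<dots> \<in> K'"
        using bk * K'b by (intro subspace_add[OF K's] subspace_scale[OF K's]) auto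
      finally show "brk u v \<in> L" using K'L by blast
    qed (use Ls LK K0 in auto)
    then have LK_eq: "L = K"
      using max[of L] dim[OF K's Ls] LK K'L x1L x1(2) by (metis leD psubsetI)
    define V1 where "V1 = {v \<in> V. \<forall>k\<in>K'. brk k v \<in> W}"
    \<comment> \<open>the induction hypothesis for \<open>K'\<close> acting on the quotient of \<open>V\<close> by \<open>W\<close>\<close>
    have "\<exists>v\<in>V - W. \<forall>k\<in>K'. brk k v \<in> W"
      by (rule less.hyps[OF lt K'(1) less.prems(2,3,4)]) (use K'(2) less.prems(5,6) in auto)
    then obtain v where v: "v \<in> V1" "v \<notin> W" by (auto simp: V1_def)
    have V1x: "brk x1 u \<in> V1" if "u \<in> V1" for u
    proof -
      have "brk k (brk x1 u) \<in> W" if k: "k \<in> K'" for k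
      proof -
        have "brk k (brk x1 u) = brk (brk k x1) u + brk x1 (brk k u)" by (simp add: brk_brk)
        moreover have "brk (brk k x1) u \<in> W" using bk[OF k] \<open>u \<in> V1\<close> by (auto simp: V1_def)
        moreover have "brk x1 (brk k u) \<in> W"
          using x1(1) \<open>u \<in> V1\<close> k less.prems(6) by (auto simp: V0_def V1_def)
        ultimately show ?thesis using subspace_add[OF less.prems(3)] by simp
      qed
      then show ?thesis using that x1(1) less.prems(5) by (auto simp: V1_def V0_def)
    qed
    have iter: "(brk x1 ^^ j) v \<in> V1" for j by (induction j) (use v V1x in auto)
    obtain n where "(brk x1 ^^ n) v = 0" using ad_nilpotent[OF x1(3,4) g0] by blast
    then have "(brk x1 ^^ n) v \<in> W" using subspace_0[OF less.prems(3)] by simp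
    then obtain j where j: "(brk x1 ^^ j) v \<in> W" "\<And>i. i < j \<Longrightarrow> (brk x1 ^^ i) v \<notin> W"
      using exists_least_iff[of "\<lambda>j. (brk x1 ^^ j) v \<in> W"] by blast
    then obtain i where i: "j = Suc i" using v(2) by (cases j) auto
    define u where "u = (brk x1 ^^ i) v"
    have u: "u \<in> V1" "u \<notin> W" "brk x1 u \<in> W" using iter j i by (auto simp: u_def)
    have "brk x u \<in> W" if "x \<in> K" for x
    proof -
      from that LK_eq obtain c k where "x = scale c x1 + k" "k \<in> K'" unfolding L_def by blast
      then show ?thesis
        using u by (auto simp: brk_simps V1_def
            intro!: subspace_add[OF less.prems(3)] subspace_scale[OF less.prems(3)])
    qed
    then show ?thesis using u by (auto simp: V1_def)
  qed
qed

section \<open>Nondegeneracy of the Killing form\<close>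

lemma abelian_ideal_zero:
  assumes I: "lie_ideal I" and "\<And>x y. x \<in> I \<Longrightarrow> y \<in> I \<Longrightarrow> brk x y = 0"
  shows "I = {0}"
proof -
  have "{brk x y |x y. x \<in> I \<and> y \<in> I} \<subseteq> {0}" using assms(2) by auto
  then have "derived I \<subseteq> {0}" unfolding derived_def using span_minimal subspace_single_0 by blast
  then have "derived I = {0}" by (auto simp: derived_def span_zero)
  then have "(derived ^^ 1) I = {0}" by simp
  then have "solvable I" unfolding solvable_def by blast
  then show ?thesis using I semisimple by (simp add: semisimple_def)
qed

lemma center_zero:
  assumes "\<And>x. brk z x = 0" shows "z = 0"
proof -
  have zx: "brk x z = 0" for x using assms brk_antisym[of x z] by simp
  have "lie_ideal (span {z})"
    unfolding lie_ideal_def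
  proof (intro conjI allI ballI)
    fix x y assume "y \<in> span {z}"
    then obtain c where "y = scale c z" by (auto simp: span_singleton)
    then have "brk x y = 0" using zx by (simp add: brk_simps)
    then show "brk x y \<in> span {z}" by (simp add: span_zero)
  qed simp
  moreover have "brk x y = 0" if "x \<in> span {z}" "y \<in> span {z}" for x y
    using that assms by (auto simp: span_singleton brk_simps)
  ultimately have "span {z} = {0}" by (rule abelian_ideal_zero)
  then show ?thesis using span_base[of z "{z}"] by simp
qed

text \<open>Let \<open>D\<close> multiply the vectors of weight \<open>\<gamma>\<close> by \<open>\<chi> \<gamma>\<close>. As \<open>\<chi>\<close> is
  constant along strings, \<open>D\<close> commutes with \<open>e\<close> and \<open>f\<close>, so the trace of \<open>D\<close>
  times the commutator of \<open>e\<close> and \<open>f\<close> is zero. With the indicator function of one string of weights this says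
  that \<open>brk e f\<close> has trace zero on the string.\<close>

lemma string_trace:
  assumes e: "e \<in> wsp \<alpha>" and f: "f \<in> wsp (- \<alpha>)" and a: "\<alpha> \<in> hfun"
    and per: "\<And>\<gamma>. \<chi> (\<gamma> + \<alpha>) = (\<chi> \<gamma> :: complex)"
  shows "(\<Sum>b\<in>wb. \<chi> (wt b) * wt b (brk e f)) = 0"
proof -
  define D where "D x = (\<Sum>b\<in>wb. scale (\<chi> (wt b) * rp x b) b)" for x
  have rpD: "rp (D x) b = \<chi> (wt b) * rp x b" if "b \<in> wb" for x b
    using that by (simp add: D_def rp_lincomb)
  have D_hom: "module_hom scale scale D"
    unfolding module_hom_iff using module_axioms
    by (auto simp: rpD rp_simps algebra_simps intro!: eq_rpI)
  have D_wsp: "D u = scale (\<chi> \<gamma>) u" if "u \<in> wsp \<gamma>" "\<gamma> \<in> hfun" for u \<gamma>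
  proof (rule eq_rpI)
    fix b assume "b \<in> wb"
    then show "rp (D u) b = rp (scale (\<chi> \<gamma>) u) b"
      using that wsp_iff[of \<gamma> u] by (cases "rp u b = 0") (auto simp: rpD rp_simps)
  qed
  have comm: "D (brk x u) = brk x (D u)"
    if x: "x \<in> wsp \<beta>" "\<beta> \<in> hfun" and p: "\<And>\<gamma>. \<chi> (\<gamma> + \<beta>) = \<chi> \<gamma>" for x u \<beta>
  proof (rule hom_eqI[of "\<lambda>u. D (brk x u)" "\<lambda>u. brk x (D u)"])
    show "module_hom scale scale (\<lambda>u. D (brk x u))"
      using module_hom_compose[OF brk_hom_right D_hom] by (simp add: comp_def)
    show "module_hom scale scale (\<lambda>u. brk x (D u))"
      using module_hom_compose[OF D_hom brk_hom_right] by (simp add: comp_def)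
    fix b assume b: "b \<in> wb"
    have "D (brk x b) = scale (\<chi> (\<beta> + wt b)) (brk x b)"
      using wsp_brk[OF x(1) wt(2)[OF b]] wt(1)[OF b] x(2) by (intro D_wsp hfun_add) auto
    also have "\<chi> (\<beta> + wt b) = \<chi> (wt b)" by (metis p add.commute)
    finally show "D (brk x b) = brk x (D b)"
      using D_wsp[OF wt(2)[OF b] wt(1)[OF b]] by (simp add: brk_simps)
  qed
  have per': "\<chi> (\<gamma> + - \<alpha>) = \<chi> \<gamma>" for \<gamma> using per[of "\<gamma> + - \<alpha>"] by simp
  let ?z = "brk e f"
  have zh: "?z \<in> h" using wsp_brk[OF e f] by (simp add: wsp_zero)
  have De: "module_hom scale scale (\<lambda>x. D (brk f x))"
    using module_hom_compose[OF brk_hom_right D_hom] by (simp add: comp_def)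
  have "trace (\<lambda>x. D (brk ?z x)) = trace (\<lambda>x. D (brk e (brk f x))) - trace (\<lambda>x. D (brk f (brk e x)))"
    by (simp add: brk_brk module_hom.diff[OF D_hom] trace_diff)
  also have "trace (\<lambda>x. D (brk e (brk f x))) = trace (\<lambda>x. brk e (D (brk f x)))"
    by (simp add: comm[OF e a per])
  also have "\<dots> = trace (\<lambda>x. D (brk f (brk e x)))"
    by (rule trace_comm[OF brk_hom_right De])
  finally have "trace (\<lambda>x. D (brk ?z x)) = 0" by simp
  moreover have "module_hom scale scale (\<lambda>x. D (brk ?z x))"
    using module_hom_compose[OF brk_hom_right D_hom] by (simp add: comp_def)
  ultimately have "(\<Sum>b\<in>wb. rp (D (brk ?z b)) b) = 0" by (simp add: trace_wb)
  moreover have "(\<Sum>b\<in>wb. rp (D (brk ?z b)) b) = (\<Sum>b\<in>wb. \<chi> (wt b) * wt b ?z)"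
    by (rule sum.cong) (auto simp: rpD rp_brk[OF zh] rp_basis)
  ultimately show ?thesis by simp
qed

text \<open>Along the string through the weight of \<open>b0\<close> the values at \<open>brk e f\<close> add up to zero, and they differ
  from the value for \<open>b0\<close> by integer multiples of \<open>\<alpha> (brk e f)\<close>.\<close>

lemma weight_ratio:
  assumes e: "e \<in> wsp \<alpha>" and f: "f \<in> wsp (- \<alpha>)" and a: "\<alpha> \<in> hfun" and b0: "b0 \<in> wb"
  shows "\<exists>r::rat. wt b0 (brk e f) = of_rat r * \<alpha> (brk e f)"
proof -
  let ?z = "brk e f"
  define Q where "Q \<gamma> \<longleftrightarrow> (\<exists>k::int. \<forall>x. \<gamma> x = wt b0 x + of_int k * \<alpha> x)" for \<gamma>
  have Qper: "Q (\<gamma> + \<alpha>) \<longleftrightarrow> Q \<gamma>" for \<gamma>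
  proof
    assume "Q (\<gamma> + \<alpha>)"
    then obtain k :: int where "\<forall>x. \<gamma> x + \<alpha> x = wt b0 x + of_int k * \<alpha> x" by (auto simp: Q_def)
    then have "\<forall>x. \<gamma> x = wt b0 x + of_int (k - 1) * \<alpha> x" by (simp add: algebra_simps)
    then show "Q \<gamma>" unfolding Q_def by blast
  next
    assume "Q \<gamma>"
    then obtain k :: int where "\<forall>x. \<gamma> x = wt b0 x + of_int k * \<alpha> x" by (auto simp: Q_def)
    then have "\<forall>x. (\<gamma> + \<alpha>) x = wt b0 x + of_int (k + 1) * \<alpha> x" by (simp add: algebra_simps)
    then show "Q (\<gamma> + \<alpha>)" unfolding Q_def by blast
  qed
  define S where "S = {b\<in>wb. Q (wt b)}"
  have finS: "finite S" using finite_wb by (simp add: S_def)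
  have "Q (wt b0)" unfolding Q_def by (intro exI[of _ 0]) simp
  then have b0S: "b0 \<in> S" using b0 by (simp add: S_def)
  have "(\<Sum>b\<in>wb. (if Q (wt b) then 1 else 0) * wt b ?z) = 0"
    using string_trace[OF e f a, of "\<lambda>\<gamma>. if Q \<gamma> then 1 else 0"] unfolding Qper by simp
  also have "(\<Sum>b\<in>wb. (if Q (wt b) then 1 else 0) * wt b ?z) = (\<Sum>b\<in>S. wt b ?z)"
    unfolding S_def by (simp add: sum.inter_filter finite_wb if_distrib[of "\<lambda>x. x * _"] cong: if_cong)
  finally have 0: "(\<Sum>b\<in>S. wt b ?z) = 0" .
  have "\<forall>b\<in>S. \<exists>k::int. wt b ?z = wt b0 ?z + of_int k * \<alpha> ?z" by (auto simp: S_def Q_def)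
  then obtain k :: "'g \<Rightarrow> int"
    where k: "\<And>b. b \<in> S \<Longrightarrow> wt b ?z = wt b0 ?z + of_int (k b) * \<alpha> ?z" by metis
  have "(\<Sum>b\<in>S. wt b ?z) = of_nat (card S) * wt b0 ?z + of_int (sum k S) * \<alpha> ?z"
    by (simp add: k sum.distrib sum_distrib_right)
  then have eq: "of_nat (card S) * wt b0 ?z = - of_int (sum k S) * \<alpha> ?z"
    using 0 by (simp add: eq_neg_iff_add_eq_0)
  have c: "card S \<noteq> 0" using b0S finS by auto
  have "wt b0 ?z = (of_nat (card S) * wt b0 ?z) / of_nat (card S)" using c by simp
  also have "\<dots> = of_rat (- of_int (sum k S) / of_nat (card S)) * \<alpha> ?z"
    unfolding eq by (simp add: of_rat_divide of_rat_minus of_rat_sum)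
  finally show ?thesis by blast
qed

text \<open>All weights take rational multiples of \<open>\<alpha> (brk e f)\<close> at \<open>brk e f\<close>. If that number were zero, \<open>brk e f\<close>
  would be central. Otherwise \<open>killing (brk e f) (brk e f)\<close> is its square times a sum of rational squares,
  one of which is the contribution of \<open>e\<close> and equals one.\<close>

lemma coroot_nonzero:
  assumes e: "e \<in> wsp \<alpha>" and f: "f \<in> wsp (- \<alpha>)" and a: "\<alpha> \<in> hfun" and nz: "brk e f \<noteq> 0"
  shows "\<alpha> (brk e f) \<noteq> 0" "killing (brk e f) (brk e f) \<noteq> 0"
proof -
  let ?z = "brk e f"
  have zh: "?z \<in> h" using wsp_brk[OF e f] by (simp add: wsp_zero)
  have "\<forall>b\<in>wb. \<exists>r::rat. wt b ?z = of_rat r * \<alpha> ?z" using weight_ratio[OF e f a] by blast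
  then obtain r :: "'g \<Rightarrow> rat" where r: "\<And>b. b \<in> wb \<Longrightarrow> wt b ?z = of_rat (r b) * \<alpha> ?z"
    by metis
  show az: "\<alpha> ?z \<noteq> 0"
  proof
    assume "\<alpha> ?z = 0"
    then have "brk ?z b = 0" if "b \<in> wb" for b
      using r[OF that] wt(2)[OF that] zh by (simp add: wsp_def)
    moreover have "module_hom scale scale (\<lambda>v. 0)" by (simp add: module_hom_iff module_axioms)
    ultimately have "\<forall>x. brk ?z x = 0"
      using hom_eqI[OF brk_hom_right, of "\<lambda>v. 0"] by blast
    then show False using center_zero[of ?z] nz by blast
  qed
  have "e \<noteq> 0" using nz by (auto simp: brk_simps)
  then obtain b where b: "b \<in> wb" "wt b = \<alpha>" using wsp_weight[OF a e] by blast
  then have "r b = 1" using r[OF b(1)] az by simp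
  have "(\<Sum>b\<in>wb. r b * r b) > 0"
    by (rule sum_pos2[OF finite_wb b(1)]) (auto simp: \<open>r b = 1\<close>)
  then have "of_rat (\<Sum>b\<in>wb. r b * r b) \<noteq> (0::complex)" by simp
  moreover have "killing ?z ?z = of_rat (\<Sum>b\<in>wb. r b * r b) * (\<alpha> ?z * \<alpha> ?z)"
    unfolding killing_h[OF zh zh] of_rat_sum of_rat_mult sum_distrib_right
    by (rule sum.cong) (auto simp: r mult_ac)
  ultimately show "killing ?z ?z \<noteq> 0" using az by simp
qed

lemma killing_wsp:
  assumes "x \<in> wsp \<gamma>" "y \<in> wsp \<delta>" "u \<in> h" "\<gamma> u + \<delta> u \<noteq> 0"
  shows "killing x y = 0"
proof -
  have "brk u x = scale (\<gamma> u) x" "brk u y = scale (\<delta> u) y" using assms by (auto simp: wsp_def)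
  moreover have "killing (brk u x) y = - killing x (brk u y)"
    using killing_invariant[of x u y] brk_antisym[of u x] by (simp add: killing_simps)
  ultimately have "(\<gamma> u + \<delta> u) * killing x y = 0" by (simp add: killing_simps algebra_simps)
  then show ?thesis using assms(4) by simp
qed

lemma derived_ideal:
  assumes "lie_ideal I" shows "lie_ideal (derived I)"
  unfolding lie_ideal_def
proof (intro conjI allI ballI)
  show "subspace (derived I)" by (simp add: derived_def)
  fix x y assume "y \<in> derived I"
  then show "brk x y \<in> derived I"
    unfolding derived_def
  proof (induction rule: span_induct_alt)
    case base
    show ?case by (simp add: brk_simps span_zero)
  next
    case (step c u v)
    then obtain a b where ab: "u = brk a b" "a \<in> I" "b \<in> I" by blast
    have "brk x u = brk (brk x a) b + brk a (brk x b)" by (simp add: ab brk_brk)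
    moreover have "brk x a \<in> I" "brk x b \<in> I" using assms ab by (auto simp: lie_ideal_def)
    ultimately have "brk x u \<in> span {brk x y |x y. x \<in> I \<and> y \<in> I}"
      using ab by (simp only:) (intro span_add span_base; blast)
    then show ?case using step by (auto simp: brk_simps intro!: span_add span_scale)
  qed
qed

lemma ideal_decomposition:
  assumes "lie_ideal I" "x \<in> I"
  shows "\<exists>\<Gamma> w. finite \<Gamma> \<and> \<Gamma> \<subseteq> hfun \<and> (\<forall>\<gamma>\<in>\<Gamma>. w \<gamma> \<in> wsp \<gamma> \<and> w \<gamma> \<in> I) \<and> x = sum w \<Gamma>"
  using assms by (intro stable_decomposition) (auto simp: lie_ideal_def)

text \<open>Cartan's criterion. Let \<open>I\<close> be the radical of the form and \<open>J\<close> its derived ideal. A bracket of opposite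
  root vectors of \<open>I\<close> is isotropic and therefore zero by \<open>coroot_nonzero\<close>, so \<open>J\<close> lies in the sum of the
  root spaces and Engel's theorem applies to it. If \<open>J\<close> were nonzero its center would be a nonzero abelian
  ideal. So \<open>I\<close> is abelian, hence zero.\<close>

lemma killing_nondegenerate:
  assumes "\<And>y. killing x y = 0" shows "x = 0"
proof -
  define I where "I = {x. \<forall>y. killing x y = 0}"
  have I: "lie_ideal I"
    unfolding lie_ideal_def
  proof (intro conjI allI ballI)
    show "subspace I" by (rule subspaceI) (auto simp: I_def killing_simps)
    fix x y assume "y \<in> I"
    have "killing (brk y x) z = 0" for z
      using \<open>y \<in> I\<close> by (simp add: killing_invariant I_def)
    then show "brk x y \<in> I" using brk_antisym[of x y] by (simp add: I_def killing_simps)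
  qed
  define J where "J = derived I"
  have J: "lie_ideal J" unfolding J_def by (rule derived_ideal[OF I])
  have Js: "subspace J" using J by (simp add: lie_ideal_def)
  define V where "V = span {b\<in>wb. wt b \<noteq> 0}"
  have wV: "x \<in> V" if "\<gamma> \<in> hfun" "\<gamma> \<noteq> 0" "x \<in> wsp \<gamma>" for x \<gamma>
  proof -
    have "(\<Sum>b\<in>wb. scale (rp x b) b) \<in> V"
      unfolding V_def
    proof (rule span_sum)
      fix b assume "b \<in> wb"
      then show "scale (rp x b) b \<in> span {b \<in> wb. wt b \<noteq> 0}"
        using wsp_iff[OF that(1)] that by (cases "rp x b = 0") (auto simp: span_zero intro!: span_scale intro: span_base)
    qed
    then show ?thesis by (simp add: rp_sum)
  qed
  have IV: "brk a b \<in> V" if ab: "a \<in> I" "b \<in> I" for a b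
  proof -
    obtain \<Gamma> w where w: "\<Gamma> \<subseteq> hfun" "\<forall>\<gamma>\<in>\<Gamma>. w \<gamma> \<in> wsp \<gamma> \<and> w \<gamma> \<in> I" "a = sum w \<Gamma>"
      using ideal_decomposition[OF I ab(1)] by blast
    obtain \<Delta> v where v: "\<Delta> \<subseteq> hfun" "\<forall>\<gamma>\<in>\<Delta>. v \<gamma> \<in> wsp \<gamma> \<and> v \<gamma> \<in> I" "b = sum v \<Delta>"
      using ideal_decomposition[OF I ab(2)] by blast
    have "brk (w \<gamma>) (v \<delta>) \<in> V" if "\<gamma> \<in> \<Gamma>" "\<delta> \<in> \<Delta>" for \<gamma> \<delta>
    proof (cases "\<gamma> + \<delta> = 0")
      case True
      then have d: "\<delta> = - \<gamma>" by (simp add: eq_neg_iff_add_eq_0 add.commute)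
      have "brk (w \<gamma>) (v \<delta>) \<in> I"
        using I v that by (auto simp: lie_ideal_def)
      then have "killing (brk (w \<gamma>) (v \<delta>)) (brk (w \<gamma>) (v \<delta>)) = 0" by (simp add: I_def)
      then have "brk (w \<gamma>) (v \<delta>) = 0"
        using coroot_nonzero(2)[of "w \<gamma>" \<gamma> "v \<delta>"] w v that d by blast
      then show ?thesis by (simp add: V_def span_zero)
    next
      case False
      then show ?thesis
        using wsp_brk[of "w \<gamma>" \<gamma> "v \<delta>" \<delta>] w v that
        by (intro wV[of "\<gamma> + \<delta>"] hfun_add) auto
    qed
    then show ?thesis
      unfolding w(3) v(3) brk_sum_left brk_sum_right V_def by (intro span_sum) auto
  qed
  have "J \<subseteq> V"
    unfolding J_def derived_def
    by (rule span_minimal) (use IV in \<open>auto simp: V_def\<close>)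
  moreover have "V \<inter> h \<subseteq> {0}"
  proof
    fix x assume x: "x \<in> V \<inter> h"
    have "rp x b = 0" if "b \<in> wb" for b
    proof (cases "wt b = 0")
      case True
      have "V \<subseteq> {x. rp x b = 0}"
        unfolding V_def using True that
        by (intro span_minimal subspaceI) (auto simp: rp_simps rp_basis)
      then have "x \<in> {x. rp x b = 0}" using x by blast
      then show ?thesis by simp
    next
      case False
      then show ?thesis using x wsp_iff[OF hfun_zero, of x] that by (auto simp: wsp_zero)
    qed
    then show "x \<in> {0}" using eq_rpI[of x 0] by (simp add: rp_simps)
  qed
  ultimately have "hsub J" using J by (auto simp: hsub_def lie_ideal_def)
  have "J = {0}"
  proof (rule ccontr)
    assume "J \<noteq> {0}"
    then have "{0} \<subset> J" using subspace_0[OF Js] by blast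
    then have "\<exists>v\<in>J - {0}. \<forall>x\<in>J. brk x v \<in> {0}"
      by (intro engel \<open>hsub J\<close> Js) (use J in \<open>auto simp: lie_ideal_def brk_simps\<close>)
    then obtain v where v: "v \<in> J" "v \<noteq> 0" "\<And>x. x \<in> J \<Longrightarrow> brk x v = 0" by blast
    define Z where "Z = {v\<in>J. \<forall>x\<in>J. brk x v = 0}"
    have "lie_ideal Z"
      unfolding lie_ideal_def
    proof (intro conjI allI ballI)
      show "subspace Z"
        by (rule subspaceI) (auto simp: Z_def brk_simps subspace_add[OF Js] subspace_scale[OF Js] subspace_0[OF Js])
      fix y u assume u: "u \<in> Z"
      have "brk k (brk y u) = 0" if "k \<in> J" for k
      proof -
        have "brk y k \<in> J" using J that by (auto simp: lie_ideal_def)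
        then have "brk k y \<in> J" using brk_antisym[of k y] subspace_neg[OF Js] by simp
        moreover have "brk k (brk y u) = brk (brk k y) u + brk y (brk k u)" by (simp add: brk_brk)
        ultimately show ?thesis using u that by (simp add: Z_def brk_simps)
      qed
      then show "brk y u \<in> Z" using u J by (auto simp: Z_def lie_ideal_def)
    qed
    then have "Z = {0}" by (rule abelian_ideal_zero) (auto simp: Z_def)
    moreover have "v \<in> Z" using v by (simp add: Z_def)
    ultimately show False using v(2) by simp
  qed
  then have "brk a b = 0" if "a \<in> I" "b \<in> I" for a b
    using that span_base[of "brk a b" "{brk x y |x y. x \<in> I \<and> y \<in> I}"]
    unfolding J_def derived_def by blast
  then have "I = {0}" by (rule abelian_ideal_zero[OF I])
  moreover have "x \<in> I" using assms by (simp add: I_def)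
  ultimately show ?thesis by simp
qed

text \<open>The root spaces are orthogonal to \<open>h\<close>.\<close>

lemma h_killing_nondegenerate:
  assumes "x \<in> h" "\<And>y. y \<in> h \<Longrightarrow> killing x y = 0" shows "x = 0"
proof (rule killing_nondegenerate)
  fix y
  have "killing x b = 0" if b: "b \<in> wb" for b
  proof (cases "wt b = 0")
    case True
    then show ?thesis using assms(2) wt(2)[OF b] by (simp add: wsp_zero)
  next
    case False
    then obtain u where "u \<in> h" "wt b u \<noteq> 0" using hfun_eqI[OF wt(1)[OF b] hfun_zero] by auto
    then show ?thesis using killing_wsp[of x 0 b "wt b" u] assms(1) wt(2)[OF b] by (simp add: wsp_zero)
  qed
  then have "killing x (\<Sum>b\<in>wb. scale (rp y b) b) = 0"
    by (simp add: module_hom.sum[OF killing_hom_right] killing_simps)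
  then show "killing x y = 0" by (simp add: rp_sum)
qed

text \<open>Nondegeneracy gives \<open>x\<close> that pairs like \<open>\<beta>\<close> with the basis vectors in \<open>h\<close> and to zero with the root
  vectors. By invariance of the form \<open>x\<close> centralizes \<open>h\<close>, so it lies in \<open>h\<close>.\<close>

lemma dual_vec_exists:
  assumes "\<beta> \<in> dual h" shows "\<exists>x\<in>h. \<forall>y\<in>h. killing x y = \<beta> y"
proof -
  \<comment> \<open>the Killing form as an endomorphism, injective by nondegeneracy\<close>
  define T where "T x = (\<Sum>b\<in>wb. scale (killing x b) b)" for x
  have rpT: "rp (T x) b = killing x b" if "b \<in> wb" for x b using that by (simp add: T_def rp_lincomb)
  have T: "Vector_Spaces.linear scale scale T"
    unfolding linear_iff_module_hom module_hom_iff using module_axioms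
    by (auto simp: rpT rp_simps killing_simps intro!: eq_rpI)
  have Th: "module_hom scale scale T" using T by (simp add: linear_iff_module_hom)
  have "inj T"
  proof (rule injI)
    fix x y assume xy: "T x = T y"
    have "x - y = 0"
    proof (rule killing_nondegenerate)
      fix z
      have "killing (x - y) b = 0" if "b \<in> wb" for b
        using rpT[OF that, of x] rpT[OF that, of y] xy by (simp add: killing_simps)
      then have "killing (x - y) (\<Sum>b\<in>wb. scale (rp z b) b) = 0"
        by (simp add: module_hom.sum[OF killing_hom_right] killing_simps)
      then show "killing (x - y) z = 0" by (simp add: rp_sum)
    qed
    then show "x = y" by simp
  qed
  interpret pp: finite_dimensional_vector_space_pair scale "extend_basis {}" scale "extend_basis {}"
    by unfold_locales
  have surj: "surj T" using pp.linear_injective_imp_surjective[OF T \<open>inj T\<close>] by simp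
  \<comment> \<open>the basis vectors of weight zero are those in \<open>h\<close>\<close>
  obtain x where x: "(\<Sum>b\<in>wb. scale (if wt b = 0 then \<beta> b else 0) b) = T x"
    by (rule surjE[OF surj])
  have kb: "killing x b = (if wt b = 0 then \<beta> b else 0)" if "b \<in> wb" for b
    using rpT[OF that, of x] unfolding x[symmetric] rp_lincomb[OF that] by simp
  have kx: "killing x y = (\<Sum>b\<in>wb. rp y b * killing x b)" for y
  proof -
    have "killing x y = killing x (\<Sum>b\<in>wb. scale (rp y b) b)" by (simp add: rp_sum)
    then show ?thesis by (simp add: module_hom.sum[OF killing_hom_right] killing_simps)
  qed
  have "x \<in> h"
  proof (rule h_self_centralizing)
    fix y assume y: "y \<in> h"
    show "brk y x = 0"
    proof (rule killing_nondegenerate)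
      fix z
      have "killing (brk y x) z = - killing x (brk y z)"
        using killing_invariant[of x y z] brk_antisym[of y x] by (simp add: killing_simps)
      also have "killing x (brk y z) = (\<Sum>b\<in>wb. rp (brk y z) b * killing x b)" by (rule kx)
      also have "\<dots> = (\<Sum>b\<in>wb. 0)"
        by (rule sum.cong) (auto simp: rp_brk y kb)
      finally show "killing (brk y x) z = 0" by simp
    qed
  qed
  moreover have "killing x y = \<beta> y" if y: "y \<in> h" for y
  proof -
    have \<beta>sum: "\<beta> (\<Sum>b\<in>S. scale (c b) b) = (\<Sum>b\<in>S. c b * \<beta> b)" if "finite S" "S \<subseteq> h" for c S
      using that
    proof (induction S rule: finite_induct)
      case empty
      have "\<beta> (scale 0 0) = 0 * \<beta> 0" using assms subspace_0[OF h_subspace] unfolding dual_def by blast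
      then show ?case by simp
    next
      case (insert s S)
      have "(\<Sum>b\<in>S. scale (c b) b) \<in> h"
        using insert by (intro subspace_sum[OF h_subspace] subspace_scale[OF h_subspace]) auto
      moreover have "scale (c s) s \<in> h" using insert subspace_scale[OF h_subspace] by auto
      ultimately show ?case using insert assms by (auto simp: dual_def)
    qed
    define S where "S = {b\<in>wb. wt b = 0}"
    have Sh: "S \<subseteq> h"
    proof
      fix b assume "b \<in> S"
      then show "b \<in> h" using wt(2)[of b] wsp_zero by (simp add: S_def)
    qed
    have rp0: "rp y b = 0" if "b \<in> wb" "b \<notin> S" for b
      using that y wsp_iff[OF hfun_zero, of y] by (auto simp: S_def wsp_zero)
    have "y = (\<Sum>b\<in>S. scale (rp y b) b)"
    proof -
      have "(\<Sum>b\<in>S. scale (rp y b) b) = (\<Sum>b\<in>wb. scale (rp y b) b)"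
        by (rule sum.mono_neutral_left) (auto simp: finite_wb rp0, auto simp: S_def)
      then show ?thesis by (simp add: rp_sum)
    qed
    then have "\<beta> y = (\<Sum>b\<in>S. rp y b * \<beta> b)" using \<beta>sum[OF _ Sh, of "rp y"] finite_wb by (simp add: S_def)
    also have "\<dots> = (\<Sum>b\<in>wb. rp y b * killing x b)"
      by (rule sum.mono_neutral_cong_left) (use finite_wb rp0 kb in \<open>auto simp: S_def\<close>)
    finally show ?thesis using kx[of y] by simp
  qed
  ultimately show ?thesis by blast
qed

section \<open>The form on weights and its integrality\<close>

abbreviation dv :: "('g \<Rightarrow> complex) \<Rightarrow> 'g" where "dv \<equiv> dual_vec h"

lemma dual_vec_unique:
  assumes "x \<in> h" "\<And>y. y \<in> h \<Longrightarrow> killing x y = \<beta> y"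
  shows "dv \<beta> = x"
  unfolding dual_vec_def
proof (rule the_equality)
  show "x \<in> h \<and> (\<forall>y\<in>h. killing x y = \<beta> y)" using assms by blast
  fix x' assume *: "x' \<in> h \<and> (\<forall>y\<in>h. killing x' y = \<beta> y)"
  have "x' - x = 0"
    by (rule h_killing_nondegenerate)
      (use * assms subspace_diff[OF h_subspace] in \<open>auto simp: killing_simps\<close>)
  then show "x' = x" by simp
qed

lemma dual_vec:
  assumes "\<beta> \<in> dual h"
  shows "dv \<beta> \<in> h" "\<And>y. y \<in> h \<Longrightarrow> killing (dv \<beta>) y = \<beta> y"
proof -
  obtain x where x: "x \<in> h" "\<And>y. y \<in> h \<Longrightarrow> killing x y = \<beta> y" using dual_vec_exists[OF assms] by blast
  then have "dv \<beta> = x" by (rule dual_vec_unique)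
  then show "dv \<beta> \<in> h" "\<And>y. y \<in> h \<Longrightarrow> killing (dv \<beta>) y = \<beta> y" using x by auto
qed


lemma dual_form_eq:
  assumes "\<mu> \<in> dual h" "\<nu> \<in> dual h"
  shows "dual_form h \<mu> \<nu> = \<mu> (dv \<nu>)"
  using dual_vec[OF assms(1)] dual_vec(1)[OF assms(2)] by (simp add: dual_form_def)

lemma dual_form_sym: "dual_form h \<mu> \<nu> = dual_form h \<nu> \<mu>"
  by (simp add: dual_form_def killing_sym)

lemma dual_add: "\<mu> \<in> dual h \<Longrightarrow> \<nu> \<in> dual h \<Longrightarrow> \<mu> + \<nu> \<in> dual h"
  by (auto simp: dual_def algebra_simps)

lemma dual_uminus: "\<mu> \<in> dual h \<Longrightarrow> - \<mu> \<in> dual h"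
  by (auto simp: dual_def algebra_simps)

lemma dual_zero: "0 \<in> dual h" by (auto simp: dual_def)

lemma dual_form_add:
  assumes "\<mu> \<in> dual h" "\<nu> \<in> dual h" "\<beta> \<in> dual h"
  shows "dual_form h (\<mu> + \<nu>) \<beta> = dual_form h \<mu> \<beta> + dual_form h \<nu> \<beta>"
  using assms by (simp add: dual_form_eq dual_add)

lemma dual_form_uminus:
  assumes "\<mu> \<in> dual h" "\<beta> \<in> dual h"
  shows "dual_form h (- \<mu>) \<beta> = - dual_form h \<mu> \<beta>"
  using assms by (simp add: dual_form_eq dual_uminus)

text \<open>Raising \<open>b\<close> as long as possible gives \<open>w\<close> killed by \<open>e\<close>, on which \<open>brk e f\<close> acts by \<open>m\<close>. Then \<open>e\<close> takes the
  iterate \<open>j + 1\<close> of \<open>f\<close> on \<open>w\<close> to \<open>(j + 1) * (m - j)\<close> times the iterate \<open>j\<close>. The iterates end, so \<open>m\<close> is a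
  natural number, and the weight of \<open>b\<close> differs from it by an even number.\<close>

lemma sl2_integral:
  assumes e: "e \<in> wsp \<alpha>" and f: "f \<in> wsp (- \<alpha>)" and a: "\<alpha> \<in> hfun"
    and two: "\<alpha> (brk e f) = 2" and b: "b \<in> wb"
  shows "wt b (brk e f) \<in> \<int>"
proof -
  let ?z = "brk e f"
  have zh: "?z \<in> h" using wsp_brk[OF e f] by (simp add: wsp_zero)
  have a0: "\<alpha> \<noteq> 0" using two by auto
  have "\<exists>k. (brk e ^^ k) b = 0" using iterate_vanishes[OF e a a0 wt(2,1)[OF b]] .
  then obtain k where k: "(brk e ^^ k) b = 0" "\<And>i. i < k \<Longrightarrow> (brk e ^^ i) b \<noteq> 0"
    using exists_least_iff[of "\<lambda>k. (brk e ^^ k) b = 0"] by blast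
  then obtain n where n: "k = Suc n" using wb_nonzero[OF b] by (cases k) auto
  define w where "w = (brk e ^^ n) b"
  define \<delta> where "\<delta> = (\<lambda>y. wt b y + of_nat n * \<alpha> y)"
  have w: "w \<noteq> 0" "brk e w = 0" "w \<in> wsp \<delta>"
    using k n iterate_wsp[OF e wt(2)[OF b]] by (auto simp: w_def \<delta>_def)
  have dh: "\<delta> \<in> hfun" using a wt(1)[OF b] by (auto simp: \<delta>_def hfun_def)
  define m where "m = \<delta> ?z"
  have zw: "brk ?z ((brk f ^^ j) w) = scale (m - 2 * of_nat j) ((brk f ^^ j) w)" for j
  proof -
    have "brk ?z ((brk f ^^ j) w) = scale (\<delta> ?z + of_nat j * (- \<alpha>) ?z) ((brk f ^^ j) w)"
      using iterate_wsp[OF f w(3), of j] zh unfolding wsp_def by blast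
    then show ?thesis using two by (simp add: m_def mult.commute)
  qed
  have step: "brk e ((brk f ^^ Suc j) w) = scale (of_nat (Suc j) * (m - of_nat j)) ((brk f ^^ j) w)" for j
  proof (induction j)
    case 0
    have "brk e (brk f w) = brk ?z w + brk f (brk e w)" by (simp add: brk_brk)
    then show ?case using zw[of 0] w(2) by (simp add: brk_simps)
  next
    case (Suc j)
    let ?u = "(brk f ^^ Suc j) w"
    have "brk e ((brk f ^^ Suc (Suc j)) w) = brk ?z ?u + brk f (brk e ?u)" by (simp add: brk_brk)
    also have "brk f (brk e ?u) = scale (of_nat (Suc j) * (m - of_nat j)) ?u"
      unfolding Suc.IH by (simp add: brk_simps)
    also have "brk ?z ?u + \<dots> =
        scale ((m - 2 * of_nat (Suc j)) + of_nat (Suc j) * (m - of_nat j)) ?u"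
      unfolding zw by (rule scale_left_distrib[symmetric])
    also have "(m - 2 * of_nat (Suc j)) + of_nat (Suc j) * (m - of_nat j) =
        of_nat (Suc (Suc j)) * (m - of_nat (Suc j))" by (simp add: algebra_simps)
    finally show ?case .
  qed
  have "- \<alpha> \<noteq> 0" using a0 by simp
  then have "\<exists>j. (brk f ^^ j) w = 0"
    using iterate_vanishes[OF f hfun_uminus[OF a] _ w(3) dh] by blast
  then obtain j where j: "(brk f ^^ j) w = 0" "\<And>i. i < j \<Longrightarrow> (brk f ^^ i) w \<noteq> 0"
    using exists_least_iff[of "\<lambda>j. (brk f ^^ j) w = 0"] by blast
  then obtain i where i: "j = Suc i" using w(1) by (cases j) auto
  have "brk e ((brk f ^^ Suc i) w) = 0" using j(1) unfolding i by (simp only: brk_simps)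
  then have "of_nat (Suc i) * (m - of_nat i) = 0" using step[of i] j(2)[of i] i by simp
  moreover have "(of_nat (Suc i) :: complex) \<noteq> 0" by (rule of_nat_neq_0)
  ultimately have "m = of_nat i" by simp
  then have "wt b ?z = of_nat i - of_nat n * 2" using two by (simp add: m_def \<delta>_def algebra_simps)
  then show ?thesis by simp
qed

lemma root_coroot:
  assumes "\<beta> \<in> roots h"
  obtains e f where "e \<in> wsp \<beta>" "f \<in> wsp (- \<beta>)" "brk e f = dv \<beta>"
proof -
  obtain e where e: "e \<in> wb" "wt e = \<beta>" and b0: "\<beta> \<noteq> 0" using assms roots_eq by auto
  have ew: "e \<in> wsp \<beta>" and bh: "\<beta> \<in> hfun" using wt e by auto
  have bd: "\<beta> \<in> dual h" using wt_dual e by auto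
  have "\<exists>b\<in>wb. killing e b \<noteq> 0"
  proof (rule ccontr)
    assume *: "\<not> ?thesis"
    have "killing e y = 0" for y
    proof -
      have "killing e (\<Sum>b\<in>wb. scale (rp y b) b) = 0"
        using * by (simp add: module_hom.sum[OF killing_hom_right] killing_simps)
      then show ?thesis by (simp add: rp_sum)
    qed
    then show False using killing_nondegenerate wb_nonzero[OF e(1)] by blast
  qed
  then obtain b where b: "b \<in> wb" "killing e b \<noteq> 0" by blast
  have "wt b = - \<beta>"
  proof (rule hfun_eqI[OF wt(1)[OF b(1)] hfun_uminus[OF bh]])
    fix u assume "u \<in> h"
    then have "\<beta> u + wt b u = 0" using killing_wsp[OF ew wt(2)[OF b(1)]] b(2) by blast
    then show "wt b u = (- \<beta>) u" by (simp add: eq_neg_iff_add_eq_0 add.commute)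
  qed
  define f where "f = scale (1 / killing e b) b"
  have f: "f \<in> wsp (- \<beta>)"
    using wt(2)[OF b(1)] subspace_scale[OF wsp_subspace] by (simp add: f_def \<open>wt b = - \<beta>\<close>)
  have "dv \<beta> = brk e f"
  proof (rule dual_vec_unique)
    show "brk e f \<in> h" using wsp_brk[OF ew f] by (simp add: wsp_zero)
    fix y assume y: "y \<in> h"
    have "killing (brk e f) y = killing e (brk f y)" by (rule killing_invariant)
    also have "brk f y = - brk y f" by (rule brk_antisym)
    also have "brk y f = scale (- \<beta> y) f" using f y by (simp add: wsp_def)
    finally show "killing (brk e f) y = \<beta> y" using b(2) by (simp add: f_def killing_simps)
  qed
  then show thesis using that ew f by simp
qed

lemma root_dual: "\<beta> \<in> roots h \<Longrightarrow> \<beta> \<in> dual h" by (simp add: roots_def)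

lemma root_form_nonzero:
  assumes "\<beta> \<in> roots h" shows "dual_form h \<beta> \<beta> \<noteq> 0"
proof -
  obtain e f where ef: "e \<in> wsp \<beta>" "f \<in> wsp (- \<beta>)" "brk e f = dv \<beta>" by (rule root_coroot[OF assms])
  have bd: "\<beta> \<in> dual h" using assms by (rule root_dual)
  have "\<exists>y\<in>h. \<beta> y \<noteq> 0"
    using assms hfun_eqI[of \<beta> 0] dual_subset_hfun hfun_zero bd by (auto simp: roots_def)
  then have "dv \<beta> \<noteq> 0" using dual_vec(2)[OF bd] by (auto simp: killing_simps)
  then have "\<beta> (dv \<beta>) \<noteq> 0" using coroot_nonzero(1)[OF ef(1,2)] ef(3) bd dual_subset_hfun by auto
  then show ?thesis by (simp add: dual_form_eq bd)
qed

lemma weight_integral: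
  assumes "\<beta> \<in> roots h" "b \<in> wb"
  shows "2 * dual_form h (wt b) \<beta> / dual_form h \<beta> \<beta> \<in> \<int>"
proof -
  obtain e f where ef: "e \<in> wsp \<beta>" "f \<in> wsp (- \<beta>)" "brk e f = dv \<beta>" by (rule root_coroot[OF assms(1)])
  have bd: "\<beta> \<in> dual h" using assms(1) by (rule root_dual)
  define c where "c = dual_form h \<beta> \<beta>"
  have c: "c \<noteq> 0" "\<beta> (dv \<beta>) = c" using root_form_nonzero[OF assms(1)] by (auto simp: c_def dual_form_eq bd)
  define f' where "f' = scale (2 / c) f"
  have f': "f' \<in> wsp (- \<beta>)" unfolding f'_def using ef(2) by (rule subspace_scale[OF wsp_subspace])
  have z: "brk e f' = scale (2 / c) (dv \<beta>)" by (simp add: f'_def brk_simps ef)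
  have app: "\<gamma> (brk e f') = 2 / c * \<gamma> (dv \<beta>)" if "\<gamma> \<in> dual h" for \<gamma>
    using that dual_vec(1)[OF bd] unfolding z dual_def by blast
  have "\<beta> (brk e f') = 2" using app[OF bd] c by simp
  then have "wt b (brk e f') \<in> \<int>"
    using sl2_integral[OF ef(1) f' _ _ assms(2)] bd dual_subset_hfun by blast
  then show ?thesis using app[OF wt_dual[OF assms(2)]] by (simp add: dual_form_eq wt_dual assms(2) bd c_def[symmetric])
qed

lemma roots_integral:
  assumes "\<beta> \<in> roots h" "\<gamma> \<in> roots h"
  shows "2 * dual_form h \<gamma> \<beta> / dual_form h \<beta> \<beta> \<in> \<int>"
  using weight_integral[OF assms(1)] assms(2) roots_eq by auto

lemma roots_subset_weight_lattice: "roots h \<subseteq> weight_lattice h"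
  using roots_integral root_dual by (auto simp: weight_lattice_def)

text \<open>By \<open>killing_h\<close> the number \<open>c\<close> is a sum of squares of values of weights at the vector dual to \<open>\<beta>\<close>. By
  integrality these values are rational multiples of \<open>c\<close>, so \<open>c\<close> is a rational multiple of its square.\<close>

lemma root_form_rational:
  assumes "\<beta> \<in> roots h" shows "dual_form h \<beta> \<beta> \<in> \<rat>"
proof -
  have bd: "\<beta> \<in> dual h" using assms by (rule root_dual)
  define c where "c = dual_form h \<beta> \<beta>"
  have c0: "c \<noteq> 0" using root_form_nonzero[OF assms] by (simp add: c_def)
  have n: "wt b (dv \<beta>) / c \<in> \<rat>" if "b \<in> wb" for b
  proof -
    have "2 * (wt b (dv \<beta>) / c) \<in> \<rat>"
      using weight_integral[OF assms that] Ints_subset_Rats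
      by (auto simp: dual_form_eq wt_dual that bd c_def)
    then have "2 * (wt b (dv \<beta>) / c) / 2 \<in> \<rat>" by (intro Rats_divide) auto
    then show ?thesis by simp
  qed
  have "c = (\<Sum>b\<in>wb. wt b (dv \<beta>) * wt b (dv \<beta>))"
    unfolding c_def dual_form_def by (rule killing_h) (rule dual_vec(1)[OF bd])+
  also have "\<dots> = c * c * (\<Sum>b\<in>wb. wt b (dv \<beta>) / c * (wt b (dv \<beta>) / c))"
    using c0 by (simp add: sum_distrib_left)
  finally have eq: "1 = c * (\<Sum>b\<in>wb. wt b (dv \<beta>) / c * (wt b (dv \<beta>) / c))" (is "1 = c * ?s")
    using c0 by simp
  have inv: "c = 1 / s" if "1 = c * s" for s using that by (cases "s = 0") (auto simp: field_simps)
  have "c = 1 / ?s" by (rule inv[OF eq])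
  moreover have "?s \<in> \<rat>" by (intro Rats_sum Rats_mult n)
  ultimately show ?thesis unfolding c_def[symmetric] by (metis Rats_1 Rats_divide)
qed

lemma weight_root_form_rational:
  assumes "\<mu> \<in> weight_lattice h" "\<beta> \<in> roots h"
  shows "dual_form h \<beta> \<mu> \<in> \<rat>"
proof -
  have "2 * dual_form h \<mu> \<beta> / dual_form h \<beta> \<beta> \<in> \<rat>"
    using assms Ints_subset_Rats by (auto simp: weight_lattice_def)
  from Rats_mult[OF this root_form_rational[OF assms(2)]]
  have "2 * dual_form h \<mu> \<beta> \<in> \<rat>" using root_form_nonzero[OF assms(2)] by simp
  from Rats_divide[OF this Rats_number_of[of "num.Bit0 num.One"]]
  show ?thesis by (simp add: dual_form_sym)
qed

lemma weight_lattice_add: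
  assumes "\<mu> \<in> weight_lattice h" "\<nu> \<in> weight_lattice h"
  shows "\<mu> + \<nu> \<in> weight_lattice h"
  using assms by (auto simp: weight_lattice_def dual_add dual_form_add root_dual
      distrib_left add_divide_distrib)

lemma weight_lattice_uminus:
  assumes "\<mu> \<in> weight_lattice h"
  shows "- \<mu> \<in> weight_lattice h"
  using assms by (auto simp: weight_lattice_def dual_uminus dual_form_uminus root_dual)

lemma weight_lattice_zero: "0 \<in> weight_lattice h"
  by (auto simp: weight_lattice_def dual_zero dual_form_eq root_dual)

end

section \<open>Semisimple and cyclic modules\<close>

locale lmodule = ring B + M: abelian_group M
  for B :: "('b, 'r) ring_scheme" (structure) and M :: "('b, 'm, 's) module_scheme" +
  assumes left_module: "left_module B M"
begin

lemma smult_closed [simp]: "b \<in> carrier B \<Longrightarrow> x \<in> carrier M \<Longrightarrow> b \<odot>\<^bsub>M\<^esub> x \<in> carrier M"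
  and smult_add_left: "b \<in> carrier B \<Longrightarrow> c \<in> carrier B \<Longrightarrow> x \<in> carrier M \<Longrightarrow>
    (b \<oplus> c) \<odot>\<^bsub>M\<^esub> x = b \<odot>\<^bsub>M\<^esub> x \<oplus>\<^bsub>M\<^esub> c \<odot>\<^bsub>M\<^esub> x"
  and smult_mult: "b \<in> carrier B \<Longrightarrow> c \<in> carrier B \<Longrightarrow> x \<in> carrier M \<Longrightarrow>
    (b \<otimes> c) \<odot>\<^bsub>M\<^esub> x = b \<odot>\<^bsub>M\<^esub> (c \<odot>\<^bsub>M\<^esub> x)"
  and smult_add_right: "b \<in> carrier B \<Longrightarrow> x \<in> carrier M \<Longrightarrow> y \<in> carrier M \<Longrightarrow>
    b \<odot>\<^bsub>M\<^esub> (x \<oplus>\<^bsub>M\<^esub> y) = b \<odot>\<^bsub>M\<^esub> x \<oplus>\<^bsub>M\<^esub> b \<odot>\<^bsub>M\<^esub> y"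
  and smult_one [simp]: "x \<in> carrier M \<Longrightarrow> \<one> \<odot>\<^bsub>M\<^esub> x = x"
  using left_module by (simp_all add: left_module_def)

lemma smult_zero_left [simp]:
  assumes x: "x \<in> carrier M" shows "\<zero> \<odot>\<^bsub>M\<^esub> x = \<zero>\<^bsub>M\<^esub>"
proof -
  have "\<zero> \<odot>\<^bsub>M\<^esub> x \<oplus>\<^bsub>M\<^esub> \<zero> \<odot>\<^bsub>M\<^esub> x = \<zero> \<odot>\<^bsub>M\<^esub> x"
    using smult_add_left[OF zero_closed zero_closed x] by simp
  then show ?thesis using x by (simp add: M.add.l_cancel_one)
qed

lemma smult_zero_right [simp]:
  assumes b: "b \<in> carrier B" shows "b \<odot>\<^bsub>M\<^esub> \<zero>\<^bsub>M\<^esub> = \<zero>\<^bsub>M\<^esub>"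
proof -
  have "b \<odot>\<^bsub>M\<^esub> \<zero>\<^bsub>M\<^esub> \<oplus>\<^bsub>M\<^esub> b \<odot>\<^bsub>M\<^esub> \<zero>\<^bsub>M\<^esub> = b \<odot>\<^bsub>M\<^esub> \<zero>\<^bsub>M\<^esub>"
    using smult_add_right[OF b M.zero_closed M.zero_closed] by simp
  then show ?thesis using b by (simp add: M.add.l_cancel_one)
qed

lemma smult_minus_left:
  assumes b: "b \<in> carrier B" and x: "x \<in> carrier M"
  shows "(\<ominus> b) \<odot>\<^bsub>M\<^esub> x = \<ominus>\<^bsub>M\<^esub> (b \<odot>\<^bsub>M\<^esub> x)"
proof -
  have "(\<ominus> b) \<odot>\<^bsub>M\<^esub> x \<oplus>\<^bsub>M\<^esub> b \<odot>\<^bsub>M\<^esub> x = (\<ominus> b \<oplus> b) \<odot>\<^bsub>M\<^esub> x"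
    using b x by (simp add: smult_add_left)
  also have "\<dots> = \<zero>\<^bsub>M\<^esub>" using b x by (simp add: l_neg)
  finally show ?thesis using b x M.minus_equality[of "(\<ominus> b) \<odot>\<^bsub>M\<^esub> x" "b \<odot>\<^bsub>M\<^esub> x"] by simp
qed

lemma smult_finsum:
  assumes b: "b \<in> carrier B" and "finite A" "g \<in> A \<rightarrow> carrier M"
  shows "b \<odot>\<^bsub>M\<^esub> finsum M g A = finsum M (\<lambda>a. b \<odot>\<^bsub>M\<^esub> g a) A"
  using assms(2,3)
proof (induction A rule: finite_induct)
  case empty
  then show ?case using b by simp
next
  case (insert a A)
  then have *: "g a \<in> carrier M" "g \<in> A \<rightarrow> carrier M" "\<forall>x\<in>A. g x \<in> carrier M"
    by auto
  then show ?case using insert.hyps insert.IH[OF *(2)] b by (simp add: smult_add_right)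
qed

lemma submodule_simps:
  assumes "submodule L B M"
  shows "L \<subseteq> carrier M" "\<zero>\<^bsub>M\<^esub> \<in> L" "\<And>x y. x \<in> L \<Longrightarrow> y \<in> L \<Longrightarrow> x \<oplus>\<^bsub>M\<^esub> y \<in> L"
    "\<And>b x. b \<in> carrier B \<Longrightarrow> x \<in> L \<Longrightarrow> b \<odot>\<^bsub>M\<^esub> x \<in> L"
  using subgroup.subset[OF submodule.axioms(1)[OF assms]]
    subgroup.one_closed[OF submodule.axioms(1)[OF assms]]
    subgroup.m_closed[OF submodule.axioms(1)[OF assms]] submodule.smult_closed[OF assms] by auto

lemma submoduleI:
  assumes "L \<subseteq> carrier M" "\<zero>\<^bsub>M\<^esub> \<in> L" "\<And>x y. x \<in> L \<Longrightarrow> y \<in> L \<Longrightarrow> x \<oplus>\<^bsub>M\<^esub> y \<in> L"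
    "\<And>b x. b \<in> carrier B \<Longrightarrow> x \<in> L \<Longrightarrow> b \<odot>\<^bsub>M\<^esub> x \<in> L"
  shows "submodule L B M"
proof (intro submodule.intro submodule_axioms.intro)
  show "subgroup L (add_monoid M)"
  proof (rule M.add.subgroupI)
    show "L \<noteq> {}" using assms(2) by blast
    fix x assume x: "x \<in> L"
    have "(\<ominus> \<one>) \<odot>\<^bsub>M\<^esub> x = \<ominus>\<^bsub>M\<^esub> x" using x assms(1) by (auto simp: smult_minus_left)
    then show "\<ominus>\<^bsub>M\<^esub> x \<in> L" using assms(4)[OF _ x, of "\<ominus> \<one>"] by simp
  qed (use assms in auto)
qed (use assms in auto)

lemma submodule_minus: "submodule L B M \<Longrightarrow> x \<in> L \<Longrightarrow> \<ominus>\<^bsub>M\<^esub> x \<in> L"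
  using subgroup.m_inv_closed[OF submodule.axioms(1), of L B M x] by (simp add: a_inv_def)

lemma submodule_finsum:
  assumes L: "submodule L B M" and "finite A" "\<And>a. a \<in> A \<Longrightarrow> g a \<in> L"
  shows "finsum M g A \<in> L"
  using assms(2,3)
proof (induction A rule: finite_induct)
  case empty
  then show ?case using submodule_simps(2)[OF L] by simp
next
  case (insert a A)
  then have "g a \<in> carrier M" "g \<in> A \<rightarrow> carrier M" using submodule_simps(1)[OF L] by auto
  then show ?case using insert submodule_simps(3)[OF L] by simp
qed

lemma submodule_Int:
  assumes "submodule L B M" "submodule L' B M" shows "submodule (L \<inter> L') B M"
  using submodule_simps[OF assms(1)] submodule_simps[OF assms(2)] by (intro submoduleI) auto

definition independent :: "'m set set \<Rightarrow> bool" where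
  "independent S \<longleftrightarrow> (\<forall>D g. finite D \<and> D \<subseteq> S \<and> (\<forall>X\<in>D. g X \<in> X) \<and> finsum M g D = \<zero>\<^bsub>M\<^esub> \<longrightarrow>
     (\<forall>X\<in>D. g X = \<zero>\<^bsub>M\<^esub>))"

definition span :: "'m set set \<Rightarrow> 'm set" where
  "span S = {finsum M g D |g D. finite D \<and> D \<subseteq> S \<and> (\<forall>X\<in>D. g X \<in> X)}"

lemma finsum_extend:
  assumes "finite D" "E \<subseteq> D" "\<And>X. X \<in> E \<Longrightarrow> g X \<in> carrier M"
  shows "finsum M (\<lambda>X. if X \<in> E then g X else \<zero>\<^bsub>M\<^esub>) D = finsum M g E"
  using assms by (intro M.add.finprod_mono_neutral_cong_right) auto

lemma span_submodule:
  assumes S: "\<And>X. X \<in> S \<Longrightarrow> submodule X B M"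
  shows "submodule (span S) B M"
proof (rule submoduleI)
  have carr: "g \<in> D \<rightarrow> carrier M" if "D \<subseteq> S" "\<forall>X\<in>D. g X \<in> X" for g D
    using that S submodule_simps(1) by blast
  show "span S \<subseteq> carrier M"
  proof
    fix x assume "x \<in> span S"
    then obtain g D where "finite D" "D \<subseteq> S" "\<forall>X\<in>D. g X \<in> X" "x = finsum M g D"
      unfolding span_def by blast
    then show "x \<in> carrier M" using carr by simp
  qed
  show "\<zero>\<^bsub>M\<^esub> \<in> span S"
    unfolding span_def by (intro CollectI exI[of _ "\<lambda>_. \<zero>\<^bsub>M\<^esub>"] exI[of _ "{}"]) simp
  fix x assume "x \<in> span S"
  then obtain g D where D: "finite D" "D \<subseteq> S" "\<forall>X\<in>D. g X \<in> X" "x = finsum M g D"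
    unfolding span_def by blast
  {
    fix y assume "y \<in> span S"
    then obtain k E where E: "finite E" "E \<subseteq> S" "\<forall>X\<in>E. k X \<in> X" "y = finsum M k E"
      unfolding span_def by blast
    define g' where "g' X = (if X \<in> D then g X else \<zero>\<^bsub>M\<^esub>)" for X
    define k' where "k' X = (if X \<in> E then k X else \<zero>\<^bsub>M\<^esub>)" for X
    have mem: "g' X \<in> X" "k' X \<in> X" if "X \<in> D \<union> E" for X
      using that D E S submodule_simps(2)[of X] by (auto simp: g'_def k'_def)
    have c: "g' \<in> D \<union> E \<rightarrow> carrier M" "k' \<in> D \<union> E \<rightarrow> carrier M"
      using mem D(2) E(2) S submodule_simps(1) by blast+
    have "x = finsum M g' (D \<union> E)" "y = finsum M k' (D \<union> E)"
      unfolding D(4) E(4) g'_def k'_def using D E carr[OF D(2,3)] carr[OF E(2,3)]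
      by (auto intro!: finsum_extend[symmetric])
    then have "x \<oplus>\<^bsub>M\<^esub> y = finsum M (\<lambda>X. g' X \<oplus>\<^bsub>M\<^esub> k' X) (D \<union> E)"
      using c by (simp add: M.finsum_addf)
    moreover have "\<forall>X\<in>D \<union> E. g' X \<oplus>\<^bsub>M\<^esub> k' X \<in> X"
      using mem S D(2) E(2) by (auto intro!: submodule_simps(3))
    ultimately show "x \<oplus>\<^bsub>M\<^esub> y \<in> span S"
      unfolding span_def using D E by (intro CollectI exI[of _ "\<lambda>X. g' X \<oplus>\<^bsub>M\<^esub> k' X"] exI[of _ "D \<union> E"]) auto
  }
  fix b assume b: "b \<in> carrier B"
  have "b \<odot>\<^bsub>M\<^esub> x = finsum M (\<lambda>X. b \<odot>\<^bsub>M\<^esub> g X) D"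
    unfolding D(4) using smult_finsum[OF b D(1) carr[OF D(2,3)]] .
  moreover have "\<forall>X\<in>D. b \<odot>\<^bsub>M\<^esub> g X \<in> X" using D S b submodule_simps(4) by blast
  ultimately show "b \<odot>\<^bsub>M\<^esub> x \<in> span S"
    unfolding span_def using D by (intro CollectI exI[of _ "\<lambda>X. b \<odot>\<^bsub>M\<^esub> g X"] exI[of _ D]) auto
qed

lemma independent_insert:
  assumes S: "\<And>X. X \<in> S \<Longrightarrow> submodule X B M" and ind: "independent S"
    and X: "submodule X B M" "X \<inter> span S = {\<zero>\<^bsub>M\<^esub>}" "X \<notin> S"
  shows "independent (insert X S)"
  unfolding independent_def
proof (intro allI impI)
  fix D g
  assume "finite D \<and> D \<subseteq> insert X S \<and> (\<forall>X\<in>D. g X \<in> X) \<and> finsum M g D = \<zero>\<^bsub>M\<^esub>"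
  then have D: "finite D" "D \<subseteq> insert X S" "\<And>X. X \<in> D \<Longrightarrow> g X \<in> X" "finsum M g D = \<zero>\<^bsub>M\<^esub>" by auto
  have carr: "g Y \<in> carrier M" if "Y \<in> D" for Y
    using that D(2) D(3)[of Y] S X(1) submodule_simps(1) by blast
  define E where "E = D - {X}"
  have E: "finite E" "E \<subseteq> S" "\<forall>X\<in>E. g X \<in> X" using D by (auto simp: E_def)
  have sE: "finsum M g E \<in> span S" using E unfolding span_def by blast
  have sub: "submodule (span S) B M" using S by (rule span_submodule)
  have "g X = \<zero>\<^bsub>M\<^esub>" "finsum M g E = \<zero>\<^bsub>M\<^esub>" if "X \<in> D"
  proof -
    have gE: "g \<in> E \<rightarrow> carrier M" using carr by (auto simp: E_def)
    have "D = insert X E" "X \<notin> E" using that by (auto simp: E_def)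
    then have 0: "g X \<oplus>\<^bsub>M\<^esub> finsum M g E = \<zero>\<^bsub>M\<^esub>"
      using D(4) E(1) gE carr[OF that] by simp
    then have "g X = \<ominus>\<^bsub>M\<^esub> finsum M g E"
      using carr[OF that] M.finsum_closed[OF gE] M.minus_equality by metis
    then have "g X \<in> X \<inter> span S" using submodule_minus[OF sub sE] D(3)[OF that] by simp
    then show "g X = \<zero>\<^bsub>M\<^esub>" using X(2) by blast
    then show "finsum M g E = \<zero>\<^bsub>M\<^esub>" using 0 M.finsum_closed[OF gE] by simp
  qed
  moreover have "finsum M g E = \<zero>\<^bsub>M\<^esub>" if "X \<notin> D" using that D(4) by (simp add: E_def)
  ultimately have "finsum M g E = \<zero>\<^bsub>M\<^esub>" by blast
  then have "\<forall>Y\<in>E. g Y = \<zero>\<^bsub>M\<^esub>" using ind E unfolding independent_def by blast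
  then show "\<forall>Y\<in>D. g Y = \<zero>\<^bsub>M\<^esub>" using \<open>X \<in> D \<Longrightarrow> g X = \<zero>\<^bsub>M\<^esub>\<close> by (auto simp: E_def)
qed

text \<open>A maximal independent family of simple submodules, given by Zorn's lemma, spans the module: a
  simple submodule meets the span in zero or is contained in it, and in the first case it could be
  added to the family.\<close>

lemma semisimple_if_generated_by_simples:
  assumes gen: "\<And>L. submodule L B M \<Longrightarrow> (\<And>N. simple_submodule B M N \<Longrightarrow> N \<subseteq> L) \<Longrightarrow> L = carrier M"
  shows "semisimple_module B M"
proof -
  define A where "A = {S. (\<forall>N\<in>S. simple_submodule B M N) \<and> independent S}"
  have "\<exists>U\<in>A. \<forall>X\<in>C. X \<subseteq> U" if C: "subset.chain A C" for C
  proof -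
    have CA: "C \<subseteq> A" using C by (auto simp: subset.chain_def)
    have "independent (\<Union>C)"
      unfolding independent_def
    proof (intro allI impI)
      fix D g
      assume D: "finite D \<and> D \<subseteq> \<Union>C \<and> (\<forall>X\<in>D. g X \<in> X) \<and> finsum M g D = \<zero>\<^bsub>M\<^esub>"
      show "\<forall>X\<in>D. g X = \<zero>\<^bsub>M\<^esub>"
      proof (cases "D = {}")
        case False
        then have "C \<noteq> {}" using D by auto
        obtain S where "S \<in> C" "D \<subseteq> S"
          by (rule finite_subset_Union_chain[OF _ _ \<open>C \<noteq> {}\<close> C]) (rule conjunct1[OF D], rule conjunct1[OF conjunct2[OF D]])
        then have "independent S" using CA by (auto simp: A_def)
        then have "finite D \<and> D \<subseteq> S \<and> (\<forall>X\<in>D. g X \<in> X) \<and> finsum M g D = \<zero>\<^bsub>M\<^esub> \<longrightarrow>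
            (\<forall>X\<in>D. g X = \<zero>\<^bsub>M\<^esub>)" unfolding independent_def by blast
        then show ?thesis using D \<open>D \<subseteq> S\<close> by blast
      qed simp
    qed
    then have "\<Union>C \<in> A" using CA unfolding A_def by blast
    then show ?thesis by blast
  qed
  from subset_Zorn[OF this] obtain S where S: "S \<in> A" "\<And>X. X \<in> A \<Longrightarrow> S \<subseteq> X \<Longrightarrow> X = S" by blast
  have simp: "\<And>N. N \<in> S \<Longrightarrow> simple_submodule B M N" and ind: "independent S"
    using S(1) by (auto simp: A_def)
  have sub: "submodule X B M" if "X \<in> S" for X using simp[OF that] by (simp add: simple_submodule_def)
  have full: "span S = carrier M"
  proof (rule gen[OF span_submodule[OF sub]])
    fix N assume N: "simple_submodule B M N"
    then have Nsub: "submodule N B M" and N0: "N \<noteq> {\<zero>\<^bsub>M\<^esub>}"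
      and Ns: "\<And>L. submodule L B M \<Longrightarrow> L \<subseteq> N \<Longrightarrow> L = {\<zero>\<^bsub>M\<^esub>} \<or> L = N"
      by (auto simp: simple_submodule_def)
    have "N \<inter> span S = {\<zero>\<^bsub>M\<^esub>} \<or> N \<inter> span S = N"
      by (rule Ns) (use submodule_Int[OF Nsub span_submodule[OF sub]] in auto)
    moreover have False if 0: "N \<inter> span S = {\<zero>\<^bsub>M\<^esub>}"
    proof -
      have "N \<subseteq> span S" if "N \<in> S"
      proof
        fix x assume x: "x \<in> N"
        then have "x \<in> carrier M" using submodule_simps(1)[OF Nsub] by blast
        then have "x = finsum M (\<lambda>_. x) {N}" by simp
        then show "x \<in> span S"
          unfolding span_def using that x by (intro CollectI exI[of _ "\<lambda>_. x"] exI[of _ "{N}"]) auto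
      qed
      then have "N \<notin> S" using 0 N0 by blast
      then have "insert N S \<in> A"
        using independent_insert[OF sub ind Nsub 0] simp N by (auto simp: A_def)
      then have "insert N S = S" using S(2) by blast
      then show False using \<open>N \<notin> S\<close> by blast
    qed
    ultimately show "N \<subseteq> span S" by blast
  qed
  have "direct_sum M S (\<lambda>N. N)"
    unfolding direct_sum_def
  proof (intro conjI ballI)
    fix N assume "N \<in> S"
    then show "subgroup N (add_monoid M)" using sub submodule.axioms(1) by blast
  next
    fix m assume "m \<in> carrier M"
    then have "m \<in> span S" using full by simp
    then obtain g D where D: "finite D" "D \<subseteq> S" "\<forall>X\<in>D. g X \<in> X" "m = finsum M g D"
      unfolding span_def by blast
    have supp: "finsum M k {X. k X \<noteq> \<zero>\<^bsub>M\<^esub>} = finsum M k E"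
      if "finite E" "{X. k X \<noteq> \<zero>\<^bsub>M\<^esub>} \<subseteq> E" "\<And>X. X \<in> E \<Longrightarrow> k X \<in> carrier M" for k :: "'m set \<Rightarrow> 'm" and E
      using that by (intro M.add.finprod_mono_neutral_cong_left) auto
    define g' where "g' X = (if X \<in> D then g X else \<zero>\<^bsub>M\<^esub>)" for X
    have carr: "k X \<in> carrier M" if "\<forall>i\<in>S. k i \<in> i" "X \<in> S" for k X
      using that sub submodule_simps(1) by blast
    have gD: "g X \<in> carrier M" if "X \<in> D" for X using that D sub submodule_simps(1) by blast
    have g'S: "\<forall>i\<in>S. g' i \<in> i" using D sub submodule_simps(2) by (auto simp: g'_def)
    have g'D: "{X. g' X \<noteq> \<zero>\<^bsub>M\<^esub>} \<subseteq> D" by (auto simp: g'_def)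
    show "\<exists>!f. (\<forall>i\<in>S. f i \<in> i) \<and> (\<forall>i. i \<notin> S \<longrightarrow> f i = \<zero>\<^bsub>M\<^esub>) \<and>
        finite {i. f i \<noteq> \<zero>\<^bsub>M\<^esub>} \<and> m = finsum M f {i. f i \<noteq> \<zero>\<^bsub>M\<^esub>}"
    proof (rule ex1I[of _ g'])
      have "finsum M g' {X. g' X \<noteq> \<zero>\<^bsub>M\<^esub>} = finsum M g' D"
        using D g'D carr[OF g'S] by (intro supp) auto
      also have "\<dots> = finsum M g D"
        using gD by (intro M.finsum_cong') (auto simp: g'_def)
      finally show "(\<forall>i\<in>S. g' i \<in> i) \<and> (\<forall>i. i \<notin> S \<longrightarrow> g' i = \<zero>\<^bsub>M\<^esub>) \<and>
          finite {i. g' i \<noteq> \<zero>\<^bsub>M\<^esub>} \<and> m = finsum M g' {i. g' i \<noteq> \<zero>\<^bsub>M\<^esub>}"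
        using D g'S finite_subset[OF g'D D(1)] by (auto simp: g'_def)
    next
      fix k
      assume k: "(\<forall>i\<in>S. k i \<in> i) \<and> (\<forall>i. i \<notin> S \<longrightarrow> k i = \<zero>\<^bsub>M\<^esub>) \<and>
        finite {i. k i \<noteq> \<zero>\<^bsub>M\<^esub>} \<and> m = finsum M k {i. k i \<noteq> \<zero>\<^bsub>M\<^esub>}"
      define E where "E = D \<union> {i. k i \<noteq> \<zero>\<^bsub>M\<^esub>}"
      have "finite {i. k i \<noteq> \<zero>\<^bsub>M\<^esub>}" using k by blast
      then have fE: "finite E" using D(1) unfolding E_def by (rule finite_UnI[rotated])
      have ES: "E \<subseteq> S" using D(2) k unfolding E_def by blast
      have kE: "k \<in> E \<rightarrow> carrier M" by (rule Pi_I, rule carr[OF conjunct1[OF k]]) (use ES in blast)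
      have gE: "g' \<in> E \<rightarrow> carrier M" by (rule Pi_I, rule carr[OF g'S]) (use ES in blast)
      have "finsum M g' {X. g' X \<noteq> \<zero>\<^bsub>M\<^esub>} = finsum M g' E"
        using fE g'D gE by (intro supp) (auto simp: E_def)
      moreover have "finsum M g' {X. g' X \<noteq> \<zero>\<^bsub>M\<^esub>} = finsum M g' D"
        using D g'D carr[OF g'S] by (intro supp) auto
      moreover have "finsum M g' D = finsum M g D"
        using gD by (intro M.finsum_cong') (auto simp: g'_def)
      moreover have "finsum M k {X. k X \<noteq> \<zero>\<^bsub>M\<^esub>} = finsum M k E"
        using fE kE by (intro supp) (auto simp: E_def)
      ultimately have eq: "finsum M k E = finsum M g' E" using k D(4) by simp
      \<comment> \<open>the difference of two decompositions is a relation in the independent family \<open>S\<close>\<close>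
      define d where "d X = k X \<oplus>\<^bsub>M\<^esub> (\<ominus> \<one>) \<odot>\<^bsub>M\<^esub> g' X" for X
      have "finsum M d E = finsum M k E \<oplus>\<^bsub>M\<^esub> finsum M (\<lambda>X. (\<ominus> \<one>) \<odot>\<^bsub>M\<^esub> g' X) E"
        unfolding d_def using kE funcset_mem[OF gE] by (intro M.finsum_addf) auto
      also have "finsum M (\<lambda>X. (\<ominus> \<one>) \<odot>\<^bsub>M\<^esub> g' X) E = (\<ominus> \<one>) \<odot>\<^bsub>M\<^esub> finsum M g' E"
        using smult_finsum[OF _ fE gE, of "\<ominus> \<one>"] by simp
      also have "finsum M k E \<oplus>\<^bsub>M\<^esub> \<dots> = \<zero>\<^bsub>M\<^esub>"
        using M.finsum_closed[OF gE] by (simp add: eq smult_minus_left M.r_neg)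
      finally have "finsum M d E = \<zero>\<^bsub>M\<^esub>" .
      moreover have "\<forall>X\<in>E. d X \<in> X"
      proof
        fix X assume "X \<in> E"
        then have "X \<in> S" using ES by blast
        then show "d X \<in> X"
          unfolding d_def using k g'S sub[of X]
          by (intro submodule_simps(3)[OF sub] submodule_simps(4)[OF sub]) auto
      qed
      ultimately have d0: "\<forall>X\<in>E. d X = \<zero>\<^bsub>M\<^esub>" using ind fE ES unfolding independent_def by blast
      show "k = g'"
      proof
        fix X
        show "k X = g' X"
        proof (cases "X \<in> E")
          case True
          have cX: "k X \<in> carrier M" "g' X \<in> carrier M" using kE gE True by auto
          moreover have "d X = \<zero>\<^bsub>M\<^esub>" using d0 True by blast
          ultimately have "k X \<oplus>\<^bsub>M\<^esub> \<ominus>\<^bsub>M\<^esub> g' X = \<zero>\<^bsub>M\<^esub>" by (simp add: d_def smult_minus_left)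
          then show ?thesis using cX M.minus_equality[of "k X" "\<ominus>\<^bsub>M\<^esub> g' X"] by simp
        next
          case False
          then show ?thesis by (auto simp: E_def g'_def)
        qed
      qed
    qed
  qed
  then show ?thesis using left_module simp unfolding semisimple_module_def by blast
qed

definition ann :: "'m \<Rightarrow> 'b set" where "ann v = {b \<in> carrier B. b \<odot>\<^bsub>M\<^esub> v = \<zero>\<^bsub>M\<^esub>}"

definition cyclic :: "'m \<Rightarrow> 'm set" where "cyclic v = (\<lambda>b. b \<odot>\<^bsub>M\<^esub> v) ` carrier B"

lemma cyclic_submodule: "v \<in> carrier M \<Longrightarrow> submodule (cyclic v) B M"
proof (rule submoduleI)
  assume v: "v \<in> carrier M"
  show "cyclic v \<subseteq> carrier M" using v by (auto simp: cyclic_def)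
  show "\<zero>\<^bsub>M\<^esub> \<in> cyclic v" using v by (auto simp: cyclic_def intro!: image_eqI[of _ _ \<zero>])
  show "x \<oplus>\<^bsub>M\<^esub> y \<in> cyclic v" if "x \<in> cyclic v" "y \<in> cyclic v" for x y
    using that v by (auto simp: cyclic_def smult_add_left[symmetric])
  show "b \<odot>\<^bsub>M\<^esub> x \<in> cyclic v" if "b \<in> carrier B" "x \<in> cyclic v" for b x
    using that v by (auto simp: cyclic_def smult_mult[symmetric])
qed

lemma cyclic_self: "v \<in> carrier M \<Longrightarrow> v \<in> cyclic v"
  by (auto simp: cyclic_def intro!: image_eqI[of _ _ \<one>])

lemma cyclic_simple:
  assumes v: "v \<in> carrier M" "v \<noteq> \<zero>\<^bsub>M\<^esub>"
    and inv: "\<And>b. b \<in> carrier B \<Longrightarrow> b \<odot>\<^bsub>M\<^esub> v \<noteq> \<zero>\<^bsub>M\<^esub> \<Longrightarrow> \<exists>c\<in>carrier B. c \<odot>\<^bsub>M\<^esub> (b \<odot>\<^bsub>M\<^esub> v) = v"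
  shows "simple_submodule B M (cyclic v)"
  unfolding simple_submodule_def
proof (intro conjI allI impI)
  show "submodule (cyclic v) B M" using v by (intro cyclic_submodule)
  show "cyclic v \<noteq> {\<zero>\<^bsub>M\<^esub>}" using cyclic_self v by blast
  fix L assume L: "submodule L B M \<and> L \<subseteq> cyclic v"
  have "cyclic v \<subseteq> L" if "L \<noteq> {\<zero>\<^bsub>M\<^esub>}"
  proof -
    from that obtain x where x: "x \<in> L" "x \<noteq> \<zero>\<^bsub>M\<^esub>" using L submodule_simps(2) by blast
    then obtain b where "b \<in> carrier B" "x = b \<odot>\<^bsub>M\<^esub> v" using L by (auto simp: cyclic_def)
    then obtain c where "c \<in> carrier B" "c \<odot>\<^bsub>M\<^esub> x = v" using inv x(2) by blast
    then have "v \<in> L" using x(1) L submodule_simps(4) by blast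
    then show ?thesis using L submodule_simps(4) by (auto simp: cyclic_def)
  qed
  then show "L = {\<zero>\<^bsub>M\<^esub>} \<or> L = cyclic v" using L by blast
qed

text \<open>The inverse of the orbit map of \<open>v\<close> sends \<open>m\<close> to the coset of the elements that take \<open>v\<close> to \<open>m\<close>.\<close>

lemma iso_quotient_ann:
  assumes v: "v \<in> carrier M" and full: "cyclic v = carrier M"
  shows "module_iso B M (quotient_module B (ann v))"
proof -
  define g where "g m = {b \<in> carrier B. b \<odot>\<^bsub>M\<^esub> v = m}" for m
  have coset: "ann v +> b = g (b \<odot>\<^bsub>M\<^esub> v)" if b: "b \<in> carrier B" for b
  proof
    show "ann v +> b \<subseteq> g (b \<odot>\<^bsub>M\<^esub> v)"
      using b v by (auto simp: a_r_coset_def' ann_def g_def smult_add_left)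
    show "g (b \<odot>\<^bsub>M\<^esub> v) \<subseteq> ann v +> b"
    proof
      fix c assume c: "c \<in> g (b \<odot>\<^bsub>M\<^esub> v)"
      then have cc: "c \<in> carrier B" "c \<odot>\<^bsub>M\<^esub> v = b \<odot>\<^bsub>M\<^esub> v" by (auto simp: g_def)
      have "c \<ominus> b \<in> ann v"
        using cc b v by (simp add: ann_def a_minus_def smult_add_left smult_minus_left M.r_neg)
      moreover have "c = (c \<ominus> b) \<oplus> b" using cc b by (simp add: a_minus_def a_assoc l_neg)
      ultimately show "c \<in> ann v +> b" by (auto simp: a_r_coset_def')
    qed
  qed
  have ex: "\<exists>b\<in>carrier B. m = b \<odot>\<^bsub>M\<^esub> v" if "m \<in> carrier M" for m
    using that full by (auto simp: cyclic_def)
  have carr: "carrier (quotient_module B (ann v)) = g ` carrier M"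
  proof -
    have "a_rcosets (ann v) = (\<lambda>b. ann v +> b) ` carrier B"
      unfolding A_RCOSETS_def RCOSETS_def a_r_coset_def by auto
    also have "\<dots> = (\<lambda>b. g (b \<odot>\<^bsub>M\<^esub> v)) ` carrier B" using coset by auto
    also have "\<dots> = g ` cyclic v" by (auto simp: cyclic_def)
    finally show ?thesis by (simp add: quotient_module_def full)
  qed
  have inj: "inj_on g (carrier M)"
  proof (rule inj_onI)
    fix x y assume xy: "x \<in> carrier M" "y \<in> carrier M" "g x = g y"
    obtain b where "b \<in> carrier B" "x = b \<odot>\<^bsub>M\<^esub> v" using ex[OF xy(1)] by blast
    then have "b \<in> g y" using xy(3) by (auto simp: g_def)
    then show "x = y" using \<open>x = b \<odot>\<^bsub>M\<^esub> v\<close> by (simp add: g_def)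
  qed
  show ?thesis
    unfolding module_iso_def
  proof (intro exI[of _ g] conjI ballI)
    show "bij_betw g (carrier M) (carrier (quotient_module B (ann v)))"
      unfolding carr using inj by (simp add: bij_betw_def)
  next
    fix x y assume xy: "x \<in> carrier M" "y \<in> carrier M"
    obtain b c where b: "b \<in> carrier B" "x = b \<odot>\<^bsub>M\<^esub> v" and c: "c \<in> carrier B" "y = c \<odot>\<^bsub>M\<^esub> v"
      using ex xy by metis
    have "g x <+> g y = g (x \<oplus>\<^bsub>M\<^esub> y)"
    proof
      show "g x <+> g y \<subseteq> g (x \<oplus>\<^bsub>M\<^esub> y)"
        using v by (auto simp: g_def set_add_def' smult_add_left)
      show "g (x \<oplus>\<^bsub>M\<^esub> y) \<subseteq> g x <+> g y"
      proof
        fix d assume "d \<in> g (x \<oplus>\<^bsub>M\<^esub> y)"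
        then have d: "d \<in> carrier B" "d \<odot>\<^bsub>M\<^esub> v = x \<oplus>\<^bsub>M\<^esub> y" by (auto simp: g_def)
        have "d \<ominus> c \<in> g x"
          using d c b v xy by (simp add: g_def a_minus_def smult_add_left smult_minus_left
              M.a_assoc M.r_neg)
        moreover have "c \<in> g y" using c by (simp add: g_def)
        moreover have "d = (d \<ominus> c) \<oplus> c" using d c by (simp add: a_minus_def a_assoc l_neg)
        ultimately show "d \<in> g x <+> g y" unfolding set_add_def' by blast
      qed
    qed
    then show "g (x \<oplus>\<^bsub>M\<^esub> y) = g x \<oplus>\<^bsub>quotient_module B (ann v)\<^esub> g y"
      by (simp add: quotient_module_def)
  next
    fix b x assume b: "b \<in> carrier B" and x: "x \<in> carrier M"
    have "(\<Union>c\<in>g x. ann v +> (b \<otimes> c)) = (\<Union>c\<in>g x. g (b \<odot>\<^bsub>M\<^esub> x))"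
    proof (rule SUP_cong)
      fix c assume "c \<in> g x"
      then show "ann v +> (b \<otimes> c) = g (b \<odot>\<^bsub>M\<^esub> x)"
        using b v by (auto simp: coset smult_mult g_def)
    qed simp
    moreover have "g x \<noteq> {}" using ex[OF x] by (auto simp: g_def)
    ultimately show "g (b \<odot>\<^bsub>M\<^esub> x) = b \<odot>\<^bsub>quotient_module B (ann v)\<^esub> g x"
      by (simp add: quotient_module_def)
  qed
qed

end

section \<open>Contractions and vacuum expectation values\<close>

lemma sum_fun_apply: "sum f A x = (\<Sum>a\<in>A. f a x)"
  by (induction A rule: infinite_finite_induct) auto

text \<open>A linear map has a right inverse on its range. The Gram matrices below are singular in general,
  and this is the inverse that remains.\<close>

lemma generalized_inverse:
  fixes G :: "'a \<Rightarrow> 'a \<Rightarrow> complex"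
  assumes fin: "finite X"
  shows "\<exists>Q. \<forall>x\<in>X. \<forall>y\<in>X. (\<Sum>u\<in>X. \<Sum>w\<in>X. G x u * Q u w * G w y) = G x y"
proof -
  define s :: "complex \<Rightarrow> ('a \<Rightarrow> complex) \<Rightarrow> 'a \<Rightarrow> complex" where "s c v = (\<lambda>x. c * v x)" for c v
  have vs: "vector_space s" by unfold_locales (auto simp: s_def algebra_simps)
  interpret vector_space_pair s s
    using vs by (simp add: vector_space_pair_def)
  define T where "T v = (\<lambda>x. if x \<in> X then \<Sum>u\<in>X. G x u * v u else 0)" for v
  have T: "Vector_Spaces.linear s s T"
    unfolding linear_iff_module_hom module_hom_iff using vs
    by (auto simp: module_iff_vector_space T_def s_def fun_eq_iff algebra_simps sum.distrib sum_distrib_left)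
  obtain S where S: "Vector_Spaces.linear s s S" "\<And>v. T (S (T v)) = T v"
    using linear_exists_right_inverse_on[OF T vs1.subspace_UNIV] by auto
  have Sh: "module_hom s s S" using S(1) by (simp add: linear_iff_module_hom)
  define d :: "'a \<Rightarrow> 'a \<Rightarrow> complex" where "d y = (\<lambda>x. if x = y then 1 else 0)" for y
  have "(\<Sum>u\<in>X. \<Sum>w\<in>X. G x u * S (d w) u * G w y) = G x y" if x: "x \<in> X" and y: "y \<in> X" for x y
  proof -
    have "T (d y) = (\<Sum>w\<in>X. s (G w y) (d w))"
    proof
      fix z
      have "(\<Sum>w\<in>X. s (G w y) (d w)) z = (\<Sum>w\<in>X. if z = w then G w y else 0)"
        by (simp add: sum_fun_apply s_def d_def if_distrib[of "(*) _"] cong: if_cong)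
      then show "T (d y) z = (\<Sum>w\<in>X. s (G w y) (d w)) z"
        using fin y by (simp add: T_def d_def if_distrib[of "(*) _"] cong: if_cong)
    qed
    then have "S (T (d y)) = (\<Sum>w\<in>X. s (G w y) (S (d w)))"
      by (simp add: module_hom.sum[OF Sh] module_hom.scale[OF Sh])
    then have "T (S (T (d y))) x = (\<Sum>u\<in>X. G x u * (\<Sum>w\<in>X. G w y * S (d w) u))"
      using x by (simp add: T_def sum_fun_apply s_def)
    moreover have "T (d y) x = G x y"
      using fin x y by (simp add: T_def d_def if_distrib[of "(*) _"] cong: if_cong)
    ultimately show ?thesis by (simp add: S(2) sum_distrib_left mult_ac)
  qed
  then show ?thesis by (intro exI[of _ "\<lambda>u w. S (d w) u"]) blast
qed

text \<open>The terms that arise when \<open>E i\<close> moves to the right through the \<open>F\<close>-word of \<open>u\<close>, other than the one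
  in which \<open>E i\<close> arrives at the right end. A term is a coefficient with a shorter word, and \<open>q i j\<close> is
  the factor for passing \<open>F j\<close>.\<close>

primrec contract :: "(nat \<Rightarrow> nat \<Rightarrow> complex) \<Rightarrow> nat \<Rightarrow> nat list \<Rightarrow> (complex \<times> nat list) list" where
  "contract q i [] = []"
| "contract q i (j # u) =
    (if i = j then [(1, u)] else []) @ map (\<lambda>p. (q i j * fst p, j # snd p)) (contract q i u)"

text \<open>The vacuum expectation value of the \<open>E\<close>-word of \<open>w\<close> followed by the \<open>F\<close>-word of \<open>u\<close>: its scalar part modulo
  the left ideal generated by the \<open>E i\<close>. The head of \<open>w\<close> is the rightmost \<open>E\<close>, which meets the \<open>F\<close>-word first.\<close>

primrec vev :: "(nat \<Rightarrow> nat \<Rightarrow> complex) \<Rightarrow> nat list \<Rightarrow> nat list \<Rightarrow> complex" where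
  "vev q [] = (\<lambda>u. if u = [] then 1 else 0)"
| "vev q (i # w) = (\<lambda>u. \<Sum>p\<leftarrow>contract q i u. fst p * vev q w (snd p))"

lemma contract_words:
  "p \<in> set (contract q i u) \<Longrightarrow> Suc (length (snd p)) = length u \<and> set (snd p) \<subseteq> set u"
  by (induction u arbitrary: p) (force split: if_splits)+

text \<open>Each contraction removes one letter from both words.\<close>

lemma vev_eq_0: "length u \<noteq> length w \<Longrightarrow> vev q w u = 0"
proof (induction w arbitrary: u)
  case (Cons i w)
  have "fst p * vev q w (snd p) = 0" if "p \<in> set (contract q i u)" for p
    using Cons contract_words[OF that] by simp
  then have "(\<Sum>p\<leftarrow>contract q i u. fst p * vev q w (snd p)) = (\<Sum>p\<leftarrow>contract q i u. 0)"
    by (intro arg_cong[where f = sum_list] map_cong) auto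
  then show ?case by simp
qed simp

definition coef :: "(complex \<times> 'a) list \<Rightarrow> 'a \<Rightarrow> complex" where
  "coef ps u = (\<Sum>p\<leftarrow>ps. if snd p = u then fst p else 0)"

lemma coef_sum:
  assumes "finite X" "snd ` set ps \<subseteq> X"
  shows "(\<Sum>u\<in>X. coef ps u * g u) = (\<Sum>p\<leftarrow>ps. fst p * g (snd p))"
  using assms(2)
proof (induction ps)
  case (Cons p ps)
  have "(\<Sum>u\<in>X. coef (p # ps) u * g u) =
      (\<Sum>u\<in>X. if snd p = u then fst p * g u else 0) + (\<Sum>u\<in>X. coef ps u * g u)"
    unfolding sum.distrib[symmetric] by (rule sum.cong) (auto simp: coef_def algebra_simps)
  then show ?case using Cons assms(1) by simp
qed (simp add: coef_def)

section \<open>Linear combinations and left ideals\<close>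

locale scalar_ring = ring B for B :: "('b, 'r) ring_scheme" (structure) +
  fixes sc :: "complex \<Rightarrow> 'b"
  assumes sc_closed [simp]: "sc c \<in> carrier B"
    and sc_add: "sc (c + d) = sc c \<oplus> sc d"
    and sc_mult: "sc (c * d) = sc c \<otimes> sc d"
    and sc_one [simp]: "sc 1 = \<one>"
    and sc_central: "x \<in> carrier B \<Longrightarrow> sc c \<otimes> x = x \<otimes> sc c"
begin

lemma sc_zero [simp]: "sc 0 = \<zero>"
  using sc_add[of 0 0] by (simp add: add.l_cancel_one')

lemma sc_left_commute:
  assumes "x \<in> carrier B" "y \<in> carrier B"
  shows "x \<otimes> (sc c \<otimes> y) = sc c \<otimes> (x \<otimes> y)"
  using assms by (simp add: m_assoc[symmetric] sc_central[of x c])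

lemma sc_sc: "x \<in> carrier B \<Longrightarrow> sc c \<otimes> (sc d \<otimes> x) = sc (c * d) \<otimes> x"
  by (simp add: sc_mult m_assoc)

lemma sc_uminus: "x \<in> carrier B \<Longrightarrow> sc (- 1) \<otimes> x = \<ominus> x"
proof -
  assume x: "x \<in> carrier B"
  have "sc (- 1) \<otimes> x \<oplus> x = (sc (- 1) \<oplus> sc 1) \<otimes> x" using x by (simp add: l_distr)
  also have "\<dots> = \<zero>" using x by (simp add: sc_add[symmetric] del: sc_one)
  finally show ?thesis using x minus_equality[of "sc (- 1) \<otimes> x" x] by simp
qed

definition lc :: "'a list \<Rightarrow> ('a \<Rightarrow> complex) \<Rightarrow> ('a \<Rightarrow> 'b) \<Rightarrow> 'b" where
  "lc xs c X = foldr (\<lambda>a s. sc (c a) \<otimes> X a \<oplus> s) xs \<zero>"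

lemma lc_simps [simp]: "lc [] c X = \<zero>" "lc (a # xs) c X = sc (c a) \<otimes> X a \<oplus> lc xs c X"
  by (simp_all add: lc_def)

lemma lc_cong [fundef_cong]:
  "xs = ys \<Longrightarrow> (\<And>a. a \<in> set ys \<Longrightarrow> c a = d a) \<Longrightarrow> (\<And>a. a \<in> set ys \<Longrightarrow> X a = Y a) \<Longrightarrow>
    lc xs c X = lc ys d Y"
  unfolding lc_def by (auto intro!: foldr_cong)

lemma lc_closed [simp, intro]: "(\<And>a. a \<in> set xs \<Longrightarrow> X a \<in> carrier B) \<Longrightarrow> lc xs c X \<in> carrier B"
  by (induction xs) auto

lemma lc_map: "lc (map f xs) c X = lc xs (\<lambda>a. c (f a)) (\<lambda>a. X (f a))"
  by (induction xs) auto

lemma lc_append: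
  "(\<And>a. a \<in> set (xs @ ys) \<Longrightarrow> X a \<in> carrier B) \<Longrightarrow> lc (xs @ ys) c X = lc xs c X \<oplus> lc ys c X"
  by (induction xs) (auto simp: a_assoc)

lemma lc_add:
  "(\<And>a. a \<in> set xs \<Longrightarrow> X a \<in> carrier B) \<Longrightarrow> lc xs (\<lambda>a. c a + d a) X = lc xs c X \<oplus> lc xs d X"
  by (induction xs) (auto simp: sc_add l_distr a_ac)

lemma lc_add_vec:
  "(\<And>a. a \<in> set xs \<Longrightarrow> X a \<in> carrier B) \<Longrightarrow> (\<And>a. a \<in> set xs \<Longrightarrow> Y a \<in> carrier B) \<Longrightarrow>
    lc xs c (\<lambda>a. X a \<oplus> Y a) = lc xs c X \<oplus> lc xs c Y"
  by (induction xs) (auto simp: r_distr a_ac)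

lemma lc_scale:
  "(\<And>a. a \<in> set xs \<Longrightarrow> X a \<in> carrier B) \<Longrightarrow> sc k \<otimes> lc xs c X = lc xs (\<lambda>a. k * c a) X"
  by (induction xs) (auto simp: sc_sc r_distr)

lemma lc_zero: "(\<And>a. a \<in> set xs \<Longrightarrow> X a \<in> carrier B) \<Longrightarrow> (\<And>a. a \<in> set xs \<Longrightarrow> c a = 0) \<Longrightarrow> lc xs c X = \<zero>"
  by (induction xs) auto

lemma lc_zero_vec: "(\<And>a. a \<in> set xs \<Longrightarrow> X a = \<zero>) \<Longrightarrow> lc xs c X = \<zero>"
  by (induction xs) auto

lemma lc_left:
  "y \<in> carrier B \<Longrightarrow> (\<And>a. a \<in> set xs \<Longrightarrow> X a \<in> carrier B) \<Longrightarrow> y \<otimes> lc xs c X = lc xs c (\<lambda>a. y \<otimes> X a)"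
  by (induction xs) (auto simp: sc_left_commute r_distr)

lemma lc_right:
  "y \<in> carrier B \<Longrightarrow> (\<And>a. a \<in> set xs \<Longrightarrow> X a \<in> carrier B) \<Longrightarrow> lc xs c X \<otimes> y = lc xs c (\<lambda>a. X a \<otimes> y)"
  by (induction xs) (auto simp: m_assoc l_distr)

lemma lc_sc: "lc xs c (\<lambda>a. sc (g a)) = sc (\<Sum>a\<leftarrow>xs. c a * g a)"
  by (induction xs) (auto simp: sc_add sc_mult)

lemma lc_lc:
  assumes "distinct xs" "\<And>b. b \<in> set ys \<Longrightarrow> X b \<in> carrier B"
  shows "lc xs c (\<lambda>a. lc ys (d a) X) = lc ys (\<lambda>b. \<Sum>a\<in>set xs. c a * d a b) X"
  using assms(1)
proof (induction xs)
  case Nil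
  then show ?case using assms(2) by (simp add: lc_zero)
next
  case (Cons a xs)
  then show ?case using assms(2) by (simp add: lc_scale lc_add)
qed

lemma lc_swap:
  assumes "\<And>a b. a \<in> set xs \<Longrightarrow> b \<in> set ys \<Longrightarrow> X a b \<in> carrier B"
  shows "lc xs (\<lambda>_. 1) (\<lambda>a. lc ys (c a) (X a)) = lc ys (\<lambda>_. 1) (\<lambda>b. lc xs (\<lambda>a. c a b) (\<lambda>a. X a b))"
  using assms
proof (induction xs)
  case Nil
  then show ?case by (simp add: lc_zero_vec)
next
  case (Cons a xs)
  have "lc ys (c a) (X a) = lc ys (\<lambda>_. 1) (\<lambda>b. sc (c a b) \<otimes> X a b)"
    using Cons.prems by (induction ys) auto
  then show ?case using Cons by (simp add: lc_add_vec)
qed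

lemma lc_single:
  assumes "distinct xs" "b \<in> set xs" "\<And>a. a \<in> set xs \<Longrightarrow> X a \<in> carrier B"
  shows "lc xs (\<lambda>a. if b = a then c else 0) X = sc c \<otimes> X b"
  using assms
proof (induction xs)
  case (Cons a xs)
  show ?case
  proof (cases "b = a")
    case True
    then have "lc xs (\<lambda>a. if b = a then c else 0) X = \<zero>" using Cons.prems by (intro lc_zero) auto
    then show ?thesis using True Cons.prems by simp
  next
    case False
    then show ?thesis using Cons by simp
  qed
qed simp

lemma lc_coef:
  assumes "distinct xs" "\<And>a. a \<in> set xs \<Longrightarrow> X a \<in> carrier B" "snd ` set ps \<subseteq> set xs"
  shows "lc ps fst (\<lambda>p. X (snd p)) = lc xs (coef ps) X"
  using assms(3)
proof (induction ps)
  case Nil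
  then show ?case using assms(2) by (simp add: lc_zero coef_def)
next
  case (Cons p ps)
  have "coef (p # ps) = (\<lambda>u. (if snd p = u then fst p else 0) + coef ps u)"
    by (simp add: coef_def fun_eq_iff)
  then have "lc xs (coef (p # ps)) X = lc xs (\<lambda>u. if snd p = u then fst p else 0) X \<oplus> lc xs (coef ps) X"
    using assms(2) by (simp add: lc_add)
  then show ?case using Cons assms by (simp add: lc_single)
qed

lemma lc_filter_split:
  assumes "\<And>a. a \<in> set xs \<Longrightarrow> X a \<in> carrier B"
  shows "lc xs c X = lc (filter P xs) c X \<oplus> lc (filter (\<lambda>a. \<not> P a) xs) c X"
  using assms
proof (induction xs)
  case (Cons a xs)
  have "lc (filter P xs) c X \<in> carrier B" "lc (filter (\<lambda>a. \<not> P a) xs) c X \<in> carrier B"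
    using Cons.prems by (auto intro!: lc_closed)
  then show ?case using Cons by (cases "P a") (auto simp: a_ac)
qed simp

lemma lc_eq_if_diff_zero:
  assumes "\<And>a. a \<in> set xs \<Longrightarrow> X a \<in> carrier B" "lc xs (\<lambda>a. c a - d a) X = \<zero>"
  shows "lc xs c X = lc xs d X"
proof -
  have "lc xs c X = lc xs (\<lambda>a. (c a - d a) + d a) X" by simp
  also have "\<dots> = lc xs (\<lambda>a. c a - d a) X \<oplus> lc xs d X" using assms(1) by (rule lc_add)
  finally show ?thesis using assms by simp
qed

definition left_ideal :: "'b set \<Rightarrow> bool" where
  "left_ideal I \<longleftrightarrow> I \<subseteq> carrier B \<and> \<zero> \<in> I \<and> (\<forall>x\<in>I. \<forall>y\<in>I. x \<oplus> y \<in> I) \<and>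
    (\<forall>b\<in>carrier B. \<forall>x\<in>I. b \<otimes> x \<in> I)"

lemma left_idealD:
  assumes "left_ideal I"
  shows "x \<in> I \<Longrightarrow> x \<in> carrier B" "\<zero> \<in> I" "x \<in> I \<Longrightarrow> y \<in> I \<Longrightarrow> x \<oplus> y \<in> I"
    "b \<in> carrier B \<Longrightarrow> x \<in> I \<Longrightarrow> b \<otimes> x \<in> I"
  using assms by (auto simp: left_ideal_def)

lemma left_ideal_uminus: "left_ideal I \<Longrightarrow> x \<in> I \<Longrightarrow> \<ominus> x \<in> I"
  using left_idealD(4)[of I "sc (- 1)" x] left_idealD(1)[of I x] by (simp add: sc_uminus)

definition eqm :: "'b set \<Rightarrow> 'b \<Rightarrow> 'b \<Rightarrow> bool" where
  "eqm I x y \<longleftrightarrow> x \<in> carrier B \<and> y \<in> carrier B \<and> x \<ominus> y \<in> I"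

lemma eqm_refl: "left_ideal I \<Longrightarrow> x \<in> carrier B \<Longrightarrow> eqm I x x"
  by (simp add: eqm_def a_minus_def r_neg left_idealD)

lemma eqm_add:
  assumes I: "left_ideal I" and "eqm I x y" "eqm I z w" shows "eqm I (x \<oplus> z) (y \<oplus> w)"
proof -
  have c: "x \<in> carrier B" "y \<in> carrier B" "z \<in> carrier B" "w \<in> carrier B"
    using assms by (auto simp: eqm_def)
  have "(x \<oplus> z) \<ominus> (y \<oplus> w) = (x \<ominus> y) \<oplus> (z \<ominus> w)"
    using c by (simp add: a_minus_def minus_add a_ac)
  then show ?thesis using assms c by (auto simp: eqm_def left_idealD(3)[OF I])
qed

lemma eqm_left:
  assumes I: "left_ideal I" and "eqm I x y" "b \<in> carrier B" shows "eqm I (b \<otimes> x) (b \<otimes> y)"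
proof -
  have c: "x \<in> carrier B" "y \<in> carrier B" using assms by (auto simp: eqm_def)
  have "(b \<otimes> x) \<ominus> (b \<otimes> y) = b \<otimes> (x \<ominus> y)" using c assms(3) by (simp add: a_minus_def r_distr r_minus)
  then show ?thesis using assms c by (auto simp: eqm_def left_idealD(4)[OF I])
qed

lemma eqm_sym:
  assumes I: "left_ideal I" and "eqm I x y" shows "eqm I y x"
proof -
  have c: "x \<in> carrier B" "y \<in> carrier B" using assms by (auto simp: eqm_def)
  have "y \<ominus> x = \<ominus> (x \<ominus> y)" using c by (simp add: a_minus_def minus_add a_comm)
  then show ?thesis using assms c left_ideal_uminus[OF I] by (auto simp: eqm_def)
qed

lemma eqm_trans:
  assumes I: "left_ideal I" and "eqm I x y" "eqm I y z" shows "eqm I x z"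
proof -
  have c: "x \<in> carrier B" "y \<in> carrier B" "z \<in> carrier B" using assms by (auto simp: eqm_def)
  have "x \<ominus> z = (x \<ominus> y) \<oplus> (y \<ominus> z)"
  proof -
    have "(x \<ominus> y) \<oplus> (y \<ominus> z) = x \<oplus> ((\<ominus> y \<oplus> y) \<oplus> \<ominus> z)" using c by (simp add: a_minus_def a_assoc del: l_neg)
    then show ?thesis using c by (simp add: l_neg a_minus_def)
  qed
  then show ?thesis using assms c by (auto simp: eqm_def left_idealD(3)[OF I])
qed

lemma eqm_zero: "left_ideal I \<Longrightarrow> x \<in> I \<longleftrightarrow> eqm I x \<zero>"
  using left_idealD(1) by (auto simp: eqm_def a_minus_def)

lemma eqm_mem: "left_ideal I \<Longrightarrow> eqm I x y \<Longrightarrow> y \<in> I \<Longrightarrow> x \<in> I"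
  using eqm_trans eqm_zero by blast

lemma eqm_lc:
  assumes I: "left_ideal I" and "\<And>a. a \<in> set xs \<Longrightarrow> eqm I (X a) (Y a)"
  shows "eqm I (lc xs c X) (lc xs c Y)"
  using assms(2) by (induction xs) (auto intro!: eqm_add[OF I] eqm_left[OF I] eqm_refl[OF I])

end

section \<open>The relations of the q-boson algebra\<close>

text \<open>The relations of the q-boson algebra for \<open>e\<^sub>i' = E i\<close>, \<open>f\<^sub>i = F i\<close> and \<open>t\<^sub>\<nu> = T \<nu>\<close>, with arbitrary structure
  constants.\<close>

locale boson_relations = scalar_ring B sc
  for B :: "('b, 'r) ring_scheme" (structure) and sc :: "complex \<Rightarrow> 'b" +
  fixes E F :: "nat \<Rightarrow> 'b" and T :: "'w \<Rightarrow> 'b" and ix :: "nat list" and Tor :: "'w set"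
    and q :: "nat \<Rightarrow> nat \<Rightarrow> complex" and r :: "nat \<Rightarrow> 'w \<Rightarrow> complex"
  assumes ix: "distinct ix"
    and E_closed [simp]: "i \<in> set ix \<Longrightarrow> E i \<in> carrier B"
    and F_closed [simp]: "i \<in> set ix \<Longrightarrow> F i \<in> carrier B"
    and T_closed [simp]: "\<nu> \<in> Tor \<Longrightarrow> T \<nu> \<in> carrier B"
    and E_F: "i \<in> set ix \<Longrightarrow> j \<in> set ix \<Longrightarrow>
      E i \<otimes> F j = sc (q i j) \<otimes> (F j \<otimes> E i) \<oplus> (if i = j then \<one> else \<zero>)"
    and T_E: "i \<in> set ix \<Longrightarrow> \<nu> \<in> Tor \<Longrightarrow> T \<nu> \<otimes> E i = sc (r i \<nu>) \<otimes> (E i \<otimes> T \<nu>)"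
    and T_F: "i \<in> set ix \<Longrightarrow> \<nu> \<in> Tor \<Longrightarrow> \<exists>c. T \<nu> \<otimes> F i = sc c \<otimes> (F i \<otimes> T \<nu>)"
begin

definition W :: "nat \<Rightarrow> nat list list" where "W k = List.n_lists k ix"

lemma set_W: "set (W k) = {u. length u = k \<and> set u \<subseteq> set ix}"
  by (simp add: W_def set_n_lists)

lemma distinct_W: "distinct (W k)"
  unfolding W_def using ix by (rule distinct_n_lists)

primrec Fw :: "nat list \<Rightarrow> 'b" where
  "Fw [] = \<one>"
| "Fw (i # u) = F i \<otimes> Fw u"

primrec Ew :: "nat list \<Rightarrow> 'b" where
  "Ew [] = \<one>"
| "Ew (i # w) = Ew w \<otimes> E i"

lemma Fw_closed [simp]: "set u \<subseteq> set ix \<Longrightarrow> Fw u \<in> carrier B"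
  and Ew_closed [simp]: "set u \<subseteq> set ix \<Longrightarrow> Ew u \<in> carrier B"
  by (induction u) auto

lemma Ew_append: "set u \<subseteq> set ix \<Longrightarrow> set w \<subseteq> set ix \<Longrightarrow> Ew (u @ w) = Ew w \<otimes> Ew u"
  by (induction u) (auto simp: m_assoc)

lemma contract_closed: "p \<in> set (contract q i u) \<Longrightarrow> set u \<subseteq> set ix \<Longrightarrow> Fw (snd p) \<in> carrier B"
  using contract_words by fastforce

lemma E_Fw:
  assumes i: "i \<in> set ix" and "set u \<subseteq> set ix"
  shows "E i \<otimes> Fw u = lc (contract q i u) fst (\<lambda>p. Fw (snd p)) \<oplus>
    sc (\<Prod>j\<leftarrow>u. q i j) \<otimes> (Fw u \<otimes> E i)"
  using assms(2)
proof (induction u)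
  case Nil
  then show ?case using i by simp
next
  case (Cons j u)
  let ?D = "contract q i u" and ?s = "\<Prod>j\<leftarrow>u. q i j"
  let ?L = "lc ?D fst (\<lambda>p. Fw (snd p))"
  have j: "j \<in> set ix" and u: "set u \<subseteq> set ix" using Cons.prems by auto
  have Dc: "\<And>p. p \<in> set ?D \<Longrightarrow> Fw (snd p) \<in> carrier B" using contract_closed u by blast
  have Lc: "?L \<in> carrier B" using Dc by blast
  have m: "lc (map (\<lambda>p. (q i j * fst p, j # snd p)) ?D) fst (\<lambda>p. Fw (snd p)) =
      sc (q i j) \<otimes> (F j \<otimes> ?L)"
  proof -
    have "F j \<otimes> ?L = lc ?D fst (\<lambda>p. F j \<otimes> Fw (snd p))" using Dc j by (intro lc_left) auto
    moreover have "sc (q i j) \<otimes> lc ?D fst (\<lambda>p. F j \<otimes> Fw (snd p)) =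
        lc ?D (\<lambda>p. q i j * fst p) (\<lambda>p. F j \<otimes> Fw (snd p))" using Dc j by (intro lc_scale) auto
    ultimately show ?thesis by (simp add: lc_map)
  qed
  have h: "lc (if i = j then [(1, u)] else []) fst (\<lambda>p. Fw (snd p)) = (if i = j then \<one> else \<zero>) \<otimes> Fw u"
    using u by simp
  have "lc (contract q i (j # u)) fst (\<lambda>p. Fw (snd p)) =
      (if i = j then \<one> else \<zero>) \<otimes> Fw u \<oplus> sc (q i j) \<otimes> (F j \<otimes> ?L)"
    unfolding contract.simps using contract_closed[of _ i "j # u"] Cons.prems
    by (subst lc_append) (auto simp: m h simp del: lc_simps)
  moreover have "E i \<otimes> Fw (j # u) = (E i \<otimes> F j) \<otimes> Fw u" using i j u by (simp add: m_assoc)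
  moreover have "\<dots> = sc (q i j) \<otimes> (F j \<otimes> (E i \<otimes> Fw u)) \<oplus> (if i = j then \<one> else \<zero>) \<otimes> Fw u"
    using i j u by (subst E_F) (auto simp: l_distr m_assoc)
  moreover have "F j \<otimes> (E i \<otimes> Fw u) = F j \<otimes> ?L \<oplus> sc ?s \<otimes> (Fw (j # u) \<otimes> E i)"
    using i j u Lc by (simp add: Cons.IH r_distr sc_left_commute m_assoc)
  moreover have "sc (q i j) \<otimes> (F j \<otimes> ?L \<oplus> sc ?s \<otimes> (Fw (j # u) \<otimes> E i)) =
      sc (q i j) \<otimes> (F j \<otimes> ?L) \<oplus> sc (q i j * ?s) \<otimes> (Fw (j # u) \<otimes> E i)"
    using i j u Lc by (simp add: r_distr sc_sc)
  ultimately show ?case using i j u Lc by (simp add: a_ac)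
qed

lemma T_Fw:
  assumes \<nu>: "\<nu> \<in> Tor" and "set u \<subseteq> set ix"
  shows "\<exists>c. T \<nu> \<otimes> Fw u = sc c \<otimes> (Fw u \<otimes> T \<nu>)"
  using assms(2)
proof (induction u)
  case Nil
  then show ?case using \<nu> by (intro exI[of _ 1]) simp
next
  case (Cons j u)
  then have j: "j \<in> set ix" and u: "set u \<subseteq> set ix" by auto
  obtain c where c: "T \<nu> \<otimes> Fw u = sc c \<otimes> (Fw u \<otimes> T \<nu>)" using Cons.IH[OF u] by blast
  obtain d where d: "T \<nu> \<otimes> F j = sc d \<otimes> (F j \<otimes> T \<nu>)" using T_F[OF j \<nu>] by blast
  have "T \<nu> \<otimes> Fw (j # u) = (T \<nu> \<otimes> F j) \<otimes> Fw u" using j u \<nu> by (simp add: m_assoc)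
  also have "\<dots> = sc d \<otimes> (F j \<otimes> (T \<nu> \<otimes> Fw u))" using j u \<nu> by (simp add: d m_assoc)
  also have "\<dots> = sc (d * c) \<otimes> (Fw (j # u) \<otimes> T \<nu>)"
  proof -
    have "F j \<otimes> (sc c \<otimes> (Fw u \<otimes> T \<nu>)) = sc c \<otimes> (F j \<otimes> (Fw u \<otimes> T \<nu>))"
      using j u \<nu> by (intro sc_left_commute) auto
    then show ?thesis using j u \<nu> by (simp add: c sc_sc m_assoc)
  qed
  finally show ?case by blast
qed

lemma Ew_Fw:
  assumes I: "left_ideal I" and EI: "\<And>i. i \<in> set ix \<Longrightarrow> E i \<in> I"
    and "set w \<subseteq> set ix" "set u \<subseteq> set ix" "length u \<le> length w"
  shows "eqm I (Ew w \<otimes> Fw u) (sc (vev q w u))"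
  using assms(3-5)
proof (induction w arbitrary: u)
  case Nil
  then show ?case using eqm_refl[OF I] by simp
next
  case (Cons i w)
  let ?D = "contract q i u"
  have i: "i \<in> set ix" and w: "set w \<subseteq> set ix" using Cons.prems by auto
  have u: "set u \<subseteq> set ix" by fact
  have Dc: "\<And>p. p \<in> set ?D \<Longrightarrow> Fw (snd p) \<in> carrier B" using contract_closed u by blast
  have Lc: "lc ?D fst (\<lambda>p. Fw (snd p)) \<in> carrier B" using Dc by blast
  have "Ew (i # w) \<otimes> Fw u = Ew w \<otimes> (E i \<otimes> Fw u)" using i w u by (simp add: m_assoc)
  also have "\<dots> = lc ?D fst (\<lambda>p. Ew w \<otimes> Fw (snd p)) \<oplus>
      Ew w \<otimes> (sc (\<Prod>j\<leftarrow>u. q i j) \<otimes> (Fw u \<otimes> E i))"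
    using i w u Dc Lc by (simp add: E_Fw r_distr lc_left)
  also have "eqm I \<dots> (lc ?D fst (\<lambda>p. sc (vev q w (snd p))) \<oplus> \<zero>)"
  proof (rule eqm_add[OF I], rule eqm_lc[OF I])
    fix p assume p: "p \<in> set ?D"
    show "eqm I (Ew w \<otimes> Fw (snd p)) (sc (vev q w (snd p)))"
      using contract_words[OF p] Cons.prems w by (intro Cons.IH) auto
  next
    have "Ew w \<otimes> (sc (\<Prod>j\<leftarrow>u. q i j) \<otimes> (Fw u \<otimes> E i)) \<in> I"
      using i w u EI by (intro left_idealD(4)[OF I]) auto
    then show "eqm I (Ew w \<otimes> (sc (\<Prod>j\<leftarrow>u. q i j) \<otimes> (Fw u \<otimes> E i))) \<zero>"
      using eqm_zero[OF I] by blast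
  qed
  finally show ?case by (simp add: lc_sc)
qed

end

text \<open>The \<open>E\<close>-words and the \<open>F\<close>-words live in quotients by the radicals of a pairing with Gram matrix \<open>vev q\<close>,
  so that vectors in the radical of this matrix are the coefficients of linear relations.\<close>

locale boson_algebra = boson_relations B sc E F T ix Tor q r
  for B :: "('b, 'r) ring_scheme" (structure) and sc E F and T :: "'w \<Rightarrow> 'b" and ix Tor q r +
  assumes E_radical: "(\<And>u. u \<in> set (W k) \<Longrightarrow> (\<Sum>w\<in>set (W k). c w * vev q w u) = 0) \<Longrightarrow>
      lc (W k) c Ew = \<zero>"
    and F_radical: "(\<And>w. w \<in> set (W k) \<Longrightarrow> (\<Sum>u\<in>set (W k). c u * vev q w u) = 0) \<Longrightarrow>
      lc (W k) c Fw = \<zero>"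
    and generated: "range sc \<subseteq> S \<Longrightarrow> E ` set ix \<subseteq> S \<Longrightarrow> F ` set ix \<subseteq> S \<Longrightarrow> T ` Tor \<subseteq> S \<Longrightarrow>
      S \<subseteq> carrier B \<Longrightarrow> (\<And>x y. x \<in> S \<Longrightarrow> y \<in> S \<Longrightarrow> x \<oplus> y \<in> S) \<Longrightarrow>
      (\<And>x y. x \<in> S \<Longrightarrow> y \<in> S \<Longrightarrow> x \<otimes> y \<in> S) \<Longrightarrow> carrier B \<subseteq> S"
begin

abbreviation lp :: "(complex \<times> nat list) list \<Rightarrow> 'b" where
  "lp ps \<equiv> lc ps fst (\<lambda>p. Fw (snd p))"

definition words :: "(complex \<times> nat list) list \<Rightarrow> bool" where
  "words ps \<longleftrightarrow> (\<forall>p\<in>set ps. set (snd p) \<subseteq> set ix)"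

lemma words_closed: "words ps \<Longrightarrow> p \<in> set ps \<Longrightarrow> Fw (snd p) \<in> carrier B"
  by (simp add: words_def)

text \<open>The combinations of \<open>F\<close>-words modulo \<open>I\<close> are stable under left multiplication by each generator: \<open>E i\<close>
  is contracted or arrives in \<open>I\<close> at the right end, and \<open>T \<nu>\<close> becomes a scalar there.\<close>

lemma words_span:
  assumes I: "left_ideal I" and EI: "\<And>i. i \<in> set ix \<Longrightarrow> E i \<in> I"
    and TI: "\<And>\<nu>. \<nu> \<in> Tor \<Longrightarrow> \<exists>c. eqm I (T \<nu>) (sc c)" and b: "b \<in> carrier B"
  shows "\<exists>ps. words ps \<and> eqm I b (lp ps)"
proof -
  define L where "L = {x. \<exists>ps. words ps \<and> eqm I x (lp ps)}"
  have Lc: "x \<in> carrier B" if "x \<in> L" for x using that by (auto simp: L_def eqm_def)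
  have L_eqm: "x \<in> L" if "eqm I x y" "y \<in> L" for x y
    using that eqm_trans[OF I] unfolding L_def by blast
  have L_I: "x \<in> L" if "x \<in> I" for x
    using that eqm_zero[OF I] unfolding L_def by (intro CollectI exI[of _ "[]"]) (auto simp: words_def)
  have L_add: "x \<oplus> y \<in> L" if xy: "x \<in> L" "y \<in> L" for x y
  proof -
    obtain ps rs where *: "words ps" "eqm I x (lp ps)" "words rs" "eqm I y (lp rs)"
      using xy unfolding L_def by blast
    have "lp (ps @ rs) = lp ps \<oplus> lp rs" using * words_closed by (intro lc_append) auto
    then have "eqm I (x \<oplus> y) (lp (ps @ rs))" using * eqm_add[OF I] by simp
    moreover have "words (ps @ rs)" using * by (auto simp: words_def)
    ultimately show ?thesis unfolding L_def by blast
  qed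
  have L_sc: "sc c \<otimes> x \<in> L" if x: "x \<in> L" for c x
  proof -
    obtain ps where *: "words ps" "eqm I x (lp ps)" using x unfolding L_def by blast
    have "sc c \<otimes> lp ps = lp (map (\<lambda>p. (c * fst p, snd p)) ps)"
      using words_closed[OF *(1)] by (simp add: lc_scale lc_map)
    then have "eqm I (sc c \<otimes> x) (lp (map (\<lambda>p. (c * fst p, snd p)) ps))"
      using eqm_left[OF I *(2) sc_closed, of c] by simp
    moreover have "words (map (\<lambda>p. (c * fst p, snd p)) ps)" using * by (auto simp: words_def)
    ultimately show ?thesis unfolding L_def by blast
  qed
  have L_lc: "lc xs c X \<in> L" if "\<And>a. a \<in> set xs \<Longrightarrow> X a \<in> L" for xs c and X :: "'a \<Rightarrow> 'b"
    using that
  proof (induction xs)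
    case Nil
    then show ?case using L_I left_idealD(2)[OF I] by simp
  qed (auto intro: L_add L_sc)
  have L_F: "Fw u \<in> L" if "set u \<subseteq> set ix" for u
    unfolding L_def using that eqm_refl[OF I] by (intro CollectI exI[of _ "[(1, u)]"]) (auto simp: words_def)
  have step: "g \<otimes> x \<in> L"
    if g: "g \<in> carrier B" and gF: "\<And>u. set u \<subseteq> set ix \<Longrightarrow> g \<otimes> Fw u \<in> L" and x: "x \<in> L" for g x
  proof -
    obtain ps where *: "words ps" "eqm I x (lp ps)" using x by (auto simp: L_def)
    have "g \<otimes> lp ps = lc ps fst (\<lambda>p. g \<otimes> Fw (snd p))"
      using words_closed[OF *(1)] g by (simp add: lc_left)
    also have "\<dots> \<in> L" using *(1) gF by (intro L_lc) (auto simp: words_def)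
    finally show ?thesis using L_eqm eqm_left[OF I *(2) g] by blast
  qed
  define S where "S = {g \<in> carrier B. \<forall>x\<in>L. g \<otimes> x \<in> L}"
  have "carrier B \<subseteq> S"
  proof (rule generated)
    show "range sc \<subseteq> S" using L_sc by (auto simp: S_def)
    show "E ` set ix \<subseteq> S"
    proof
      fix g assume "g \<in> E ` set ix"
      then obtain i where i: "i \<in> set ix" "g = E i" by blast
      have "E i \<otimes> Fw u \<in> L" if u: "set u \<subseteq> set ix" for u
        unfolding E_Fw[OF i(1) u]
      proof (rule L_add[OF L_lc])
        show "Fw (snd p) \<in> L" if "p \<in> set (contract q i u)" for p
          using contract_words[OF that] u by (intro L_F) auto
        show "sc (\<Prod>j\<leftarrow>u. q i j) \<otimes> (Fw u \<otimes> E i) \<in> L"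
          using u EI[OF i(1)] by (intro L_sc L_I left_idealD(4)[OF I]) auto
      qed
      then show "g \<in> S" using step i by (auto simp: S_def)
    qed
    show "F ` set ix \<subseteq> S"
    proof
      fix g assume "g \<in> F ` set ix"
      then obtain i where i: "i \<in> set ix" "g = F i" by blast
      have "F i \<otimes> Fw u \<in> L" if "set u \<subseteq> set ix" for u using L_F[of "i # u"] that i by simp
      then show "g \<in> S" using step i by (auto simp: S_def)
    qed
    show "T ` Tor \<subseteq> S"
    proof
      fix g assume "g \<in> T ` Tor"
      then obtain \<nu> where \<nu>: "\<nu> \<in> Tor" "g = T \<nu>" by blast
      obtain c where c: "eqm I (T \<nu>) (sc c)" using TI[OF \<nu>(1)] by blast
      have "T \<nu> \<otimes> Fw u \<in> L" if u: "set u \<subseteq> set ix" for u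
      proof -
        obtain d where d: "T \<nu> \<otimes> Fw u = sc d \<otimes> (Fw u \<otimes> T \<nu>)" using T_Fw[OF \<nu>(1) u] by blast
        have "eqm I (Fw u \<otimes> T \<nu>) (Fw u \<otimes> sc c)" using eqm_left[OF I c] u by simp
        moreover have "Fw u \<otimes> sc c \<in> L" using L_sc[OF L_F[OF u], of c] u by (simp add: sc_central)
        ultimately show ?thesis unfolding d using L_eqm L_sc by blast
      qed
      then show "g \<in> S" using step \<nu> by (auto simp: S_def)
    qed
    show "x \<oplus> y \<in> S" if "x \<in> S" "y \<in> S" for x y
      using that L_add Lc by (auto simp: S_def l_distr)
    show "x \<otimes> y \<in> S" if "x \<in> S" "y \<in> S" for x y
      using that Lc by (auto simp: S_def m_assoc)
  qed (auto simp: S_def)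
  then have "b \<in> S" using b by blast
  moreover have "Fw [] \<in> L" by (rule L_F) simp
  ultimately have "b \<otimes> Fw [] \<in> L" unfolding S_def by blast
  then show ?thesis using b by (simp add: L_def)
qed

lemma radical_lp:
  assumes "words ps" "\<And>p. p \<in> set ps \<Longrightarrow> length (snd p) = n"
    and rad: "\<And>w. w \<in> set (W n) \<Longrightarrow> (\<Sum>p\<leftarrow>ps. fst p * vev q w (snd p)) = 0"
  shows "lp ps = \<zero>"
proof -
  have sub: "snd ` set ps \<subseteq> set (W n)" using assms by (auto simp: set_W words_def)
  have "lp ps = lc (W n) (coef ps) Fw"
    using sub by (intro lc_coef distinct_W) (auto simp: set_W)
  also have "\<dots> = \<zero>"
  proof (rule F_radical)
    fix w assume "w \<in> set (W n)"
    then show "(\<Sum>u\<in>set (W n). coef ps u * vev q w u) = 0"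
      using coef_sum[OF _ sub, of "vev q w"] rad by simp
  qed
  finally show ?thesis .
qed

text \<open>Induction on the degree of a combination of \<open>F\<close>-words that represents \<open>b\<close> modulo \<open>I\<close>. If the part of
  top degree lies in the radical of the Gram matrix, it is zero and the degree drops. Otherwise some
  \<open>E\<close>-word of this degree takes \<open>b\<close> to a nonzero scalar modulo \<open>I\<close>, since its values on shorter \<open>F\<close>-words
  are zero.\<close>

lemma maximal_left_ideal:
  assumes I: "left_ideal I" and EI: "\<And>i. i \<in> set ix \<Longrightarrow> E i \<in> I"
    and TI: "\<And>\<nu>. \<nu> \<in> Tor \<Longrightarrow> \<exists>c. eqm I (T \<nu>) (sc c)" and b: "b \<in> carrier B" "b \<notin> I"
  shows "\<exists>c\<in>carrier B. eqm I (c \<otimes> b) \<one>"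
proof -
  have "\<exists>c\<in>carrier B. eqm I (c \<otimes> b) \<one>"
    if "words ps" "\<And>p. p \<in> set ps \<Longrightarrow> length (snd p) < n" "eqm I b (lp ps)" for n ps
    using that
  proof (induction n arbitrary: ps)
    case 0
    then have "ps = []" by (cases ps) auto
    then have False using 0 b(2) eqm_zero[OF I, of b] by simp
    then show ?case ..
  next
    case (Suc n)
    show ?case
    proof (cases "\<exists>w\<in>set (W n). (\<Sum>p\<leftarrow>ps. fst p * vev q w (snd p)) \<noteq> 0")
      case True
      then obtain w where w: "w \<in> set (W n)" "(\<Sum>p\<leftarrow>ps. fst p * vev q w (snd p)) \<noteq> 0" by blast
      let ?s = "\<Sum>p\<leftarrow>ps. fst p * vev q w (snd p)"
      have wix: "set w \<subseteq> set ix" "length w = n" using w(1) by (auto simp: set_W)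
      have "eqm I (Ew w \<otimes> b) (Ew w \<otimes> lp ps)" using Suc.prems(3) wix by (intro eqm_left[OF I]) auto
      also have "Ew w \<otimes> lp ps = lc ps fst (\<lambda>p. Ew w \<otimes> Fw (snd p))"
        using words_closed[OF Suc.prems(1)] wix by (simp add: lc_left)
      finally have 1: "eqm I (Ew w \<otimes> b) (lc ps fst (\<lambda>p. Ew w \<otimes> Fw (snd p)))" .
      have "eqm I (lc ps fst (\<lambda>p. Ew w \<otimes> Fw (snd p))) (lc ps fst (\<lambda>p. sc (vev q w (snd p))))"
      proof (rule eqm_lc[OF I])
        fix p assume "p \<in> set ps"
        then show "eqm I (Ew w \<otimes> Fw (snd p)) (sc (vev q w (snd p)))"
          using Suc.prems(1) Suc.prems(2)[of p] wix by (intro Ew_Fw[OF I EI]) (auto simp: words_def)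
      qed
      then have "eqm I (Ew w \<otimes> b) (sc ?s)" using eqm_trans[OF I 1] by (simp add: lc_sc)
      then have "eqm I (sc (1 / ?s) \<otimes> (Ew w \<otimes> b)) (sc (1 / ?s) \<otimes> sc ?s)"
        by (rule eqm_left[OF I]) simp
      moreover have "sc (1 / ?s) \<otimes> sc ?s = \<one>" using w(2) by (simp add: sc_mult[symmetric])
      ultimately have "eqm I ((sc (1 / ?s) \<otimes> Ew w) \<otimes> b) \<one>" using wix b by (simp add: m_assoc)
      then show ?thesis using wix by (intro bexI[of _ "sc (1 / ?s) \<otimes> Ew w"]) auto
    next
      case False
      define ts where "ts = filter (\<lambda>p. length (snd p) = n) ps"
      define rs where "rs = filter (\<lambda>p. length (snd p) \<noteq> n) ps"
      have tw: "words ts" and rw: "words rs" using Suc.prems(1) by (auto simp: ts_def rs_def words_def)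
      have split: "lp ps = lp ts \<oplus> lp rs"
        unfolding ts_def rs_def by (rule lc_filter_split) (rule words_closed[OF Suc.prems(1)])
      have "lp ts = \<zero>"
      proof (rule radical_lp[OF tw])
        fix w assume w: "w \<in> set (W n)"
        have "(\<Sum>p\<leftarrow>ps. fst p * vev q w (snd p)) =
            (\<Sum>p\<leftarrow>ts. fst p * vev q w (snd p))"
          unfolding ts_def using Suc.prems(2)
        proof (induction ps)
          case (Cons p ps)
          have "length (snd p) \<noteq> n \<Longrightarrow> vev q w (snd p) = 0"
            using Cons.prems[of p] w by (intro vev_eq_0) (auto simp: set_W)
          then show ?case using Cons by auto
        qed simp
        then show "(\<Sum>p\<leftarrow>ts. fst p * vev q w (snd p)) = 0" using False w by auto
      qed (auto simp: ts_def)
      moreover have "lp rs \<in> carrier B" using words_closed[OF rw] by blast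
      ultimately have "eqm I b (lp rs)" using split Suc.prems(3) by simp
      moreover have "length (snd p) < n" if "p \<in> set rs" for p
        using Suc.prems(2)[of p] that by (auto simp: rs_def)
      ultimately show ?thesis using Suc.IH[OF rw] by blast
    qed
  qed
  moreover obtain ps where ps: "words ps" "eqm I b (lp ps)" using words_span[OF I EI TI b(1)] by blast
  moreover have "length (snd p) < Suc (\<Sum>p\<leftarrow>ps. length (snd p))" if "p \<in> set ps" for p
    using member_le_sum_list[of "length (snd p)" "map (\<lambda>p. length (snd p)) ps"] that by (auto simp: less_Suc_eq_le)
  ultimately show ?thesis by blast
qed

section \<open>Extremal projectors\<close>

text \<open>A generalized inverse of the Gram matrix on the words of length \<open>k\<close>.\<close>

definition Q :: "nat \<Rightarrow> nat list \<Rightarrow> nat list \<Rightarrow> complex" where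
  "Q k = (SOME Q. \<forall>x\<in>set (W k). \<forall>y\<in>set (W k).
     (\<Sum>u\<in>set (W k). \<Sum>w\<in>set (W k). vev q x u * Q u w * vev q w y) = vev q x y)"

lemma Q:
  assumes "x \<in> set (W k)" "y \<in> set (W k)"
  shows "(\<Sum>u\<in>set (W k). \<Sum>w\<in>set (W k). vev q x u * Q k u w * vev q w y) = vev q x y"
proof -
  have "\<exists>Q. \<forall>x\<in>set (W k). \<forall>y\<in>set (W k).
     (\<Sum>u\<in>set (W k). \<Sum>w\<in>set (W k). vev q x u * Q u w * vev q w y) = vev q x y"
    by (rule generalized_inverse) simp
  from someI_ex[OF this] show ?thesis using assms unfolding Q_def by blast
qed

text \<open>The canonical element of degree \<open>k\<close> for the Gram matrix, with \<open>g\<close> inserted between the \<open>F\<close>-words and the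
  \<open>E\<close>-words.\<close>

definition layer :: "nat \<Rightarrow> 'b \<Rightarrow> 'b" where
  "layer k g = lc (W k) (\<lambda>_. 1) (\<lambda>u. lc (W k) (Q k u) (\<lambda>w. Fw u \<otimes> (g \<otimes> Ew w)))"

lemma W_closed [simp]: "u \<in> set (W k) \<Longrightarrow> Fw u \<in> carrier B" "u \<in> set (W k) \<Longrightarrow> Ew u \<in> carrier B"
  by (simp_all add: set_W)

lemma layer_closed [simp]: "g \<in> carrier B \<Longrightarrow> layer k g \<in> carrier B"
  unfolding layer_def by (intro lc_closed) auto

lemma layer_0: "g \<in> carrier B \<Longrightarrow> layer 0 g = g"
proof -
  assume g: "g \<in> carrier B"
  have W0: "W 0 = [[]]" by (simp add: W_def)
  have "Q 0 [] [] = 1" using Q[of "[]" 0 "[]"] by (simp add: W0)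
  then show ?thesis using g by (simp add: layer_def W0)
qed

text \<open>The rows of \<open>vev q\<close> times \<open>Q k\<close> minus the identity lie in the radical of the Gram matrix, where the
  \<open>E\<close>-words satisfy linear relations.\<close>

lemma Ew_expand:
  assumes y: "y \<in> set (W k)"
  shows "lc (W k) (\<lambda>w. \<Sum>u\<in>set (W k). vev q y u * Q k u w) Ew = Ew y"
proof -
  have "lc (W k) (\<lambda>w. \<Sum>u\<in>set (W k). vev q y u * Q k u w) Ew =
      lc (W k) (\<lambda>w. if y = w then 1 else 0) Ew"
  proof (rule lc_eq_if_diff_zero[OF W_closed(2)])
    show "lc (W k) (\<lambda>w. (\<Sum>u\<in>set (W k). vev q y u * Q k u w) - (if y = w then 1 else 0)) Ew = \<zero>"
    proof (rule E_radical)
      fix v assume v: "v \<in> set (W k)"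
      have "(\<Sum>w\<in>set (W k). ((\<Sum>u\<in>set (W k). vev q y u * Q k u w) - (if y = w then 1 else 0)) * vev q w v) =
          (\<Sum>w\<in>set (W k). \<Sum>u\<in>set (W k). vev q y u * Q k u w * vev q w v) -
          (\<Sum>w\<in>set (W k). if y = w then vev q w v else 0)"
        unfolding sum_subtractf[symmetric]
        by (rule sum.cong) (auto simp: left_diff_distrib sum_distrib_right)
      also have "(\<Sum>w\<in>set (W k). \<Sum>u\<in>set (W k). vev q y u * Q k u w * vev q w v) = vev q y v"
        by (subst sum.swap) (rule Q[OF y v])
      finally show "(\<Sum>w\<in>set (W k). ((\<Sum>u\<in>set (W k). vev q y u * Q k u w) - (if y = w then 1 else 0)) * vev q w v) = 0"
        using y by simp
    qed
  qed
  also have "\<dots> = Ew y" using y distinct_W by (simp add: lc_single)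
  finally show ?thesis .
qed

text \<open>The vector \<open>c - c'\<close> is in the radical of the Gram matrix, as \<open>Q k\<close> is a generalized inverse.\<close>

lemma Fw_expand:
  assumes cf: "c' = (\<lambda>v. \<Sum>x\<in>set (W k). Q k v x * (\<Sum>u\<in>set (W k). vev q x u * c u))"
  shows "lc (W k) c Fw = lc (W k) c' Fw"
proof (rule lc_eq_if_diff_zero[OF W_closed(1)])
  show "lc (W k) (\<lambda>a. c a - c' a) Fw = \<zero>"
  proof (rule F_radical)
    fix y assume y: "y \<in> set (W k)"
    have "(\<Sum>v\<in>set (W k). c' v * vev q y v) =
        (\<Sum>v\<in>set (W k). \<Sum>x\<in>set (W k). \<Sum>u\<in>set (W k). vev q y v * Q k v x * vev q x u * c u)"
      unfolding cf sum_distrib_left sum_distrib_right by (intro sum.cong) (auto simp: mult_ac)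
    also have "\<dots> = (\<Sum>v\<in>set (W k). \<Sum>u\<in>set (W k). \<Sum>x\<in>set (W k). vev q y v * Q k v x * vev q x u * c u)"
      by (rule sum.cong[OF refl], rule sum.swap)
    also have "\<dots> = (\<Sum>u\<in>set (W k). \<Sum>v\<in>set (W k). \<Sum>x\<in>set (W k). vev q y v * Q k v x * vev q x u * c u)"
      by (rule sum.swap)
    also have "\<dots> = (\<Sum>u\<in>set (W k). vev q y u * c u)"
      by (rule sum.cong) (auto simp: Q[OF y] sum_distrib_right[symmetric])
    finally show "(\<Sum>u\<in>set (W k). (c u - c' u) * vev q y u) = 0"
      by (simp only: left_diff_distrib sum_subtractf) (simp add: mult.commute)
  qed
qed

text \<open>Moving \<open>E i\<close> through an \<open>F\<close>-word contracts it or leaves \<open>E i\<close> in front of \<open>g\<close>, where the result is in \<open>J\<close>.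
  Contraction of the \<open>F\<close>-words with \<open>E i\<close> is adjoint, for \<open>vev q\<close>, to adding the letter \<open>i\<close> to the \<open>E\<close>-words.
  So it can be moved to the \<open>E\<close>-words, where it puts \<open>E i\<close> at the right end and leaves \<open>Q n\<close> as the
  coefficients.\<close>

lemma E_layer:
  assumes J: "left_ideal J" and g: "g \<in> carrier B" and i: "i \<in> set ix"
    and gJ: "\<And>w. w \<in> set (W (Suc n)) \<Longrightarrow> E i \<otimes> (g \<otimes> Ew w) \<in> J"
  shows "eqm J (E i \<otimes> layer (Suc n) g) (layer n g \<otimes> E i)"
proof -
  let ?V = "W (Suc n)" and ?V' = "W n"
  define Y where "Y w = g \<otimes> Ew w" for w
  have Yc: "Y w \<in> carrier B" if "set w \<subseteq> set ix" for w using that g by (simp add: Y_def)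
  have YV: "Y w \<in> carrier B" if "w \<in> set ?V" for w using that Yc by (simp add: set_W)
  \<comment> \<open>\<open>c1\<close> are the coefficients after contraction; \<open>c2\<close> are equivalent ones by \<open>Fw_expand\<close>, with \<open>Q n\<close> in front\<close>
  define d where "d u = coef (contract q i u)" for u
  define c1 where "c1 v w = (\<Sum>u\<in>set ?V. Q (Suc n) u w * d u v)" for v w
  define c2 where "c2 v w = (\<Sum>x\<in>set ?V'. Q n v x * (\<Sum>u\<in>set ?V'. vev q x u * c1 u w))" for v w
  have Vix: "set u \<subseteq> set ix" if "u \<in> set (W k)" for u k using that by (simp add: set_W)
  have sub: "snd ` set (contract q i u) \<subseteq> set ?V'" if "u \<in> set ?V" for u
    using contract_words[of _ q i u] that by (force simp: set_W)
  have FY: "Fw u \<otimes> Y w \<in> carrier B" if "u \<in> set (W k)" "w \<in> set ?V" for u w k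
    using that YV by simp
  have step: "eqm J (E i \<otimes> (Fw u \<otimes> Y w)) (lc ?V' (d u) (\<lambda>v. Fw v \<otimes> Y w))"
    if u: "u \<in> set ?V" and w: "w \<in> set ?V" for u w
  proof -
    have Dc: "\<And>p. p \<in> set (contract q i u) \<Longrightarrow> Fw (snd p) \<in> carrier B"
      using contract_closed Vix[OF u] by blast
    have Lc: "lc (contract q i u) fst (\<lambda>p. Fw (snd p)) \<in> carrier B" using Dc by blast
    have "E i \<otimes> (Fw u \<otimes> Y w) = (E i \<otimes> Fw u) \<otimes> Y w"
      using i Vix[OF u] YV[OF w] by (simp add: m_assoc)
    also have "\<dots> = lc (contract q i u) fst (\<lambda>p. Fw (snd p)) \<otimes> Y w \<oplus>
        (sc (\<Prod>j\<leftarrow>u. q i j) \<otimes> Fw u) \<otimes> (E i \<otimes> Y w)"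
      unfolding E_Fw[OF i Vix[OF u]] using i Vix[OF u] YV[OF w] Lc by (simp add: l_distr m_assoc)
    also have "lc (contract q i u) fst (\<lambda>p. Fw (snd p)) = lc ?V' (d u) Fw"
      unfolding d_def by (rule lc_coef[OF distinct_W _ sub[OF u]]) simp
    also have "lc ?V' (d u) Fw \<otimes> Y w = lc ?V' (d u) (\<lambda>v. Fw v \<otimes> Y w)"
      using YV[OF w] by (simp add: lc_right)
    finally have eq: "E i \<otimes> (Fw u \<otimes> Y w) = lc ?V' (d u) (\<lambda>v. Fw v \<otimes> Y w) \<oplus>
        (sc (\<Prod>j\<leftarrow>u. q i j) \<otimes> Fw u) \<otimes> (E i \<otimes> Y w)" .
    have "(sc (\<Prod>j\<leftarrow>u. q i j) \<otimes> Fw u) \<otimes> (E i \<otimes> Y w) \<in> J"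
      unfolding Y_def by (rule left_idealD(4)[OF J _ gJ[OF w]]) (use Vix[OF u] in simp)
    then have z: "eqm J ((sc (\<Prod>j\<leftarrow>u. q i j) \<otimes> Fw u) \<otimes> (E i \<otimes> Y w)) \<zero>" using eqm_zero[OF J] by blast
    have lcc: "lc ?V' (d u) (\<lambda>v. Fw v \<otimes> Y w) \<in> carrier B" using FY[OF _ w] by blast
    show ?thesis using eqm_add[OF J eqm_refl[OF J lcc] z] lcc unfolding eq by simp
  qed
  have "E i \<otimes> layer (Suc n) g = lc ?V (\<lambda>_. 1) (\<lambda>u. lc ?V (Q (Suc n) u) (\<lambda>w. E i \<otimes> (Fw u \<otimes> Y w)))"
    unfolding layer_def Y_def[symmetric] using i FY by (subst lc_left) (auto intro!: lc_cong lc_left)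
  also have "eqm J \<dots> (lc ?V (\<lambda>_. 1) (\<lambda>u. lc ?V (Q (Suc n) u) (\<lambda>w. lc ?V' (d u) (\<lambda>v. Fw v \<otimes> Y w))))"
    by (intro eqm_lc[OF J] step)
  also have "lc ?V (\<lambda>_. 1) (\<lambda>u. lc ?V (Q (Suc n) u) (\<lambda>w. lc ?V' (d u) (\<lambda>v. Fw v \<otimes> Y w))) =
      lc ?V (\<lambda>_. 1) (\<lambda>w. lc ?V (\<lambda>u. Q (Suc n) u w) (\<lambda>u. lc ?V' (d u) (\<lambda>v. Fw v \<otimes> Y w)))"
    using FY by (intro lc_swap) blast
  also have "\<dots> = lc ?V (\<lambda>_. 1) (\<lambda>w. lc ?V' (\<lambda>v. c1 v w) (\<lambda>v. Fw v \<otimes> Y w))"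
    unfolding c1_def using FY by (intro lc_cong lc_lc distinct_W) auto
  also have "\<dots> = lc ?V (\<lambda>_. 1) (\<lambda>w. lc ?V' (\<lambda>v. c2 v w) (\<lambda>v. Fw v \<otimes> Y w))"
  proof (rule lc_cong[OF refl refl])
    fix w assume w: "w \<in> set ?V"
    have "lc ?V' (\<lambda>v. c1 v w) Fw = lc ?V' (\<lambda>v. c2 v w) Fw"
      by (rule Fw_expand) (simp add: c2_def)
    then have "lc ?V' (\<lambda>v. c1 v w) Fw \<otimes> Y w = lc ?V' (\<lambda>v. c2 v w) Fw \<otimes> Y w" by simp
    then show "lc ?V' (\<lambda>v. c1 v w) (\<lambda>v. Fw v \<otimes> Y w) = lc ?V' (\<lambda>v. c2 v w) (\<lambda>v. Fw v \<otimes> Y w)"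
      using YV[OF w] by (simp add: lc_right)
  qed
  also have "\<dots> = lc ?V' (\<lambda>_. 1) (\<lambda>v. lc ?V (c2 v) (\<lambda>w. Fw v \<otimes> Y w))"
    by (rule lc_swap[where X = "\<lambda>v w. Fw v \<otimes> Y w" and c = c2, symmetric]) (rule FY)
  also have "\<dots> = lc ?V' (\<lambda>_. 1) (\<lambda>v. lc ?V' (Q n v) (\<lambda>x. Fw v \<otimes> Y (i # x)))"
  proof (rule lc_cong[OF refl refl])
    fix v assume v: "v \<in> set ?V'"
    \<comment> \<open>contraction of \<open>y\<close> is adjoint to adding \<open>i\<close> to \<open>x\<close>\<close>
    have pairing: "(\<Sum>u\<in>set ?V'. vev q x u * d y u) = vev q (i # x) y" if "y \<in> set ?V" for x y
      using coef_sum[OF _ sub[OF that], of "vev q x"] by (simp add: d_def mult.commute)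
    have "c2 v = (\<lambda>w. \<Sum>x\<in>set ?V'. Q n v x * (\<Sum>u\<in>set ?V. vev q (i # x) u * Q (Suc n) u w))"
    proof
      fix w
      have "(\<Sum>u\<in>set ?V'. vev q x u * c1 u w) = (\<Sum>u\<in>set ?V. vev q (i # x) u * Q (Suc n) u w)" for x
      proof -
        have "(\<Sum>u\<in>set ?V'. vev q x u * c1 u w) =
            (\<Sum>u\<in>set ?V'. \<Sum>y\<in>set ?V. Q (Suc n) y w * (vev q x u * d y u))"
          unfolding c1_def sum_distrib_left by (intro sum.cong) (auto simp: mult_ac)
        also have "\<dots> = (\<Sum>y\<in>set ?V. Q (Suc n) y w * (\<Sum>u\<in>set ?V'. vev q x u * d y u))"
          unfolding sum_distrib_left by (rule sum.swap)
        also have "\<dots> = (\<Sum>y\<in>set ?V. vev q (i # x) y * Q (Suc n) y w)"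
          using pairing by (intro sum.cong) (auto simp: mult.commute)
        finally show ?thesis .
      qed
      then show "c2 v w = (\<Sum>x\<in>set ?V'. Q n v x * (\<Sum>u\<in>set ?V. vev q (i # x) u * Q (Suc n) u w))"
        by (simp add: c2_def)
    qed
    moreover have "lc ?V' (Q n v) (\<lambda>x. lc ?V (\<lambda>w. \<Sum>u\<in>set ?V. vev q (i # x) u * Q (Suc n) u w) Y) =
        lc ?V (\<lambda>w. \<Sum>x\<in>set ?V'. Q n v x * (\<Sum>u\<in>set ?V. vev q (i # x) u * Q (Suc n) u w)) Y"
      using YV by (intro lc_lc distinct_W) auto
    moreover have "lc ?V (\<lambda>w. \<Sum>u\<in>set ?V. vev q (i # x) u * Q (Suc n) u w) Y = Y (i # x)"
      if x: "x \<in> set ?V'" for x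
    proof -
      have ixx: "i # x \<in> set ?V" using x i by (simp add: set_W)
      have "g \<otimes> lc ?V (\<lambda>w. \<Sum>u\<in>set ?V. vev q (i # x) u * Q (Suc n) u w) Ew = Y (i # x)"
        unfolding Ew_expand[OF ixx] Y_def ..
      then show ?thesis unfolding Y_def using g by (simp only: lc_left W_closed)
    qed
    ultimately have eq: "lc ?V (c2 v) Y = lc ?V' (Q n v) (\<lambda>x. Y (i # x))"
      by (simp cong: lc_cong)
    have "Fw v \<otimes> lc ?V (c2 v) Y = lc ?V (c2 v) (\<lambda>w. Fw v \<otimes> Y w)"
      using v YV by (intro lc_left) auto
    moreover have "Fw v \<otimes> lc ?V' (Q n v) (\<lambda>x. Y (i # x)) = lc ?V' (Q n v) (\<lambda>x. Fw v \<otimes> Y (i # x))"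
      using v Yc i Vix by (intro lc_left) auto
    ultimately show "lc ?V (c2 v) (\<lambda>w. Fw v \<otimes> Y w) = lc ?V' (Q n v) (\<lambda>x. Fw v \<otimes> Y (i # x))"
      unfolding eq by simp
  qed
  also have "\<dots> = layer n g \<otimes> E i"
  proof -
    have "Fw v \<otimes> Y (i # x) = (Fw v \<otimes> (g \<otimes> Ew x)) \<otimes> E i" if "v \<in> set ?V'" "x \<in> set ?V'" for v x
      using that g i by (simp add: Y_def m_assoc)
    moreover have "lc ?V' (Q n v) (\<lambda>x. (Fw v \<otimes> (g \<otimes> Ew x)) \<otimes> E i) =
        lc ?V' (Q n v) (\<lambda>x. Fw v \<otimes> (g \<otimes> Ew x)) \<otimes> E i" if "v \<in> set ?V'" for v
      using that g i by (intro lc_right[symmetric]) auto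
    ultimately have "lc ?V' (\<lambda>_. 1) (\<lambda>v. lc ?V' (Q n v) (\<lambda>x. Fw v \<otimes> Y (i # x))) =
        lc ?V' (\<lambda>_. 1) (\<lambda>v. lc ?V' (Q n v) (\<lambda>x. Fw v \<otimes> (g \<otimes> Ew x)) \<otimes> E i)"
      by (simp cong: lc_cong)
    also have "\<dots> = layer n g \<otimes> E i"
      unfolding layer_def using g i by (intro lc_right[symmetric] lc_closed) auto
    finally show ?thesis .
  qed
  finally show ?thesis .
qed

text \<open>The extremal projector for vectors on which all \<open>E\<close>-words longer than \<open>l\<close> vanish. Since \<open>layer 0\<close> is the
  identity, the recursion says that the layers of degree \<open>0\<close> to \<open>l\<close> add up to one.\<close>

function gam :: "nat \<Rightarrow> 'b" where
  "gam l = \<one> \<ominus> lc [1..<Suc l] (\<lambda>_. 1) (\<lambda>k. layer k (gam (l - k)))"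
  by pat_completeness auto
termination by (relation "measure id") auto

declare gam.simps [simp del]

lemma gam_closed [simp]: "gam l \<in> carrier B"
proof (induction l rule: less_induct)
  case (less l)
  then show ?case by (subst gam.simps) (auto intro!: minus_closed lc_closed simp del: upt_Suc)
qed

lemma layers_sum: "lc [0..<Suc l] (\<lambda>_. 1) (\<lambda>k. layer k (gam (l - k))) = \<one>"
proof -
  have "[0..<Suc l] = 0 # [1..<Suc l]" by (simp add: upt_conv_Cons)
  then have "lc [0..<Suc l] (\<lambda>_. 1) (\<lambda>k. layer k (gam (l - k))) =
      gam l \<oplus> lc [1..<Suc l] (\<lambda>_. 1) (\<lambda>k. layer k (gam (l - k)))"
    by (simp only: lc_simps) (simp add: layer_0)
  also have "\<dots> = \<one>"
    by (subst gam.simps) (simp add: a_minus_def a_assoc l_neg lc_closed del: upt_Suc)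
  finally show ?thesis .
qed

text \<open>By induction the projectors \<open>gam (l - k)\<close> inside the layers satisfy the condition of \<open>E_layer\<close>. So \<open>E i\<close>
  times the layers of degree \<open>1\<close> to \<open>l\<close> is congruent to the layers of degree \<open>0\<close> to \<open>l - 1\<close> that belong to
  \<open>l - 1\<close>, times \<open>E i\<close>, and those layers add up to one.\<close>

lemma E_gam:
  assumes J: "left_ideal J" and i: "i \<in> set ix"
    and nil: "\<And>w. set w \<subseteq> set ix \<Longrightarrow> length w > l \<Longrightarrow> Ew w \<in> J"
  shows "E i \<otimes> gam l \<in> J"
  using J nil
proof (induction l arbitrary: J rule: less_induct)
  case (less l)
  note J = less.prems(1)
  have EJ: "E i \<otimes> (gam (l - k) \<otimes> Ew w) \<in> J" if k: "1 \<le> k" "k \<le> l" and w: "w \<in> set (W k)" for k w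
  proof -
    have wix: "set w \<subseteq> set ix" "length w = k" using w by (auto simp: set_W)
    \<comment> \<open>the hypothesis on long \<open>E\<close>-words for \<open>J\<close> and \<open>l\<close> gives the one for this left ideal and \<open>l - k\<close>\<close>
    define J' where "J' = {b \<in> carrier B. b \<otimes> Ew w \<in> J}"
    have J': "left_ideal J'"
      unfolding left_ideal_def J'_def using wix
      by (auto simp: l_distr m_assoc left_idealD(2)[OF J] intro!: left_idealD(3,4)[OF J])
    have "E i \<otimes> gam (l - k) \<in> J'"
    proof (rule less.IH[OF _ J'])
      show "l - k < l" using k by simp
      fix v assume v: "set v \<subseteq> set ix" "length v > l - k"
      then have "Ew (w @ v) \<in> J" using wix k by (intro less.prems(2)) auto
      then show "Ew v \<in> J'" using v wix by (simp add: J'_def Ew_append)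
    qed
    then show ?thesis using wix i by (simp add: J'_def m_assoc)
  qed
  let ?S = "lc [1..<Suc l] (\<lambda>_. 1) (\<lambda>k. layer k (gam (l - k)))"
  have Sc: "?S \<in> carrier B" by (intro lc_closed) auto
  have "eqm J (lc [1..<Suc l] (\<lambda>_. 1) (\<lambda>k. E i \<otimes> layer k (gam (l - k))))
      (lc [1..<Suc l] (\<lambda>_. 1) (\<lambda>k. layer (k - 1) (gam (l - k)) \<otimes> E i))"
  proof (rule eqm_lc[OF J])
    fix k assume "k \<in> set [1..<Suc l]"
    then have k: "1 \<le> k" "k \<le> l" by auto
    then have "eqm J (E i \<otimes> layer (Suc (k - 1)) (gam (l - k))) (layer (k - 1) (gam (l - k)) \<otimes> E i)"
      using EJ[OF k] by (intro E_layer[OF J _ i]) auto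
    then show "eqm J (E i \<otimes> layer k (gam (l - k))) (layer (k - 1) (gam (l - k)) \<otimes> E i)" using k by simp
  qed
  moreover have "E i \<otimes> ?S = lc [1..<Suc l] (\<lambda>_. 1) (\<lambda>k. E i \<otimes> layer k (gam (l - k)))"
    using i by (intro lc_left) auto
  ultimately have S1: "eqm J (E i \<otimes> ?S) (lc [1..<Suc l] (\<lambda>_. 1) (\<lambda>k. layer (k - 1) (gam (l - k)) \<otimes> E i))"
    by simp
  have "eqm J (E i \<otimes> ?S) (E i)"
  proof (cases l)
    case 0
    have "E i \<in> J" using less.prems(2)[of "[i]"] i 0 by simp
    then have "eqm J \<zero> (E i)" using eqm_zero[OF J] eqm_sym[OF J] by blast
    then show ?thesis using 0 i by simp
  next
    case (Suc n)
    have "[1..<Suc l] = map Suc [0..<Suc n]" by (simp only: Suc One_nat_def map_Suc_upt)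
    then have "lc [1..<Suc l] (\<lambda>_. 1) (\<lambda>k. layer (k - 1) (gam (l - k)) \<otimes> E i) =
        lc [0..<Suc n] (\<lambda>_. 1) (\<lambda>k. layer k (gam (n - k)) \<otimes> E i)"
      by (simp only: lc_map Suc diff_Suc_Suc diff_Suc_1)
    also have "\<dots> = lc [0..<Suc n] (\<lambda>_. 1) (\<lambda>k. layer k (gam (n - k))) \<otimes> E i"
      using i by (intro lc_right[symmetric]) auto
    finally show ?thesis using S1 i by (simp only: layers_sum) simp
  qed
  then have "E i \<otimes> ?S \<ominus> E i \<in> J" by (simp add: eqm_def)
  from left_ideal_uminus[OF J this] have "\<ominus> (E i \<otimes> ?S \<ominus> E i) \<in> J" .
  also have "\<ominus> (E i \<otimes> ?S \<ominus> E i) = E i \<otimes> (\<one> \<ominus> ?S)"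
    using i Sc by (simp add: a_minus_def minus_add r_distr r_minus a_comm del: upt_Suc)
  finally show ?case unfolding gam.simps[of l] .
qed

end

section \<open>Modules of the category O\<close>

text \<open>Weights \<open>\<mu>\<close> with characters \<open>\<chi> \<mu>\<close> of the torus. \<open>E i\<close> changes weights by the injective shift \<open>sh i\<close>.\<close>

locale boson_weights = boson_algebra B sc E F T ix Tor q r
  for B :: "('b, 'r) ring_scheme" (structure) and sc E F and T :: "'w \<Rightarrow> 'b" and ix Tor q r +
  fixes P :: "'l set" and \<chi> :: "'l \<Rightarrow> 'w \<Rightarrow> complex" and sh :: "nat \<Rightarrow> 'l \<Rightarrow> 'l"
  assumes sh_closed: "i \<in> set ix \<Longrightarrow> \<mu> \<in> P \<Longrightarrow> sh i \<mu> \<in> P"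
    and sh_inj: "i \<in> set ix \<Longrightarrow> inj_on (sh i) P"
    and \<chi>_sh: "i \<in> set ix \<Longrightarrow> \<mu> \<in> P \<Longrightarrow> \<nu> \<in> Tor \<Longrightarrow> \<chi> (sh i \<mu>) \<nu> = r i \<nu> * \<chi> \<mu> \<nu>"
begin

definition Ilam :: "'l \<Rightarrow> 'b set" where
  "Ilam \<mu> = generate (add_monoid B)
    ({b \<otimes> E i |b i. b \<in> carrier B \<and> i \<in> set ix} \<union>
     {b \<otimes> (T \<nu> \<ominus> sc (\<chi> \<mu> \<nu>)) |b \<nu>. b \<in> carrier B \<and> \<nu> \<in> Tor})"

lemma Ilam_left_ideal: "left_ideal (Ilam \<mu>)"
proof -
  let ?G = "{b \<otimes> E i |b i. b \<in> carrier B \<and> i \<in> set ix} \<union>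
     {b \<otimes> (T \<nu> \<ominus> sc (\<chi> \<mu> \<nu>)) |b \<nu>. b \<in> carrier B \<and> \<nu> \<in> Tor}"
  have Gc: "?G \<subseteq> carrier B" by auto
  have G: "c \<otimes> x \<in> ?G" if c: "c \<in> carrier B" and x: "x \<in> ?G" for c x
  proof -
    from x consider (a) b i where "x = b \<otimes> E i" "b \<in> carrier B" "i \<in> set ix"
      | (b) b \<nu> where "x = b \<otimes> (T \<nu> \<ominus> sc (\<chi> \<mu> \<nu>))" "b \<in> carrier B" "\<nu> \<in> Tor" by blast
    then show ?thesis
    proof cases
      case a
      then have "c \<otimes> x = (c \<otimes> b) \<otimes> E i" using c by (simp add: m_assoc)
      then show ?thesis using a c m_closed by blast
    next
      case b
      then have "c \<otimes> x = (c \<otimes> b) \<otimes> (T \<nu> \<ominus> sc (\<chi> \<mu> \<nu>))" using c by (simp add: m_assoc)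
      then show ?thesis using b c m_closed by blast
    qed
  qed
  have sub: "Ilam \<mu> \<subseteq> carrier B" unfolding Ilam_def using add.generate_incl[OF Gc] by simp
  have left: "c \<otimes> x \<in> Ilam \<mu>" if c: "c \<in> carrier B" and x: "x \<in> Ilam \<mu>" for c x
    using x unfolding Ilam_def
  proof (induction x rule: generate.induct)
    case one
    then show ?case using c generate.one[of "add_monoid B" ?G] by simp
  next
    case (incl g)
    show ?case using G[OF c incl] by (rule generate.incl)
  next
    case (inv g)
    then have "g \<in> carrier B" using Gc by blast
    then have "c \<otimes> inv\<^bsub>add_monoid B\<^esub> g = inv\<^bsub>add_monoid B\<^esub> (c \<otimes> g)"
      using c by (simp add: a_inv_def[symmetric] r_minus)
    then show ?case using generate.inv[OF G[OF c inv]] by simp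
  next
    case (eng g k)
    then have "g \<in> carrier B" "k \<in> carrier B" using sub by (auto simp: Ilam_def)
    then have "c \<otimes> (g \<oplus> k) = c \<otimes> g \<oplus> c \<otimes> k" using c by (simp add: r_distr)
    then show ?case using generate.eng[OF eng.IH] by simp
  qed
  have zero: "\<zero> \<in> Ilam \<mu>" using generate.one[of "add_monoid B" ?G] by (simp add: Ilam_def)
  have add: "x \<oplus> y \<in> Ilam \<mu>" if "x \<in> Ilam \<mu>" "y \<in> Ilam \<mu>" for x y
    using generate.eng[of x "add_monoid B" ?G y] that by (simp add: Ilam_def)
  show ?thesis unfolding left_ideal_def using sub left zero add by blast
qed

lemma Ilam_generators:
  "i \<in> set ix \<Longrightarrow> E i \<in> Ilam \<mu>" "\<nu> \<in> Tor \<Longrightarrow> eqm (Ilam \<mu>) (T \<nu>) (sc (\<chi> \<mu> \<nu>))"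
proof -
  assume "i \<in> set ix"
  then have "\<one> \<otimes> E i \<in> Ilam \<mu>" unfolding Ilam_def by (intro generate.incl) blast
  then show "E i \<in> Ilam \<mu>" using \<open>i \<in> set ix\<close> by simp
next
  assume "\<nu> \<in> Tor"
  then have "\<one> \<otimes> (T \<nu> \<ominus> sc (\<chi> \<mu> \<nu>)) \<in> Ilam \<mu>" unfolding Ilam_def by (intro generate.incl) blast
  then show "eqm (Ilam \<mu>) (T \<nu>) (sc (\<chi> \<mu> \<nu>))" using \<open>\<nu> \<in> Tor\<close> by (simp add: eqm_def)
qed

lemma Ilam_least:
  assumes J: "left_ideal J" and "\<And>i. i \<in> set ix \<Longrightarrow> E i \<in> J"
    and "\<And>\<nu>. \<nu> \<in> Tor \<Longrightarrow> T \<nu> \<ominus> sc (\<chi> \<mu> \<nu>) \<in> J"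
  shows "Ilam \<mu> \<subseteq> J"
proof
  fix x assume "x \<in> Ilam \<mu>"
  then show "x \<in> J"
    unfolding Ilam_def
  proof (induction x rule: generate.induct)
    case one
    then show ?case using left_idealD(2)[OF J] by simp
  next
    case (incl g)
    then show ?case using assms left_idealD(4)[OF J] by auto
  next
    case (inv g)
    then have "g \<in> J" using assms left_idealD(4)[OF J] by auto
    then show ?case using left_ideal_uminus[OF J] by (simp add: a_inv_def)
  next
    case (eng g k)
    then show ?case using left_idealD(3)[OF J] by simp
  qed
qed

end

text \<open>Modules of the category O.\<close>

locale boson_module = boson_weights B sc E F T ix Tor q r P \<chi> sh + lmodule B M
  for B :: "('b, 'r) ring_scheme" (structure) and sc E F and T :: "'w \<Rightarrow> 'b" and ix Tor q r
    and P :: "'l set" and \<chi> sh and M :: "('b, 'm, 's) module_scheme" +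
  assumes weights: "direct_sum M P
      (\<lambda>\<mu>. {m \<in> carrier M. \<forall>\<nu>\<in>Tor. T \<nu> \<odot>\<^bsub>M\<^esub> m = sc (\<chi> \<mu> \<nu>) \<odot>\<^bsub>M\<^esub> m})"
    and nilpotent: "m \<in> carrier M \<Longrightarrow> \<exists>l>0. \<forall>js. length js = l \<and> set js \<subseteq> set ix \<longrightarrow>
      foldr (\<lambda>i x. E i \<odot>\<^bsub>M\<^esub> x) js m = \<zero>\<^bsub>M\<^esub>"
begin

definition wspace :: "'l \<Rightarrow> 'm set" where
  "wspace \<mu> = {m \<in> carrier M. \<forall>\<nu>\<in>Tor. T \<nu> \<odot>\<^bsub>M\<^esub> m = sc (\<chi> \<mu> \<nu>) \<odot>\<^bsub>M\<^esub> m}"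

definition K :: "'m set" where "K = {m \<in> carrier M. \<forall>i\<in>set ix. E i \<odot>\<^bsub>M\<^esub> m = \<zero>\<^bsub>M\<^esub>}"

lemma ann_left_ideal:
  assumes v: "v \<in> carrier M" shows "left_ideal (ann v)"
  unfolding left_ideal_def ann_def using v by (auto simp: smult_add_left smult_mult)

lemma lc_smult_mem:
  assumes L: "submodule L B M" and m: "m \<in> carrier M"
    and "\<And>a. a \<in> set xs \<Longrightarrow> X a \<in> carrier B" "\<And>a. a \<in> set xs \<Longrightarrow> X a \<odot>\<^bsub>M\<^esub> m \<in> L"
  shows "lc xs c X \<odot>\<^bsub>M\<^esub> m \<in> L"
  using assms(3,4)
proof (induction xs)
  case Nil
  then show ?case using submodule_simps(2)[OF L] m by simp
next
  case (Cons a xs)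
  then have "lc (a # xs) c X \<odot>\<^bsub>M\<^esub> m = sc (c a) \<odot>\<^bsub>M\<^esub> (X a \<odot>\<^bsub>M\<^esub> m) \<oplus>\<^bsub>M\<^esub> lc xs c X \<odot>\<^bsub>M\<^esub> m"
    using m by (simp add: smult_add_left smult_mult lc_closed)
  moreover have "sc (c a) \<odot>\<^bsub>M\<^esub> (X a \<odot>\<^bsub>M\<^esub> m) \<in> L"
    using Cons.prems by (intro submodule_simps(4)[OF L sc_closed]) simp
  moreover have "lc xs c X \<odot>\<^bsub>M\<^esub> m \<in> L" using Cons by simp
  ultimately show ?case using submodule_simps(3)[OF L] by simp
qed

lemma Ew_foldr:
  assumes "m \<in> carrier M" "set w \<subseteq> set ix"
  shows "Ew w \<odot>\<^bsub>M\<^esub> m = foldr (\<lambda>i x. E i \<odot>\<^bsub>M\<^esub> x) (rev w) m"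
  using assms
proof (induction w arbitrary: m)
  case (Cons i w)
  then show ?case by (simp add: smult_mult)
qed simp

lemma Ew_vanishes:
  assumes m: "m \<in> carrier M"
  obtains l where "\<And>w. set w \<subseteq> set ix \<Longrightarrow> length w > l \<Longrightarrow> Ew w \<odot>\<^bsub>M\<^esub> m = \<zero>\<^bsub>M\<^esub>"
proof -
  obtain l where l: "\<And>js. length js = l \<Longrightarrow> set js \<subseteq> set ix \<Longrightarrow>
      foldr (\<lambda>i x. E i \<odot>\<^bsub>M\<^esub> x) js m = \<zero>\<^bsub>M\<^esub>" using nilpotent[OF m] by blast
  have "Ew w \<odot>\<^bsub>M\<^esub> m = \<zero>\<^bsub>M\<^esub>" if w: "set w \<subseteq> set ix" "length w > l" for w
  proof -
    have tk: "set (take l w) \<subseteq> set ix" "set (drop l w) \<subseteq> set ix"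
      using w by (meson order_trans set_take_subset set_drop_subset)+
    have "Ew w = Ew (drop l w) \<otimes> Ew (take l w)" using Ew_append[OF tk] by simp
    moreover have "Ew (take l w) \<odot>\<^bsub>M\<^esub> m = \<zero>\<^bsub>M\<^esub>" using w tk by (simp add: Ew_foldr m l)
    ultimately show ?thesis using tk m by (simp add: smult_mult)
  qed
  then show thesis by (rule that)
qed

text \<open>The layers of the projectors add up to one, and each writes its part of \<open>m\<close> as \<open>F\<close>-words applied to
  vectors in \<open>K\<close>.\<close>

lemma generated_by_K:
  assumes L: "submodule L B M" and KL: "K \<subseteq> L"
  shows "L = carrier M"
proof
  show "L \<subseteq> carrier M" by (rule submodule_simps(1)[OF L])
  show "carrier M \<subseteq> L"
  proof
    fix m assume m: "m \<in> carrier M"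
    obtain l where l: "\<And>w. set w \<subseteq> set ix \<Longrightarrow> length w > l \<Longrightarrow> Ew w \<odot>\<^bsub>M\<^esub> m = \<zero>\<^bsub>M\<^esub>"
      using Ew_vanishes[OF m] by blast
    have gK: "(gam (l - k) \<otimes> Ew w) \<odot>\<^bsub>M\<^esub> m \<in> K" if k: "k \<le> l" and w: "w \<in> set (W k)" for k w
    proof -
      have wix: "set w \<subseteq> set ix" "length w = k" using w by (auto simp: set_W)
      have c: "Ew w \<odot>\<^bsub>M\<^esub> m \<in> carrier M" using wix m by simp
      have "E i \<otimes> gam (l - k) \<in> ann (Ew w \<odot>\<^bsub>M\<^esub> m)" if i: "i \<in> set ix" for i
      proof (rule E_gam[OF ann_left_ideal[OF c] i])
        fix v assume v: "set v \<subseteq> set ix" "length v > l - k"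
        then have "Ew (w @ v) \<odot>\<^bsub>M\<^esub> m = \<zero>\<^bsub>M\<^esub>" using wix k by (intro l) auto
        then show "Ew v \<in> ann (Ew w \<odot>\<^bsub>M\<^esub> m)"
          using v wix m by (simp add: ann_def Ew_append smult_mult)
      qed
      then show ?thesis using wix m by (auto simp: K_def ann_def smult_mult)
    qed
    have "lc [0..<Suc l] (\<lambda>_. 1) (\<lambda>k. layer k (gam (l - k))) \<odot>\<^bsub>M\<^esub> m \<in> L"
    proof (rule lc_smult_mem[OF L m])
      fix k assume "k \<in> set [0..<Suc l]"
      then have k: "k \<le> l" by auto
      show "layer k (gam (l - k)) \<odot>\<^bsub>M\<^esub> m \<in> L"
        unfolding layer_def
      proof (intro lc_smult_mem[OF L m] lc_closed)
        fix u w assume u: "u \<in> set (W k)" and w: "w \<in> set (W k)"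
        have "Fw u \<odot>\<^bsub>M\<^esub> ((gam (l - k) \<otimes> Ew w) \<odot>\<^bsub>M\<^esub> m) \<in> L"
          by (rule submodule_simps(4)[OF L W_closed(1)[OF u]]) (use gK[OF k w] KL in blast)
        then show "(Fw u \<otimes> (gam (l - k) \<otimes> Ew w)) \<odot>\<^bsub>M\<^esub> m \<in> L" using u w m by (simp add: smult_mult)
      qed auto
    qed simp
    then show "m \<in> L" using m by (simp only: layers_sum smult_one)
  qed
qed

lemma decomposition:
  assumes "m \<in> carrier M"
  shows "\<exists>f. (\<forall>\<mu>\<in>P. f \<mu> \<in> wspace \<mu>) \<and> (\<forall>\<mu>. \<mu> \<notin> P \<longrightarrow> f \<mu> = \<zero>\<^bsub>M\<^esub>) \<and>
    finite {\<mu>. f \<mu> \<noteq> \<zero>\<^bsub>M\<^esub>} \<and> m = finsum M f {\<mu>. f \<mu> \<noteq> \<zero>\<^bsub>M\<^esub>}"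
  using weights assms unfolding direct_sum_def wspace_def[symmetric] by (intro ex1_implies_ex) blast

lemma decomposition_zero:
  assumes f: "\<And>\<mu>. \<mu> \<in> P \<Longrightarrow> f \<mu> \<in> wspace \<mu>" "\<And>\<mu>. \<mu> \<notin> P \<Longrightarrow> f \<mu> = \<zero>\<^bsub>M\<^esub>"
    "finite {\<mu>. f \<mu> \<noteq> \<zero>\<^bsub>M\<^esub>}" "finsum M f {\<mu>. f \<mu> \<noteq> \<zero>\<^bsub>M\<^esub>} = \<zero>\<^bsub>M\<^esub>"
  shows "f \<mu> = \<zero>\<^bsub>M\<^esub>"
proof -
  let ?D = "\<lambda>f. (\<forall>\<mu>\<in>P. f \<mu> \<in> wspace \<mu>) \<and> (\<forall>\<mu>. \<mu> \<notin> P \<longrightarrow> f \<mu> = \<zero>\<^bsub>M\<^esub>) \<and>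
      finite {\<mu>. f \<mu> \<noteq> \<zero>\<^bsub>M\<^esub>} \<and> \<zero>\<^bsub>M\<^esub> = finsum M f {\<mu>. f \<mu> \<noteq> \<zero>\<^bsub>M\<^esub>}"
  have "\<exists>!f. ?D f"
    using weights M.zero_closed unfolding direct_sum_def wspace_def[symmetric] by blast
  then obtain g where g: "\<And>f. ?D f \<Longrightarrow> f = g" by (rule ex1E) blast
  have "f = g" by (rule g) (use f in auto)
  moreover have "(\<lambda>\<mu>. \<zero>\<^bsub>M\<^esub>) = g" by (rule g) (auto simp: wspace_def)
  ultimately show ?thesis by metis
qed

lemma E_wspace:
  assumes i: "i \<in> set ix" and \<mu>: "\<mu> \<in> P" and m: "m \<in> wspace \<mu>"
  shows "E i \<odot>\<^bsub>M\<^esub> m \<in> wspace (sh i \<mu>)"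
proof -
  have mc: "m \<in> carrier M" using m by (simp add: wspace_def)
  have "T \<nu> \<odot>\<^bsub>M\<^esub> (E i \<odot>\<^bsub>M\<^esub> m) = sc (\<chi> (sh i \<mu>) \<nu>) \<odot>\<^bsub>M\<^esub> (E i \<odot>\<^bsub>M\<^esub> m)" if \<nu>: "\<nu> \<in> Tor" for \<nu>
  proof -
    have "T \<nu> \<odot>\<^bsub>M\<^esub> (E i \<odot>\<^bsub>M\<^esub> m) = (T \<nu> \<otimes> E i) \<odot>\<^bsub>M\<^esub> m" using i \<nu> mc by (simp add: smult_mult)
    also have "\<dots> = sc (r i \<nu>) \<odot>\<^bsub>M\<^esub> (E i \<odot>\<^bsub>M\<^esub> (T \<nu> \<odot>\<^bsub>M\<^esub> m))"
      using i \<nu> mc by (simp add: T_E smult_mult)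
    also have "T \<nu> \<odot>\<^bsub>M\<^esub> m = sc (\<chi> \<mu> \<nu>) \<odot>\<^bsub>M\<^esub> m" using m \<nu> by (simp add: wspace_def)
    also have "E i \<odot>\<^bsub>M\<^esub> (sc (\<chi> \<mu> \<nu>) \<odot>\<^bsub>M\<^esub> m) = (E i \<otimes> sc (\<chi> \<mu> \<nu>)) \<odot>\<^bsub>M\<^esub> m"
      using i mc by (simp add: smult_mult)
    also have "\<dots> = sc (\<chi> \<mu> \<nu>) \<odot>\<^bsub>M\<^esub> (E i \<odot>\<^bsub>M\<^esub> m)" using i mc by (simp add: sc_central[symmetric] smult_mult)
    also have "sc (r i \<nu>) \<odot>\<^bsub>M\<^esub> \<dots> = sc (\<chi> (sh i \<mu>) \<nu>) \<odot>\<^bsub>M\<^esub> (E i \<odot>\<^bsub>M\<^esub> m)"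
      using i mc by (simp add: \<chi>_sh[OF i \<mu> \<nu>] sc_mult smult_mult)
    finally show ?thesis .
  qed
  then show ?thesis using i mc by (simp add: wspace_def)
qed

text \<open>Different components of \<open>k\<close> are taken by \<open>E i\<close> to different weights, because the shift is injective.
  So they are taken to the weight components of \<open>E i \<odot>\<^bsub>M\<^esub> k = \<zero>\<^bsub>M\<^esub>\<close>.\<close>

lemma K_components:
  assumes k: "k \<in> K" and f: "\<And>\<mu>. \<mu> \<in> P \<Longrightarrow> f \<mu> \<in> wspace \<mu>" "\<And>\<mu>. \<mu> \<notin> P \<Longrightarrow> f \<mu> = \<zero>\<^bsub>M\<^esub>"
    "finite {\<mu>. f \<mu> \<noteq> \<zero>\<^bsub>M\<^esub>}" "k = finsum M f {\<mu>. f \<mu> \<noteq> \<zero>\<^bsub>M\<^esub>}"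
  shows "f \<mu> \<in> K"
proof -
  define A where "A = {\<mu>. f \<mu> \<noteq> \<zero>\<^bsub>M\<^esub>}"
  have A: "finite A" "A \<subseteq> P" "k = finsum M f A" using f by (auto simp: A_def)
  have fc: "f \<mu> \<in> carrier M" for \<mu> using f(1)[of \<mu>] f(2)[of \<mu>] by (cases "\<mu> \<in> P") (auto simp: wspace_def)
  have "E i \<odot>\<^bsub>M\<^esub> f \<mu> = \<zero>\<^bsub>M\<^esub>" if i: "i \<in> set ix" for i
  proof (cases "\<mu> \<in> P")
    case False
    then show ?thesis using f(2) i by simp
  next
    case True
    \<comment> \<open>the weight decomposition of the image of \<open>k\<close> under \<open>E i\<close>\<close>
    define g where "g \<nu> = (if \<nu> \<in> sh i ` P then E i \<odot>\<^bsub>M\<^esub> f (the_inv_into P (sh i) \<nu>) else \<zero>\<^bsub>M\<^esub>)" for \<nu>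
    have gsh: "g (sh i \<mu>) = E i \<odot>\<^bsub>M\<^esub> f \<mu>" if "\<mu> \<in> P" for \<mu>
      using that sh_inj[OF i] by (simp add: g_def the_inv_into_f_f)
    have gP: "g \<nu> \<in> wspace \<nu>" if "\<nu> \<in> P" for \<nu>
    proof (cases "\<nu> \<in> sh i ` P")
      case True
      then obtain \<mu> where "\<mu> \<in> P" "\<nu> = sh i \<mu>" by blast
      then show ?thesis using gsh E_wspace[OF i _ f(1)] by simp
    qed (auto simp: g_def wspace_def)
    have gn: "g \<nu> = \<zero>\<^bsub>M\<^esub>" if "\<nu> \<notin> P" for \<nu> using that sh_closed[OF i] by (auto simp: g_def)
    have gc: "g \<nu> \<in> carrier M" for \<nu> using gP[of \<nu>] gn[of \<nu>] by (cases "\<nu> \<in> P") (auto simp: wspace_def)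
    have supp: "{\<nu>. g \<nu> \<noteq> \<zero>\<^bsub>M\<^esub>} \<subseteq> sh i ` A"
    proof
      fix \<nu> assume \<nu>: "\<nu> \<in> {\<nu>. g \<nu> \<noteq> \<zero>\<^bsub>M\<^esub>}"
      then have "\<nu> \<in> sh i ` P" by (cases "\<nu> \<in> sh i ` P") (simp_all add: g_def)
      then obtain \<mu> where \<mu>: "\<mu> \<in> P" "\<nu> = sh i \<mu>" by blast
      then have "E i \<odot>\<^bsub>M\<^esub> f \<mu> \<noteq> \<zero>\<^bsub>M\<^esub>" using \<nu> gsh by simp
      then have "f \<mu> \<noteq> \<zero>\<^bsub>M\<^esub>" using i by auto
      then show "\<nu> \<in> sh i ` A" using \<mu> by (auto simp: A_def)
    qed
    have "finsum M g {\<nu>. g \<nu> \<noteq> \<zero>\<^bsub>M\<^esub>} = finsum M g (sh i ` A)"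
      using supp A gc by (intro M.add.finprod_mono_neutral_cong_left) auto
    also have "\<dots> = finsum M (\<lambda>\<mu>. g (sh i \<mu>)) A"
      using gc inj_on_subset[OF sh_inj[OF i] A(2)] by (intro M.finsum_reindex) auto
    also have "\<dots> = finsum M (\<lambda>\<mu>. E i \<odot>\<^bsub>M\<^esub> f \<mu>) A"
      using gsh A fc i by (intro M.finsum_cong') auto
    also have "\<dots> = E i \<odot>\<^bsub>M\<^esub> k"
      unfolding A(3) using i A fc by (intro smult_finsum[symmetric]) auto
    also have "\<dots> = \<zero>\<^bsub>M\<^esub>" using k i by (simp add: K_def)
    finally have "finsum M g {\<nu>. g \<nu> \<noteq> \<zero>\<^bsub>M\<^esub>} = \<zero>\<^bsub>M\<^esub>" .
    moreover have "finite {\<nu>. g \<nu> \<noteq> \<zero>\<^bsub>M\<^esub>}" using supp A by (meson finite_imageI finite_subset)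
    ultimately have "g (sh i \<mu>) = \<zero>\<^bsub>M\<^esub>" using decomposition_zero[of g, OF gP gn] by blast
    then show ?thesis using gsh[OF True] by simp
  qed
  then show ?thesis using fc by (simp add: K_def)
qed

lemma generated_by_highest_weight_vectors:
  assumes L: "submodule L B M" and KL: "\<And>\<mu> v. \<mu> \<in> P \<Longrightarrow> v \<in> K \<Longrightarrow> v \<in> wspace \<mu> \<Longrightarrow> v \<in> L"
  shows "L = carrier M"
proof (rule generated_by_K[OF L])
  show "K \<subseteq> L"
  proof
    fix k assume k: "k \<in> K"
    then have kc: "k \<in> carrier M" by (simp add: K_def)
    obtain f where f: "\<And>\<mu>. \<mu> \<in> P \<Longrightarrow> f \<mu> \<in> wspace \<mu>" "\<And>\<mu>. \<mu> \<notin> P \<Longrightarrow> f \<mu> = \<zero>\<^bsub>M\<^esub>"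
      "finite {\<mu>. f \<mu> \<noteq> \<zero>\<^bsub>M\<^esub>}" "k = finsum M f {\<mu>. f \<mu> \<noteq> \<zero>\<^bsub>M\<^esub>}"
      using decomposition[OF kc] by blast
    have "f \<mu> \<in> L" for \<mu>
      using K_components[OF k f] KL f(1,2) submodule_simps(2)[OF L] by (cases "\<mu> \<in> P") auto
    then show "k \<in> L" using submodule_finsum[OF L f(3)] f(4) by simp
  qed
qed

text \<open>An element of the annihilator outside \<open>Ilam \<mu>\<close> would have a left multiple congruent to one, and \<open>v\<close>
  would be zero.\<close>

lemma ann_highest_weight:
  assumes v: "v \<in> K" "v \<in> wspace \<mu>" "v \<noteq> \<zero>\<^bsub>M\<^esub>"
  shows "ann v = Ilam \<mu>"
proof
  have vc: "v \<in> carrier M" using v by (simp add: K_def)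
  show sub: "Ilam \<mu> \<subseteq> ann v"
  proof (rule Ilam_least[OF ann_left_ideal[OF vc]])
    show "E i \<in> ann v" if "i \<in> set ix" for i using v that by (simp add: ann_def K_def)
    show "T \<nu> \<ominus> sc (\<chi> \<mu> \<nu>) \<in> ann v" if "\<nu> \<in> Tor" for \<nu>
      using v that vc by (simp add: ann_def wspace_def a_minus_def smult_add_left smult_minus_left M.r_neg)
  qed
  show "ann v \<subseteq> Ilam \<mu>"
  proof
    fix b assume b: "b \<in> ann v"
    show "b \<in> Ilam \<mu>"
    proof (rule ccontr)
      assume "b \<notin> Ilam \<mu>"
      then obtain c where c: "c \<in> carrier B" "eqm (Ilam \<mu>) (c \<otimes> b) \<one>"
        using maximal_left_ideal[OF Ilam_left_ideal Ilam_generators(1), of \<mu> b] Ilam_generators(2) b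
        by (auto simp: ann_def)
      have "eqm (ann v) (c \<otimes> b) \<one>" using c sub by (auto simp: eqm_def)
      moreover have "c \<otimes> b \<in> ann v" using left_idealD(4)[OF ann_left_ideal[OF vc]] b c by blast
      ultimately have "\<one> \<in> ann v"
        using eqm_mem[OF ann_left_ideal[OF vc]] eqm_sym[OF ann_left_ideal[OF vc]] by blast
      then show False using v vc by (simp add: ann_def)
    qed
  qed
qed

lemma highest_weight_simple:
  assumes v: "v \<in> K" "v \<in> wspace \<mu>" "v \<noteq> \<zero>\<^bsub>M\<^esub>"
  shows "simple_submodule B M (cyclic v)"
proof (rule cyclic_simple[OF _ v(3)])
  show vc: "v \<in> carrier M" using v by (simp add: K_def)
  fix b assume b: "b \<in> carrier B" "b \<odot>\<^bsub>M\<^esub> v \<noteq> \<zero>\<^bsub>M\<^esub>"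
  then have "b \<notin> Ilam \<mu>" using ann_highest_weight[OF v] by (auto simp: ann_def)
  then obtain c where c: "c \<in> carrier B" "eqm (Ilam \<mu>) (c \<otimes> b) \<one>"
    using maximal_left_ideal[OF Ilam_left_ideal Ilam_generators(1), of \<mu> b] Ilam_generators(2) b by auto
  then have "(c \<otimes> b \<ominus> \<one>) \<odot>\<^bsub>M\<^esub> v = \<zero>\<^bsub>M\<^esub>"
    using ann_highest_weight[OF v] by (auto simp: eqm_def ann_def)
  then have "c \<odot>\<^bsub>M\<^esub> (b \<odot>\<^bsub>M\<^esub> v) \<oplus>\<^bsub>M\<^esub> \<ominus>\<^bsub>M\<^esub> v = \<zero>\<^bsub>M\<^esub>"
    using b c vc by (simp add: a_minus_def smult_add_left smult_minus_left smult_mult)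
  then have "c \<odot>\<^bsub>M\<^esub> (b \<odot>\<^bsub>M\<^esub> v) = v"
    using b c vc M.minus_equality[of "c \<odot>\<^bsub>M\<^esub> (b \<odot>\<^bsub>M\<^esub> v)" "\<ominus>\<^bsub>M\<^esub> v"] by simp
  then show "\<exists>c\<in>carrier B. c \<odot>\<^bsub>M\<^esub> (b \<odot>\<^bsub>M\<^esub> v) = v" using c by blast
qed

theorem semisimple: "semisimple_module B M"
proof (rule semisimple_if_generated_by_simples)
  fix L assume L: "submodule L B M" and simples: "\<And>N. simple_submodule B M N \<Longrightarrow> N \<subseteq> L"
  show "L = carrier M"
  proof (rule generated_by_highest_weight_vectors[OF L])
    fix \<mu> v assume v: "v \<in> K" "v \<in> wspace \<mu>"
    then have "v \<in> cyclic v" by (intro cyclic_self) (simp add: K_def)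
    then show "v \<in> L"
      using simples[OF highest_weight_simple[OF v]] submodule_simps(2)[OF L] by (cases "v = \<zero>\<^bsub>M\<^esub>") auto
  qed
qed

theorem simple_iso:
  assumes "simple_module B M"
  shows "\<exists>\<mu>\<in>P. module_iso B M (quotient_module B (Ilam \<mu>))"
proof -
  have S: "submodule (carrier M) B M" "carrier M \<noteq> {\<zero>\<^bsub>M\<^esub>}"
    "\<And>L. submodule L B M \<Longrightarrow> L \<subseteq> carrier M \<Longrightarrow> L = {\<zero>\<^bsub>M\<^esub>} \<or> L = carrier M"
    using assms by (auto simp: simple_module_def simple_submodule_def)
  have "\<exists>\<mu> v. \<mu> \<in> P \<and> v \<in> K \<and> v \<in> wspace \<mu> \<and> v \<noteq> \<zero>\<^bsub>M\<^esub>"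
  proof (rule ccontr)
    assume *: "\<not> ?thesis"
    have "submodule {\<zero>\<^bsub>M\<^esub>} B M" by (rule submoduleI) auto
    then have "{\<zero>\<^bsub>M\<^esub>} = carrier M" by (rule generated_by_highest_weight_vectors) (use * in blast)
    then show False using S(2) by blast
  qed
  then obtain \<mu> v where \<mu>: "\<mu> \<in> P" and v: "v \<in> K" "v \<in> wspace \<mu>" "v \<noteq> \<zero>\<^bsub>M\<^esub>" by blast
  have vc: "v \<in> carrier M" using v by (simp add: K_def)
  have "cyclic v = carrier M"
    using S(3)[OF cyclic_submodule[OF vc] submodule_simps(1)[OF cyclic_submodule[OF vc]]]
      cyclic_self[OF vc] v(3) by blast
  from iso_quotient_ann[OF vc this] show ?thesis using \<mu> ann_highest_weight[OF v] by auto
qed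

end

section \<open>Linear extension and Sweedler sums\<close>

definition psum :: "('k \<Rightarrow> complex \<Rightarrow> 'v::comm_monoid_add) \<Rightarrow> ('k \<Rightarrow>\<^sub>0 complex) \<Rightarrow> 'v" where
  "psum G p = (\<Sum>k\<in>Poly_Mapping.keys p. G k (Poly_Mapping.lookup p k))"

text \<open>The condition on \<open>G\<close> under which \<open>psum G\<close> is additive.\<close>

definition coeff_additive :: "('k \<Rightarrow> complex \<Rightarrow> 'v::comm_monoid_add) \<Rightarrow> bool" where
  "coeff_additive G \<longleftrightarrow> (\<forall>k. G k 0 = 0) \<and> (\<forall>k a b. G k (a + b) = G k a + G k b)"

lemma coeff_additiveI:
  "(\<And>k. G k 0 = 0) \<Longrightarrow> (\<And>k a b. G k (a + b) = G k a + G k b) \<Longrightarrow> coeff_additive G"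
  by (simp add: coeff_additive_def)

lemma psum_zero [simp]: "psum G 0 = 0" by (simp add: psum_def)

lemma psum_superset:
  assumes "coeff_additive G" "finite A" "Poly_Mapping.keys p \<subseteq> A"
  shows "psum G p = (\<Sum>k\<in>A. G k (Poly_Mapping.lookup p k))"
  unfolding psum_def using assms
  by (intro sum.mono_neutral_left) (auto simp: coeff_additive_def in_keys_iff)

lemma psum_add:
  assumes "coeff_additive G" shows "psum G (p + r) = psum G p + psum G r"
proof -
  let ?A = "Poly_Mapping.keys p \<union> Poly_Mapping.keys r"
  have "psum G s = (\<Sum>k\<in>?A. G k (Poly_Mapping.lookup s k))" if "Poly_Mapping.keys s \<subseteq> ?A" for s
    using that by (intro psum_superset[OF assms]) auto
  then show ?thesis using assms keys_add[of p r]
    by (simp add: lookup_add coeff_additive_def sum.distrib)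
qed

lemma psum_single:
  assumes "coeff_additive G" shows "psum G (Poly_Mapping.single k c) = G k c"
  using psum_superset[OF assms, of "{k}" "Poly_Mapping.single k c"] by simp

lemma psum_uminus:
  fixes G :: "'k \<Rightarrow> complex \<Rightarrow> 'v::ab_group_add"
  assumes "coeff_additive G" shows "psum G (- p) = - psum G p"
proof -
  have "psum G (- p) + psum G p = 0" by (simp add: psum_add[OF assms, symmetric])
  then show ?thesis by (simp add: eq_neg_iff_add_eq_0)
qed

lemma psum_diff:
  fixes G :: "'k \<Rightarrow> complex \<Rightarrow> 'v::ab_group_add"
  assumes "coeff_additive G" shows "psum G (p - r) = psum G p - psum G r"
  using psum_add[OF assms, of p "- r"] psum_uminus[OF assms, of r] by simp

lemma psum_cong:
  "(\<And>k c. k \<in> Poly_Mapping.keys p \<Longrightarrow> G k c = G' k c) \<Longrightarrow> psum G p = psum G' p"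
  unfolding psum_def by (rule sum.cong) auto

lemma poly_mapping_sum_singles:
  "(\<Sum>k\<in>Poly_Mapping.keys p. Poly_Mapping.single k (Poly_Mapping.lookup p k)) = p"
proof (rule poly_mapping_eqI)
  fix j
  have "Poly_Mapping.lookup (\<Sum>k\<in>Poly_Mapping.keys p. Poly_Mapping.single k (Poly_Mapping.lookup p k)) j =
      (\<Sum>k\<in>Poly_Mapping.keys p. if k = j then Poly_Mapping.lookup p k else 0)"
    unfolding lookup_sum by (rule sum.cong) (auto simp: lookup_single when_def)
  also have "\<dots> = Poly_Mapping.lookup p j" by (simp add: in_keys_iff)
  finally show "Poly_Mapping.lookup (\<Sum>k\<in>Poly_Mapping.keys p. Poly_Mapping.single k (Poly_Mapping.lookup p k)) j =
    Poly_Mapping.lookup p j" .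
qed

lemma poly_mapping_span_induct [consumes 1, case_names zero single add]:
  fixes p :: "'k \<Rightarrow>\<^sub>0 complex"
  assumes "Poly_Mapping.keys p \<subseteq> X" and zero: "Q 0"
    and single: "\<And>k c. k \<in> X \<Longrightarrow> Q (Poly_Mapping.single k c)"
    and add: "\<And>p r. Poly_Mapping.keys p \<subseteq> X \<Longrightarrow> Poly_Mapping.keys r \<subseteq> X \<Longrightarrow> Q p \<Longrightarrow> Q r \<Longrightarrow> Q (p + r)"
  shows "Q p"
proof -
  have "Q (\<Sum>k\<in>A. Poly_Mapping.single k (c k)) \<and>
      Poly_Mapping.keys (\<Sum>k\<in>A. Poly_Mapping.single k (c k)) \<subseteq> X" if "finite A" "A \<subseteq> X" for A c
    using that
  proof (induction A rule: finite_induct)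
    case (insert k A)
    have "Poly_Mapping.keys (Poly_Mapping.single k (c k)) \<subseteq> X" using insert by auto
    moreover have "Q (\<Sum>k\<in>A. Poly_Mapping.single k (c k))"
      "Poly_Mapping.keys (\<Sum>k\<in>A. Poly_Mapping.single k (c k)) \<subseteq> X" using insert by auto
    moreover have "Poly_Mapping.keys (Poly_Mapping.single k (c k) + (\<Sum>k\<in>A. Poly_Mapping.single k (c k))) \<subseteq> X"
      using keys_add[of "Poly_Mapping.single k (c k)" "\<Sum>k\<in>A. Poly_Mapping.single k (c k)"] calculation
      by blast
    moreover have "Q (Poly_Mapping.single k (c k))" using insert.prems by (intro single) auto
    ultimately show ?case using insert.hyps by (auto intro!: add)
  qed (use zero in auto)
  from this[of "Poly_Mapping.keys p" "Poly_Mapping.lookup p"] show ?thesis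
    using assms(1) poly_mapping_sum_singles[of p] by simp
qed

lemma psum_linear:
  fixes h :: "'v::comm_monoid_add \<Rightarrow> 'w::comm_monoid_add" and G :: "'k \<Rightarrow> complex \<Rightarrow> 'v"
  assumes h0: "h 0 = 0" and h: "\<And>x y. h (x + y) = h x + h y"
  shows "h (psum G p) = psum (\<lambda>k c. h (G k c)) p"
proof -
  have "h (\<Sum>k\<in>A. g k) = (\<Sum>k\<in>A. h (g k))" for A :: "'k set" and g :: "'k \<Rightarrow> 'v"
    by (induction A rule: infinite_finite_induct) (auto simp: h0 h)
  then show ?thesis by (simp add: psum_def)
qed

text \<open>Sweedler sums: \<open>cs dl a g\<close> is the sum of \<open>g a\<^sub>1 a\<^sub>2\<close> over the terms of the coproduct of the word \<open>a\<close>, where \<open>dl\<close>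
  lists the terms of the coproduct of a letter.\<close>

primrec cs :: "('x \<Rightarrow> ('x list \<times> 'x list) list) \<Rightarrow> 'x list \<Rightarrow>
    ('x list \<Rightarrow> 'x list \<Rightarrow> 'v::comm_monoid_add) \<Rightarrow> 'v" where
  "cs dl [] = (\<lambda>g. g [] [])"
| "cs dl (x # a) = (\<lambda>g. \<Sum>d\<leftarrow>dl x. cs dl a (\<lambda>p r. g (fst d @ p) (snd d @ r)))"

lemma sum_list_cong: "(\<And>x. x \<in> set xs \<Longrightarrow> f x = g x) \<Longrightarrow> (\<Sum>x\<leftarrow>xs. f x) = (\<Sum>x\<leftarrow>xs. g x)"
  by (induction xs) auto

lemma cs_append: "cs dl (a @ a') g = cs dl a (\<lambda>x y. cs dl a' (\<lambda>x' y'. g (x @ x') (y @ y')))"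
  by (induction a arbitrary: g) simp_all

lemma cs_hom:
  fixes h :: "'v::comm_monoid_add \<Rightarrow> 'w::comm_monoid_add" and dl :: "'x \<Rightarrow> ('x list \<times> 'x list) list"
  assumes h0: "h 0 = 0" and h: "\<And>x y. h (x + y) = h x + h y"
  shows "h (cs dl a g) = cs dl a (\<lambda>x y. h (g x y))"
proof (induction a arbitrary: g)
  case (Cons x a)
  have "h (\<Sum>d\<leftarrow>ds. k d) = (\<Sum>d\<leftarrow>ds. h (k d))" for ds and k :: "'x list \<times> 'x list \<Rightarrow> 'v"
    by (induction ds) (auto simp: h0 h)
  then show ?case using Cons by simp
qed simp

lemma cs_zero: "cs dl a (\<lambda>x y. 0) = 0"
  by (induction a) simp_all

lemma cs_add: "cs dl a (\<lambda>x y. g x y + k x y) = cs dl a g + cs dl a k"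
  by (induction a arbitrary: g k) (simp_all add: sum_list_addf)

lemma cs_sum_list: "cs dl a (\<lambda>x y. \<Sum>i\<leftarrow>is. g i x y) = (\<Sum>i\<leftarrow>is. cs dl a (g i))"
  by (induction "is") (simp_all add: cs_zero cs_add)

lemma cs_swap:
  "cs dl a (\<lambda>x y. cs dl' b (\<lambda>z w. g x y z w)) = cs dl' b (\<lambda>z w. cs dl a (\<lambda>x y. g x y z w))"
  by (induction a arbitrary: g) (simp_all add: cs_sum_list)

definition cop_closed :: "'x set \<Rightarrow> ('x \<Rightarrow> ('x list \<times> 'x list) list) \<Rightarrow> bool" where
  "cop_closed X dl \<longleftrightarrow> (\<forall>x\<in>X. \<forall>d\<in>set (dl x). set (fst d) \<subseteq> X \<and> set (snd d) \<subseteq> X)"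

lemma cs_cong:
  assumes "cop_closed X dl" "set a \<subseteq> X"
    and "\<And>x y. set x \<subseteq> X \<Longrightarrow> set y \<subseteq> X \<Longrightarrow> g x y = k x y"
  shows "cs dl a g = cs dl a k"
  using assms(2,3)
proof (induction a arbitrary: g k)
  case (Cons x a)
  show ?case
    unfolding cs.simps
  proof (rule sum_list_cong)
    fix d assume d: "d \<in> set (dl x)"
    then have "set (fst d) \<subseteq> X" "set (snd d) \<subseteq> X" using assms(1) Cons.prems(1) by (auto simp: cop_closed_def)
    then show "cs dl a (\<lambda>p r. g (fst d @ p) (snd d @ r)) = cs dl a (\<lambda>p r. k (fst d @ p) (snd d @ r))"
      using Cons.prems by (intro Cons.IH) auto
  qed
qed simp

text \<open>Coproducts of words are products of coproducts of letters, so coassociativity passes from letters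
  to words by interchanging sums.\<close>

lemma cs_coassoc:
  fixes g :: "'x list \<Rightarrow> 'x list \<Rightarrow> 'x list \<Rightarrow> 'v::comm_monoid_add"
  assumes letters: "\<And>x (g :: 'x list \<Rightarrow> 'x list \<Rightarrow> 'x list \<Rightarrow> 'v).
    (\<Sum>d\<leftarrow>dl x. cs dl (fst d) (\<lambda>u v. g u v (snd d))) = (\<Sum>d\<leftarrow>dl x. cs dl (snd d) (\<lambda>u v. g (fst d) u v))"
  shows "cs dl a (\<lambda>p r. cs dl p (\<lambda>p1 p2. g p1 p2 r)) = cs dl a (\<lambda>p r. cs dl r (\<lambda>r1 r2. g p r1 r2))"
proof (induction a arbitrary: g)
  case (Cons x a)
  define G where "G u1 u2 v = cs dl a (\<lambda>p r. cs dl p (\<lambda>p1 p2. g (u1 @ p1) (u2 @ p2) (v @ r)))" for u1 u2 v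
  have G: "G u1 u2 v = cs dl a (\<lambda>p r. cs dl r (\<lambda>r1 r2. g (u1 @ p) (u2 @ r1) (v @ r2)))" for u1 u2 v
    unfolding G_def by (rule Cons)
  have "cs dl (x # a) (\<lambda>p r. cs dl p (\<lambda>p1 p2. g p1 p2 r)) =
      (\<Sum>d\<leftarrow>dl x. cs dl a (\<lambda>p r. cs dl (fst d) (\<lambda>u1 u2. cs dl p (\<lambda>p1 p2. g (u1 @ p1) (u2 @ p2) (snd d @ r)))))"
    by (simp add: cs_append)
  also have "\<dots> = (\<Sum>d\<leftarrow>dl x. cs dl (fst d) (\<lambda>u1 u2. G u1 u2 (snd d)))"
    unfolding G_def by (rule sum_list_cong) (rule cs_swap)
  also have "\<dots> = (\<Sum>d\<leftarrow>dl x. cs dl (snd d) (\<lambda>v1 v2. G (fst d) v1 v2))" by (rule letters)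
  also have "\<dots> = (\<Sum>d\<leftarrow>dl x. cs dl a (\<lambda>p r. cs dl (snd d) (\<lambda>v1 v2. cs dl r (\<lambda>r1 r2.
      g (fst d @ p) (v1 @ r1) (v2 @ r2)))))"
    unfolding G by (rule sum_list_cong) (rule cs_swap)
  also have "\<dots> = cs dl (x # a) (\<lambda>p r. cs dl r (\<lambda>r1 r2. g p r1 r2))"
    by (simp add: cs_append)
  finally show ?case .
qed simp

lemma cs_counit:
  fixes G :: "'x list \<Rightarrow> complex \<Rightarrow> 'v::comm_monoid_add"
  assumes letters: "\<And>x (G :: 'x list \<Rightarrow> complex \<Rightarrow> 'v) c. coeff_additive G \<Longrightarrow>
      (\<Sum>d\<leftarrow>dl x. G (snd d) (c * ep (fst d))) = G [x] c"
    and ep: "ep [] = 1" "\<And>u v. ep (u @ v) = ep u * ep v" and G: "coeff_additive G"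
  shows "cs dl a (\<lambda>x y. G y (c * ep x)) = G a c"
  using G
proof (induction a arbitrary: G c)
  case (Cons x a)
  have "cs dl (x # a) (\<lambda>x y. G y (c * ep x)) =
      (\<Sum>d\<leftarrow>dl x. cs dl a (\<lambda>p r. G (snd d @ r) ((c * ep (fst d)) * ep p)))"
    by (simp add: ep mult.assoc)
  also have "\<dots> = (\<Sum>d\<leftarrow>dl x. G (snd d @ a) (c * ep (fst d)))"
  proof (rule sum_list_cong)
    fix d :: "'x list \<times> 'x list"
    have "coeff_additive (\<lambda>r. G (snd d @ r))" using Cons.prems by (simp add: coeff_additive_def)
    from Cons.IH[OF this]
    show "cs dl a (\<lambda>p r. G (snd d @ r) ((c * ep (fst d)) * ep p)) = G (snd d @ a) (c * ep (fst d))" .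
  qed
  also have "\<dots> = G ([x] @ a) c"
    using Cons.prems by (intro letters[of "\<lambda>v. G (v @ a)"]) (simp add: coeff_additive_def)
  finally show ?case by simp
qed (simp add: ep)

lemma scal_single: "scal c * Poly_Mapping.single k d = Poly_Mapping.single k (c * d)"
  by (simp add: scal_def mult_single)

lemma scal_zero [simp]: "scal 0 = 0" by (simp add: scal_def)
lemma scal_one [simp]: "scal 1 = 1" by (simp add: scal_def)
lemma mon_mult: "mon u * mon v = mon (u + v)" by (simp add: mon_def mult_single)

lemma Word_plus: "Word u + Word v = Word (u @ v)" by (simp add: plus_word_def)
lemma Word_Nil: "Word [] = 0" by (simp add: zero_word_def)
lemma mon_Nil: "mon (Word []) = 1" by (simp add: mon_def Word_Nil)

lemma tens_psum: "tens p r = psum (\<lambda>u c. psum (\<lambda>v d. Poly_Mapping.single (u, v) (c * d)) r) p"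
  by (simp add: tens_def psum_def)

lemma coeff_additive_single: "coeff_additive (\<lambda>v d. Poly_Mapping.single (z v) (c * d))"
  by (simp add: coeff_additive_def single_add distrib_left)

lemma psum_additive_inner:
  assumes "\<And>v d. coeff_additive (H v d)"
  shows "coeff_additive (\<lambda>u c. psum (\<lambda>v d. H v d u c) r)"
  using assms by (simp add: coeff_additive_def psum_def sum.distrib)

lemma coeff_additive_tens: "coeff_additive (\<lambda>u c. psum (\<lambda>v d. Poly_Mapping.single (u, v) (c * d)) r)"
  by (rule psum_additive_inner) (simp add: coeff_additive_def single_add distrib_right)

lemma tens_add_left: "tens (p + p') r = tens p r + tens p' r"
  unfolding tens_psum by (rule psum_add[OF coeff_additive_tens])

lemma tens_add_right: "tens p (r + r') = tens p r + tens p r'"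
  unfolding tens_psum psum_add[OF coeff_additive_single] by (simp add: psum_def sum.distrib)

lemma tens_zero [simp]: "tens 0 r = 0" "tens p 0 = 0"
  by (simp_all add: tens_def)

lemma tens_single: "tens (Poly_Mapping.single u c) (Poly_Mapping.single v d) = Poly_Mapping.single (u, v) (c * d)"
proof -
  have "coeff_additive (\<lambda>u c. Poly_Mapping.single (u, v) (c * d))"
    by (simp add: coeff_additive_def single_add distrib_right)
  then show ?thesis unfolding tens_psum psum_single[OF coeff_additive_single] by (rule psum_single)
qed

lemma tens_mon: "tens (mon u) (mon v) = mon (u, v)"
  by (simp add: mon_def tens_single)

lemma one_mon: "1 = mon 0" by (simp add: mon_def)

lemma prod_list_cs:
  assumes "\<And>x. gx x = (\<Sum>d\<leftarrow>dl x. mon (Word (fst d), Word (snd d)))"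
  shows "prod_list (map gx a) = cs dl a (\<lambda>u v. mon (Word u, Word v))"
proof (induction a)
  case Nil
  then show ?case by (simp add: one_mon Word_Nil zero_prod_def)
next
  case (Cons x a)
  have "prod_list (map gx (x # a)) = (\<Sum>d\<leftarrow>dl x. mon (Word (fst d), Word (snd d)) * cs dl a (\<lambda>u v. mon (Word u, Word v)))"
    by (simp add: assms Cons sum_list_mult_const)
  also have "\<dots> = (\<Sum>d\<leftarrow>dl x. cs dl a (\<lambda>u v. mon (Word (fst d @ u), Word (snd d @ v))))"
  proof (rule sum_list_cong)
    fix d
    have "mon (Word (fst d), Word (snd d)) * cs dl a (\<lambda>u v. mon (Word u, Word v)) =
        cs dl a (\<lambda>u v. mon (Word (fst d), Word (snd d)) * mon (Word u, Word v))"
      by (rule cs_hom) (simp_all add: distrib_left)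
    then show "mon (Word (fst d), Word (snd d)) * cs dl a (\<lambda>u v. mon (Word u, Word v)) =
        cs dl a (\<lambda>u v. mon (Word (fst d @ u), Word (snd d @ v)))"
      by (simp add: mon_mult Word_plus)
  qed
  finally show ?case by simp
qed

text \<open>This replaces the coproduct of the free algebra, an algebra homomorphism into the tensor square,
  by sums over words.\<close>

lemma psum_hom_ext:
  fixes G :: "'x word \<times> 'x word \<Rightarrow> complex \<Rightarrow> 'v::comm_monoid_add"
  assumes gx: "\<And>x. gx x = (\<Sum>d\<leftarrow>dl x. mon (Word (fst d), Word (snd d)))" and G: "coeff_additive G"
  shows "psum G (hom_ext gx p) = psum (\<lambda>w c. cs dl (letters w) (\<lambda>u v. G (Word u, Word v) c)) p"
proof -
  have "hom_ext gx p = psum (\<lambda>w c. scal c * cs dl (letters w) (\<lambda>u v. mon (Word u, Word v))) p"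
    unfolding hom_ext_def psum_def prod_list_cs[OF gx] by simp
  also have "psum G \<dots> = psum (\<lambda>w c. psum G (scal c * cs dl (letters w) (\<lambda>u v. mon (Word u, Word v)))) p"
    by (rule psum_linear) (simp_all add: psum_add[OF G])
  also have "\<dots> = psum (\<lambda>w c. cs dl (letters w) (\<lambda>u v. G (Word u, Word v) c)) p"
  proof (rule psum_cong)
    fix w c
    have "psum G (scal c * cs dl (letters w) (\<lambda>u v. mon (Word u, Word v))) =
        cs dl (letters w) (\<lambda>u v. psum G (scal c * mon (Word u, Word v)))"
      by (rule cs_hom[of "\<lambda>z. psum G (scal c * z)"]) (simp_all add: psum_add[OF G] distrib_left)
    then show "psum G (scal c * cs dl (letters w) (\<lambda>u v. mon (Word u, Word v))) =
        cs dl (letters w) (\<lambda>u v. G (Word u, Word v) c)"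
      by (simp add: mon_def scal_single psum_single[OF G])
  qed
  finally show ?thesis .
qed

section \<open>Weights and powers of q\<close>

sublocale quantum_datum \<subseteq> cartan: cartan_pair scale brk \<hh>
  using semisimple cartan by unfold_locales

context quantum_datum begin

lemma simple_root: "i \<in> Ind \<Longrightarrow> \<alpha> i \<in> roots \<hh>"
  using simple_roots by (simp add: simple_roots_def Ind_def)

lemma P_add: "\<mu> \<in> P \<Longrightarrow> \<nu> \<in> P \<Longrightarrow> \<mu> + \<nu> \<in> P"
  and P_uminus: "\<mu> \<in> P \<Longrightarrow> - \<mu> \<in> P" and P_zero: "0 \<in> P"
  unfolding P_def by (fact cartan.weight_lattice_add cartan.weight_lattice_uminus cartan.weight_lattice_zero)+

lemma P_root: "i \<in> Ind \<Longrightarrow> \<alpha> i \<in> P"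
  using cartan.roots_subset_weight_lattice simple_root unfolding P_def by blast

lemma P_dual: "\<mu> \<in> P \<Longrightarrow> \<mu> \<in> dual \<hh>"
  by (simp add: P_def weight_lattice_def)

lemma P_plus_P: "\<mu> \<in> P_plus \<Longrightarrow> \<mu> \<in> P" by (simp add: P_plus_def)

lemma P_plusI: "\<mu> \<in> P \<Longrightarrow> \<mu> = (\<lambda>x. \<Sum>i\<in>Ind. of_rat (r i) * \<alpha> i x) \<Longrightarrow> \<mu> \<in> P_plus"
  unfolding P_plus_def by (intro CollectI conjI exI[of _ r])

lemma P_plus_add:
  assumes "\<mu> \<in> P_plus" "\<nu> \<in> P_plus" shows "\<mu> + \<nu> \<in> P_plus"
proof -
  obtain r s :: "nat \<Rightarrow> rat" where
    rs: "\<mu> = (\<lambda>x. \<Sum>i\<in>Ind. of_rat (r i) * \<alpha> i x)" "\<nu> = (\<lambda>x. \<Sum>i\<in>Ind. of_rat (s i) * \<alpha> i x)"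
    using assms by (auto simp: P_plus_def)
  then have "\<mu> + \<nu> = (\<lambda>x. \<Sum>i\<in>Ind. of_rat (r i + s i) * \<alpha> i x)"
    by (simp add: fun_eq_iff of_rat_add distrib_right sum.distrib)
  moreover have "\<mu> + \<nu> \<in> P" using P_add assms by (simp add: P_plus_def)
  ultimately show ?thesis by (intro P_plusI)
qed

lemma P_plus_uminus:
  assumes "\<mu> \<in> P_plus" shows "- \<mu> \<in> P_plus"
proof -
  obtain r :: "nat \<Rightarrow> rat" where r: "\<mu> = (\<lambda>x. \<Sum>i\<in>Ind. of_rat (r i) * \<alpha> i x)"
    using assms by (auto simp: P_plus_def)
  then have "- \<mu> = (\<lambda>x. \<Sum>i\<in>Ind. of_rat (- r i) * \<alpha> i x)"
    by (simp add: fun_eq_iff of_rat_minus sum_negf)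
  moreover have "- \<mu> \<in> P" using P_uminus assms by (simp add: P_plus_def)
  ultimately show ?thesis by (intro P_plusI)
qed

lemma P_plus_zero: "0 \<in> P_plus"
  using P_zero by (auto simp: P_plus_def fun_eq_iff intro!: exI[of _ "\<lambda>i. 0"])

lemma finite_Ind: "finite Ind" by (simp add: Ind_def)

lemma P_plus_root:
  assumes i: "i \<in> Ind" shows "\<alpha> i \<in> P_plus"
proof -
  have "\<alpha> i = (\<lambda>x. \<Sum>j\<in>Ind. of_rat (if i = j then 1 else 0) * \<alpha> j x)"
  proof
    fix x
    have "(\<Sum>j\<in>Ind. of_rat (if i = j then 1 else 0) * \<alpha> j x) = (\<Sum>j\<in>Ind. if i = j then \<alpha> j x else 0)"
      by (rule sum.cong) auto
    then show "\<alpha> i x = (\<Sum>j\<in>Ind. of_rat (if i = j then 1 else 0) * \<alpha> j x)"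
      using i finite_Ind by simp
  qed
  then show ?thesis by (rule P_plusI[OF P_root[OF i]])
qed

lemma form_sym: "form \<mu> \<nu> = form \<nu> \<mu>" by (simp add: form_def cartan.dual_form_sym)

lemma form_add_right:
  assumes "\<mu> \<in> P" "\<nu> \<in> P" "\<beta> \<in> P" shows "form \<beta> (\<mu> + \<nu>) = form \<beta> \<mu> + form \<beta> \<nu>"
  using cartan.dual_form_add[of \<mu> \<nu> \<beta>] assms P_dual
  by (simp add: form_def cartan.dual_form_sym[of \<beta>])

text \<open>The left argument is a rational combination of simple roots, and weights have rational products with
  roots.\<close>

lemma form_rational:
  assumes \<nu>: "\<nu> \<in> P_plus" and \<mu>: "\<mu> \<in> P" shows "form \<nu> \<mu> \<in> \<rat>"
proof -
  obtain r :: "nat \<Rightarrow> rat" where r: "\<nu> = (\<lambda>x. \<Sum>i\<in>Ind. of_rat (r i) * \<alpha> i x)"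
    using \<nu> by (auto simp: P_plus_def)
  have "form \<nu> \<mu> = \<nu> (dual_vec \<hh> \<mu>)"
    using P_dual[OF P_plus_P[OF \<nu>]] P_dual[OF \<mu>] by (simp add: form_def cartan.dual_form_eq)
  also have "\<dots> = (\<Sum>i\<in>Ind. of_rat (r i) * dual_form \<hh> (\<alpha> i) \<mu>)"
    unfolding r using P_dual[OF P_root] P_dual[OF \<mu>] by (simp add: cartan.dual_form_eq)
  also have "\<dots> \<in> \<rat>"
    using \<mu> simple_root by (intro Rats_sum Rats_mult cartan.weight_root_form_rational) (auto simp: P_def)
  finally show ?thesis .
qed

lemma qpow_of_rat: "qpow (of_rat r) = qp r"
  by (simp add: qpow_def)

lemma qp_zero: "qp 0 = 1" using qp_add[of 0 0] qp_nonzero[of 0] by simp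

lemma qpow_add: "a \<in> \<rat> \<Longrightarrow> b \<in> \<rat> \<Longrightarrow> qpow (a + b) = qpow a * qpow b"
  by (metis Rats_cases of_rat_add qp_add qpow_of_rat)

lemma qpow_zero: "qpow 0 = 1" using qpow_of_rat[of 0] by (simp add: qp_zero)

lemma qpow_uminus: "a \<in> \<rat> \<Longrightarrow> qpow (- a) * qpow a = 1"
  using qpow_add[of "- a" a] qpow_zero by simp

lemma qpow_nonzero: "a \<in> \<rat> \<Longrightarrow> qpow a \<noteq> 0"
  using qpow_uminus by fastforce

lemma qp_power: "qp (of_nat n * r) = qp r ^ n"
  by (induction n) (simp_all add: qp_zero qp_add distrib_right)

text \<open>For \<open>r = a / b\<close>, raising to the power \<open>b\<close> gives that \<open>q\<close> to the power \<open>a\<close> is one.\<close>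

lemma qp_eq_1: assumes "qp r = 1" shows "r = 0"
proof (rule ccontr)
  assume r0: "r \<noteq> 0"
  obtain a b where ab: "r = of_int a / of_int b" "b > 0" by (cases r) (auto simp: Fract_of_int_quotient)
  then have a0: "a \<noteq> 0" using r0 by auto
  have "of_nat (nat b) * r = of_int a" using ab by simp
  then have "qp (of_int a) = 1" using qp_power[of "nat b" r] assms by simp
  moreover have "qp (of_int (- a)) * qp (of_int a) = 1" by (simp add: qp_add[symmetric] qp_zero)
  ultimately have "qp (of_int \<bar>a\<bar>) = 1" by (cases "a \<ge> 0") auto
  moreover have "(of_int \<bar>a\<bar> :: rat) = of_nat (nat \<bar>a\<bar>) * 1" by simp
  ultimately have "qp 1 ^ nat \<bar>a\<bar> = 1" using qp_power[of "nat \<bar>a\<bar>" 1] by simp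
  then show False using not_root_of_unity[of "nat \<bar>a\<bar>"] a0 by simp
qed

text \<open>The square of \<open>q_i i\<close> is a power of \<open>q\<close> whose exponent is rational and nonzero.\<close>

lemma q_i_nonzero: assumes i: "i \<in> Ind" shows "inverse (q_i i) - q_i i \<noteq> 0"
proof
  assume *: "inverse (q_i i) - q_i i = 0"
  have rat: "form (\<alpha> i) (\<alpha> i) \<in> \<rat>" using form_rational P_plus_root P_root i by blast
  then have half: "form (\<alpha> i) (\<alpha> i) / 2 \<in> \<rat>" by (intro Rats_divide) auto
  have "q_i i \<noteq> 0" unfolding q_i_def by (rule qpow_nonzero[OF half])
  then have "q_i i * q_i i = 1" using * by (simp add: field_simps)
  then have "qpow (form (\<alpha> i) (\<alpha> i)) = 1"
    using qpow_add[OF half half] by (simp add: q_i_def)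
  moreover obtain r where r: "form (\<alpha> i) (\<alpha> i) = of_rat r" using rat by (rule Rats_cases)
  ultimately have "r = 0" using qp_eq_1 by (simp add: qpow_of_rat)
  then show False using r cartan.root_form_nonzero[OF simple_root[OF i]] by (simp add: form_def)
qed

end

section \<open>The Hopf pairing on words and its radicals\<close>

lemma keys_uminus: "Poly_Mapping.keys (- p) = Poly_Mapping.keys (p :: 'k \<Rightarrow>\<^sub>0 complex)"
  by (auto simp: in_keys_iff)

lemma words_over_add: "u \<in> words_over X \<Longrightarrow> v \<in> words_over X \<Longrightarrow> u + v \<in> words_over X"
  by (auto simp: words_over_def plus_word_def)

lemma words_over_zero: "0 \<in> words_over X" by (simp add: words_over_def zero_word_def)

lemma free_carrier: "p \<in> carrier (free_algebra X) \<longleftrightarrow> Poly_Mapping.keys p \<subseteq> words_over X"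
  by (simp add: free_algebra_def)

lemma free_closed:
  assumes p: "p \<in> carrier (free_algebra X)" and r: "r \<in> carrier (free_algebra X)"
  shows "p + r \<in> carrier (free_algebra X)" "p * r \<in> carrier (free_algebra X)"
    "- p \<in> carrier (free_algebra X)" "p - r \<in> carrier (free_algebra X)"
proof -
  show "p + r \<in> carrier (free_algebra X)" using assms keys_add[of p r] by (auto simp: free_carrier)
  show "- p \<in> carrier (free_algebra X)" using p by (simp add: free_carrier keys_uminus)
  show "p - r \<in> carrier (free_algebra X)"
    using assms keys_add[of p "- r"] by (auto simp: free_carrier keys_uminus)
  show "p * r \<in> carrier (free_algebra X)"
    using assms keys_mult[of p r] words_over_add by (fastforce simp: free_carrier)
qed

lemma free_single: "set a \<subseteq> X \<Longrightarrow> Poly_Mapping.single (Word a) c \<in> carrier (free_algebra X)"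
  by (auto simp: free_carrier words_over_def)

lemma free_mon: "set a \<subseteq> X \<Longrightarrow> mon (Word a) \<in> carrier (free_algebra X)"
  by (simp add: mon_def free_single)

lemma free_one: "1 \<in> carrier (free_algebra X)" and free_zero: "0 \<in> carrier (free_algebra X)"
  by (simp_all add: free_carrier words_over_zero)

lemma free_scal: "scal c \<in> carrier (free_algebra X)"
  using free_single[of "[]" X c] by (simp add: scal_def Word_Nil)

lemma free_algebra_ring: "ring (free_algebra X)"
proof (rule ringI)
  show "abelian_group (free_algebra X)"
  proof (rule abelian_groupI)
    fix x assume "x \<in> carrier (free_algebra X)"
    then show "\<exists>y\<in>carrier (free_algebra X). y \<oplus>\<^bsub>free_algebra X\<^esub> x = \<zero>\<^bsub>free_algebra X\<^esub>"
      using free_closed(3)[of x X x] by (intro bexI[of _ "- x"]) (auto simp: free_algebra_def)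
  qed (use free_closed(1) free_zero in \<open>simp_all add: free_algebra_def add.assoc add.commute\<close>)
  show "Group.monoid (free_algebra X)"
    by (rule Group.monoidI) (use free_closed(2) free_one in \<open>simp_all add: free_algebra_def mult.assoc\<close>)
qed (auto simp: free_algebra_def distrib_left distrib_right)

lemma quotient_class_eq:
  assumes I: "ideal I R" and x: "x \<in> carrier R" "y \<in> carrier R" and d: "x \<ominus>\<^bsub>R\<^esub> y \<in> I"
  shows "I +>\<^bsub>R\<^esub> x = I +>\<^bsub>R\<^esub> y"
proof -
  interpret ideal I R by fact
  have "x = (x \<ominus>\<^bsub>R\<^esub> y) \<oplus>\<^bsub>R\<^esub> y" using x by (simp add: a_minus_def a_assoc l_neg)
  then have "x \<in> I +>\<^bsub>R\<^esub> y" using d by (auto simp: a_r_coset_def')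
  from a_repr_independence[OF this x(2)] a_subgroup show ?thesis by (simp add: additive_subgroup.a_subgroup is_additive_subgroup)
qed

lemma coset_eq_self_iff:
  assumes "ring R" "additive_subgroup H R" "x \<in> carrier R"
  shows "H +>\<^bsub>R\<^esub> x = H \<longleftrightarrow> x \<in> H"
proof -
  interpret ring R by fact
  interpret additive_subgroup H R by fact
  show ?thesis
  proof
    assume "H +>\<^bsub>R\<^esub> x = H"
    moreover have "\<zero>\<^bsub>R\<^esub> \<oplus>\<^bsub>R\<^esub> x \<in> H +>\<^bsub>R\<^esub> x" using zero_closed by (auto simp: a_r_coset_def')
    ultimately show "x \<in> H" using assms(3) by simp
  next
    assume "x \<in> H"
    then show "H +>\<^bsub>R\<^esub> x = H" using a_coset_join2[OF assms(3) a_subgroup] by simp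
  qed
qed

lemma keys_mon [simp]: "Poly_Mapping.keys (mon w) = {w}" "Poly_Mapping.lookup (mon w) w = 1"
  by (simp_all add: mon_def)

lemma psum_mon_left:
  assumes G: "coeff_additive G"
  shows "psum G (mon w * p) = psum (\<lambda>u c. G (w + u) c) p"
proof -
  have G': "coeff_additive (\<lambda>u c. G (w + u) c)" using G by (simp add: coeff_additive_def)
  have "Poly_Mapping.keys p \<subseteq> UNIV" by simp
  then show ?thesis
  proof (induction p rule: poly_mapping_span_induct)
    case (single k c)
    show ?case by (simp add: mon_def mult_single psum_single[OF G] psum_single[OF G'])
  next
    case (add p r)
    then show ?case by (simp add: distrib_left psum_add[OF G] psum_add[OF G'])
  qed simp
qed

lemma psum_mon_right:
  assumes G: "coeff_additive G"
  shows "psum G (p * mon w) = psum (\<lambda>u c. G (u + w) c) p"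
proof -
  have G': "coeff_additive (\<lambda>u c. G (u + w) c)" using G by (simp add: coeff_additive_def)
  have "Poly_Mapping.keys p \<subseteq> UNIV" by simp
  then show ?thesis
  proof (induction p rule: poly_mapping_span_induct)
    case (single k c)
    show ?case by (simp add: mon_def mult_single psum_single[OF G] psum_single[OF G'])
  next
    case (add p r)
    then show ?case by (simp add: distrib_right psum_add[OF G] psum_add[OF G'])
  qed simp
qed

lemma cs_sum: "cs dl a (\<lambda>x y. \<Sum>k\<in>A. g k x y) = (\<Sum>k\<in>A. cs dl a (g k))"
  by (induction A rule: infinite_finite_induct) (simp_all add: cs_zero cs_add)

lemma psum_cs: "psum (\<lambda>k c. cs dl b (g k c)) p = cs dl b (\<lambda>x y. psum (\<lambda>k c. g k c x y) p)"
  by (simp add: psum_def cs_sum)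

lemma coeff_additive_cs:
  assumes "\<And>x y. coeff_additive (\<lambda>k c. g k c x y)"
  shows "coeff_additive (\<lambda>k c. cs dl (a k) (g k c))"
proof (rule coeff_additiveI)
  fix k c d
  have "g k 0 = (\<lambda>x y. 0)" "g k (c + d) = (\<lambda>x y. g k c x y + g k d x y)"
    using assms by (auto simp: coeff_additive_def fun_eq_iff)
  then show "cs dl (a k) (g k 0) = 0" "cs dl (a k) (g k (c + d)) = cs dl (a k) (g k c) + cs dl (a k) (g k d)"
    by (simp_all add: cs_zero cs_add)
qed

lemma cs_property:
  assumes "cop_closed X dl" "set a \<subseteq> X" and Q0: "Q 0" and Qadd: "\<And>x y. Q x \<Longrightarrow> Q y \<Longrightarrow> Q (x + y)"
    and "\<And>x y. set x \<subseteq> X \<Longrightarrow> set y \<subseteq> X \<Longrightarrow> Q (g x y)"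
  shows "Q (cs dl a g)"
  using assms(2,5)
proof (induction a arbitrary: g)
  case (Cons x a)
  have "Q (\<Sum>d\<leftarrow>ds. k d)" if "\<And>d. d \<in> set ds \<Longrightarrow> Q (k d)" for ds and k :: "'a list \<times> 'a list \<Rightarrow> 'b"
    using that by (induction ds) (auto simp: Q0 intro: Qadd)
  moreover have "Q (cs dl a (\<lambda>p r. g (fst d @ p) (snd d @ r)))" if d: "d \<in> set (dl x)" for d
  proof -
    have "set (fst d) \<subseteq> X" "set (snd d) \<subseteq> X" using assms(1) Cons.prems(1) d by (auto simp: cop_closed_def)
    then show ?thesis using Cons.prems by (intro Cons.IH) auto
  qed
  ultimately show ?case by simp
qed simp

lemma psum_property:
  assumes Q0: "Q 0" and Qadd: "\<And>x y. Q x \<Longrightarrow> Q y \<Longrightarrow> Q (x + y)"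
    and "\<And>k c. k \<in> Poly_Mapping.keys p \<Longrightarrow> Q (G k c)"
  shows "Q (psum G p)"
proof -
  have "Q (\<Sum>k\<in>A. G k (Poly_Mapping.lookup p k))" if "finite A" "A \<subseteq> Poly_Mapping.keys p" for A
    using that by (induction A rule: finite_induct) (auto simp: Q0 assms(3) intro: Qadd)
  then show ?thesis unfolding psum_def by simp
qed

context quantum_datum begin

definition dlP :: "('g \<Rightarrow> complex) lplus \<Rightarrow> (('g \<Rightarrow> complex) lplus list \<times> ('g \<Rightarrow> complex) lplus list) list" where
  "dlP x = (case x of Le i \<Rightarrow> [([Le i], [Lt (- \<alpha> i)]), ([], [Le i])] | Lt \<mu> \<Rightarrow> [([Lt \<mu>], [Lt \<mu>])])"

definition dlM :: "('g \<Rightarrow> complex) lminus \<Rightarrow> (('g \<Rightarrow> complex) lminus list \<times> ('g \<Rightarrow> complex) lminus list) list" where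
  "dlM x = (case x of Lf i \<Rightarrow> [([Lf i], []), ([Lt' (\<alpha> i)], [Lf i])] | Lt' \<mu> \<Rightarrow> [([Lt' \<mu>], [Lt' \<mu>])])"

lemma dlP_simps: "dlP (Le i) = [([Le i], [Lt (- \<alpha> i)]), ([], [Le i])]" "dlP (Lt \<mu>) = [([Lt \<mu>], [Lt \<mu>])]"
  and dlM_simps: "dlM (Lf i) = [([Lf i], []), ([Lt' (\<alpha> i)], [Lf i])]" "dlM (Lt' \<mu>) = [([Lt' \<mu>], [Lt' \<mu>])]"
  by (simp_all add: dlP_def dlM_def)

abbreviation csP where "csP \<equiv> cs dlP"
abbreviation csM where "csM \<equiv> cs dlM"

abbreviation LX :: "('g \<Rightarrow> complex) lplus set" where "LX \<equiv> Le ` Ind \<union> Lt ` P_plus"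
abbreviation LY :: "('g \<Rightarrow> complex) lminus set" where "LY \<equiv> Lf ` Ind \<union> Lt' ` P_plus"

lemma csP_closed: "cop_closed LX dlP" and csM_closed: "cop_closed LY dlM"
  by (auto simp: cop_closed_def dlP_def dlM_def P_plus_root P_plus_uminus)

lemma csP_coassoc: "csP a (\<lambda>p r. csP p (\<lambda>p1 p2. g p1 p2 r)) = csP a (\<lambda>p r. csP r (\<lambda>r1 r2. g p r1 r2))"
proof (rule cs_coassoc)
  fix x and g :: "('g \<Rightarrow> complex) lplus list \<Rightarrow> ('g \<Rightarrow> complex) lplus list \<Rightarrow> ('g \<Rightarrow> complex) lplus list \<Rightarrow> 'a"
  show "(\<Sum>d\<leftarrow>dlP x. csP (fst d) (\<lambda>u v. g u v (snd d))) = (\<Sum>d\<leftarrow>dlP x. csP (snd d) (\<lambda>u v. g (fst d) u v))"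
    by (cases x) (simp_all add: dlP_simps add.assoc)
qed

lemma csM_coassoc: "csM a (\<lambda>p r. csM p (\<lambda>p1 p2. g p1 p2 r)) = csM a (\<lambda>p r. csM r (\<lambda>r1 r2. g p r1 r2))"
proof (rule cs_coassoc)
  fix x and g :: "('g \<Rightarrow> complex) lminus list \<Rightarrow> ('g \<Rightarrow> complex) lminus list \<Rightarrow> ('g \<Rightarrow> complex) lminus list \<Rightarrow> 'a"
  show "(\<Sum>d\<leftarrow>dlM x. csM (fst d) (\<lambda>u v. g u v (snd d))) = (\<Sum>d\<leftarrow>dlM x. csM (snd d) (\<lambda>u v. g (fst d) u v))"
    by (cases x) (simp_all add: dlM_simps add.assoc)
qed

definition epsP :: "('g \<Rightarrow> complex) lplus list \<Rightarrow> complex" where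
  "epsP a = prod_list (map (\<lambda>x. case x of Le i \<Rightarrow> 0 | Lt \<mu> \<Rightarrow> 1) a)"

definition epsM :: "('g \<Rightarrow> complex) lminus list \<Rightarrow> complex" where
  "epsM a = prod_list (map (\<lambda>x. case x of Lf i \<Rightarrow> 0 | Lt' \<mu> \<Rightarrow> 1) a)"

lemma csP_counit: "coeff_additive G \<Longrightarrow> csP a (\<lambda>x y. G y (c * epsP x)) = G a c"
proof (rule cs_counit)
  fix x and G :: "('g \<Rightarrow> complex) lplus list \<Rightarrow> complex \<Rightarrow> 'a" and c
  assume "coeff_additive G"
  then show "(\<Sum>d\<leftarrow>dlP x. G (snd d) (c * epsP (fst d))) = G [x] c"
    by (cases x) (simp_all add: dlP_simps epsP_def coeff_additive_def)
qed (simp_all add: epsP_def)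

lemma csM_counit: "coeff_additive G \<Longrightarrow> csM a (\<lambda>x y. G y (c * epsM x)) = G a c"
proof (rule cs_counit)
  fix x and G :: "('g \<Rightarrow> complex) lminus list \<Rightarrow> complex \<Rightarrow> 'a" and c
  assume "coeff_additive G"
  then show "(\<Sum>d\<leftarrow>dlM x. G (snd d) (c * epsM (fst d))) = G [x] c"
    by (cases x) (simp_all add: dlM_simps epsM_def coeff_additive_def)
qed (simp_all add: epsM_def)

lemma psum_Delta_plus:
  fixes G :: "_ \<Rightarrow> complex \<Rightarrow> 'v::comm_monoid_add"
  assumes "coeff_additive G"
  shows "psum G (\<Delta>_plus p) = psum (\<lambda>w c. csP (letters w) (\<lambda>u v. G (Word u, Word v) c)) p"
  unfolding \<Delta>_plus_def
proof (rule psum_hom_ext[OF _ assms])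
  fix x
  show "(case x of Le i \<Rightarrow> tens (e i) (t (- \<alpha> i)) + tens 1 (e i) | Lt \<mu> \<Rightarrow> tens (t \<mu>) (t \<mu>)) =
      (\<Sum>d\<leftarrow>dlP x. mon (Word (fst d), Word (snd d)))"
    by (cases x) (simp_all add: dlP_simps gen_def tens_mon one_mon Word_Nil)
qed

lemma psum_Delta_minus:
  fixes G :: "_ \<Rightarrow> complex \<Rightarrow> 'v::comm_monoid_add"
  assumes "coeff_additive G"
  shows "psum G (\<Delta>_minus p) = psum (\<lambda>w c. csM (letters w) (\<lambda>u v. G (Word u, Word v) c)) p"
  unfolding \<Delta>_minus_def
proof (rule psum_hom_ext[OF _ assms])
  fix x
  show "(case x of Lf i \<Rightarrow> tens (f i) 1 + tens (t' (\<alpha> i)) (f i) | Lt' \<mu> \<Rightarrow> tens (t' \<mu>) (t' \<mu>)) =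
      (\<Sum>d\<leftarrow>dlM x. mon (Word (fst d), Word (snd d)))"
    by (cases x) (simp_all add: dlM_simps gen_def tens_mon one_mon Word_Nil)
qed

lemma Fplus_ring: "ring Fplus" and Fminus_ring: "ring Fminus"
  by (simp_all add: Fplus_def Fminus_def free_algebra_ring)

lemma Fplus_ops: "mult Fplus = (*)" "one Fplus = 1" "zero Fplus = 0" "add Fplus = (+)"
  and Fminus_ops: "mult Fminus = (*)" "one Fminus = 1" "zero Fminus = 0" "add Fminus = (+)"
  by (simp_all add: Fplus_def Fminus_def free_algebra_def)

lemmas Fplus_closed = free_closed[of _ LX, folded Fplus_def] free_mon[of _ LX, folded Fplus_def]
  free_one[of LX, folded Fplus_def] free_zero[of LX, folded Fplus_def] free_scal[of _ LX, folded Fplus_def]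
  free_single[of _ LX, folded Fplus_def]
lemmas Fminus_closed = free_closed[of _ LY, folded Fminus_def] free_mon[of _ LY, folded Fminus_def]
  free_one[of LY, folded Fminus_def] free_zero[of LY, folded Fminus_def] free_scal[of _ LY, folded Fminus_def]
  free_single[of _ LY, folded Fminus_def]

lemma Fplus_carrier: "p \<in> carrier Fplus \<longleftrightarrow> Poly_Mapping.keys p \<subseteq> words_over LX"
  and Fminus_carrier: "r \<in> carrier Fminus \<longleftrightarrow> Poly_Mapping.keys r \<subseteq> words_over LY"
  by (simp_all add: Fplus_def Fminus_def free_carrier)

lemma gens_closed:
  "\<mu> \<in> P_plus \<Longrightarrow> t \<mu> \<in> carrier Fplus" "i \<in> Ind \<Longrightarrow> e i \<in> carrier Fplus"
  "\<mu> \<in> P_plus \<Longrightarrow> t' \<mu> \<in> carrier Fminus" "i \<in> Ind \<Longrightarrow> f i \<in> carrier Fminus"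
  unfolding gen_def by (intro Fplus_closed Fminus_closed; simp)+

lemma rel_plus_closed: "rel_plus \<subseteq> carrier Fplus"
  unfolding rel_plus_def
  by (auto intro!: Fplus_closed gens_closed P_plus_add P_plus_zero P_plus_uminus)

lemma rel_minus_closed: "rel_minus \<subseteq> carrier Fminus"
  unfolding rel_minus_def
  by (auto intro!: Fminus_closed gens_closed P_plus_add P_plus_zero P_plus_uminus)

lemma ideal_plus: "ideal (genideal Fplus rel_plus) Fplus"
  by (rule ring.genideal_ideal[OF Fplus_ring rel_plus_closed])

lemma ideal_minus: "ideal (genideal Fminus rel_minus) Fminus"
  by (rule ring.genideal_ideal[OF Fminus_ring rel_minus_closed])

lemma Fplus_minus: "x \<in> carrier Fplus \<Longrightarrow> y \<in> carrier Fplus \<Longrightarrow> x \<ominus>\<^bsub>Fplus\<^esub> y = x - y"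
proof -
  interpret ring Fplus by (rule Fplus_ring)
  assume "x \<in> carrier Fplus" "y \<in> carrier Fplus"
  moreover from this have "\<ominus>\<^bsub>Fplus\<^esub> y = - y"
    by (intro minus_equality) (auto simp: Fplus_ops Fplus_closed)
  ultimately show ?thesis by (simp add: a_minus_def Fplus_ops)
qed

lemma Fminus_minus: "x \<in> carrier Fminus \<Longrightarrow> y \<in> carrier Fminus \<Longrightarrow> x \<ominus>\<^bsub>Fminus\<^esub> y = x - y"
proof -
  interpret ring Fminus by (rule Fminus_ring)
  assume "x \<in> carrier Fminus" "y \<in> carrier Fminus"
  moreover from this have "\<ominus>\<^bsub>Fminus\<^esub> y = - y"
    by (intro minus_equality) (auto simp: Fminus_ops Fminus_closed)
  ultimately show ?thesis by (simp add: a_minus_def Fminus_ops)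
qed

lemma cl_plus_eq:
  assumes "x \<in> carrier Fplus" "y \<in> carrier Fplus" "x - y \<in> rel_plus" shows "cl_plus x = cl_plus y"
  unfolding cl_plus_def using assms ring.genideal_self[OF Fplus_ring rel_plus_closed]
  by (intro quotient_class_eq[OF ideal_plus]) (auto simp: Fplus_minus)

lemma cl_minus_eq:
  assumes "x \<in> carrier Fminus" "y \<in> carrier Fminus" "x - y \<in> rel_minus" shows "cl_minus x = cl_minus y"
  unfolding cl_minus_def using assms ring.genideal_self[OF Fminus_ring rel_minus_closed]
  by (intro quotient_class_eq[OF ideal_minus]) (auto simp: Fminus_minus)

lemma Ut_plus_ring: "ring Ut_plus" and Ut_minus_ring: "ring Ut_minus"
  unfolding Ut_plus_def Ut_minus_def
  by (rule ideal.quotient_is_ring[OF ideal_plus], rule ideal.quotient_is_ring[OF ideal_minus])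

lemma cl_plus_hom: "cl_plus \<in> ring_hom Fplus Ut_plus" and cl_minus_hom: "cl_minus \<in> ring_hom Fminus Ut_minus"
  using ideal.rcos_ring_hom[OF ideal_plus] ideal.rcos_ring_hom[OF ideal_minus]
  unfolding Ut_plus_def Ut_minus_def cl_plus_def[abs_def] cl_minus_def[abs_def] by simp_all

lemma Ut_plus_carrier: "carrier Ut_plus = cl_plus ` carrier Fplus"
  and Ut_minus_carrier: "carrier Ut_minus = cl_minus ` carrier Fminus"
  unfolding Ut_plus_def Ut_minus_def FactRing_def A_RCOSETS_def RCOSETS_def cl_plus_def cl_minus_def a_r_coset_def
  by auto

end

context qboson begin

text \<open>The pairing on words. It determines \<open>\<phi>\<close>, and the axioms of a Hopf pairing turn into the recursions
  \<open>ph_append_left\<close> and \<open>ph_append_right\<close>.\<close>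

definition ph :: "('g \<Rightarrow> complex) lplus list \<Rightarrow> ('g \<Rightarrow> complex) lminus list \<Rightarrow> complex" where
  "ph a b = \<phi> (cl_plus (mon (Word a))) (cl_minus (mon (Word b)))"

abbreviation WX :: "('g \<Rightarrow> complex) lplus list set" where "WX \<equiv> {a. set a \<subseteq> LX}"
abbreviation WY :: "('g \<Rightarrow> complex) lminus list set" where "WY \<equiv> {b. set b \<subseteq> LY}"

lemmas pairing_left = pairing[unfolded hopf_pairing_def, THEN conjunct1]
lemmas pairing_right = pairing[unfolded hopf_pairing_def, THEN conjunct2, THEN conjunct1]
lemmas pairing_mult_right = pairing[unfolded hopf_pairing_def, THEN conjunct2, THEN conjunct2, THEN conjunct1]
lemmas pairing_mult_left = pairing[unfolded hopf_pairing_def, THEN conjunct2, THEN conjunct2, THEN conjunct2, THEN conjunct1]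
lemmas pairing_one_right = pairing[unfolded hopf_pairing_def, THEN conjunct2, THEN conjunct2, THEN conjunct2, THEN conjunct2, THEN conjunct1]
lemmas pairing_one_left = pairing[unfolded hopf_pairing_def, THEN conjunct2, THEN conjunct2, THEN conjunct2, THEN conjunct2, THEN conjunct2, THEN conjunct1]
lemmas pairing_e_f = pairing[unfolded hopf_pairing_def, THEN conjunct2, THEN conjunct2, THEN conjunct2, THEN conjunct2, THEN conjunct2, THEN conjunct2, THEN conjunct1]
lemmas pairing_t_t = pairing[unfolded hopf_pairing_def, THEN conjunct2, THEN conjunct2, THEN conjunct2, THEN conjunct2, THEN conjunct2, THEN conjunct2, THEN conjunct2, THEN conjunct1]
lemmas pairing_mixed = pairing[unfolded hopf_pairing_def, THEN conjunct2, THEN conjunct2, THEN conjunct2, THEN conjunct2, THEN conjunct2, THEN conjunct2, THEN conjunct2, THEN conjunct2]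

lemma phi_add_left: "a \<in> carrier Fplus \<Longrightarrow> a' \<in> carrier Fplus \<Longrightarrow> b \<in> carrier Fminus \<Longrightarrow>
    \<phi> (cl_plus (a + a')) (cl_minus b) = \<phi> (cl_plus a) (cl_minus b) + \<phi> (cl_plus a') (cl_minus b)"
  using pairing_left by blast

lemma phi_scal_left: "a \<in> carrier Fplus \<Longrightarrow> b \<in> carrier Fminus \<Longrightarrow>
    \<phi> (cl_plus (scal c * a)) (cl_minus b) = c * \<phi> (cl_plus a) (cl_minus b)"
  using pairing_left by blast

lemma phi_add_right: "a \<in> carrier Fplus \<Longrightarrow> b \<in> carrier Fminus \<Longrightarrow> b' \<in> carrier Fminus \<Longrightarrow>
    \<phi> (cl_plus a) (cl_minus (b + b')) = \<phi> (cl_plus a) (cl_minus b) + \<phi> (cl_plus a) (cl_minus b')"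
  using pairing_right by blast

lemma phi_scal_right: "a \<in> carrier Fplus \<Longrightarrow> b \<in> carrier Fminus \<Longrightarrow>
    \<phi> (cl_plus a) (cl_minus (scal c * b)) = c * \<phi> (cl_plus a) (cl_minus b)"
  using pairing_right by blast

lemma phi_mult_right:
  assumes "a \<in> carrier Fplus" "b \<in> carrier Fminus" "b' \<in> carrier Fminus"
  shows "\<phi> (cl_plus a) (cl_minus (b * b')) = psum (\<lambda>k c. c *
      \<phi> (cl_plus (mon (fst k))) (cl_minus b) * \<phi> (cl_plus (mon (snd k))) (cl_minus b')) (\<Delta>_plus a)"
proof -
  have "\<phi> (cl_plus a) (cl_minus (b * b')) =
        (\<Sum>(a1, a2)\<in>Poly_Mapping.keys (\<Delta>_plus a). Poly_Mapping.lookup (\<Delta>_plus a) (a1, a2) *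
           \<phi> (cl_plus (mon a1)) (cl_minus b) * \<phi> (cl_plus (mon a2)) (cl_minus b'))"
    using pairing_mult_right assms by blast
  then show ?thesis by (simp add: psum_def split_def)
qed

lemma phi_mult_left:
  assumes "a \<in> carrier Fplus" "a' \<in> carrier Fplus" "b \<in> carrier Fminus"
  shows "\<phi> (cl_plus (a * a')) (cl_minus b) = psum (\<lambda>k c. c *
      \<phi> (cl_plus a) (cl_minus (mon (snd k))) * \<phi> (cl_plus a') (cl_minus (mon (fst k)))) (\<Delta>_minus b)"
proof -
  have "\<phi> (cl_plus (a * a')) (cl_minus b) =
        (\<Sum>(b1, b2)\<in>Poly_Mapping.keys (\<Delta>_minus b). Poly_Mapping.lookup (\<Delta>_minus b) (b1, b2) *
           \<phi> (cl_plus a) (cl_minus (mon b2)) * \<phi> (cl_plus a') (cl_minus (mon b1)))"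
    using pairing_mult_left assms by blast
  then show ?thesis by (simp add: psum_def split_def)
qed

lemma ph_append_right:
  assumes "a \<in> WX" "b \<in> WY" "b' \<in> WY"
  shows "ph a (b @ b') = csP a (\<lambda>x y. ph x b * ph y b')"
proof -
  have "ph a (b @ b') = \<phi> (cl_plus (mon (Word a))) (cl_minus (mon (Word b) * mon (Word b')))"
    by (simp add: ph_def mon_mult Word_plus)
  also have "\<dots> = psum (\<lambda>k c. c * \<phi> (cl_plus (mon (fst k))) (cl_minus (mon (Word b))) *
      \<phi> (cl_plus (mon (snd k))) (cl_minus (mon (Word b')))) (\<Delta>_plus (mon (Word a)))"
    using assms by (intro phi_mult_right Fplus_closed Fminus_closed) auto
  also have "\<dots> = psum (\<lambda>w c. csP (letters w) (\<lambda>x y. c * ph x b * ph y b')) (mon (Word a))"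
    by (subst psum_Delta_plus) (auto simp: ph_def coeff_additive_def algebra_simps)
  also have "\<dots> = csP a (\<lambda>x y. 1 * ph x b * ph y b')"
    unfolding mon_def
    by (subst psum_single[OF coeff_additive_cs]) (simp_all add: coeff_additive_def algebra_simps)
  finally show ?thesis by simp
qed

lemma ph_append_left:
  assumes "a \<in> WX" "a' \<in> WX" "b \<in> WY"
  shows "ph (a @ a') b = csM b (\<lambda>x y. ph a y * ph a' x)"
proof -
  have "ph (a @ a') b = \<phi> (cl_plus (mon (Word a) * mon (Word a'))) (cl_minus (mon (Word b)))"
    by (simp add: ph_def mon_mult Word_plus)
  also have "\<dots> = psum (\<lambda>k c. c * \<phi> (cl_plus (mon (Word a))) (cl_minus (mon (snd k))) *
      \<phi> (cl_plus (mon (Word a'))) (cl_minus (mon (fst k)))) (\<Delta>_minus (mon (Word b)))"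
    using assms by (intro phi_mult_left Fplus_closed Fminus_closed) auto
  also have "\<dots> = psum (\<lambda>w c. csM (letters w) (\<lambda>x y. c * ph a y * ph a' x)) (mon (Word b))"
    by (subst psum_Delta_minus) (auto simp: ph_def coeff_additive_def algebra_simps)
  also have "\<dots> = csM b (\<lambda>x y. 1 * ph a y * ph a' x)"
    unfolding mon_def
    by (subst psum_single[OF coeff_additive_cs]) (simp_all add: coeff_additive_def algebra_simps)
  finally show ?thesis by simp
qed

lemma ph_Nil_right: "a \<in> WX \<Longrightarrow> ph a [] = epsP a"
proof -
  assume a: "a \<in> WX"
  then have "\<phi> (cl_plus (mon (Word a))) (cl_minus 1) = \<epsilon>_plus (mon (Word a))"
    using pairing_one_right Fplus_closed(5)[of a] by blast
  then show ?thesis by (simp add: ph_def mon_Nil \<epsilon>_plus_def char_ext_def epsP_def)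
qed

lemma ph_Nil_left: "b \<in> WY \<Longrightarrow> ph [] b = epsM b"
proof -
  assume b: "b \<in> WY"
  then have "\<phi> (cl_plus 1) (cl_minus (mon (Word b))) = \<epsilon>_minus (mon (Word b))"
    using pairing_one_left Fminus_closed(5)[of b] by blast
  then show ?thesis by (simp add: ph_def mon_Nil \<epsilon>_minus_def char_ext_def epsM_def)
qed

lemma ph_gens:
  "i \<in> Ind \<Longrightarrow> j \<in> Ind \<Longrightarrow> ph [Le i] [Lf j] = (if i = j then 1 / (inverse (q_i i) - q_i i) else 0)"
  "\<mu> \<in> P_plus \<Longrightarrow> \<nu> \<in> P_plus \<Longrightarrow> ph [Lt \<mu>] [Lt' \<nu>] = qpow (- form \<mu> \<nu>)"
  "i \<in> Ind \<Longrightarrow> \<mu> \<in> P_plus \<Longrightarrow> ph [Le i] [Lt' \<mu>] = 0"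
  "i \<in> Ind \<Longrightarrow> \<mu> \<in> P_plus \<Longrightarrow> ph [Lt \<mu>] [Lf i] = 0"
  unfolding ph_def gen_def[symmetric] using pairing_e_f pairing_t_t pairing_mixed by blast+

definition lpair :: "('g \<Rightarrow> complex) fplus \<Rightarrow> ('g \<Rightarrow> complex) lminus list \<Rightarrow> complex" where
  "lpair p b = psum (\<lambda>u c. c * ph (letters u) b) p"

definition rpair :: "('g \<Rightarrow> complex) lplus list \<Rightarrow> ('g \<Rightarrow> complex) fminus \<Rightarrow> complex" where
  "rpair a r = psum (\<lambda>v d. d * ph a (letters v)) r"

lemma coeff_additive_times: "coeff_additive (\<lambda>u c. c * g u :: complex)"
  by (simp add: coeff_additive_def algebra_simps)

lemma letters_words: "u \<in> words_over X \<Longrightarrow> set (letters u) \<subseteq> X" by (simp add: words_over_def)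

lemma phi_lpair:
  assumes "p \<in> carrier Fplus" and b: "b \<in> WY"
  shows "\<phi> (cl_plus p) (cl_minus (mon (Word b))) = lpair p b"
  using assms(1) unfolding Fplus_carrier
proof (induction p rule: poly_mapping_span_induct)
  case zero
  have "\<phi> (cl_plus (scal 0 * 0)) (cl_minus (mon (Word b))) = 0 * \<phi> (cl_plus 0) (cl_minus (mon (Word b)))"
    using b by (intro phi_scal_left Fplus_closed Fminus_closed) auto
  then show ?case by (simp add: lpair_def)
next
  case (single u c)
  have "\<phi> (cl_plus (scal c * mon (Word (letters u)))) (cl_minus (mon (Word b))) = c * ph (letters u) b"
    unfolding ph_def using b letters_words[OF single] by (intro phi_scal_left Fplus_closed Fminus_closed) auto
  then show ?case by (simp add: lpair_def psum_single[OF coeff_additive_times] mon_def scal_single)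
next
  case (add p r)
  then show ?case
    using phi_add_left[of p r "mon (Word b)"] b Fminus_closed(5)[of b]
    by (simp add: Fplus_carrier lpair_def psum_add[OF coeff_additive_times])
qed

lemma phi_rpair:
  assumes "r \<in> carrier Fminus" and a: "a \<in> WX"
  shows "\<phi> (cl_plus (mon (Word a))) (cl_minus r) = rpair a r"
  using assms(1) unfolding Fminus_carrier
proof (induction r rule: poly_mapping_span_induct)
  case zero
  have "\<phi> (cl_plus (mon (Word a))) (cl_minus (scal 0 * 0)) = 0 * \<phi> (cl_plus (mon (Word a))) (cl_minus 0)"
    using a by (intro phi_scal_right Fplus_closed Fminus_closed) auto
  then show ?case by (simp add: rpair_def)
next
  case (single u c)
  have "\<phi> (cl_plus (mon (Word a))) (cl_minus (scal c * mon (Word (letters u)))) = c * ph a (letters u)"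
    unfolding ph_def using a letters_words[OF single] by (intro phi_scal_right Fplus_closed Fminus_closed) auto
  then show ?case by (simp add: rpair_def psum_single[OF coeff_additive_times] mon_def scal_single)
next
  case (add p r)
  then show ?case
    using phi_add_right[of "mon (Word a)" p r] a Fplus_closed(5)[of a]
    by (simp add: Fminus_carrier rpair_def psum_add[OF coeff_additive_times])
qed

text \<open>By \<open>rad_plus_eq\<close> and \<open>rad_minus_eq\<close> the classes of these elements form the radicals of \<open>\<phi>\<close>.\<close>

definition radP :: "('g \<Rightarrow> complex) fplus \<Rightarrow> bool" where "radP p \<longleftrightarrow> (\<forall>b\<in>WY. lpair p b = 0)"
definition radM :: "('g \<Rightarrow> complex) fminus \<Rightarrow> bool" where "radM r \<longleftrightarrow> (\<forall>a\<in>WX. rpair a r = 0)"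

lemma radP_iff:
  assumes p: "p \<in> carrier Fplus"
  shows "radP p \<longleftrightarrow> (\<forall>r\<in>carrier Fminus. \<phi> (cl_plus p) (cl_minus r) = 0)"
proof
  assume rad: "radP p"
  show "\<forall>r\<in>carrier Fminus. \<phi> (cl_plus p) (cl_minus r) = 0"
  proof
    fix r assume "r \<in> carrier Fminus"
    then show "\<phi> (cl_plus p) (cl_minus r) = 0"
      unfolding Fminus_carrier
    proof (induction r rule: poly_mapping_span_induct)
      case zero
      show ?case using phi_scal_right[OF p Fminus_closed(7), of 0] by simp
    next
      case (single u c)
      have w: "letters u \<in> WY" using letters_words[OF single] by simp
      have "\<phi> (cl_plus p) (cl_minus (scal c * mon (Word (letters u)))) = c * lpair p (letters u)"
        unfolding phi_lpair[OF p w, symmetric] using w p by (intro phi_scal_right Fminus_closed) auto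
      then show ?case using rad w by (simp add: radP_def mon_def scal_single)
    next
      case (add s r)
      then show ?case using phi_add_right[OF p, of s r] by (simp add: Fminus_carrier)
    qed
  qed
next
  assume *: "\<forall>r\<in>carrier Fminus. \<phi> (cl_plus p) (cl_minus r) = 0"
  show "radP p"
    unfolding radP_def
  proof
    fix b assume b: "b \<in> WY"
    then have "mon (Word b) \<in> carrier Fminus" by (intro Fminus_closed) auto
    then show "lpair p b = 0" using * phi_lpair[OF p b] by simp
  qed
qed

lemma radM_iff:
  assumes r: "r \<in> carrier Fminus"
  shows "radM r \<longleftrightarrow> (\<forall>p\<in>carrier Fplus. \<phi> (cl_plus p) (cl_minus r) = 0)"
proof
  assume rad: "radM r"
  show "\<forall>p\<in>carrier Fplus. \<phi> (cl_plus p) (cl_minus r) = 0"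
  proof
    fix p assume "p \<in> carrier Fplus"
    then show "\<phi> (cl_plus p) (cl_minus r) = 0"
      unfolding Fplus_carrier
    proof (induction p rule: poly_mapping_span_induct)
      case zero
      show ?case using phi_scal_left[OF Fplus_closed(7) r, of 0] by simp
    next
      case (single u c)
      have w: "letters u \<in> WX" using letters_words[OF single] by simp
      have "\<phi> (cl_plus (scal c * mon (Word (letters u)))) (cl_minus r) = c * rpair (letters u) r"
        unfolding phi_rpair[OF r w, symmetric] using w r by (intro phi_scal_left Fplus_closed) auto
      then show ?case using rad w by (simp add: radM_def mon_def scal_single)
    next
      case (add s p)
      then show ?case using phi_add_left[OF _ _ r, of s p] by (simp add: Fplus_carrier)
    qed
  qed
next
  assume *: "\<forall>p\<in>carrier Fplus. \<phi> (cl_plus p) (cl_minus r) = 0"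
  show "radM r"
    unfolding radM_def
  proof
    fix a assume a: "a \<in> WX"
    then have "mon (Word a) \<in> carrier Fplus" by (intro Fplus_closed) auto
    then show "rpair a r = 0" using * phi_rpair[OF r a] by simp
  qed
qed

lemma rad_plus_eq: "rad_plus = cl_plus ` {p \<in> carrier Fplus. radP p}"
  unfolding rad_plus_def Ut_plus_carrier Ut_minus_carrier using radP_iff by auto

lemma rad_minus_eq: "rad_minus = cl_minus ` {r \<in> carrier Fminus. radM r}"
  unfolding rad_minus_def Ut_plus_carrier Ut_minus_carrier using radM_iff by auto

lemma radP_closed:
  "radP 0" "radP p \<Longrightarrow> radP r \<Longrightarrow> radP (p + r)" "radP p \<Longrightarrow> radP (- p)"
  by (simp_all add: radP_def lpair_def psum_add[OF coeff_additive_times] psum_uminus[OF coeff_additive_times])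

lemma radM_closed:
  "radM 0" "radM p \<Longrightarrow> radM r \<Longrightarrow> radM (p + r)" "radM p \<Longrightarrow> radM (- p)"
  by (simp_all add: radM_def rpair_def psum_add[OF coeff_additive_times] psum_uminus[OF coeff_additive_times])

lemma image_additive_subgroup:
  assumes R: "ring R" and S: "ring S" and h: "h \<in> ring_hom R S"
    and A: "A \<subseteq> carrier R" "\<zero>\<^bsub>R\<^esub> \<in> A" "\<And>x y. x \<in> A \<Longrightarrow> y \<in> A \<Longrightarrow> x \<oplus>\<^bsub>R\<^esub> y \<in> A"
      "\<And>x. x \<in> A \<Longrightarrow> \<ominus>\<^bsub>R\<^esub> x \<in> A"
  shows "additive_subgroup (h ` A) S"
proof -
  interpret ring_hom_ring R S h using R S h by (intro ring_hom_ringI2)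
  show ?thesis
  proof (rule additive_subgroupI, rule S.add.subgroupI)
    show "h ` A \<subseteq> carrier S" using A(1) by auto
    show "h ` A \<noteq> {}" using A(2) by blast
    fix x assume "x \<in> h ` A"
    then obtain a where a: "a \<in> A" "x = h a" by blast
    then show "\<ominus>\<^bsub>S\<^esub> x \<in> h ` A" using A(1,4) by (auto intro!: image_eqI[of _ _ "\<ominus>\<^bsub>R\<^esub> a"])
    fix y assume "y \<in> h ` A"
    then obtain b where b: "b \<in> A" "y = h b" by blast
    then have "h (a \<oplus>\<^bsub>R\<^esub> b) = x \<oplus>\<^bsub>S\<^esub> y"
      using a A(1) ring_hom_add[OF h subsetD[OF A(1) a(1)] subsetD[OF A(1) b(1)]] by simp
    then show "x \<oplus>\<^bsub>S\<^esub> y \<in> h ` A" using A(3) a b by (metis image_eqI)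
  qed
qed

lemma a_inv_Fplus: "x \<in> carrier Fplus \<Longrightarrow> \<ominus>\<^bsub>Fplus\<^esub> x = - x"
  using ring.ring_simprules(22)[OF Fplus_ring] abelian_group.minus_equality[OF ring.is_abelian_group[OF Fplus_ring], of "- x" x]
  by (simp add: Fplus_ops Fplus_closed)

lemma a_inv_Fminus: "x \<in> carrier Fminus \<Longrightarrow> \<ominus>\<^bsub>Fminus\<^esub> x = - x"
  using abelian_group.minus_equality[OF ring.is_abelian_group[OF Fminus_ring], of "- x" x]
  by (simp add: Fminus_ops Fminus_closed)

lemma rad_plus_subgroup: "additive_subgroup rad_plus Ut_plus"
  unfolding rad_plus_eq
  by (rule image_additive_subgroup[OF Fplus_ring Ut_plus_ring cl_plus_hom])
    (auto simp: Fplus_ops a_inv_Fplus Fplus_closed radP_closed)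

lemma rad_minus_subgroup: "additive_subgroup rad_minus Ut_minus"
  unfolding rad_minus_eq
  by (rule image_additive_subgroup[OF Fminus_ring Ut_minus_ring cl_minus_hom])
    (auto simp: Fminus_ops a_inv_Fminus Fminus_closed radM_closed)

lemma Uq_plus_zero_iff:
  assumes p: "p \<in> carrier Fplus"
  shows "rad_plus +>\<^bsub>Ut_plus\<^esub> cl_plus p = \<zero>\<^bsub>Uq_plus\<^esub> \<longleftrightarrow> radP p"
proof -
  have c: "cl_plus p \<in> carrier Ut_plus" using p Ut_plus_carrier by blast
  have "\<zero>\<^bsub>Uq_plus\<^esub> = rad_plus" by (simp add: Uq_plus_def FactRing_def)
  then have "rad_plus +>\<^bsub>Ut_plus\<^esub> cl_plus p = \<zero>\<^bsub>Uq_plus\<^esub> \<longleftrightarrow> cl_plus p \<in> rad_plus"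
    using coset_eq_self_iff[OF Ut_plus_ring rad_plus_subgroup c] by simp
  also have "\<dots> \<longleftrightarrow> radP p" using radP_iff[OF p] c by (auto simp: rad_plus_def Ut_minus_carrier)
  finally show ?thesis .
qed

lemma Uq_minus_zero_iff:
  assumes p: "p \<in> carrier Fminus"
  shows "rad_minus +>\<^bsub>Ut_minus\<^esub> cl_minus p = \<zero>\<^bsub>Uq_minus\<^esub> \<longleftrightarrow> radM p"
proof -
  have c: "cl_minus p \<in> carrier Ut_minus" using p Ut_minus_carrier by blast
  have "\<zero>\<^bsub>Uq_minus\<^esub> = rad_minus" by (simp add: Uq_minus_def FactRing_def)
  then have "rad_minus +>\<^bsub>Ut_minus\<^esub> cl_minus p = \<zero>\<^bsub>Uq_minus\<^esub> \<longleftrightarrow> cl_minus p \<in> rad_minus"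
    using coset_eq_self_iff[OF Ut_minus_ring rad_minus_subgroup c] by simp
  also have "\<dots> \<longleftrightarrow> radM p" using radM_iff[OF p] c by (auto simp: rad_minus_def Ut_plus_carrier)
  finally show ?thesis .
qed

end

section \<open>The Heisenberg product on the free algebras\<close>

context qboson begin

text \<open>The Heisenberg product of the pure tensors of the words \<open>b\<close>, \<open>a\<close> and \<open>b'\<close>, \<open>a'\<close>, times \<open>c\<close>.\<close>

definition hm :: "('g \<Rightarrow> complex) lminus list \<Rightarrow> ('g \<Rightarrow> complex) lplus list \<Rightarrow> ('g \<Rightarrow> complex) lminus list \<Rightarrow>
    ('g \<Rightarrow> complex) lplus list \<Rightarrow> complex \<Rightarrow> ('g \<Rightarrow> complex) heis" where
  "hm b a b' a' c = csP a (\<lambda>a1 a2. csM b' (\<lambda>b1 b2.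
     Poly_Mapping.single (Word (b @ b2), Word (a2 @ a')) (c * ph a1 b1)))"

lemma hm_additive: "hm b a b' a' 0 = 0" "hm b a b' a' (c + d) = hm b a b' a' c + hm b a b' a' d"
  by (simp_all add: hm_def cs_zero cs_add[symmetric] distrib_right single_add)

abbreviation hmk where
  "hmk k k' c \<equiv> hm (letters (fst k)) (letters (snd k)) (letters (fst k')) (letters (snd k')) c"

lemma heis_mult_psum: "heis_mult x y = psum (\<lambda>k c. psum (\<lambda>k' c'. hmk k k' (c * c')) y) x"
proof -
  have inner: "(\<Sum>(a1, a2)\<in>Poly_Mapping.keys (\<Delta>_plus (mon a)). \<Sum>(b1, b2)\<in>Poly_Mapping.keys (\<Delta>_minus (mon b')).
       Poly_Mapping.single (b + b2, a2 + a')
         (c * c' * Poly_Mapping.lookup (\<Delta>_plus (mon a)) (a1, a2) * Poly_Mapping.lookup (\<Delta>_minus (mon b')) (b1, b2) *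
          \<phi> (cl_plus (mon a1)) (cl_minus (mon b1)))) = hm (letters b) (letters a) (letters b') (letters a') (c * c')"
    for a b a' b' c c'
  proof -
    let ?G = "\<lambda>j d k d'. Poly_Mapping.single (b + snd k, snd j + a')
        (c * c' * d * d' * \<phi> (cl_plus (mon (fst j))) (cl_minus (mon (fst k))))"
    have G: "coeff_additive (?G j d)" "coeff_additive (\<lambda>j d. ?G j d k d')" for j d k d'
      by (simp_all add: coeff_additive_def single_add algebra_simps)
    have "(\<Sum>(a1, a2)\<in>Poly_Mapping.keys (\<Delta>_plus (mon a)). \<Sum>(b1, b2)\<in>Poly_Mapping.keys (\<Delta>_minus (mon b')).
       Poly_Mapping.single (b + b2, a2 + a')
         (c * c' * Poly_Mapping.lookup (\<Delta>_plus (mon a)) (a1, a2) * Poly_Mapping.lookup (\<Delta>_minus (mon b')) (b1, b2) *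
          \<phi> (cl_plus (mon a1)) (cl_minus (mon b1)))) =
        psum (\<lambda>j d. psum (?G j d) (\<Delta>_minus (mon b'))) (\<Delta>_plus (mon a))"
      by (simp add: psum_def split_def)
    also have "\<dots> = psum (\<lambda>w d. csP (letters w) (\<lambda>u v. psum (?G (Word u, Word v) d) (\<Delta>_minus (mon b')))) (mon a)"
      by (rule psum_Delta_plus) (rule psum_additive_inner[OF G(2)])
    also have "\<dots> = csP (letters a) (\<lambda>u v. psum (?G (Word u, Word v) 1) (\<Delta>_minus (mon b')))"
      by (simp add: psum_def)
    also have "\<dots> = csP (letters a) (\<lambda>u v. csM (letters b') (\<lambda>w z. ?G (Word u, Word v) 1 (Word w, Word z) 1))"
      unfolding psum_Delta_minus[OF G(1)] by (simp add: psum_def)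
    also have "\<dots> = hm (letters b) (letters a) (letters b') (letters a') (c * c')"
      by (simp add: hm_def ph_def plus_word_def)
    finally show ?thesis .
  qed
  have "heis_mult x y = (\<Sum>k\<in>Poly_Mapping.keys x. \<Sum>k'\<in>Poly_Mapping.keys y.
      hmk k k' (Poly_Mapping.lookup x k * Poly_Mapping.lookup y k'))"
    unfolding heis_mult_def
  proof (rule sum.cong[OF refl])
    fix k :: "('g \<Rightarrow> complex) lminus word \<times> ('g \<Rightarrow> complex) lplus word"
    obtain b a where k: "k = (b, a)" by (cases k)
    show "(case k of (b, a) \<Rightarrow> \<Sum>(b', a')\<in>Poly_Mapping.keys y.
        \<Sum>(a1, a2)\<in>Poly_Mapping.keys (\<Delta>_plus (mon a)). \<Sum>(b1, b2)\<in>Poly_Mapping.keys (\<Delta>_minus (mon b')).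
        Poly_Mapping.single (b + b2, a2 + a')
         (Poly_Mapping.lookup x (b, a) * Poly_Mapping.lookup y (b', a') *
          Poly_Mapping.lookup (\<Delta>_plus (mon a)) (a1, a2) * Poly_Mapping.lookup (\<Delta>_minus (mon b')) (b1, b2) *
          \<phi> (cl_plus (mon a1)) (cl_minus (mon b1)))) =
        (\<Sum>k'\<in>Poly_Mapping.keys y. hmk k k' (Poly_Mapping.lookup x k * Poly_Mapping.lookup y k'))"
      unfolding k prod.case
    proof (rule sum.cong[OF refl])
      fix k' :: "('g \<Rightarrow> complex) lminus word \<times> ('g \<Rightarrow> complex) lplus word"
      obtain b' a' where k': "k' = (b', a')" by (cases k')
      show "(case k' of (b', a') \<Rightarrow>
        \<Sum>(a1, a2)\<in>Poly_Mapping.keys (\<Delta>_plus (mon a)). \<Sum>(b1, b2)\<in>Poly_Mapping.keys (\<Delta>_minus (mon b')).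
        Poly_Mapping.single (b + b2, a2 + a')
         (Poly_Mapping.lookup x (b, a) * Poly_Mapping.lookup y (b', a') *
          Poly_Mapping.lookup (\<Delta>_plus (mon a)) (a1, a2) * Poly_Mapping.lookup (\<Delta>_minus (mon b')) (b1, b2) *
          \<phi> (cl_plus (mon a1)) (cl_minus (mon b1)))) =
        hmk (b, a) k' (Poly_Mapping.lookup x (b, a) * Poly_Mapping.lookup y k')"
        unfolding k' prod.case fst_conv snd_conv by (rule inner)
    qed
  qed
  then show ?thesis by (simp add: psum_def)
qed

lemma heis_additive: "coeff_additive (\<lambda>k' c'. hmk k k' (c * c'))"
  "coeff_additive (\<lambda>k c. psum (\<lambda>k' c'. hmk k k' (c * c')) y)"
  "coeff_additive (\<lambda>k c. hmk k k' (c * c'))"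
proof -
  show "coeff_additive (\<lambda>k c. hmk k k' (c * c'))" for k' c'
    by (simp add: coeff_additive_def hm_additive distrib_right)
  show "coeff_additive (\<lambda>k' c'. hmk k k' (c * c'))" for k c
    by (simp add: coeff_additive_def hm_additive distrib_left)
  show "coeff_additive (\<lambda>k c. psum (\<lambda>k' c'. hmk k k' (c * c')) y)"
    by (rule psum_additive_inner) (simp add: coeff_additive_def hm_additive distrib_right)
qed

lemma heis_mult_add_left: "heis_mult (x + x') y = heis_mult x y + heis_mult x' y"
  unfolding heis_mult_psum by (rule psum_add[OF heis_additive(2)])

lemma heis_mult_add_right: "heis_mult x (y + y') = heis_mult x y + heis_mult x y'"
  unfolding heis_mult_psum psum_add[OF heis_additive(1)] by (simp add: psum_def sum.distrib)

lemma heis_mult_zero [simp]: "heis_mult 0 y = 0" "heis_mult x 0 = 0"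
  unfolding heis_mult_psum by (simp_all add: psum_def)

lemma heis_mult_single:
  "heis_mult (Poly_Mapping.single k c) (Poly_Mapping.single k' c') = hmk k k' (c * c')"
  unfolding heis_mult_psum psum_single[OF heis_additive(1)] by (rule psum_single[OF heis_additive(3)])

lemma sg_csM:
  "Poly_Mapping.single k ((c :: complex) * csM z g) = csM z (\<lambda>u v. Poly_Mapping.single k (c * g u v))"
  by (rule cs_hom[of "\<lambda>h. Poly_Mapping.single k (c * h)"]) (simp_all add: single_add distrib_left)

lemma sg_csP:
  "Poly_Mapping.single k ((c :: complex) * csP z g) = csP z (\<lambda>u v. Poly_Mapping.single k (c * g u v))"
  by (rule cs_hom[of "\<lambda>h. Poly_Mapping.single k (c * h)"]) (simp_all add: single_add distrib_left)

abbreviation sg :: "('g \<Rightarrow> complex) lminus list \<Rightarrow> ('g \<Rightarrow> complex) lplus list \<Rightarrow> complex \<Rightarrow> ('g \<Rightarrow> complex) heis" where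
  "sg b a c \<equiv> Poly_Mapping.single (Word b, Word a) c"

lemma heis_mult_sg: "heis_mult (sg b a c) (sg b' a' c') = hm b a b' a' (c * c')"
  by (simp add: heis_mult_single)

abbreviation HW where "HW \<equiv> words_over LY \<times> words_over LX"

abbreviation HC :: "('g \<Rightarrow> complex) heis set" where "HC \<equiv> {x. Poly_Mapping.keys x \<subseteq> HW}"

lemma HC_add: "x \<in> HC \<Longrightarrow> y \<in> HC \<Longrightarrow> x + y \<in> HC" using keys_add[of x y] by auto
lemma HC_zero: "0 \<in> HC" by simp
lemma HC_single: "b \<in> WY \<Longrightarrow> a \<in> WX \<Longrightarrow> sg b a c \<in> HC" by (auto simp: words_over_def)

lemma HC_induct [consumes 1, case_names zero single add]:
  assumes "x \<in> HC" "Q 0" "\<And>b a c. b \<in> WY \<Longrightarrow> a \<in> WX \<Longrightarrow> Q (sg b a c)"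
    "\<And>x y. x \<in> HC \<Longrightarrow> y \<in> HC \<Longrightarrow> Q x \<Longrightarrow> Q y \<Longrightarrow> Q (x + y)"
  shows "Q x"
  using assms(1)
proof -
  assume "x \<in> HC"
  then have "Poly_Mapping.keys x \<subseteq> HW" by simp
  then show "Q x"
  proof (induction x rule: poly_mapping_span_induct)
    case (single k c)
    obtain u v where k: "k = (u, v)" by (cases k)
    have "letters u \<in> WY" "letters v \<in> WX"
      using letters_words[of u LY] letters_words[of v LX] single by (auto simp: k)
    then show ?case using assms(3)[of "letters u" "letters v" c] by (simp add: k)
  qed (use assms in auto)
qed

lemma hm_closed:
  assumes "b \<in> WY" "a \<in> WX" "b' \<in> WY" "a' \<in> WX" shows "hm b a b' a' c \<in> HC"
  unfolding hm_def
proof (rule cs_property[OF csP_closed _ HC_zero HC_add])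
  fix x y :: "('g \<Rightarrow> complex) lplus list" assume xy: "set x \<subseteq> LX" "set y \<subseteq> LX"
  show "csM b' (\<lambda>b1 b2. sg (b @ b2) (y @ a') (c * ph x b1)) \<in> HC"
  proof (rule cs_property[OF csM_closed _ HC_zero HC_add])
    fix z w :: "('g \<Rightarrow> complex) lminus list" assume "set z \<subseteq> LY" "set w \<subseteq> LY"
    then show "sg (b @ w) (y @ a') (c * ph x z) \<in> HC" using assms xy by (intro HC_single) auto
  qed (use assms in auto)
qed (use assms in auto)

lemma heis_mult_closed: "x \<in> HC \<Longrightarrow> y \<in> HC \<Longrightarrow> heis_mult x y \<in> HC"
proof (induction x rule: HC_induct)
  case (single b a c)
  from single(3) show ?case
  proof (induction y rule: HC_induct)
    case (single b' a' c')
    then show ?case using hm_closed \<open>b \<in> WY\<close> \<open>a \<in> WX\<close> by (simp only: heis_mult_sg)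
  next
    case (add x y)
    then show ?case unfolding heis_mult_add_right by (intro HC_add)
  qed simp
next
  case (add x x')
  then show ?case unfolding heis_mult_add_left by (intro HC_add) auto
qed simp

lemma csM_csP_swap: "csM b (\<lambda>z w. csP a (\<lambda>x y. g x y z w)) = csP a (\<lambda>x y. csM b (\<lambda>z w. g x y z w))"
  by (rule cs_swap)

text \<open>Both sides are the sum of \<open>N\<close> over the terms of the iterated coproducts of \<open>a\<close> and \<open>b''\<close> into three
  factors and of the coproducts of \<open>a'\<close> and \<open>b'\<close>. The pairing is multiplicative in each argument, and
  coassociativity brings the two threefold coproducts into the same form.\<close>

lemma heis_assoc_words:
  assumes w: "b \<in> WY" "a \<in> WX" "b' \<in> WY" "a' \<in> WX" "b'' \<in> WY" "a'' \<in> WX"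
  shows "heis_mult (heis_mult (sg b a c) (sg b' a' c')) (sg b'' a'' c'') =
    heis_mult (sg b a c) (heis_mult (sg b' a' c') (sg b'' a'' c''))"
proof -
  define k where "k = c * c' * c''"
  define N where "N a1 a2 a3 b1 b2 p s z1 z2 z3 =
    sg (b @ b2 @ z3) (a3 @ s @ a'') (k * (ph a1 b1 * (ph a2 z2 * ph p z1)))" for a1 a2 a3 b1 b2 p s z1 z2 z3
  have "heis_mult (heis_mult (sg b a c) (sg b' a' c')) (sg b'' a'' c'') =
      csP a (\<lambda>a1 a2. csM b' (\<lambda>b1 b2. hm (b @ b2) (a2 @ a') b'' a'' (c * c' * ph a1 b1 * c'')))"
    unfolding heis_mult_sg hm_def[of b a b' a']
    by (subst cs_hom[of "\<lambda>z. heis_mult z (sg b'' a'' c'')"], simp, simp add: heis_mult_add_left,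
        subst cs_hom[of "\<lambda>z. heis_mult z (sg b'' a'' c'')"], simp, simp add: heis_mult_add_left)
      (simp only: heis_mult_sg)
  also have "\<dots> = csP a (\<lambda>a1 a2. csM b' (\<lambda>b1 b2. csP a2 (\<lambda>x y. csP a' (\<lambda>p s. csM b'' (\<lambda>z1 z2.
      sg (b @ b2 @ z2) (y @ s @ a'') (c * c' * ph a1 b1 * c'' * ph (x @ p) z1))))))"
    by (simp add: hm_def cs_append)
  also have "\<dots> = csP a (\<lambda>a1 a2. csM b' (\<lambda>b1 b2. csP a2 (\<lambda>x y. csP a' (\<lambda>p s. csM b'' (\<lambda>z1 r. csM r (\<lambda>z2 z3.
      N a1 x y b1 b2 p s z1 z2 z3))))))"
  proof (rule cs_cong[OF csP_closed], use w in simp, rule cs_cong[OF csM_closed], use w in simp,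
      rule cs_cong[OF csP_closed], simp, rule cs_cong[OF csP_closed], use w in simp)
    fix a1 a2 x y p s :: "('g \<Rightarrow> complex) lplus list" and b1 b2 :: "('g \<Rightarrow> complex) lminus list"
    assume X: "set x \<subseteq> LX" "set p \<subseteq> LX"
    have "csM b'' (\<lambda>z1 z2. sg (b @ b2 @ z2) (y @ s @ a'') (c * c' * ph a1 b1 * c'' * ph (x @ p) z1)) =
        csM b'' (\<lambda>z1 z2. csM z1 (\<lambda>u v. N a1 x y b1 b2 p s u v z2))"
    proof (rule cs_cong[OF csM_closed])
      show "set b'' \<subseteq> LY" using w by simp
      fix z1 z2 :: "('g \<Rightarrow> complex) lminus list" assume "set z1 \<subseteq> LY"
      then have eq: "ph (x @ p) z1 = csM z1 (\<lambda>u v. ph x v * ph p u)"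
        using X by (intro ph_append_left) auto
      show "sg (b @ b2 @ z2) (y @ s @ a'') (c * c' * ph a1 b1 * c'' * ph (x @ p) z1) =
          csM z1 (\<lambda>u v. N a1 x y b1 b2 p s u v z2)"
        unfolding eq sg_csM by (simp add: N_def k_def mult_ac)
    qed
    also have "\<dots> = csM b'' (\<lambda>z1 r. csM r (\<lambda>z2 z3. N a1 x y b1 b2 p s z1 z2 z3))" by (rule csM_coassoc)
    finally show "csM b'' (\<lambda>z1 z2. sg (b @ b2 @ z2) (y @ s @ a'') (c * c' * ph a1 b1 * c'' * ph (x @ p) z1)) =
        csM b'' (\<lambda>z1 r. csM r (\<lambda>z2 z3. N a1 x y b1 b2 p s z1 z2 z3))" .
  qed
  also have "\<dots> = csP a (\<lambda>a1 r. csP r (\<lambda>a2 a3. csP a' (\<lambda>p s. csM b' (\<lambda>b1 b2. csM b'' (\<lambda>z1 r. csM r (\<lambda>z2 z3.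
      N a1 a2 a3 b1 b2 p s z1 z2 z3))))))"
    by (simp only: csM_csP_swap)
  finally have L: "heis_mult (heis_mult (sg b a c) (sg b' a' c')) (sg b'' a'' c'') = \<dots>" .
  have "heis_mult (sg b a c) (heis_mult (sg b' a' c') (sg b'' a'' c'')) =
      csP a' (\<lambda>p s. csM b'' (\<lambda>z1 r. hm b a (b' @ r) (s @ a'') (c * (c' * c'' * ph p z1))))"
    unfolding heis_mult_sg hm_def[of b' a' b'' a'']
    by (subst cs_hom[of "\<lambda>z. heis_mult (sg b a c) z"], simp, simp add: heis_mult_add_right,
        subst cs_hom[of "\<lambda>z. heis_mult (sg b a c) z"], simp, simp add: heis_mult_add_right)
      (simp only: heis_mult_sg)
  also have "\<dots> = csP a' (\<lambda>p s. csM b'' (\<lambda>z1 r. csP a (\<lambda>a1 a2. csM b' (\<lambda>b1 b2. csM r (\<lambda>z2 z3.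
      sg (b @ b2 @ z3) (a2 @ s @ a'') (c * (c' * c'' * ph p z1) * ph a1 (b1 @ z2)))))))"
    by (simp add: hm_def cs_append)
  also have "\<dots> = csP a' (\<lambda>p s. csM b'' (\<lambda>z1 r. csP a (\<lambda>a1 a2. csM b' (\<lambda>b1 b2. csM r (\<lambda>z2 z3.
      csP a1 (\<lambda>x y. N x y a2 b1 b2 p s z1 z2 z3))))))"
  proof (rule cs_cong[OF csP_closed], use w in simp, rule cs_cong[OF csM_closed], use w in simp,
      rule cs_cong[OF csP_closed], use w in simp, rule cs_cong[OF csM_closed], use w in simp,
      rule cs_cong[OF csM_closed], simp)
    fix a1 a2 p s :: "('g \<Rightarrow> complex) lplus list" and b1 b2 z1 z2 z3 :: "('g \<Rightarrow> complex) lminus list"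
    assume X: "set a1 \<subseteq> LX" "set b1 \<subseteq> LY" "set z2 \<subseteq> LY"
    then have eq: "ph a1 (b1 @ z2) = csP a1 (\<lambda>x y. ph x b1 * ph y z2)"
      by (intro ph_append_right) auto
    show "sg (b @ b2 @ z3) (a2 @ s @ a'') (c * (c' * c'' * ph p z1) * ph a1 (b1 @ z2)) =
        csP a1 (\<lambda>x y. N x y a2 b1 b2 p s z1 z2 z3)"
      unfolding eq sg_csP by (simp add: N_def k_def mult_ac)
  qed
  also have "\<dots> = csP a' (\<lambda>p s. csP a (\<lambda>a1 a2. csP a1 (\<lambda>x y. csM b' (\<lambda>b1 b2. csM b'' (\<lambda>z1 r. csM r (\<lambda>z2 z3.
      N x y a2 b1 b2 p s z1 z2 z3))))))"
    by (simp only: csM_csP_swap cs_swap[where dl = dlM and a = b'' and dl' = dlM and b = b'])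
  also have "\<dots> = csP a' (\<lambda>p s. csP a (\<lambda>a1 r. csP r (\<lambda>a2 a3. csM b' (\<lambda>b1 b2. csM b'' (\<lambda>z1 r. csM r (\<lambda>z2 z3.
      N a1 a2 a3 b1 b2 p s z1 z2 z3))))))"
    by (simp only: csP_coassoc)
  also have "\<dots> = csP a (\<lambda>a1 r. csP a' (\<lambda>p s. csP r (\<lambda>a2 a3. csM b' (\<lambda>b1 b2. csM b'' (\<lambda>z1 r. csM r (\<lambda>z2 z3.
      N a1 a2 a3 b1 b2 p s z1 z2 z3))))))"
    by (rule cs_swap)
  also have "\<dots> = csP a (\<lambda>a1 r. csP r (\<lambda>a2 a3. csP a' (\<lambda>p s. csM b' (\<lambda>b1 b2. csM b'' (\<lambda>z1 r. csM r (\<lambda>z2 z3.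
      N a1 a2 a3 b1 b2 p s z1 z2 z3))))))"
    by (rule cs_cong[OF csP_closed]) (use w in simp, rule cs_swap)
  finally show ?thesis unfolding L by simp
qed

lemma heis_mult_assoc:
  "x \<in> HC \<Longrightarrow> y \<in> HC \<Longrightarrow> z \<in> HC \<Longrightarrow> heis_mult (heis_mult x y) z = heis_mult x (heis_mult y z)"
proof (induction x rule: HC_induct)
  case (single b a c)
  from \<open>y \<in> HC\<close> show ?case
  proof (induction y rule: HC_induct)
    case (single b' a' c')
    from \<open>z \<in> HC\<close> show ?case
    proof (induction z rule: HC_induct)
      case (single b'' a'' c'')
      then show ?case using \<open>b \<in> WY\<close> \<open>a \<in> WX\<close> \<open>b' \<in> WY\<close> \<open>a' \<in> WX\<close> by (intro heis_assoc_words)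
    qed (simp_all add: heis_mult_add_right)
  qed (simp_all add: heis_mult_add_left heis_mult_add_right)
qed (simp_all add: heis_mult_add_left)

lemma heis_one: "(1 :: ('g \<Rightarrow> complex) heis) = sg [] [] 1"
  by (simp add: one_mon mon_def Word_Nil zero_prod_def)

lemma heis_mult_one_left: "x \<in> HC \<Longrightarrow> heis_mult 1 x = x"
proof (induction x rule: HC_induct)
  case (single b a c)
  have "heis_mult 1 (sg b a c) = csM b (\<lambda>b1 b2. sg b2 a (c * ph [] b1))"
    unfolding heis_one heis_mult_sg by (simp add: hm_def)
  also have "\<dots> = csM b (\<lambda>b1 b2. sg b2 a (c * epsM b1))"
    using single by (intro cs_cong[OF csM_closed]) (auto simp: ph_Nil_left)
  also have "\<dots> = sg b a c"
    by (rule csM_counit[of "\<lambda>b2 c. sg b2 a c"]) (simp add: coeff_additive_def single_add)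
  finally show ?case .
qed (simp_all add: heis_mult_add_right)

lemma heis_mult_one_right: "x \<in> HC \<Longrightarrow> heis_mult x 1 = x"
proof (induction x rule: HC_induct)
  case (single b a c)
  have "heis_mult (sg b a c) 1 = csP a (\<lambda>a1 a2. sg b a2 (c * ph a1 []))"
    unfolding heis_one heis_mult_sg by (simp add: hm_def)
  also have "\<dots> = csP a (\<lambda>a1 a2. sg b a2 (c * epsP a1))"
    using single by (intro cs_cong[OF csP_closed]) (auto simp: ph_Nil_right)
  also have "\<dots> = sg b a c"
    by (rule csP_counit[of "\<lambda>a2 c. sg b a2 c"]) (simp add: coeff_additive_def single_add)
  finally show ?case .
qed (simp_all add: heis_mult_add_left)

lemma heis_free_ops: "carrier heis_free = HC" "mult heis_free = heis_mult" "one heis_free = 1"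
  "zero heis_free = 0" "add heis_free = (+)"
  by (simp_all add: heis_free_def)

lemma HC_one: "1 \<in> HC" unfolding heis_one by (rule HC_single) auto
lemma HC_uminus: "x \<in> HC \<Longrightarrow> - x \<in> HC" by (simp add: keys_uminus)

lemma heis_free_ring: "ring heis_free"
proof (rule ringI)
  show "abelian_group heis_free"
  proof (rule abelian_groupI)
    fix x assume "x \<in> carrier heis_free"
    then show "\<exists>y\<in>carrier heis_free. y \<oplus>\<^bsub>heis_free\<^esub> x = \<zero>\<^bsub>heis_free\<^esub>"
      using HC_uminus[of x] by (intro bexI[of _ "- x"]) (auto simp only: heis_free_ops ab_left_minus)
  qed (use HC_add HC_zero in \<open>simp_all only: heis_free_ops add_ac add_0_left add_0_right\<close>)
  show "Group.monoid heis_free"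
    by (rule Group.monoidI)
      (use heis_mult_closed HC_one heis_mult_assoc heis_mult_one_left heis_mult_one_right in
        \<open>simp_all only: heis_free_ops\<close>)
qed (simp_all only: heis_free_ops heis_mult_add_left heis_mult_add_right)

end

section \<open>The kernel of the projection to the Heisenberg double\<close>

lemma psum_scal:
  assumes G: "coeff_additive G"
  shows "psum G (scal c * p) = psum (\<lambda>u d. G u (c * d)) p"
proof -
  have G': "coeff_additive (\<lambda>u d. G u (c * d))" using G by (simp add: coeff_additive_def distrib_left)
  have "Poly_Mapping.keys p \<subseteq> UNIV" by simp
  then show ?thesis
  proof (induction p rule: poly_mapping_span_induct)
    case (single k d)
    show ?case by (simp add: scal_single psum_single[OF G] psum_single[OF G'])
  next
    case (add p r)
    then show ?case by (simp add: distrib_left psum_add[OF G] psum_add[OF G'])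
  qed simp
qed

context qboson begin

lemma letters_plus: "letters (u + v) = letters u @ letters v" by (simp add: plus_word_def)

lemma Fplus_letters: "p \<in> carrier Fplus \<Longrightarrow> u \<in> Poly_Mapping.keys p \<Longrightarrow> letters u \<in> WX"
  and Fminus_letters: "r \<in> carrier Fminus \<Longrightarrow> v \<in> Poly_Mapping.keys r \<Longrightarrow> letters v \<in> WY"
  using letters_words Fplus_carrier Fminus_carrier by blast+

lemma lpair_mon_left:
  assumes "y \<in> WX" "p \<in> carrier Fplus" "b \<in> WY"
  shows "lpair (mon (Word y) * p) b = csM b (\<lambda>b1 b2. ph y b2 * lpair p b1)"
proof -
  have "lpair (mon (Word y) * p) b = psum (\<lambda>u c. csM b (\<lambda>b1 b2. c * (ph y b2 * ph (letters u) b1))) p"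
    unfolding lpair_def psum_mon_left[OF coeff_additive_times]
  proof (rule psum_cong)
    fix u c assume "u \<in> Poly_Mapping.keys p"
    then have "ph (y @ letters u) b = csM b (\<lambda>b1 b2. ph y b2 * ph (letters u) b1)"
      using assms Fplus_letters by (intro ph_append_left) auto
    then show "c * ph (letters (Word y + u)) b = csM b (\<lambda>b1 b2. c * (ph y b2 * ph (letters u) b1))"
      by (simp add: letters_plus cs_hom[of "(*) c"] distrib_left)
  qed
  also have "\<dots> = csM b (\<lambda>b1 b2. psum (\<lambda>u c. c * (ph y b2 * ph (letters u) b1)) p)" by (rule psum_cs)
  also have "\<dots> = csM b (\<lambda>b1 b2. ph y b2 * lpair p b1)"
    by (simp add: lpair_def psum_def sum_distrib_left mult_ac)
  finally show ?thesis .
qed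

lemma lpair_mon_right:
  assumes "y \<in> WX" "p \<in> carrier Fplus" "b \<in> WY"
  shows "lpair (p * mon (Word y)) b = csM b (\<lambda>b1 b2. lpair p b2 * ph y b1)"
proof -
  have "lpair (p * mon (Word y)) b = psum (\<lambda>u c. csM b (\<lambda>b1 b2. c * (ph (letters u) b2 * ph y b1))) p"
    unfolding lpair_def psum_mon_right[OF coeff_additive_times]
  proof (rule psum_cong)
    fix u c assume "u \<in> Poly_Mapping.keys p"
    then have "ph (letters u @ y) b = csM b (\<lambda>b1 b2. ph (letters u) b2 * ph y b1)"
      using assms Fplus_letters by (intro ph_append_left) auto
    then show "c * ph (letters (u + Word y)) b = csM b (\<lambda>b1 b2. c * (ph (letters u) b2 * ph y b1))"
      by (simp add: letters_plus cs_hom[of "(*) c"] distrib_left)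
  qed
  also have "\<dots> = csM b (\<lambda>b1 b2. psum (\<lambda>u c. c * (ph (letters u) b2 * ph y b1)) p)" by (rule psum_cs)
  also have "\<dots> = csM b (\<lambda>b1 b2. lpair p b2 * ph y b1)"
    by (simp add: lpair_def psum_def sum_distrib_left mult_ac)
  finally show ?thesis .
qed

lemma rpair_mon_left:
  assumes "z \<in> WY" "r \<in> carrier Fminus" "a \<in> WX"
  shows "rpair a (mon (Word z) * r) = csP a (\<lambda>a1 a2. ph a1 z * rpair a2 r)"
proof -
  have "rpair a (mon (Word z) * r) = psum (\<lambda>u c. csP a (\<lambda>a1 a2. c * (ph a1 z * ph a2 (letters u)))) r"
    unfolding rpair_def psum_mon_left[OF coeff_additive_times]
  proof (rule psum_cong)
    fix u c assume "u \<in> Poly_Mapping.keys r"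
    then have "ph a (z @ letters u) = csP a (\<lambda>a1 a2. ph a1 z * ph a2 (letters u))"
      using assms Fminus_letters by (intro ph_append_right) auto
    then show "c * ph a (letters (Word z + u)) = csP a (\<lambda>a1 a2. c * (ph a1 z * ph a2 (letters u)))"
      by (simp add: letters_plus cs_hom[of "(*) c"] distrib_left)
  qed
  also have "\<dots> = csP a (\<lambda>a1 a2. psum (\<lambda>u c. c * (ph a1 z * ph a2 (letters u))) r)" by (rule psum_cs)
  also have "\<dots> = csP a (\<lambda>a1 a2. ph a1 z * rpair a2 r)"
    by (simp add: rpair_def psum_def sum_distrib_left mult_ac)
  finally show ?thesis .
qed

lemma rpair_mon_right:
  assumes "z \<in> WY" "r \<in> carrier Fminus" "a \<in> WX"
  shows "rpair a (r * mon (Word z)) = csP a (\<lambda>a1 a2. rpair a1 r * ph a2 z)"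
proof -
  have "rpair a (r * mon (Word z)) = psum (\<lambda>u c. csP a (\<lambda>a1 a2. c * (ph a1 (letters u) * ph a2 z))) r"
    unfolding rpair_def psum_mon_right[OF coeff_additive_times]
  proof (rule psum_cong)
    fix u c assume "u \<in> Poly_Mapping.keys r"
    then have "ph a (letters u @ z) = csP a (\<lambda>a1 a2. ph a1 (letters u) * ph a2 z)"
      using assms Fminus_letters by (intro ph_append_right) auto
    then show "c * ph a (letters (u + Word z)) = csP a (\<lambda>a1 a2. c * (ph a1 (letters u) * ph a2 z))"
      by (simp add: letters_plus cs_hom[of "(*) c"] distrib_left)
  qed
  also have "\<dots> = csP a (\<lambda>a1 a2. psum (\<lambda>u c. c * (ph a1 (letters u) * ph a2 z)) r)" by (rule psum_cs)
  also have "\<dots> = csP a (\<lambda>a1 a2. rpair a1 r * ph a2 z)"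
    by (simp add: rpair_def psum_def sum_distrib_left mult_ac)
  finally show ?thesis .
qed

lemma csM_zero: "b \<in> WY \<Longrightarrow> (\<And>x y. x \<in> WY \<Longrightarrow> y \<in> WY \<Longrightarrow> g x y = 0) \<Longrightarrow> csM b g = 0"
  by (subst cs_cong[OF csM_closed, of b g "\<lambda>x y. 0"]) (auto simp: cs_zero)

lemma csP_zero: "b \<in> WX \<Longrightarrow> (\<And>x y. x \<in> WX \<Longrightarrow> y \<in> WX \<Longrightarrow> g x y = 0) \<Longrightarrow> csP b g = 0"
  by (subst cs_cong[OF csP_closed, of b g "\<lambda>x y. 0"]) (auto simp: cs_zero)

text \<open>The radicals are ideals, since pairing with a product is a sum of products of pairings with the
  factors.\<close>

lemma radP_mon_left: "y \<in> WX \<Longrightarrow> p \<in> carrier Fplus \<Longrightarrow> radP p \<Longrightarrow> radP (mon (Word y) * p)"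
  and radP_mon_right: "y \<in> WX \<Longrightarrow> p \<in> carrier Fplus \<Longrightarrow> radP p \<Longrightarrow> radP (p * mon (Word y))"
  and radM_mon_left: "z \<in> WY \<Longrightarrow> r \<in> carrier Fminus \<Longrightarrow> radM r \<Longrightarrow> radM (mon (Word z) * r)"
  and radM_mon_right: "z \<in> WY \<Longrightarrow> r \<in> carrier Fminus \<Longrightarrow> radM r \<Longrightarrow> radM (r * mon (Word z))"
  unfolding radP_def radM_def
  by (safe, subst lpair_mon_left lpair_mon_right rpair_mon_left rpair_mon_right; (rule csM_zero csP_zero)?; simp)+

lemma radP_scal: "radP p \<Longrightarrow> radP (scal c * p)" and radM_scal: "radM r \<Longrightarrow> radM (scal c * r)"
proof -
  have "lpair (scal c * p) b = c * lpair p b" "rpair a (scal c * r) = c * rpair a r" for a b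
    unfolding lpair_def rpair_def psum_scal[OF coeff_additive_times]
    by (simp_all add: psum_def sum_distrib_left mult_ac)
  then show "radP p \<Longrightarrow> radP (scal c * p)" "radM r \<Longrightarrow> radM (scal c * r)"
    by (simp_all add: radP_def radM_def)
qed

text \<open>The terms \<open>\<phi> x r\<^sub>1\<close> times \<open>r\<^sub>2\<close> of the Heisenberg product, linearly in \<open>r\<close>; \<open>actP\<close> is the mirror image. By
  \<open>rpair_actM\<close> and \<open>lpair_actP\<close> these maps are adjoint to multiplication, so they preserve the radicals.\<close>

definition actM :: "('g \<Rightarrow> complex) lplus list \<Rightarrow> ('g \<Rightarrow> complex) fminus \<Rightarrow> ('g \<Rightarrow> complex) fminus" where
  "actM x r = psum (\<lambda>v d. csM (letters v) (\<lambda>b1 b2. Poly_Mapping.single (Word b2) (d * ph x b1))) r"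

definition actP :: "('g \<Rightarrow> complex) lminus list \<Rightarrow> ('g \<Rightarrow> complex) fplus \<Rightarrow> ('g \<Rightarrow> complex) fplus" where
  "actP z p = psum (\<lambda>u c. csP (letters u) (\<lambda>a1 a2. Poly_Mapping.single (Word a2) (c * ph a1 z))) p"

lemma act_additive:
  "coeff_additive (\<lambda>v d. csM (letters v) (\<lambda>b1 b2. Poly_Mapping.single (Word b2) (d * ph x b1)))"
  "coeff_additive (\<lambda>u c. csP (letters u) (\<lambda>a1 a2. Poly_Mapping.single (Word a2) (c * ph a1 z)))"
  by (rule coeff_additive_cs; simp add: coeff_additive_def distrib_right single_add)+

lemma actM_closed: "x \<in> WX \<Longrightarrow> r \<in> carrier Fminus \<Longrightarrow> actM x r \<in> carrier Fminus"
  unfolding actM_def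
proof (rule psum_property[where Q = "\<lambda>r. r \<in> carrier Fminus", OF Fminus_closed(7) Fminus_closed(1)])
  fix k c assume "r \<in> carrier Fminus" "k \<in> Poly_Mapping.keys r"
  then have "set (letters k) \<subseteq> LY" using Fminus_letters by blast
  then show "csM (letters k) (\<lambda>b1 b2. Poly_Mapping.single (Word b2) (c * ph x b1)) \<in> carrier Fminus"
    by (rule cs_property[OF csM_closed _ Fminus_closed(7) Fminus_closed(1)]) (auto intro!: Fminus_closed)
qed

lemma actP_closed: "z \<in> WY \<Longrightarrow> p \<in> carrier Fplus \<Longrightarrow> actP z p \<in> carrier Fplus"
  unfolding actP_def
proof (rule psum_property[where Q = "\<lambda>r. r \<in> carrier Fplus", OF Fplus_closed(7) Fplus_closed(1)])
  fix k c assume "p \<in> carrier Fplus" "k \<in> Poly_Mapping.keys p"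
  then have "set (letters k) \<subseteq> LX" using Fplus_letters by blast
  then show "csP (letters k) (\<lambda>a1 a2. Poly_Mapping.single (Word a2) (c * ph a1 z)) \<in> carrier Fplus"
    by (rule cs_property[OF csP_closed _ Fplus_closed(7) Fplus_closed(1)]) (auto intro!: Fplus_closed)
qed

lemma rpair_actM:
  assumes "x \<in> WX" "a \<in> WX" "r \<in> carrier Fminus"
  shows "rpair a (actM x r) = rpair (a @ x) r"
proof -
  have "rpair a (actM x r) = psum (\<lambda>v d. rpair a (csM (letters v) (\<lambda>b1 b2. Poly_Mapping.single (Word b2) (d * ph x b1)))) r"
    unfolding actM_def by (rule psum_linear) (simp_all add: rpair_def psum_add[OF coeff_additive_times])
  also have "\<dots> = psum (\<lambda>v d. d * ph (a @ x) (letters v)) r"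
  proof (rule psum_cong)
    fix v d assume "v \<in> Poly_Mapping.keys r"
    then have eq: "ph (a @ x) (letters v) = csM (letters v) (\<lambda>b1 b2. ph a b2 * ph x b1)"
      using assms Fminus_letters by (intro ph_append_left) auto
    have "rpair a (csM (letters v) (\<lambda>b1 b2. Poly_Mapping.single (Word b2) (d * ph x b1))) =
        csM (letters v) (\<lambda>b1 b2. rpair a (Poly_Mapping.single (Word b2) (d * ph x b1)))"
      by (rule cs_hom) (simp_all add: rpair_def psum_add[OF coeff_additive_times])
    also have "\<dots> = csM (letters v) (\<lambda>b1 b2. d * (ph a b2 * ph x b1))"
      by (simp add: rpair_def psum_single[OF coeff_additive_times] mult_ac)
    also have "\<dots> = d * ph (a @ x) (letters v)"
      unfolding eq by (rule cs_hom[symmetric]) (simp_all add: distrib_left)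
    finally show "rpair a (csM (letters v) (\<lambda>b1 b2. Poly_Mapping.single (Word b2) (d * ph x b1))) =
        d * ph (a @ x) (letters v)" .
  qed
  finally show ?thesis by (simp add: rpair_def)
qed

lemma lpair_actP:
  assumes "z \<in> WY" "b \<in> WY" "p \<in> carrier Fplus"
  shows "lpair (actP z p) b = lpair p (z @ b)"
proof -
  have "lpair (actP z p) b = psum (\<lambda>u c. lpair (csP (letters u) (\<lambda>a1 a2. Poly_Mapping.single (Word a2) (c * ph a1 z))) b) p"
    unfolding actP_def
    by (rule psum_linear[of "\<lambda>p. lpair p b"]) (simp_all add: lpair_def psum_add[OF coeff_additive_times])
  also have "\<dots> = psum (\<lambda>u c. c * ph (letters u) (z @ b)) p"
  proof (rule psum_cong)
    fix u c assume "u \<in> Poly_Mapping.keys p"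
    then have eq: "ph (letters u) (z @ b) = csP (letters u) (\<lambda>a1 a2. ph a1 z * ph a2 b)"
      using assms Fplus_letters by (intro ph_append_right) auto
    have "lpair (csP (letters u) (\<lambda>a1 a2. Poly_Mapping.single (Word a2) (c * ph a1 z))) b =
        csP (letters u) (\<lambda>a1 a2. lpair (Poly_Mapping.single (Word a2) (c * ph a1 z)) b)"
      by (rule cs_hom[of "\<lambda>p. lpair p b"]) (simp_all add: lpair_def psum_add[OF coeff_additive_times])
    also have "\<dots> = csP (letters u) (\<lambda>a1 a2. c * (ph a1 z * ph a2 b))"
      by (simp add: lpair_def psum_single[OF coeff_additive_times] mult_ac)
    also have "\<dots> = c * ph (letters u) (z @ b)"
      unfolding eq by (rule cs_hom[symmetric]) (simp_all add: distrib_left)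
    finally show "lpair (csP (letters u) (\<lambda>a1 a2. Poly_Mapping.single (Word a2) (c * ph a1 z))) b =
        c * ph (letters u) (z @ b)" .
  qed
  finally show ?thesis by (simp add: lpair_def)
qed

lemma radM_actM: "x \<in> WX \<Longrightarrow> r \<in> carrier Fminus \<Longrightarrow> radM r \<Longrightarrow> radM (actM x r)"
  by (simp add: radM_def rpair_actM)

lemma radP_actP: "z \<in> WY \<Longrightarrow> p \<in> carrier Fplus \<Longrightarrow> radP p \<Longrightarrow> radP (actP z p)"
  by (simp add: radP_def lpair_actP)

lemma tens_csM: "tens (csM b g) p = csM b (\<lambda>x y. tens (g x y) p)"
  by (rule cs_hom[of "\<lambda>z. tens z p"]) (simp_all add: tens_add_left)

lemma tens_csP: "tens r (csP b g) = csP b (\<lambda>x y. tens r (g x y))"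
  by (rule cs_hom[of "\<lambda>z. tens r z"]) (simp_all add: tens_add_right)

lemma mult_cs: "x * cs dl b g = cs dl b (\<lambda>u v. x * g u v)" "cs dl b g * x = cs dl b (\<lambda>u v. g u v * x)"
  for x :: "'z :: semiring_0"
  by (rule cs_hom[of "\<lambda>z. x * z"] cs_hom[of "\<lambda>z. z * x"]; simp add: distrib_left distrib_right)+

lemma heis_mult_tens_right:
  "heis_mult (sg b' a' c) (tens r p) =
    csP a' (\<lambda>x y. tens (scal c * (mon (Word b') * actM x r)) (mon (Word y) * p))"
proof -
  have "Poly_Mapping.keys r \<subseteq> UNIV" by simp
  then show ?thesis
  proof (induction r rule: poly_mapping_span_induct)
    case zero
    show ?case by (simp add: actM_def cs_zero)
  next
    case (add r r')
    have "actM x (r + r') = actM x r + actM x r'" for x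
      unfolding actM_def by (rule psum_add[OF act_additive(1)])
    then show ?case using add by (simp add: tens_add_left heis_mult_add_right distrib_left cs_add)
  next
    case (single u d)
    have "Poly_Mapping.keys p \<subseteq> UNIV" by simp
    then show ?case
    proof (induction p rule: poly_mapping_span_induct)
      case zero
      show ?case by (simp add: cs_zero)
    next
      case (add p p')
      then show ?case by (simp add: tens_add_right heis_mult_add_right distrib_left cs_add)
    next
      case (single v d')
      have act: "actM x (Poly_Mapping.single u d) =
          csM (letters u) (\<lambda>b1 b2. Poly_Mapping.single (Word b2) (d * ph x b1))" for x
        unfolding actM_def by (rule psum_single[OF act_additive(1)])
      show ?case
        unfolding tens_single heis_mult_single act mult_cs tens_csM
        by (simp add: hm_def mon_def scal_single mult_single tens_single plus_word_def mult_ac)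
    qed
  qed
qed

lemma heis_mult_tens_left:
  "heis_mult (tens r p) (sg b' a' c) =
    csM b' (\<lambda>z w. tens (r * mon (Word w)) (scal c * (actP z p * mon (Word a'))))"
proof -
  have "Poly_Mapping.keys r \<subseteq> UNIV" by simp
  then show ?thesis
  proof (induction r rule: poly_mapping_span_induct)
    case zero
    show ?case by (simp add: cs_zero)
  next
    case (add r r')
    then show ?case by (simp add: tens_add_left heis_mult_add_left distrib_right cs_add)
  next
    case (single u d)
    have "Poly_Mapping.keys p \<subseteq> UNIV" by simp
    then show ?case
    proof (induction p rule: poly_mapping_span_induct)
      case zero
      show ?case by (simp add: actP_def cs_zero)
    next
      case (add p p')
      have "actP x (p + p') = actP x p + actP x p'" for x
        unfolding actP_def by (rule psum_add[OF act_additive(2)])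
      then show ?case using add by (simp add: tens_add_right heis_mult_add_left distrib_left distrib_right cs_add)
    next
      case (single v d')
      have act: "actP z (Poly_Mapping.single v d') =
          csP (letters v) (\<lambda>a1 a2. Poly_Mapping.single (Word a2) (d' * ph a1 z))" for z
        unfolding actP_def by (rule psum_single[OF act_additive(2)])
      show ?case
        unfolding tens_single heis_mult_single act mult_cs tens_csP csM_csP_swap
        by (simp add: hm_def mon_def scal_single mult_single tens_single plus_word_def mult_ac)
    qed
  qed
qed

lemma tens_closed:
  assumes "r \<in> carrier Fminus" "p \<in> carrier Fplus" shows "tens r p \<in> HC"
  unfolding tens_psum
proof (rule psum_property[where Q = "\<lambda>x. x \<in> HC", OF HC_zero HC_add])
  fix u c assume u: "u \<in> Poly_Mapping.keys r"
  show "psum (\<lambda>v d. Poly_Mapping.single (u, v) (c * d)) p \<in> HC"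
  proof (rule psum_property[where Q = "\<lambda>x. x \<in> HC", OF HC_zero HC_add])
    fix v d assume "v \<in> Poly_Mapping.keys p"
    then show "Poly_Mapping.single (u, v) (c * d) \<in> HC" using assms u by (auto simp: Fplus_carrier Fminus_carrier)
  qed
qed

lemma heis_ker_eq: "heis_ker = generate (add_monoid heis_free)
    {tens b a |b a. b \<in> carrier Fminus \<and> a \<in> carrier Fplus \<and> (radM b \<or> radP a)}"
  unfolding heis_ker_def using Uq_plus_zero_iff Uq_minus_zero_iff
  by (intro arg_cong[where f = "generate (add_monoid heis_free)"]) blast

lemma heis_ker_subgroup: "additive_subgroup heis_ker heis_free"
proof -
  interpret ring heis_free by (rule heis_free_ring)
  have "{tens b a |b a. b \<in> carrier Fminus \<and> a \<in> carrier Fplus \<and> (radM b \<or> radP a)} \<subseteq> carrier heis_free"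
    unfolding heis_free_ops using tens_closed by blast
  then show ?thesis
    unfolding heis_ker_eq by (intro additive_subgroupI add.generate_is_subgroup) simp
qed

lemma heis_ker_closed: "0 \<in> heis_ker" "x \<in> heis_ker \<Longrightarrow> y \<in> heis_ker \<Longrightarrow> x + y \<in> heis_ker"
  using additive_subgroup.zero_closed[OF heis_ker_subgroup]
    additive_subgroup.a_closed[OF heis_ker_subgroup, of x y] by (simp_all add: heis_free_ops)

lemma heis_ker_tens:
  "r \<in> carrier Fminus \<Longrightarrow> p \<in> carrier Fplus \<Longrightarrow> radM r \<or> radP p \<Longrightarrow> tens r p \<in> heis_ker"
  unfolding heis_ker_eq by (rule generate.incl) blast

lemma a_inv_heis: "x \<in> HC \<Longrightarrow> \<ominus>\<^bsub>heis_free\<^esub> x = - x"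
  using abelian_group.minus_equality[OF ring.is_abelian_group[OF heis_free_ring], of "- x" x] HC_uminus[of x]
  by (simp add: heis_free_ops)

lemma heis_mult_uminus: "heis_mult (- x) y = - heis_mult x y" "heis_mult x (- y) = - heis_mult x y"
  using heis_mult_add_left[of "- x" x y] heis_mult_add_right[of x "- y" y]
  by (simp_all add: eq_neg_iff_add_eq_0)

lemma heis_ker_uminus: "x \<in> heis_ker \<Longrightarrow> - x \<in> heis_ker"
  using additive_subgroup.a_inv_closed[OF heis_ker_subgroup, of x]
    additive_subgroup.a_subset[OF heis_ker_subgroup] ring.is_abelian_group[OF heis_free_ring]
  by (auto simp: a_inv_heis heis_free_ops subset_iff)

text \<open>Multiplying a tensor \<open>tens r p\<close> by words on one side changes \<open>r\<close> and \<open>p\<close> by multiplications and by the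
  maps \<open>actM\<close> and \<open>actP\<close>, which preserve the radicals.\<close>

lemma heis_ker_ideal: "ideal heis_ker heis_free"
proof (rule idealI[OF heis_free_ring])
  show "subgroup heis_ker (add_monoid heis_free)"
    using additive_subgroup.a_subgroup[OF heis_ker_subgroup] .
  have gen: "heis_mult y x \<in> heis_ker \<and> heis_mult x y \<in> heis_ker" if x: "x \<in> heis_ker" and y: "y \<in> HC" for x y
    using y
  proof (induction y rule: HC_induct)
    case zero
    then show ?case by (simp add: heis_ker_closed)
  next
    case (add y z)
    then show ?case by (simp add: heis_mult_add_left heis_mult_add_right heis_ker_closed)
  next
    case (single b' a' c)
    have T: "heis_mult (sg b' a' c) (tens r p) \<in> heis_ker \<and> heis_mult (tens r p) (sg b' a' c) \<in> heis_ker"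
      if rp: "r \<in> carrier Fminus" "p \<in> carrier Fplus" "radM r \<or> radP p" for r p
    proof
      show "heis_mult (sg b' a' c) (tens r p) \<in> heis_ker"
        unfolding heis_mult_tens_right
      proof (rule cs_property[where Q = "\<lambda>x. x \<in> heis_ker", OF csP_closed _ heis_ker_closed])
        fix x y assume "set x \<subseteq> LX" "set y \<subseteq> LX"
        then have xy: "x \<in> WX" "y \<in> WX" by auto
        show "tens (scal c * (mon (Word b') * actM x r)) (mon (Word y) * p) \<in> heis_ker"
        proof (rule heis_ker_tens)
          show "scal c * (mon (Word b') * actM x r) \<in> carrier Fminus" "mon (Word y) * p \<in> carrier Fplus"
            using xy rp single actM_closed by (auto intro!: Fplus_closed Fminus_closed)
          show "radM (scal c * (mon (Word b') * actM x r)) \<or> radP (mon (Word y) * p)"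
            using rp(3) radM_scal radM_mon_left[OF single(1) actM_closed[OF xy(1) rp(1)]] radM_actM[OF xy(1) rp(1)]
              radP_mon_left[OF xy(2) rp(2)] by blast
        qed
      qed (use single in auto)
      show "heis_mult (tens r p) (sg b' a' c) \<in> heis_ker"
        unfolding heis_mult_tens_left
      proof (rule cs_property[where Q = "\<lambda>x. x \<in> heis_ker", OF csM_closed _ heis_ker_closed])
        fix x y assume "set x \<subseteq> LY" "set y \<subseteq> LY"
        then have xy: "x \<in> WY" "y \<in> WY" by auto
        show "tens (r * mon (Word y)) (scal c * (actP x p * mon (Word a'))) \<in> heis_ker"
        proof (rule heis_ker_tens)
          show "r * mon (Word y) \<in> carrier Fminus" "scal c * (actP x p * mon (Word a')) \<in> carrier Fplus"
            using xy rp single actP_closed by (auto intro!: Fplus_closed Fminus_closed)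
          show "radM (r * mon (Word y)) \<or> radP (scal c * (actP x p * mon (Word a')))"
            using rp(3) radP_scal radP_mon_right[OF single(2) actP_closed[OF xy(1) rp(2)]] radP_actP[OF xy(1) rp(2)]
              radM_mon_right[OF xy(2) rp(1)] by blast
        qed
      qed (use single in auto)
    qed
    from x show ?case
      unfolding heis_ker_eq
    proof (induction x rule: generate.induct)
      case one
      show ?case using heis_ker_closed(1) by (simp add: heis_ker_eq heis_free_ops)
    next
      case (incl h)
      then show ?case unfolding heis_ker_eq[symmetric] using T by blast
    next
      case (inv h)
      then have "h \<in> HC" "heis_mult (sg b' a' c) h \<in> heis_ker \<and> heis_mult h (sg b' a' c) \<in> heis_ker"
        using T tens_closed by blast+
      moreover have "inv\<^bsub>add_monoid heis_free\<^esub> h = - h"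
        using a_inv_heis[OF \<open>h \<in> HC\<close>] unfolding a_inv_def .
      ultimately show ?case unfolding heis_ker_eq[symmetric]
        by (simp only: heis_mult_uminus heis_ker_uminus)
    next
      case (eng h k)
      then show ?case unfolding heis_ker_eq[symmetric]
        by (simp add: heis_free_ops heis_mult_add_left heis_mult_add_right heis_ker_closed)
    qed
  qed
  show "x \<otimes>\<^bsub>heis_free\<^esub> a \<in> heis_ker" "a \<otimes>\<^bsub>heis_free\<^esub> x \<in> heis_ker"
    if "a \<in> heis_ker" "x \<in> carrier heis_free" for a x
    using gen[of a x] that by (simp_all only: heis_free_ops)
qed

end

section \<open>The Gram matrix of the Hopf pairing\<close>

context qboson begin

lemmas lattice_closed = P_plus_root P_plus_uminus P_plus_add P_plus_zero

lemma words_WX: "[] \<in> WX" "x \<in> LX \<Longrightarrow> a \<in> WX \<Longrightarrow> x # a \<in> WX" "a \<in> WX \<Longrightarrow> a' \<in> WX \<Longrightarrow> a @ a' \<in> WX"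
  and words_WY: "[] \<in> WY" "y \<in> LY \<Longrightarrow> b \<in> WY \<Longrightarrow> y # b \<in> WY" "b \<in> WY \<Longrightarrow> b' \<in> WY \<Longrightarrow> b @ b' \<in> WY"
  by auto

text \<open>The classes of the words \<open>a\<close> and \<open>a'\<close> in the quotient by the radical agree up to the factor \<open>k\<close>.\<close>

definition eqP :: "complex \<Rightarrow> ('g \<Rightarrow> complex) lplus list \<Rightarrow> ('g \<Rightarrow> complex) lplus list \<Rightarrow> bool" where
  "eqP k a a' \<longleftrightarrow> a \<in> WX \<and> a' \<in> WX \<and> (\<forall>b\<in>WY. ph a b = k * ph a' b)"

definition eqM :: "complex \<Rightarrow> ('g \<Rightarrow> complex) lminus list \<Rightarrow> ('g \<Rightarrow> complex) lminus list \<Rightarrow> bool" where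
  "eqM k b b' \<longleftrightarrow> b \<in> WY \<and> b' \<in> WY \<and> (\<forall>a\<in>WX. ph a b = k * ph a b')"

lemma eqP_refl: "a \<in> WX \<Longrightarrow> eqP 1 a a" and eqM_refl: "b \<in> WY \<Longrightarrow> eqM 1 b b"
  by (simp_all add: eqP_def eqM_def)

lemma eqP_trans: "eqP k a a' \<Longrightarrow> eqP k' a' a'' \<Longrightarrow> eqP (k * k') a a''"
  and eqM_trans: "eqM k b b' \<Longrightarrow> eqM k' b' b'' \<Longrightarrow> eqM (k * k') b b''"
  by (simp_all add: eqP_def eqM_def)

lemma eqP_append:
  assumes "eqP k a a'" "x \<in> WX" "y \<in> WX" shows "eqP k (x @ a @ y) (x @ a' @ y)"
proof -
  have w: "a \<in> WX" "a' \<in> WX" "x @ a @ y \<in> WX" "x @ a' @ y \<in> WX"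
    and eq: "\<And>b. b \<in> WY \<Longrightarrow> ph a b = k * ph a' b"
    using assms by (auto simp: eqP_def)
  have r: "ph (a @ y) b = k * ph (a' @ y) b" if "b \<in> WY" for b
  proof -
    have "ph (a @ y) b = csM b (\<lambda>z v. k * (ph a' v * ph y z))"
      unfolding ph_append_left[OF w(1) assms(3) that]
      using that by (intro cs_cong[OF csM_closed]) (auto simp: eq)
    also have "\<dots> = k * csM b (\<lambda>z v. ph a' v * ph y z)"
      by (rule cs_hom[of "\<lambda>z. k * z", symmetric]) (simp_all add: distrib_left)
    finally show ?thesis by (simp only: ph_append_left[OF w(2) assms(3) that])
  qed
  have "ph (x @ a @ y) b = k * ph (x @ a' @ y) b" if "b \<in> WY" for b
  proof -
    have ay: "a @ y \<in> WX" "a' @ y \<in> WX" using w assms(3) by auto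
    have "ph (x @ a @ y) b = csM b (\<lambda>z v. k * (ph x v * ph (a' @ y) z))"
      unfolding ph_append_left[OF assms(2) ay(1) that]
      using that by (intro cs_cong[OF csM_closed]) (auto simp: r)
    also have "\<dots> = k * csM b (\<lambda>z v. ph x v * ph (a' @ y) z)"
      by (rule cs_hom[of "\<lambda>z. k * z", symmetric]) (simp_all add: distrib_left)
    finally show ?thesis by (simp only: ph_append_left[OF assms(2) ay(2) that])
  qed
  then show ?thesis using w by (simp add: eqP_def)
qed

lemma eqM_append:
  assumes "eqM k a a'" "x \<in> WY" "y \<in> WY" shows "eqM k (x @ a @ y) (x @ a' @ y)"
proof -
  have w: "a \<in> WY" "a' \<in> WY" "x @ a @ y \<in> WY" "x @ a' @ y \<in> WY"
    and eq: "\<And>b. b \<in> WX \<Longrightarrow> ph b a = k * ph b a'"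
    using assms by (auto simp: eqM_def)
  have r: "ph b (a @ y) = k * ph b (a' @ y)" if "b \<in> WX" for b
  proof -
    have "ph b (a @ y) = csP b (\<lambda>z v. k * (ph z a' * ph v y))"
      unfolding ph_append_right[OF that w(1) assms(3)]
      using that by (intro cs_cong[OF csP_closed]) (auto simp: eq)
    also have "\<dots> = k * csP b (\<lambda>z v. ph z a' * ph v y)"
      by (rule cs_hom[of "\<lambda>z. k * z", symmetric]) (simp_all add: distrib_left)
    finally show ?thesis by (simp only: ph_append_right[OF that w(2) assms(3)])
  qed
  have "ph b (x @ a @ y) = k * ph b (x @ a' @ y)" if "b \<in> WX" for b
  proof -
    have ay: "a @ y \<in> WY" "a' @ y \<in> WY" using w assms(3) by auto
    have "ph b (x @ a @ y) = csP b (\<lambda>z v. k * (ph z x * ph v (a' @ y)))"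
      unfolding ph_append_right[OF that assms(2) ay(1)]
      using that by (intro cs_cong[OF csP_closed]) (auto simp: r)
    also have "\<dots> = k * csP b (\<lambda>z v. ph z x * ph v (a' @ y))"
      by (rule cs_hom[of "\<lambda>z. k * z", symmetric]) (simp_all add: distrib_left)
    finally show ?thesis by (simp only: ph_append_right[OF that assms(2) ay(2)])
  qed
  then show ?thesis using w by (simp add: eqM_def)
qed

lemma eqP_rel:
  assumes "a \<in> WX" "a' \<in> WX" "mon (Word a) - scal k * mon (Word a') \<in> rel_plus" shows "eqP k a a'"
proof -
  have c: "mon (Word a) \<in> carrier Fplus" "mon (Word a') \<in> carrier Fplus"
    "scal k * mon (Word a') \<in> carrier Fplus"
    using assms(1,2) by (auto intro!: Fplus_closed)
  have "ph a b = k * ph a' b" if b: "b \<in> WY" for b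
    using cl_plus_eq[OF c(1,3) assms(3)] phi_scal_left[OF c(2) Fminus_closed(5), of b k] b
    by (simp add: ph_def)
  then show ?thesis using assms by (simp add: eqP_def)
qed

lemma eqM_rel:
  assumes "b \<in> WY" "b' \<in> WY" "mon (Word b) - scal k * mon (Word b') \<in> rel_minus" shows "eqM k b b'"
proof -
  have c: "mon (Word b) \<in> carrier Fminus" "mon (Word b') \<in> carrier Fminus"
    "scal k * mon (Word b') \<in> carrier Fminus"
    using assms(1,2) by (auto intro!: Fminus_closed)
  have "ph a b = k * ph a b'" if a: "a \<in> WX" for a
    using cl_minus_eq[OF c(1,3) assms(3)] phi_scal_right[OF Fplus_closed(5) c(2), of a k] a
    by (simp add: ph_def)
  then show ?thesis using assms by (simp add: eqM_def)
qed

lemma gen_mult: "gen x = mon (Word [x])" "mon (Word u) * mon (Word v) = mon (Word (u @ v))"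
  by (simp_all add: gen_def mon_mult Word_plus)

lemma torus_relations:
  assumes "\<mu> \<in> P_plus" "\<nu> \<in> P_plus"
  shows eqP_tt: "eqP 1 [Lt \<mu>, Lt \<nu>] [Lt (\<mu> + \<nu>)]" and eqM_tt: "eqM 1 [Lt' \<mu>, Lt' \<nu>] [Lt' (\<mu> + \<nu>)]"
proof -
  have "t \<mu> * t \<nu> - t (\<mu> + \<nu>) \<in> rel_plus" "t' \<mu> * t' \<nu> - t' (\<mu> + \<nu>) \<in> rel_minus"
    using assms by (auto simp: rel_plus_def rel_minus_def)
  then show "eqP 1 [Lt \<mu>, Lt \<nu>] [Lt (\<mu> + \<nu>)]" "eqM 1 [Lt' \<mu>, Lt' \<nu>] [Lt' (\<mu> + \<nu>)]"
    using assms by (auto intro!: eqP_rel eqM_rel simp: gen_mult P_plus_add)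
qed

lemma eqP_t0: "eqP 1 [Lt 0] []" and eqM_t0: "eqM 1 [Lt' 0] []"
proof -
  have "t 0 - 1 \<in> rel_plus" "t' 0 - 1 \<in> rel_minus" by (auto simp: rel_plus_def rel_minus_def)
  then show "eqP 1 [Lt 0] []" "eqM 1 [Lt' 0] []"
    by (auto intro!: eqP_rel eqM_rel simp: gen_mult P_plus_zero mon_Nil)
qed

lemma eqP_inv: "\<mu> \<in> P_plus \<Longrightarrow> eqP 1 [Lt \<mu>, Lt (- \<mu>)] []" "\<mu> \<in> P_plus \<Longrightarrow> eqP 1 [Lt (- \<mu>), Lt \<mu>] []"
  and eqM_inv: "\<mu> \<in> P_plus \<Longrightarrow> eqM 1 [Lt' \<mu>, Lt' (- \<mu>)] []" "\<mu> \<in> P_plus \<Longrightarrow> eqM 1 [Lt' (- \<mu>), Lt' \<mu>] []"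
  using eqP_trans[OF eqP_tt[of \<mu> "- \<mu>"], of 1 "[]"] eqP_trans[OF eqP_tt[of "- \<mu>" \<mu>], of 1 "[]"]
    eqM_trans[OF eqM_tt[of \<mu> "- \<mu>"], of 1 "[]"] eqM_trans[OF eqM_tt[of "- \<mu>" \<mu>], of 1 "[]"] eqP_t0 eqM_t0
  by (simp_all add: P_plus_uminus)

lemma eqP_tet:
  assumes "\<mu> \<in> P_plus" "i \<in> Ind" shows "eqP (qpow (form (\<alpha> i) \<mu>)) [Lt \<mu>, Le i, Lt (- \<mu>)] [Le i]"
proof -
  have "t \<mu> * e i * t (- \<mu>) - scal (qpow (form (\<alpha> i) \<mu>)) * e i \<in> rel_plus"
    using assms unfolding rel_plus_def by blast
  then show ?thesis using assms by (intro eqP_rel) (auto simp: gen_mult P_plus_uminus)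
qed

lemma eqM_tft:
  assumes "\<mu> \<in> P_plus" "i \<in> Ind" shows "eqM (qpow (- form (\<alpha> i) \<mu>)) [Lt' \<mu>, Lf i, Lt' (- \<mu>)] [Lf i]"
proof -
  have "t' \<mu> * f i * t' (- \<mu>) - scal (qpow (- form (\<alpha> i) \<mu>)) * f i \<in> rel_minus"
    using assms unfolding rel_minus_def by blast
  then show ?thesis using assms by (intro eqM_rel) (auto simp: gen_mult P_plus_uminus)
qed

lemma eqP_sym1: "eqP 1 a a' \<Longrightarrow> eqP 1 a' a" and eqM_sym1: "eqM 1 b b' \<Longrightarrow> eqM 1 b' b"
  by (simp_all add: eqP_def eqM_def)

lemma eqP_et:
  assumes \<mu>: "\<mu> \<in> P_plus" and i: "i \<in> Ind" shows "\<exists>k. eqP k [Le i, Lt \<mu>] [Lt \<mu>, Le i]"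
proof -
  have "eqP 1 [Lt \<mu>, Lt (- \<mu>), Le i, Lt \<mu>] [Le i, Lt \<mu>]"
    using eqP_append[OF eqP_inv(1)[OF \<mu>], of "[]" "[Le i, Lt \<mu>]"] \<mu> i by simp
  moreover have "eqP (qpow (form (\<alpha> i) (- \<mu>))) [Lt \<mu>, Lt (- \<mu>), Le i, Lt \<mu>] [Lt \<mu>, Le i]"
    using eqP_append[OF eqP_tet[OF P_plus_uminus[OF \<mu>] i], of "[Lt \<mu>]" "[]"] \<mu> i by simp
  ultimately show ?thesis using eqP_trans[OF eqP_sym1] by blast
qed

lemma eqM_tf:
  assumes \<mu>: "\<mu> \<in> P_plus" and i: "i \<in> Ind" shows "\<exists>k. eqM k [Lt' \<mu>, Lf i] [Lf i, Lt' \<mu>]"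
proof -
  have "eqM 1 [Lt' \<mu>, Lf i, Lt' (- \<mu>), Lt' \<mu>] [Lt' \<mu>, Lf i]"
    using eqM_append[OF eqM_inv(2)[OF \<mu>], of "[Lt' \<mu>, Lf i]" "[]"] \<mu> i by simp
  moreover have "eqM (qpow (- form (\<alpha> i) \<mu>)) [Lt' \<mu>, Lf i, Lt' (- \<mu>), Lt' \<mu>] [Lf i, Lt' \<mu>]"
    using eqM_append[OF eqM_tft[OF \<mu> i], of "[]" "[Lt' \<mu>]"] \<mu> i by simp
  ultimately show ?thesis using eqM_trans[OF eqM_sym1] by blast
qed

lemma eqP_t_comm: "\<mu> \<in> P_plus \<Longrightarrow> \<nu> \<in> P_plus \<Longrightarrow> eqP 1 [Lt \<mu>, Lt \<nu>] [Lt \<nu>, Lt \<mu>]"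
  using eqP_trans[OF eqP_tt[of \<mu> \<nu>] eqP_sym1[OF eqP_tt[of \<nu> \<mu>, unfolded add.commute[of \<nu>]]]] by simp

abbreviation fword :: "nat list \<Rightarrow> ('g \<Rightarrow> complex) lminus list" where "fword u \<equiv> map Lf u"

text \<open>The word of the product of the \<open>t\<^sub>\<alpha> e\<^sub>i\<close> for \<open>\<alpha> = \<alpha> i\<close>, which is \<open>e\<^sub>i'\<close> up to the factor \<open>\<kappa> i\<close>. As in \<open>Ew\<close> the
  head of \<open>w\<close> is the rightmost factor.\<close>

primrec eword :: "nat list \<Rightarrow> ('g \<Rightarrow> complex) lplus list" where
  "eword [] = []"
| "eword (i # w) = eword w @ [Lt (\<alpha> i), Le i]"

lemma eword_closed: "set w \<subseteq> Ind \<Longrightarrow> eword w \<in> WX"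
  by (induction w) (auto simp: P_plus_root)

lemma fword_closed: "set u \<subseteq> Ind \<Longrightarrow> fword u \<in> WY" by auto

lemma fword_torus:
  assumes \<mu>: "\<mu> \<in> P_plus" and "set u \<subseteq> Ind"
  shows "\<exists>k. eqM k ([Lt' \<mu>] @ fword u) (fword u @ [Lt' \<mu>])"
  using assms(2)
proof (induction u)
  case Nil
  then show ?case using eqM_refl[of "[Lt' \<mu>]"] \<mu> by auto
next
  case (Cons i u)
  then obtain k where "eqM k ([Lt' \<mu>] @ fword u) (fword u @ [Lt' \<mu>])" by auto
  then have "eqM k ([Lf i] @ ([Lt' \<mu>] @ fword u) @ []) ([Lf i] @ (fword u @ [Lt' \<mu>]) @ [])"
    using Cons.prems by (intro eqM_append) auto
  moreover obtain k' where "eqM k' [Lt' \<mu>, Lf i] [Lf i, Lt' \<mu>]" using eqM_tf[OF \<mu>] Cons.prems by auto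
  then have "eqM k' ([] @ [Lt' \<mu>, Lf i] @ fword u) ([] @ [Lf i, Lt' \<mu>] @ fword u)"
    using Cons.prems by (intro eqM_append) auto
  ultimately show ?case using eqM_trans by fastforce
qed

lemma eword_torus:
  assumes \<mu>: "\<mu> \<in> P_plus" and "set w \<subseteq> Ind"
  shows "\<exists>k. eqP k (eword w @ [Lt \<mu>]) ([Lt \<mu>] @ eword w)"
  using assms(2)
proof (induction w)
  case Nil
  then show ?case using eqP_refl[of "[Lt \<mu>]"] \<mu> by auto
next
  case (Cons i w)
  then have i: "i \<in> Ind" and w: "eword w \<in> WX" using eword_closed by auto
  obtain k where "eqP k [Le i, Lt \<mu>] [Lt \<mu>, Le i]" using eqP_et[OF \<mu> i] by blast
  then have "eqP k ((eword w @ [Lt (\<alpha> i)]) @ [Le i, Lt \<mu>] @ []) ((eword w @ [Lt (\<alpha> i)]) @ [Lt \<mu>, Le i] @ [])"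
    using w i by (intro eqP_append) (auto simp: P_plus_root)
  moreover have "eqP 1 (eword w @ [Lt (\<alpha> i), Lt \<mu>] @ [Le i]) (eword w @ [Lt \<mu>, Lt (\<alpha> i)] @ [Le i])"
    using w i \<mu> by (intro eqP_append eqP_t_comm) (auto simp: P_plus_root)
  moreover obtain k' where "eqP k' (eword w @ [Lt \<mu>]) ([Lt \<mu>] @ eword w)" using Cons by auto
  then have "eqP k' ([] @ (eword w @ [Lt \<mu>]) @ [Lt (\<alpha> i), Le i]) ([] @ ([Lt \<mu>] @ eword w) @ [Lt (\<alpha> i), Le i])"
    using i by (intro eqP_append) (auto simp: P_plus_root)
  ultimately have "eqP (k * (1 * k')) (eword (i # w) @ [Lt \<mu>]) ([Lt \<mu>] @ eword (i # w))"
    by (intro eqP_trans) simp_all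
  then show ?case by blast
qed

text \<open>Torus letters move to the right end, where they merge into one.\<close>

lemma fword_normal_form:
  "b \<in> WY \<Longrightarrow> \<exists>k u \<mu>. set u \<subseteq> Ind \<and> \<mu> \<in> P_plus \<and> eqM k b (fword u @ [Lt' \<mu>])"
proof (induction b)
  case Nil
  have "set [] \<subseteq> Ind" "eqM 1 [] (fword [] @ [Lt' 0])" using eqM_sym1[OF eqM_t0] by simp_all
  then show ?case using P_plus_zero by blast
next
  case (Cons y b)
  then obtain k u \<mu> where u: "set u \<subseteq> Ind" "\<mu> \<in> P_plus" "eqM k b (fword u @ [Lt' \<mu>])" by auto
  from Cons.prems consider (a) i where "y = Lf i" "i \<in> Ind" | (b) \<nu> where "y = Lt' \<nu>" "\<nu> \<in> P_plus" by auto
  then show ?case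
  proof cases
    case a
    then have "eqM k ([y] @ b @ []) ([y] @ (fword u @ [Lt' \<mu>]) @ [])" using u by (intro eqM_append) auto
    then show ?thesis using a u by (intro exI[of _ k] exI[of _ "i # u"] exI[of _ \<mu>]) simp
  next
    case b
    then have 1: "eqM k ([y] @ b @ []) ([y] @ (fword u @ [Lt' \<mu>]) @ [])" using u by (intro eqM_append) auto
    obtain k' where "eqM k' ([Lt' \<nu>] @ fword u) (fword u @ [Lt' \<nu>])" using fword_torus[OF b(2) u(1)] by blast
    then have "eqM k' ([] @ ([Lt' \<nu>] @ fword u) @ [Lt' \<mu>]) ([] @ (fword u @ [Lt' \<nu>]) @ [Lt' \<mu>])"
      using u by (intro eqM_append) auto
    moreover have "eqM 1 (fword u @ [Lt' \<nu>, Lt' \<mu>] @ []) (fword u @ [Lt' (\<nu> + \<mu>)] @ [])"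
      using u b by (intro eqM_append eqM_tt) auto
    ultimately have "eqM (k * (k' * 1)) (y # b) (fword u @ [Lt' (\<nu> + \<mu>)])"
      using 1 b by (intro eqM_trans[OF _ eqM_trans]) simp_all
    then show ?thesis using u b P_plus_add by blast
  qed
qed

text \<open>Torus letters move to the left end, where they merge into one. A letter \<open>Le i\<close> becomes the pair that
  represents \<open>e\<^sub>i'\<close> by splitting off the torus letter of \<open>- \<alpha> i\<close>.\<close>

lemma eword_normal_form:
  "a \<in> WX \<Longrightarrow> \<exists>k w \<mu>. set w \<subseteq> Ind \<and> \<mu> \<in> P_plus \<and> eqP k a ([Lt \<mu>] @ eword w)"
proof (induction a rule: rev_induct)
  case Nil
  have "set [] \<subseteq> Ind" "eqP 1 [] ([Lt 0] @ eword [])" using eqP_sym1[OF eqP_t0] by simp_all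
  then show ?case using P_plus_zero by blast
next
  case (snoc x a)
  then obtain k w \<mu> where w: "set w \<subseteq> Ind" "\<mu> \<in> P_plus" "eqP k a ([Lt \<mu>] @ eword w)" by auto
  have ew: "eword w \<in> WX" using eword_closed w by simp
  have torus: "\<exists>k' \<mu>'. \<mu>' \<in> P_plus \<and> eqP k' (a @ [Lt \<nu>]) ([Lt \<mu>'] @ eword w)" if \<nu>: "\<nu> \<in> P_plus" for \<nu>
  proof -
    have 1: "eqP k ([] @ a @ [Lt \<nu>]) ([] @ ([Lt \<mu>] @ eword w) @ [Lt \<nu>])" using w \<nu> by (intro eqP_append) auto
    obtain k' where "eqP k' (eword w @ [Lt \<nu>]) ([Lt \<nu>] @ eword w)" using eword_torus[OF \<nu> w(1)] by blast
    then have "eqP k' ([Lt \<mu>] @ (eword w @ [Lt \<nu>]) @ []) ([Lt \<mu>] @ ([Lt \<nu>] @ eword w) @ [])"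
      using w by (intro eqP_append) auto
    moreover have "eqP 1 ([] @ [Lt \<mu>, Lt \<nu>] @ eword w) ([] @ [Lt (\<mu> + \<nu>)] @ eword w)"
      using w \<nu> ew by (intro eqP_append eqP_tt) auto
    ultimately have "eqP (k * (k' * 1)) (a @ [Lt \<nu>]) ([Lt (\<mu> + \<nu>)] @ eword w)"
      using 1 by (intro eqP_trans[OF _ eqP_trans]) simp_all
    then show ?thesis using w \<nu> P_plus_add by blast
  qed
  from snoc.prems consider (a) i where "x = Le i" "i \<in> Ind" | (b) \<nu> where "x = Lt \<nu>" "\<nu> \<in> P_plus" by auto
  then show ?case
  proof cases
    case a
    then have P: "- \<alpha> i \<in> P_plus" "\<alpha> i \<in> P_plus" by (simp_all add: lattice_closed)
    have aw: "a \<in> WX" using snoc.prems by simp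
    have "eqP 1 (a @ [Lt (- \<alpha> i), Lt (\<alpha> i)] @ [Le i]) (a @ [] @ [Le i])"
      using a aw P by (intro eqP_append eqP_inv) auto
    moreover obtain k' \<mu>' where k': "\<mu>' \<in> P_plus" "eqP k' (a @ [Lt (- \<alpha> i)]) ([Lt \<mu>'] @ eword w)"
      using torus[OF P(1)] by blast
    then have "eqP k' ([] @ (a @ [Lt (- \<alpha> i)]) @ [Lt (\<alpha> i), Le i]) ([] @ ([Lt \<mu>'] @ eword w) @ [Lt (\<alpha> i), Le i])"
      using P a by (intro eqP_append) auto
    ultimately have "eqP (1 * k') (a @ [Le i]) ([Lt \<mu>'] @ eword (i # w))"
      by (intro eqP_trans[OF eqP_sym1]) simp_all
    then show ?thesis using a w k' by (intro exI[of _ "1 * k'"] exI[of _ "i # w"] exI[of _ \<mu>']) simp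
  next
    case b
    then show ?thesis using torus w by blast
  qed
qed

abbreviation \<kappa> :: "nat \<Rightarrow> complex" where "\<kappa> i \<equiv> inverse (q_i i) - q_i i"

definition qmat :: "nat \<Rightarrow> nat \<Rightarrow> complex" where "qmat i j = qpow (- form (\<alpha> i) (\<alpha> j))"

lemma pair_e_Nil: assumes "i \<in> Ind" shows "ph [Lt (\<alpha> i), Le i] [] = 0"
proof -
  have "[Lt (\<alpha> i), Le i] \<in> WX" using assms by (auto simp: P_plus_root)
  then show ?thesis by (simp add: ph_Nil_right epsP_def)
qed

lemma pair_tt_inv: "i \<in> Ind \<Longrightarrow> b \<in> WY \<Longrightarrow> ph [Lt (\<alpha> i), Lt (- \<alpha> i)] b = epsM b"
  using eqP_inv(1)[OF P_plus_root] ph_Nil_left by (simp add: eqP_def)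

lemma pair_e_append:
  assumes i: "i \<in> Ind" and b: "b \<in> WY" "b' \<in> WY"
  shows "ph [Lt (\<alpha> i), Le i] (b @ b') =
    ph [Lt (\<alpha> i), Le i] b * epsM b' + ph [Lt (\<alpha> i)] b * ph [Lt (\<alpha> i), Le i] b'"
proof -
  have "[Lt (\<alpha> i), Le i] \<in> WX" using i by (auto simp: P_plus_root)
  then have "ph [Lt (\<alpha> i), Le i] (b @ b') = csP [Lt (\<alpha> i), Le i] (\<lambda>x y. ph x b * ph y b')"
    using b by (rule ph_append_right)
  then show ?thesis using pair_tt_inv[OF i b(2)] by (simp add: dlP_simps)
qed

lemma pair_e_f:
  assumes ij: "i \<in> Ind" "j \<in> Ind" shows "\<kappa> i * ph [Lt (\<alpha> i), Le i] [Lf j] = (if i = j then 1 else 0)"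
proof -
  have w: "[Lt (\<alpha> i)] \<in> WX" "[Le i] \<in> WX" "[Lf j] \<in> WY" using ij by (auto simp: P_plus_root)
  have "ph ([Lt (\<alpha> i)] @ [Le i]) [Lf j] = ph [Lt (\<alpha> i)] [] * ph [Le i] [Lf j]"
    unfolding ph_append_left[OF w] using ij by (simp add: dlM_simps ph_gens P_plus_root)
  also have "ph [Lt (\<alpha> i)] [] = 1" using w by (simp add: ph_Nil_right epsP_def)
  finally show ?thesis using ij q_i_nonzero[OF ij(1)] by (auto simp: ph_gens)
qed

lemma pair_e_t:
  assumes i: "i \<in> Ind" and \<mu>: "\<mu> \<in> P_plus" shows "ph [Lt (\<alpha> i), Le i] [Lt' \<mu>] = 0"
proof -
  have w: "[Lt (\<alpha> i)] \<in> WX" "[Le i] \<in> WX" "[Lt' \<mu>] \<in> WY" using i \<mu> by (auto simp: P_plus_root)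
  have "ph ([Lt (\<alpha> i)] @ [Le i]) [Lt' \<mu>] = 0"
    unfolding ph_append_left[OF w] using i \<mu> by (simp add: dlM_simps ph_gens)
  then show ?thesis by simp
qed

text \<open>The element \<open>e\<^sub>i'\<close> is primitive up to torus elements, so in its pairing with the first tensor factors it
  meets exactly one letter of \<open>u\<close>. The letters \<open>f\<^sub>j\<close> to the left of it contribute \<open>t'\<close> of \<open>\<alpha> j\<close>, whose pairing with
  \<open>t\<close> of \<open>\<alpha> i\<close> is the factor \<open>qmat i j\<close>.\<close>

lemma csM_contract:
  assumes i: "i \<in> Ind" and "set u \<subseteq> Ind"
  shows "csM (fword u) (\<lambda>x y. \<kappa> i * ph [Lt (\<alpha> i), Le i] x * g y) =
    (\<Sum>p\<leftarrow>contract qmat i u. fst p * g (fword (snd p)))"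
  using assms(2)
proof (induction u arbitrary: g)
  case Nil
  then show ?case by (simp add: pair_e_Nil[OF i])
next
  case (Cons j u)
  then have j: "j \<in> Ind" and u: "set u \<subseteq> Ind" by auto
  have "csM (fword u) (\<lambda>x y. \<kappa> i * ph [Lt (\<alpha> i), Le i] (Lf j # x) * g y) =
      csM (fword u) (\<lambda>x y. ((if i = j then 1 else 0) * epsM x) * g y)"
  proof (rule cs_cong[OF csM_closed])
    show "set (fword u) \<subseteq> LY" using u by auto
    fix x y assume "set x \<subseteq> LY"
    then have "ph [Lt (\<alpha> i), Le i] ([Lf j] @ x) = ph [Lt (\<alpha> i), Le i] [Lf j] * epsM x"
      using i j by (subst pair_e_append) (auto simp: ph_gens P_plus_root)
    then have "\<kappa> i * ph [Lt (\<alpha> i), Le i] (Lf j # x) = (\<kappa> i * ph [Lt (\<alpha> i), Le i] [Lf j]) * epsM x"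
      by simp
    then show "\<kappa> i * ph [Lt (\<alpha> i), Le i] (Lf j # x) * g y = ((if i = j then 1 else 0) * epsM x) * g y"
      by (simp only: pair_e_f[OF i j])
  qed
  also have "\<dots> = (if i = j then 1 else 0) * g (fword u)"
    by (rule csM_counit[of "\<lambda>y c. c * g y"]) (simp add: coeff_additive_def distrib_right)
  finally have A: "csM (fword u) (\<lambda>x y. \<kappa> i * ph [Lt (\<alpha> i), Le i] (Lf j # x) * g y) =
      (if i = j then 1 else 0) * g (fword u)" .
  have "csM (fword u) (\<lambda>x y. \<kappa> i * ph [Lt (\<alpha> i), Le i] (Lt' (\<alpha> j) # x) * g (Lf j # y)) =
      csM (fword u) (\<lambda>x y. \<kappa> i * ph [Lt (\<alpha> i), Le i] x * (qmat i j * g (Lf j # y)))"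
  proof (rule cs_cong[OF csM_closed])
    show "set (fword u) \<subseteq> LY" using u by auto
    fix x y assume "set x \<subseteq> LY"
    then have "ph [Lt (\<alpha> i), Le i] ([Lt' (\<alpha> j)] @ x) = qmat i j * ph [Lt (\<alpha> i), Le i] x"
      using i j by (subst pair_e_append) (auto simp: pair_e_t ph_gens P_plus_root qmat_def)
    then show "\<kappa> i * ph [Lt (\<alpha> i), Le i] (Lt' (\<alpha> j) # x) * g (Lf j # y) =
        \<kappa> i * ph [Lt (\<alpha> i), Le i] x * (qmat i j * g (Lf j # y))"
      by simp
  qed
  also have "\<dots> = (\<Sum>p\<leftarrow>contract qmat i u. fst p * (qmat i j * g (Lf j # fword (snd p))))"
    by (rule Cons.IH[OF u])
  finally show ?case using A by (simp add: dlM_simps o_def mult_ac)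
qed

definition pe :: "nat list \<Rightarrow> ('g \<Rightarrow> complex) lminus list \<Rightarrow> complex" where
  "pe w b = prod_list (map \<kappa> w) * ph (eword w) b"

lemma pe_Cons:
  assumes "set (i # w) \<subseteq> Ind" "b \<in> WY"
  shows "pe (i # w) b = csM b (\<lambda>x y. \<kappa> i * ph [Lt (\<alpha> i), Le i] x * pe w y)"
proof -
  have "eword w \<in> WX" "[Lt (\<alpha> i), Le i] \<in> WX" using assms eword_closed by (auto simp: P_plus_root)
  then have "ph (eword (i # w)) b = csM b (\<lambda>x y. ph (eword w) y * ph [Lt (\<alpha> i), Le i] x)"
    using assms by (simp add: ph_append_left)
  then have "pe (i # w) b = (\<kappa> i * prod_list (map \<kappa> w)) * csM b (\<lambda>x y. ph (eword w) y * ph [Lt (\<alpha> i), Le i] x)"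
    by (simp add: pe_def)
  also have "\<dots> = csM b (\<lambda>x y. (\<kappa> i * prod_list (map \<kappa> w)) * (ph (eword w) y * ph [Lt (\<alpha> i), Le i] x))"
    by (rule cs_hom) (simp_all only: mult_zero_right distrib_left)
  finally show ?thesis by (simp add: pe_def mult_ac)
qed

text \<open>The Gram matrix of the Hopf pairing is the matrix of vacuum expectation values: by \<open>csM_contract\<close> both
  satisfy the same recursion.\<close>

lemma pe_vev: "set w \<subseteq> Ind \<Longrightarrow> set u \<subseteq> Ind \<Longrightarrow> pe w (fword u) = vev qmat w u"
proof (induction w arbitrary: u)
  case Nil
  have "epsM (fword u) = (if u = [] then 1 else 0)" by (cases u) (simp_all add: epsM_def)
  then show ?case using ph_Nil_left[OF fword_closed[OF Nil(2)]] by (simp add: pe_def)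
next
  case (Cons i w)
  have "pe (i # w) (fword u) = (\<Sum>p\<leftarrow>contract qmat i u. fst p * pe w (fword (snd p)))"
    unfolding pe_Cons[OF Cons.prems(1) fword_closed[OF Cons.prems(2)]]
    by (rule csM_contract) (use Cons.prems in auto)
  also have "\<dots> = (\<Sum>p\<leftarrow>contract qmat i u. fst p * vev qmat w (snd p))"
  proof (rule sum_list_cong)
    fix p assume "p \<in> set (contract qmat i u)"
    then have "set (snd p) \<subseteq> Ind" using contract_words Cons.prems(2) by blast
    then show "fst p * pe w (fword (snd p)) = fst p * vev qmat w (snd p)" using Cons by simp
  qed
  finally show ?case by simp
qed

lemma pe_torus: "set w \<subseteq> Ind \<Longrightarrow> b \<in> WY \<Longrightarrow> \<mu> \<in> P_plus \<Longrightarrow> pe w (b @ [Lt' \<mu>]) = pe w b"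
proof (induction w arbitrary: b)
  case Nil
  then have "b @ [Lt' \<mu>] \<in> WY" by auto
  then show ?case using Nil by (simp add: pe_def ph_Nil_left epsM_def)
next
  case (Cons i w)
  have bt: "b @ [Lt' \<mu>] \<in> WY" using Cons.prems by auto
  have "pe (i # w) (b @ [Lt' \<mu>]) =
      csM b (\<lambda>x y. \<kappa> i * ph [Lt (\<alpha> i), Le i] (x @ [Lt' \<mu>]) * pe w (y @ [Lt' \<mu>]))"
    unfolding pe_Cons[OF Cons.prems(1) bt] by (simp add: cs_append dlM_simps)
  also have "\<dots> = csM b (\<lambda>x y. \<kappa> i * ph [Lt (\<alpha> i), Le i] x * pe w y)"
  proof (rule cs_cong[OF csM_closed])
    show "set b \<subseteq> LY" using Cons.prems by simp
    fix x y assume xy: "set x \<subseteq> LY" "set y \<subseteq> LY"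
    have "epsM [Lt' \<mu>] = 1" by (simp add: epsM_def)
    then have "ph [Lt (\<alpha> i), Le i] (x @ [Lt' \<mu>]) = ph [Lt (\<alpha> i), Le i] x"
      using xy Cons.prems by (subst pair_e_append) (auto simp: pair_e_t)
    moreover have "pe w (y @ [Lt' \<mu>]) = pe w y" using xy Cons by simp
    ultimately show "\<kappa> i * ph [Lt (\<alpha> i), Le i] (x @ [Lt' \<mu>]) * pe w (y @ [Lt' \<mu>]) =
        \<kappa> i * ph [Lt (\<alpha> i), Le i] x * pe w y" by simp
  qed
  finally show ?case using pe_Cons[of i w b] Cons.prems by simp
qed

lemma pair_t_fword:
  fixes g :: "('g \<Rightarrow> complex) lminus list \<Rightarrow> complex"
  assumes \<mu>: "\<mu> \<in> P_plus" and "set u \<subseteq> Ind"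
  shows "csM (fword u) (\<lambda>x y. ph [Lt \<mu>] y * g x) = g (fword u)"
  using assms(2)
proof (induction u arbitrary: g)
  case Nil
  have "[Lt \<mu>] \<in> WX" using \<mu> by simp
  then show ?case by (simp add: ph_Nil_right epsP_def)
next
  case (Cons j u)
  then have j: "j \<in> Ind" and u: "set u \<subseteq> Ind" by auto
  have "csM (fword u) (\<lambda>x y. ph [Lt \<mu>] (Lf j # y) * g (Lt' (\<alpha> j) # x)) = 0"
  proof (rule csM_zero)
    show "fword u \<in> WY" using u by auto
    fix y assume y: "y \<in> WY"
    have "ph [Lt \<mu>] ([Lf j] @ y) = 0"
      using \<mu> j y by (subst ph_append_right) (auto simp: dlP_simps ph_gens)
    then show "ph [Lt \<mu>] (Lf j # y) * g (Lt' (\<alpha> j) # x) = 0" for x by simp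
  qed
  then show ?case using Cons.IH[OF u, of "\<lambda>x. g (Lf j # x)"] by (simp add: dlM_simps)
qed

lemma pair_torus_left:
  assumes "\<mu> \<in> P_plus" "a \<in> WX" "set u \<subseteq> Ind" shows "ph ([Lt \<mu>] @ a) (fword u) = ph a (fword u)"
proof -
  have "[Lt \<mu>] \<in> WX" "fword u \<in> WY" using assms by auto
  then show ?thesis
    using pair_t_fword[OF assms(1,3), of "\<lambda>x. ph a x"] assms(2) by (subst ph_append_left) simp_all
qed

text \<open>By the normal form an arbitrary word pairs with \<open>E\<close>-words like a multiple of an \<open>F\<close>-word, and words of
  different lengths are orthogonal.\<close>

lemma radP_combination:
  assumes fin: "finite A" and A: "\<And>w. w \<in> A \<Longrightarrow> length w = k \<and> set w \<subseteq> Ind"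
    and zero: "\<And>u. length u = k \<Longrightarrow> set u \<subseteq> Ind \<Longrightarrow> (\<Sum>w\<in>A. c w * vev qmat w u) = 0"
  shows "radP (\<Sum>w\<in>A. Poly_Mapping.single (Word (eword w)) (c w * prod_list (map \<kappa> w)))"
  unfolding radP_def
proof
  fix b assume b: "b \<in> WY"
  have "lpair (\<Sum>w\<in>A. Poly_Mapping.single (Word (eword w)) (c w * prod_list (map \<kappa> w))) b =
      (\<Sum>w\<in>A. c w * pe w b)"
    using fin
    by (induction A rule: finite_induct)
      (simp_all add: lpair_def psum_add[OF coeff_additive_times] psum_single[OF coeff_additive_times] pe_def)
  also have "\<dots> = 0"
  proof -
    obtain d u \<mu> where u: "set u \<subseteq> Ind" "\<mu> \<in> P_plus" "eqM d b (fword u @ [Lt' \<mu>])"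
      using fword_normal_form[OF b] by blast
    have "pe w b = d * vev qmat w u" if "w \<in> A" for w
    proof -
      have "pe w b = d * pe w (fword u @ [Lt' \<mu>])"
        using u(3) eword_closed[of w] A[OF that] by (simp add: eqM_def pe_def)
      then show ?thesis using pe_torus[of w "fword u" \<mu>] pe_vev[of w u] A[OF that] u fword_closed by simp
    qed
    then have "(\<Sum>w\<in>A. c w * pe w b) = d * (\<Sum>w\<in>A. c w * vev qmat w u)"
      by (simp add: sum_distrib_left mult_ac)
    also have "(\<Sum>w\<in>A. c w * vev qmat w u) = 0"
    proof (cases "length u = k")
      case False
      then show ?thesis using A by (intro sum.neutral) (auto simp: vev_eq_0)
    qed (use zero u in simp)
    finally show ?thesis by simp
  qed
  finally show "lpair (\<Sum>w\<in>A. Poly_Mapping.single (Word (eword w)) (c w * prod_list (map \<kappa> w))) b = 0" .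
qed

lemma prod_\<kappa>_nonzero: "set w \<subseteq> Ind \<Longrightarrow> prod_list (map \<kappa> w) \<noteq> 0"
  by (induction w) (auto simp: q_i_nonzero simp del: right_minus_eq)

text \<open>The mirror image of \<open>radP_combination\<close>, with the normal form of the other argument.\<close>

lemma radM_combination:
  assumes fin: "finite A" and A: "\<And>u. u \<in> A \<Longrightarrow> length u = k \<and> set u \<subseteq> Ind"
    and zero: "\<And>w. length w = k \<Longrightarrow> set w \<subseteq> Ind \<Longrightarrow> (\<Sum>u\<in>A. c u * vev qmat w u) = 0"
  shows "radM (\<Sum>u\<in>A. Poly_Mapping.single (Word (fword u)) (c u))"
  unfolding radM_def
proof
  fix a assume a: "a \<in> WX"
  have "rpair a (\<Sum>u\<in>A. Poly_Mapping.single (Word (fword u)) (c u)) = (\<Sum>u\<in>A. c u * ph a (fword u))"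
    using fin
    by (induction A rule: finite_induct)
      (simp_all add: rpair_def psum_add[OF coeff_additive_times] psum_single[OF coeff_additive_times])
  also have "\<dots> = 0"
  proof -
    obtain d w \<mu> where w: "set w \<subseteq> Ind" "\<mu> \<in> P_plus" "eqP d a ([Lt \<mu>] @ eword w)"
      using eword_normal_form[OF a] by blast
    have "ph a (fword u) = d / prod_list (map \<kappa> w) * vev qmat w u" if "u \<in> A" for u
    proof -
      have "ph a (fword u) = d * ph ([Lt \<mu>] @ eword w) (fword u)"
        using w(3) fword_closed[of u] A[OF that] unfolding eqP_def by blast
      also have "ph ([Lt \<mu>] @ eword w) (fword u) = ph (eword w) (fword u)"
        using w A[OF that] eword_closed by (intro pair_torus_left) auto
      also have "ph (eword w) (fword u) = vev qmat w u / prod_list (map \<kappa> w)"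
        using pe_vev[of w u] prod_\<kappa>_nonzero[OF w(1)] w(1) A[OF that] by (simp add: pe_def field_simps)
      finally show ?thesis by simp
    qed
    then have "(\<Sum>u\<in>A. c u * ph a (fword u)) = d / prod_list (map \<kappa> w) * (\<Sum>u\<in>A. c u * vev qmat w u)"
      by (simp add: sum_distrib_left sum_divide_distrib mult_ac)
    also have "(\<Sum>u\<in>A. c u * vev qmat w u) = 0"
    proof (cases "length w = k")
      case False
      then show ?thesis using A by (intro sum.neutral) (auto simp: vev_eq_0)
    qed (use zero w in simp)
    finally show ?thesis by simp
  qed
  finally show "rpair a (\<Sum>u\<in>A. Poly_Mapping.single (Word (fword u)) (c u)) = 0" .
qed

end

section \<open>Images of the Heisenberg double\<close>

lemma sum_property:
  "Q 0 \<Longrightarrow> (\<And>x y. Q x \<Longrightarrow> Q y \<Longrightarrow> Q (x + y)) \<Longrightarrow> (\<And>x. x \<in> A \<Longrightarrow> Q (g x)) \<Longrightarrow> Q (sum g A)"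
  by (induction A rule: infinite_finite_induct) auto

context qboson begin

lemma heis_mult_sg_left:
  assumes "b' \<in> WY" shows "heis_mult (sg b [] c) (sg b' a' c') = sg (b @ b') a' (c * c')"
proof -
  have "heis_mult (sg b [] c) (sg b' a' c') = csM b' (\<lambda>b1 b2. sg (b @ b2) a' (c * c' * epsM b1))"
    unfolding heis_mult_sg hm_def cs.simps
    using assms by (intro cs_cong[OF csM_closed]) (auto simp: ph_Nil_left)
  also have "\<dots> = sg (b @ b') a' (c * c')"
    by (rule csM_counit[of "\<lambda>b2 c. sg (b @ b2) a' c"]) (simp add: coeff_additive_def single_add)
  finally show ?thesis .
qed

lemma heis_mult_sg_right:
  assumes "a \<in> WX" shows "heis_mult (sg b a c) (sg [] a' c') = sg b (a @ a') (c * c')"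
proof -
  have "heis_mult (sg b a c) (sg [] a' c') = csP a (\<lambda>a1 a2. sg b (a2 @ a') (c * c' * epsP a1))"
    unfolding heis_mult_sg hm_def cs.simps append_Nil2
    using assms by (intro cs_cong[OF csP_closed]) (auto simp: ph_Nil_right)
  also have "\<dots> = sg b (a @ a') (c * c')"
    by (rule csP_counit[of "\<lambda>a2 c. sg b (a2 @ a') c"]) (simp add: coeff_additive_def single_add)
  finally show ?thesis .
qed

lemma heis_scalar_central: "x \<in> HC \<Longrightarrow> heis_mult (sg [] [] k) x = heis_mult x (sg [] [] k)"
proof (induction x rule: HC_induct)
  case (single b a c)
  then show ?case by (simp add: heis_mult_sg_left heis_mult_sg_right mult.commute del: mem_Collect_eq)
qed (simp_all add: heis_mult_add_left heis_mult_add_right)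

lemma tens_one: "tens 1 (Poly_Mapping.single (Word a) c) = sg [] a c"
  "tens (Poly_Mapping.single (Word b) c) 1 = sg b [] c"
  using tens_single[of 0 1 "Word a" c] tens_single[of "Word b" c 0 1] by (simp_all add: Word_Nil)

lemma tens_sum:
  fixes p :: "'i \<Rightarrow> ('g \<Rightarrow> complex) fplus" and r :: "'i \<Rightarrow> ('g \<Rightarrow> complex) fminus"
  shows "tens b (\<Sum>x\<in>A. p x) = (\<Sum>x\<in>A. tens b (p x))" "tens (\<Sum>x\<in>A. r x) a = (\<Sum>x\<in>A. tens (r x) a)"
  by (induction A rule: infinite_finite_induct) (simp_all add: tens_add_left tens_add_right)

lemma heis_E_F:
  assumes ij: "i \<in> Ind" "j \<in> Ind"
  shows "heis_mult (sg [] [Lt (\<alpha> i), Le i] (\<kappa> i)) (sg [Lf j] [] 1) =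
    heis_mult (sg [] [] (qmat i j)) (heis_mult (sg [Lf j] [] 1) (sg [] [Lt (\<alpha> i), Le i] (\<kappa> i))) +
    sg [] [Lt (\<alpha> i), Lt (- \<alpha> i)] (if i = j then 1 else 0)"
proof -
  have P: "\<alpha> i \<in> P_plus" "\<alpha> j \<in> P_plus" "[Lf j] \<in> WY" using ij P_plus_root by auto
  have "heis_mult (sg [] [Lt (\<alpha> i), Le i] (\<kappa> i)) (sg [Lf j] [] 1) =
      sg [] [Lt (\<alpha> i), Lt (- \<alpha> i)] (\<kappa> i * ph [Lt (\<alpha> i), Le i] [Lf j]) +
      sg [Lf j] [Lt (\<alpha> i), Le i] (\<kappa> i * qmat i j)"
    unfolding heis_mult_sg hm_def
    using ij P by (simp add: dlP_simps dlM_simps ph_gens pair_e_t qmat_def)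
  moreover have "heis_mult (sg [] [] (qmat i j)) (heis_mult (sg [Lf j] [] 1) (sg [] [Lt (\<alpha> i), Le i] (\<kappa> i))) =
      sg [Lf j] [Lt (\<alpha> i), Le i] (\<kappa> i * qmat i j)"
    using heis_mult_sg_left[OF words_WY(1), of "[Lf j]" 1 "[Lt (\<alpha> i), Le i]" "\<kappa> i"]
      heis_mult_sg_left[OF P(3), of "[]" "qmat i j" "[Lt (\<alpha> i), Le i]" "\<kappa> i"] by (simp add: mult.commute)
  ultimately show ?thesis unfolding pair_e_f[OF ij] by simp
qed

lemma heis_T_E:
  assumes i: "i \<in> Ind" and \<nu>: "\<nu> \<in> P_plus"
  shows "heis_mult (sg [Lt' \<nu>] [] 1) (sg [] [Lt (\<alpha> i), Le i] (\<kappa> i)) =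
    heis_mult (sg [] [] (qpow (form (\<alpha> i) \<nu>))) (heis_mult (sg [] [Lt (\<alpha> i), Le i] (\<kappa> i)) (sg [Lt' \<nu>] [] 1))"
proof -
  have P: "\<alpha> i \<in> P_plus" "[Lt' \<nu>] \<in> WY" using i \<nu> P_plus_root by auto
  have "heis_mult (sg [] [Lt (\<alpha> i), Le i] (\<kappa> i)) (sg [Lt' \<nu>] [] 1) =
      sg [Lt' \<nu>] [Lt (\<alpha> i), Le i] (\<kappa> i * qpow (- form (\<alpha> i) \<nu>))"
    unfolding heis_mult_sg hm_def
    using i \<nu> P by (simp add: dlP_simps dlM_simps ph_gens pair_e_t)
  then have "heis_mult (sg [] [] (qpow (form (\<alpha> i) \<nu>)))
        (heis_mult (sg [] [Lt (\<alpha> i), Le i] (\<kappa> i)) (sg [Lt' \<nu>] [] 1)) =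
      sg [Lt' \<nu>] [Lt (\<alpha> i), Le i] (qpow (form (\<alpha> i) \<nu>) * (\<kappa> i * qpow (- form (\<alpha> i) \<nu>)))"
    using heis_mult_sg_left[OF P(2), of "[]"] by simp
  also have "qpow (form (\<alpha> i) \<nu>) * (\<kappa> i * qpow (- form (\<alpha> i) \<nu>)) =
      \<kappa> i * (qpow (- form (\<alpha> i) \<nu>) * qpow (form (\<alpha> i) \<nu>))" by (simp only: mult_ac)
  also have "\<dots> = \<kappa> i" unfolding qpow_uminus[OF form_rational[OF P(1) P_plus_P[OF \<nu>]]] by simp
  finally show ?thesis
    using heis_mult_sg_left[OF words_WY(1), of "[Lt' \<nu>]" 1 "[Lt (\<alpha> i), Le i]" "\<kappa> i"] by simp
qed

end

text \<open>Rings with a multiplicative additive map from the free Heisenberg algebra that kills the kernel of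
  the projection to the double, generated by the images of the scalars and of \<open>e\<^sub>i'\<close>, \<open>f\<^sub>i\<close> and \<open>t'\<^sub>\<nu>\<close>. The image of
  \<open>\<rho>\<close> may be larger than \<open>R\<close>, so that a subalgebra of the double is included.\<close>

locale boson_image = qboson scale brk \<hh> \<alpha> qp \<phi> + ring R
  for scale :: "complex \<Rightarrow> 'g::ab_group_add \<Rightarrow> 'g" and brk \<hh> \<alpha> qp \<phi>
    and R :: "('b, 'r) ring_scheme" (structure) +
  fixes \<rho> :: "('g \<Rightarrow> complex) heis \<Rightarrow> 'b"
  assumes image: "carrier R \<subseteq> \<rho> ` HC"
    and map_add: "x \<in> HC \<Longrightarrow> y \<in> HC \<Longrightarrow> \<rho> (x + y) = \<rho> x \<oplus> \<rho> y"
    and map_mult: "x \<in> HC \<Longrightarrow> y \<in> HC \<Longrightarrow> \<rho> (heis_mult x y) = \<rho> x \<otimes> \<rho> y"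
    and map_one: "\<rho> 1 = \<one>" and map_zero: "\<rho> 0 = \<zero>"
    and map_ker: "r \<in> carrier Fminus \<Longrightarrow> p \<in> carrier Fplus \<Longrightarrow> radM r \<or> radP p \<Longrightarrow> \<rho> (tens r p) = \<zero>"
    and map_scalar: "\<rho> (sg [] [] c) \<in> carrier R"
    and map_e: "i \<in> Ind \<Longrightarrow> \<rho> (sg [] [Lt (\<alpha> i), Le i] (\<kappa> i)) \<in> carrier R"
    and map_f: "i \<in> Ind \<Longrightarrow> \<rho> (sg [Lf i] [] 1) \<in> carrier R"
    and map_t: "\<nu> \<in> P_plus \<Longrightarrow> \<rho> (sg [Lt' \<nu>] [] 1) \<in> carrier R"
    and map_generated: "range (\<lambda>c. \<rho> (sg [] [] c)) \<subseteq> S \<Longrightarrow>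
      (\<lambda>i. \<rho> (sg [] [Lt (\<alpha> i), Le i] (\<kappa> i))) ` Ind \<subseteq> S \<Longrightarrow> (\<lambda>i. \<rho> (sg [Lf i] [] 1)) ` Ind \<subseteq> S \<Longrightarrow>
      (\<lambda>\<nu>. \<rho> (sg [Lt' \<nu>] [] 1)) ` P_plus \<subseteq> S \<Longrightarrow> S \<subseteq> carrier R \<Longrightarrow>
      (\<And>x y. x \<in> S \<Longrightarrow> y \<in> S \<Longrightarrow> x \<oplus> y \<in> S) \<Longrightarrow> (\<And>x y. x \<in> S \<Longrightarrow> y \<in> S \<Longrightarrow> x \<otimes> y \<in> S) \<Longrightarrow>
      carrier R \<subseteq> S"
begin

abbreviation "Sc c \<equiv> \<rho> (sg [] [] c)"
abbreviation "Ee i \<equiv> \<rho> (sg [] [Lt (\<alpha> i), Le i] (\<kappa> i))"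
abbreviation "Ff i \<equiv> \<rho> (sg [Lf i] [] 1)"
abbreviation "Tt \<nu> \<equiv> \<rho> (sg [Lt' \<nu>] [] 1)"
abbreviation "ixl \<equiv> sorted_list_of_set Ind"

lemma ixl: "set ixl = Ind" using finite_Ind by simp

lemma HC_words: "b \<in> WY \<Longrightarrow> a \<in> WX \<Longrightarrow> sg b a c \<in> HC" by (rule HC_single)

lemma WX_e: "i \<in> Ind \<Longrightarrow> [Lt (\<alpha> i), Le i] \<in> WX" "i \<in> Ind \<Longrightarrow> [Lt (\<alpha> i), Lt (- \<alpha> i)] \<in> WX" "[] \<in> WX"
  and WY_f: "i \<in> Ind \<Longrightarrow> [Lf i] \<in> WY" "\<nu> \<in> P_plus \<Longrightarrow> [Lt' \<nu>] \<in> WY" "[] \<in> WY"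
  using P_plus_root P_plus_uminus by auto

lemmas HC_gens = HC_words[OF WY_f(3) WX_e(1)] HC_words[OF WY_f(3) WX_e(3)] HC_words[OF WY_f(1) WX_e(3)]
  HC_words[OF WY_f(2) WX_e(3)]

lemma map_eqI:
  assumes "x \<in> HC" "y \<in> HC" "\<rho> (x - y) = \<zero>" "\<rho> y \<in> carrier R" shows "\<rho> x = \<rho> y"
proof -
  have "x - y \<in> HC" using HC_add[OF assms(1) HC_uminus[OF assms(2)]] by simp
  then show ?thesis using map_add[of "x - y" y] assms by simp
qed

lemma map_eqP:
  assumes "eqP k a a'" "\<rho> (sg [] a' (k * c)) \<in> carrier R" shows "\<rho> (sg [] a c) = \<rho> (sg [] a' (k * c))"
proof (rule map_eqI[OF HC_words HC_words _ assms(2)])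
  let ?p = "Poly_Mapping.single (Word a) c - Poly_Mapping.single (Word a') (k * c)"
  show w: "a \<in> WX" "a' \<in> WX" "[] \<in> WY" "[] \<in> WY" using assms by (auto simp: eqP_def)
  have "radP ?p"
    using assms(1) by (simp add: radP_def lpair_def psum_diff[OF coeff_additive_times]
        psum_single[OF coeff_additive_times] eqP_def)
  moreover have "?p \<in> carrier Fplus" using w by (intro Fplus_closed) auto
  ultimately have "\<rho> (tens 1 ?p) = \<zero>" by (intro map_ker) (simp_all add: Fminus_closed)
  moreover have "tens (1 :: ('g \<Rightarrow> complex) fminus) (x - y) = tens 1 x - tens 1 y" for x y :: "('g \<Rightarrow> complex) fplus"
    using tens_add_right[of "1 :: ('g \<Rightarrow> complex) fminus" "x - y" y] by (simp add: eq_diff_eq)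
  ultimately show "\<rho> (sg [] a c - sg [] a' (k * c)) = \<zero>" by (simp add: tens_one)
qed

lemma map_eqM:
  assumes "eqM k b b'" "\<rho> (sg b' [] (k * c)) \<in> carrier R" shows "\<rho> (sg b [] c) = \<rho> (sg b' [] (k * c))"
proof (rule map_eqI[OF HC_words HC_words _ assms(2)])
  let ?p = "Poly_Mapping.single (Word b) c - Poly_Mapping.single (Word b') (k * c)"
  show w: "b \<in> WY" "b' \<in> WY" "[] \<in> WX" "[] \<in> WX" using assms by (auto simp: eqM_def)
  have "radM ?p"
    using assms(1) by (simp add: radM_def rpair_def psum_diff[OF coeff_additive_times]
        psum_single[OF coeff_additive_times] eqM_def)
  moreover have "?p \<in> carrier Fminus" using w by (intro Fminus_closed) auto
  ultimately have "\<rho> (tens ?p 1) = \<zero>" by (intro map_ker) (simp_all add: Fplus_closed)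
  moreover have "tens (x - y) (1 :: ('g \<Rightarrow> complex) fplus) = tens x 1 - tens y 1" for x y :: "('g \<Rightarrow> complex) fminus"
    using tens_add_left[of "x - y" y "1 :: ('g \<Rightarrow> complex) fplus"] by (simp add: eq_diff_eq)
  ultimately show "\<rho> (sg b [] c - sg b' [] (k * c)) = \<zero>" by (simp add: tens_one)
qed

lemma map_sg_one: "Sc 1 = \<one>" using map_one by (simp only: heis_one)

sublocale scalar_ring R Sc
proof unfold_locales
  show "Sc c \<in> carrier R" for c by (rule map_scalar)
  show "Sc (c + d) = Sc c \<oplus> Sc d" for c d
    using map_add[OF HC_gens(2) HC_gens(2), of c d] by (simp add: single_add)
  show "Sc (c * d) = Sc c \<otimes> Sc d" for c d
    using map_mult[OF HC_gens(2) HC_gens(2), of c d] heis_mult_sg_left[OF WY_f(3)] by simp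
  show "Sc 1 = \<one>" by (rule map_sg_one)
  fix x c assume "x \<in> carrier R"
  then obtain y where y: "y \<in> HC" "x = \<rho> y" using image by blast
  then show "Sc c \<otimes> x = x \<otimes> Sc c"
    using map_mult[OF HC_gens(2) y(1), of c] map_mult[OF y(1) HC_gens(2), of c] heis_scalar_central[OF y(1)]
    by simp
qed

sublocale boson_relations R Sc Ee Ff Tt ixl P_plus qmat "\<lambda>i \<nu>. qpow (form (\<alpha> i) \<nu>)"
proof (unfold_locales; (unfold ixl)?)
  show "distinct ixl" by simp
  show "i \<in> Ind \<Longrightarrow> Ee i \<in> carrier R" "i \<in> Ind \<Longrightarrow> Ff i \<in> carrier R" "\<nu> \<in> P_plus \<Longrightarrow> Tt \<nu> \<in> carrier R" for i \<nu>
    by (fact map_e map_f map_t)+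
  show "Ee i \<otimes> Ff j = Sc (qmat i j) \<otimes> (Ff j \<otimes> Ee i) \<oplus> (if i = j then \<one> else \<zero>)"
    if ij: "i \<in> Ind" "j \<in> Ind" for i j
  proof -
    let ?tt = "sg [] [Lt (\<alpha> i), Lt (- \<alpha> i)] (if i = j then 1 else 0)"
    note E = HC_gens(1)[OF ij(1)] note F = HC_gens(3)[OF ij(2)]
    have tt: "?tt \<in> HC" by (rule HC_words[OF WY_f(3) WX_e(2)[OF ij(1)]])
    have "\<rho> ?tt = Sc (if i = j then 1 else 0)"
      using map_eqP[OF eqP_inv(1)[OF P_plus_root[OF ij(1)]]] map_scalar by simp
    also have "\<dots> = (if i = j then \<one> else \<zero>)" using map_sg_one map_zero by simp
    finally show ?thesis
      using arg_cong[OF heis_E_F[OF ij], of \<rho>] E F tt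
      by (simp only: map_add map_mult heis_mult_closed HC_gens(2))
  qed
  show "Tt \<nu> \<otimes> Ee i = Sc (qpow (form (\<alpha> i) \<nu>)) \<otimes> (Ee i \<otimes> Tt \<nu>)" if "i \<in> Ind" "\<nu> \<in> P_plus" for i \<nu>
    using arg_cong[OF heis_T_E[OF that], of \<rho>] HC_gens(1)[OF that(1)] HC_gens(4)[OF that(2)]
    by (simp only: map_mult heis_mult_closed HC_gens(2))
  show "\<exists>c. Tt \<nu> \<otimes> Ff i = Sc c \<otimes> (Ff i \<otimes> Tt \<nu>)" if i: "i \<in> Ind" and \<nu>: "\<nu> \<in> P_plus" for i \<nu>
  proof -
    obtain k where k: "eqM k [Lt' \<nu>, Lf i] [Lf i, Lt' \<nu>]" using eqM_tf[OF \<nu> i] by blast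
    note F = HC_gens(3)[OF i] note T = HC_gens(4)[OF \<nu>] note fc = WY_f(1)[OF i] note tc = WY_f(2)[OF \<nu>]
    have "[Lf i] @ [Lt' \<nu>] \<in> WY" by (rule words_WY(3)[OF fc tc])
    then have FT: "heis_mult (sg [] [] k) (heis_mult (sg [Lf i] [] 1) (sg [Lt' \<nu>] [] 1)) = sg [Lf i, Lt' \<nu>] [] (k * 1)"
      using heis_mult_sg_left[OF tc, of "[Lf i]" 1 "[]" 1]
        heis_mult_sg_left[of "[Lf i] @ [Lt' \<nu>]" "[]" k "[]" 1] by simp
    have TF: "heis_mult (sg [Lt' \<nu>] [] 1) (sg [Lf i] [] 1) = sg [Lt' \<nu>, Lf i] [] 1"
      using heis_mult_sg_left[OF fc, of "[Lt' \<nu>]" 1 "[]" 1] by simp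
    have im: "\<rho> (sg [Lf i, Lt' \<nu>] [] (k * 1)) = Sc k \<otimes> (Ff i \<otimes> Tt \<nu>)"
      using arg_cong[OF FT, of \<rho>] F T by (simp only: map_mult heis_mult_closed HC_gens(2))
    have "Sc k \<otimes> (Ff i \<otimes> Tt \<nu>) \<in> carrier R" using map_f[OF i] map_t[OF \<nu>] by simp
    then have "\<rho> (sg [Lt' \<nu>, Lf i] [] 1) = Sc k \<otimes> (Ff i \<otimes> Tt \<nu>)"
      using map_eqM[OF k, of 1] im by simp
    then have "Tt \<nu> \<otimes> Ff i = Sc k \<otimes> (Ff i \<otimes> Tt \<nu>)"
      using arg_cong[OF TF, of \<rho>] F T by (simp only: map_mult)
    then show ?thesis by blast
  qed
qed

lemma lc_map_sum:
  assumes "distinct xs" "\<And>x. x \<in> set xs \<Longrightarrow> X x \<in> HC"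
  shows "lc xs c (\<lambda>x. \<rho> (X x)) = \<rho> (\<Sum>x\<in>set xs. heis_mult (sg [] [] (c x)) (X x)) \<and>
    (\<Sum>x\<in>set xs. heis_mult (sg [] [] (c x)) (X x)) \<in> HC"
  using assms
proof (induction xs)
  case Nil
  then show ?case using map_zero by simp
next
  case (Cons y xs)
  have "X y \<in> HC" by (rule Cons.prems) simp
  then have y: "heis_mult (sg [] [] (c y)) (X y) \<in> HC" "\<rho> (heis_mult (sg [] [] (c y)) (X y)) = Sc (c y) \<otimes> \<rho> (X y)"
    using HC_gens(2) heis_mult_closed map_mult by blast+
  have IH: "lc xs c (\<lambda>x. \<rho> (X x)) = \<rho> (\<Sum>x\<in>set xs. heis_mult (sg [] [] (c x)) (X x))"
    "(\<Sum>x\<in>set xs. heis_mult (sg [] [] (c x)) (X x)) \<in> HC"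
    using Cons by auto
  show ?case
    using Cons.prems(1) map_add[OF y(1) IH(2)] HC_add[OF y(1) IH(2)] IH(1) y(2)
    by (simp del: mem_Collect_eq)
qed

lemma Ew_map: "set w \<subseteq> Ind \<Longrightarrow> Ew w = \<rho> (sg [] (eword w) (prod_list (map \<kappa> w)))"
proof (induction w)
  case Nil
  then show ?case by (simp add: map_sg_one)
next
  case (Cons i w)
  then have i: "i \<in> Ind" and w: "set w \<subseteq> Ind" by auto
  have "\<rho> (sg [] (eword (i # w)) (prod_list (map \<kappa> (i # w)))) =
      \<rho> (heis_mult (sg [] (eword w) (prod_list (map \<kappa> w))) (sg [] [Lt (\<alpha> i), Le i] (\<kappa> i)))"
    using heis_mult_sg_right[OF eword_closed[OF w]] by (simp add: mult.commute)
  then show ?case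
    using Cons.IH[OF w] map_mult[OF HC_words[OF WY_f(3) eword_closed[OF w]] HC_gens(1)[OF i]] by simp
qed

lemma Fw_map: "set u \<subseteq> Ind \<Longrightarrow> Fw u = \<rho> (sg (fword u) [] 1)"
proof (induction u)
  case Nil
  then show ?case by (simp add: map_sg_one)
next
  case (Cons i u)
  then have i: "i \<in> Ind" and u: "set u \<subseteq> Ind" by auto
  have "\<rho> (sg (fword (i # u)) [] 1) = \<rho> (heis_mult (sg [Lf i] [] 1) (sg (fword u) [] 1))"
    using heis_mult_sg_left[OF fword_closed[OF u]] by simp
  then show ?case
    using Cons.IH[OF u] map_mult[OF HC_gens(3)[OF i] HC_words[OF fword_closed[OF u] WX_e(3)]] by simp
qed

lemma set_W': "set (W k) = {u. length u = k \<and> set u \<subseteq> Ind}" using set_W ixl by simp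

sublocale boson_algebra R Sc Ee Ff Tt ixl P_plus qmat "\<lambda>i \<nu>. qpow (form (\<alpha> i) \<nu>)"
proof unfold_locales
  fix k c assume zero: "\<And>u. u \<in> set (W k) \<Longrightarrow> (\<Sum>w\<in>set (W k). c w * vev qmat w u) = 0"
  have W: "w \<in> set (W k) \<Longrightarrow> length w = k \<and> set w \<subseteq> Ind" for w by (simp add: set_W')
  have "lc (W k) c Ew = lc (W k) c (\<lambda>w. \<rho> (sg [] (eword w) (prod_list (map \<kappa> w))))"
    using W by (intro lc_cong) (simp_all add: Ew_map)
  also have "\<dots> = \<rho> (\<Sum>w\<in>set (W k). heis_mult (sg [] [] (c w)) (sg [] (eword w) (prod_list (map \<kappa> w))))"
    using lc_map_sum[OF distinct_W, of k "\<lambda>w. sg [] (eword w) (prod_list (map \<kappa> w))" c]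
      HC_words[OF WY_f(3) eword_closed] W by blast
  also have "(\<Sum>w\<in>set (W k). heis_mult (sg [] [] (c w)) (sg [] (eword w) (prod_list (map \<kappa> w)))) =
      tens 1 (\<Sum>w\<in>set (W k). Poly_Mapping.single (Word (eword w)) (c w * prod_list (map \<kappa> w)))"
    unfolding tens_sum tens_one using heis_mult_sg_left[OF WY_f(3)] by simp
  also have "\<rho> \<dots> = \<zero>"
  proof (rule map_ker)
    show "1 \<in> carrier Fminus" by (rule Fminus_closed)
    show "(\<Sum>w\<in>set (W k). Poly_Mapping.single (Word (eword w)) (c w * prod_list (map \<kappa> w))) \<in> carrier Fplus"
    proof (rule sum_property[where Q = "\<lambda>p. p \<in> carrier Fplus", OF Fplus_closed(7) Fplus_closed(1) Fplus_closed(9)])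
      show "set (eword w) \<subseteq> LX" if "w \<in> set (W k)" for w
        using eword_closed[of w] W[OF that] by blast
    qed
    show "radM 1 \<or> radP (\<Sum>w\<in>set (W k). Poly_Mapping.single (Word (eword w)) (c w * prod_list (map \<kappa> w)))"
    proof (rule disjI2, rule radP_combination[OF finite_set W])
      fix u assume "length u = k" "set u \<subseteq> Ind"
      then have "u \<in> set (W k)" by (simp add: set_W')
      then show "(\<Sum>x\<in>set (W k). c x * vev qmat x u) = 0" by (rule zero)
    qed
  qed
  finally show "lc (W k) c Ew = \<zero>" .
next
  fix k c assume zero: "\<And>w. w \<in> set (W k) \<Longrightarrow> (\<Sum>u\<in>set (W k). c u * vev qmat w u) = 0"
  have W: "w \<in> set (W k) \<Longrightarrow> length w = k \<and> set w \<subseteq> Ind" for w by (simp add: set_W')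
  have "lc (W k) c Fw = lc (W k) c (\<lambda>u. \<rho> (sg (fword u) [] 1))"
    using W by (intro lc_cong) (simp_all add: Fw_map)
  also have "\<dots> = \<rho> (\<Sum>u\<in>set (W k). heis_mult (sg [] [] (c u)) (sg (fword u) [] 1))"
    using lc_map_sum[OF distinct_W, of k "\<lambda>u. sg (fword u) [] 1" c]
      HC_words[OF fword_closed WX_e(3)] W by blast
  also have "(\<Sum>u\<in>set (W k). heis_mult (sg [] [] (c u)) (sg (fword u) [] 1)) =
      tens (\<Sum>u\<in>set (W k). Poly_Mapping.single (Word (fword u)) (c u)) 1"
    unfolding tens_sum tens_one using heis_mult_sg_left[OF fword_closed] W by (intro sum.cong) simp_all
  also have "\<rho> \<dots> = \<zero>"
  proof (rule map_ker)
    show "1 \<in> carrier Fplus" by (rule Fplus_closed)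
    show "(\<Sum>u\<in>set (W k). Poly_Mapping.single (Word (fword u)) (c u)) \<in> carrier Fminus"
    proof (rule sum_property[where Q = "\<lambda>p. p \<in> carrier Fminus", OF Fminus_closed(7) Fminus_closed(1) Fminus_closed(9)])
      show "set (fword u) \<subseteq> LY" if "u \<in> set (W k)" for u
        using fword_closed[of u] W[OF that] by blast
    qed
    show "radM (\<Sum>u\<in>set (W k). Poly_Mapping.single (Word (fword u)) (c u)) \<or> radP 1"
    proof (rule disjI1, rule radM_combination[OF finite_set W])
      fix w assume "length w = k" "set w \<subseteq> Ind"
      then have "w \<in> set (W k)" by (simp add: set_W')
      then show "(\<Sum>x\<in>set (W k). c x * vev qmat w x) = 0" by (rule zero)
    qed
  qed
  finally show "lc (W k) c Fw = \<zero>" .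
next
  fix S assume "range Sc \<subseteq> S" "Ee ` set ixl \<subseteq> S" "Ff ` set ixl \<subseteq> S" "Tt ` P_plus \<subseteq> S" "S \<subseteq> carrier R"
    "\<And>x y. x \<in> S \<Longrightarrow> y \<in> S \<Longrightarrow> x \<oplus> y \<in> S" "\<And>x y. x \<in> S \<Longrightarrow> y \<in> S \<Longrightarrow> x \<otimes> y \<in> S"
  then show "carrier R \<subseteq> S" unfolding ixl by (rule map_generated)
qed

sublocale boson_weights R Sc Ee Ff Tt ixl P_plus qmat "\<lambda>i \<nu>. qpow (form (\<alpha> i) \<nu>)"
  P "\<lambda>\<mu> \<nu>. qpow (form \<nu> \<mu>)" "\<lambda>i \<mu>. \<alpha> i + \<mu>"
proof (unfold_locales; (unfold ixl)?)
  show "\<alpha> i + \<mu> \<in> P" if "i \<in> Ind" "\<mu> \<in> P" for i \<mu> using that P_add P_root by blast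
  show "inj_on (\<lambda>\<mu>. \<alpha> i + \<mu>) P" for i by (simp add: inj_on_def)
  show "qpow (form \<nu> (\<alpha> i + \<mu>)) = qpow (form (\<alpha> i) \<nu>) * qpow (form \<nu> \<mu>)"
    if "i \<in> Ind" "\<mu> \<in> P" "\<nu> \<in> P_plus" for i \<mu> \<nu>
    using that P_root P_plus_P
    by (simp add: form_add_right qpow_add form_rational form_sym[of "\<alpha> i" \<nu>])
qed

end

section \<open>The q-boson algebra and its category O\<close>

lemma ring_same_operations:
  assumes "ring R" "carrier S = carrier R" "mult S = mult R" "one S = one R" "zero S = zero R" "add S = add R"
  shows "ring S"
proof -
  interpret ring R by fact
  show ?thesis
  proof (rule ringI)
    show "abelian_group S"
    proof (rule abelian_groupI)
      fix x assume "x \<in> carrier S"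
      then show "\<exists>y\<in>carrier S. y \<oplus>\<^bsub>S\<^esub> x = \<zero>\<^bsub>S\<^esub>"
        using l_neg[of x] a_inv_closed[of x] unfolding assms(2-) by blast
    qed (simp_all add: assms(2-) a_assoc, simp add: a_comm)
    show "Group.monoid S"
      by (rule Group.monoidI) (simp_all add: assms(2-) m_assoc)
  qed (simp_all add: assms(2-) l_distr r_distr)
qed

lemma extend_operations:
  "carrier (ring.extend R m) = carrier R" "mult (ring.extend R m) = mult R" "one (ring.extend R m) = one R"
  "zero (ring.extend R m) = zero R" "add (ring.extend R m) = add R"
  by (simp_all add: ring.defs)

lemma carrier_update_operations:
  "carrier (R\<lparr>carrier := X\<rparr>) = X" "mult (R\<lparr>carrier := X\<rparr>) = mult R" "one (R\<lparr>carrier := X\<rparr>) = one R"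
  "zero (R\<lparr>carrier := X\<rparr>) = zero R" "add (R\<lparr>carrier := X\<rparr>) = add R"
  by simp_all

lemma fields_selectors:
  "scalar (ring.extend R (boson_algebra.fields s e t)) = s"
  "eprime (ring.extend R (boson_algebra.fields s e t)) = e"
  "torus (ring.extend R (boson_algebra.fields s e t)) = t"
  by (simp_all add: ring.defs boson_algebra.defs)

locale boson_presentation = boson_image scale brk \<hh> \<alpha> qp \<phi> R \<rho>
  for scale :: "complex \<Rightarrow> 'g::ab_group_add \<Rightarrow> 'g" and brk \<hh> \<alpha> qp \<phi>
    and R :: "('b, 'g \<Rightarrow> complex, 'r) boson_algebra_scheme" (structure) and \<rho> +
  assumes scalar: "scalar R c = Sc c"
    and eprime: "i \<in> Ind \<Longrightarrow> eprime R i = Ee i"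
    and torus: "\<nu> \<in> P_plus \<Longrightarrow> torus R \<nu> = Tt \<nu>"
begin

lemma I_lambda_eq: "I_lambda R \<mu> = Ilam \<mu>"
proof -
  have "{b \<otimes> eprime R i |b i. b \<in> carrier R \<and> i \<in> Ind} = {b \<otimes> Ee i |b i. b \<in> carrier R \<and> i \<in> Ind}"
    using eprime by (intro Collect_cong) metis
  moreover have "{b \<otimes> (torus R \<nu> \<ominus> scalar R (qpow (form \<mu> \<nu>))) |b \<nu>. b \<in> carrier R \<and> \<nu> \<in> P_plus} =
      {b \<otimes> (Tt \<nu> \<ominus> Sc (qpow (form \<nu> \<mu>))) |b \<nu>. b \<in> carrier R \<and> \<nu> \<in> P_plus}"
    unfolding form_sym[of \<mu>] scalar using torus by (intro Collect_cong) metis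
  ultimately show ?thesis unfolding I_lambda_def Ilam_def ixl by simp
qed

theorem category_O:
  fixes M :: "('b, 'm, 's) module_scheme"
  assumes O: "in_O R M"
  shows "(simple_module R M \<longrightarrow> (\<exists>\<mu>\<in>P. module_iso R M (H R \<mu>))) \<and> semisimple_module R M"
proof -
  have lm: "left_module R M" and ds: "direct_sum M P (weight_space R M)"
    and nil: "m \<in> carrier M \<Longrightarrow> \<exists>l>0. \<forall>js. length js = l \<and> set js \<subseteq> Ind \<longrightarrow>
       foldr (\<lambda>i x. eprime R i \<odot>\<^bsub>M\<^esub> x) js m = \<zero>\<^bsub>M\<^esub>" for m
    using O by (auto simp: in_O_def)
  have foldr_eq: "foldr (\<lambda>i x. eprime R i \<odot>\<^bsub>M\<^esub> x) js m = foldr (\<lambda>i x. Ee i \<odot>\<^bsub>M\<^esub> x) js m"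
    if "set js \<subseteq> Ind" for js m
    using that by (induction js) (simp_all add: eprime)
  have weight_eq: "weight_space R M =
      (\<lambda>\<mu>. {m \<in> carrier M. \<forall>\<nu>\<in>P_plus. Tt \<nu> \<odot>\<^bsub>M\<^esub> m = Sc (qpow (form \<nu> \<mu>)) \<odot>\<^bsub>M\<^esub> m})"
    unfolding weight_space_def scalar using torus by (intro ext Collect_cong) auto
  interpret M: abelian_group M using lm by (simp add: left_module_def)
  interpret bm: boson_module R Sc Ee Ff Tt ixl P_plus qmat "\<lambda>i \<nu>. qpow (form (\<alpha> i) \<nu>)"
    P "\<lambda>\<mu> \<nu>. qpow (form \<nu> \<mu>)" "\<lambda>i \<mu>. \<alpha> i + \<mu>" M
  proof unfold_locales
    show "left_module R M" by (rule lm)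
    show "direct_sum M P (\<lambda>\<mu>. {m \<in> carrier M. \<forall>\<nu>\<in>P_plus. Tt \<nu> \<odot>\<^bsub>M\<^esub> m = Sc (qpow (form \<nu> \<mu>)) \<odot>\<^bsub>M\<^esub> m})"
      using ds unfolding weight_eq .
    show "\<exists>l>0. \<forall>js. length js = l \<and> set js \<subseteq> set ixl \<longrightarrow> foldr (\<lambda>i x. Ee i \<odot>\<^bsub>M\<^esub> x) js m = \<zero>\<^bsub>M\<^esub>"
      if m: "m \<in> carrier M" for m
    proof -
      obtain l where "l > 0" "\<forall>js. length js = l \<and> set js \<subseteq> Ind \<longrightarrow>
          foldr (\<lambda>i x. eprime R i \<odot>\<^bsub>M\<^esub> x) js m = \<zero>\<^bsub>M\<^esub>" using nil[OF m] by blast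
      then show ?thesis unfolding ixl using foldr_eq[of _ m] by (intro exI[of _ l]) simp
    qed
  qed
  show ?thesis using bm.semisimple bm.simple_iso unfolding H_def I_lambda_eq by blast
qed

end

context qboson begin

definition proj :: "('g \<Rightarrow> complex) heis \<Rightarrow> ('g \<Rightarrow> complex) heis set" where
  "proj x = heis_ker +>\<^bsub>heis_free\<^esub> x"

lemma Heis_ring: "ring Heis"
  unfolding Heis_def by (rule ideal.quotient_is_ring[OF heis_ker_ideal])

lemma proj_hom: "proj \<in> ring_hom heis_free Heis"
  using ideal.rcos_ring_hom[OF heis_ker_ideal] unfolding Heis_def proj_def[abs_def] by simp

lemma proj_closed: "x \<in> HC \<Longrightarrow> proj x \<in> carrier Heis"
  and proj_add: "x \<in> HC \<Longrightarrow> y \<in> HC \<Longrightarrow> proj (x + y) = proj x \<oplus>\<^bsub>Heis\<^esub> proj y"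
  and proj_mult: "x \<in> HC \<Longrightarrow> y \<in> HC \<Longrightarrow> proj (heis_mult x y) = proj x \<otimes>\<^bsub>Heis\<^esub> proj y"
  and proj_one: "proj 1 = \<one>\<^bsub>Heis\<^esub>"
  using ring_hom_memE[OF proj_hom] by (simp_all only: heis_free_ops)

lemma proj_ker: "x \<in> HC \<Longrightarrow> proj x = \<zero>\<^bsub>Heis\<^esub> \<longleftrightarrow> x \<in> heis_ker"
  using coset_eq_self_iff[OF heis_free_ring heis_ker_subgroup, of x]
  by (simp add: proj_def Heis_def FactRing_def heis_free_ops)

lemma proj_zero: "proj 0 = \<zero>\<^bsub>Heis\<^esub>"
  using proj_ker[OF HC_zero] heis_ker_closed(1) by blast

lemma Heis_carrier: "carrier Heis = proj ` HC"
  unfolding Heis_def FactRing_def A_RCOSETS_def RCOSETS_def proj_def a_r_coset_def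
  by (auto simp: heis_free_ops)

lemma Heis_uminus:
  assumes "x \<in> carrier Heis" shows "\<ominus>\<^bsub>Heis\<^esub> x = proj (sg [] [] (- 1)) \<otimes>\<^bsub>Heis\<^esub> x"
proof -
  interpret Heis: ring Heis by (rule Heis_ring)
  obtain y where y: "y \<in> HC" "x = proj y" using assms Heis_carrier by blast
  have "sg [] [] (- 1) = - (1 :: ('g \<Rightarrow> complex) heis)" by (simp only: heis_one single_uminus)
  then have m: "heis_mult (sg [] [] (- 1)) y = - y"
    using heis_mult_one_left[OF y(1)] by (simp only: heis_mult_uminus)
  have "sg [] [] (- 1) \<in> HC" by (rule HC_single) auto
  from proj_mult[OF this y(1)] have "proj (sg [] [] (- 1)) \<otimes>\<^bsub>Heis\<^esub> x = proj (- y)" using y(2) m by simp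
  moreover have "proj (- y) \<oplus>\<^bsub>Heis\<^esub> proj y = \<zero>\<^bsub>Heis\<^esub>"
    using proj_add[OF HC_uminus[OF y(1)] y(1)] proj_zero by simp
  ultimately show ?thesis
    using Heis.minus_equality[of "proj (- y)" "proj y"] proj_closed HC_uminus[OF y(1)] y by simp
qed

lemma sharp_words:
  "sharp 1 (Poly_Mapping.single (Word a) c) = proj (sg [] a c)"
  "sharp (Poly_Mapping.single (Word b) c) 1 = proj (sg b [] c)"
  by (simp_all only: sharp_def proj_def tens_one)

lemma gen_single: "gen x = Poly_Mapping.single (Word [x]) 1" by (simp add: gen_def mon_def)

lemma generators_sharp:
  "heis_scalar c = proj (sg [] [] c)" "heis_eprime i = proj (sg [] [Lt (\<alpha> i), Le i] (\<kappa> i))"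
  "sharp (f i) 1 = proj (sg [Lf i] [] 1)" "sharp (t' \<nu>) 1 = proj (sg [Lt' \<nu>] [] 1)"
  "sharp 1 (t \<nu>) = proj (sg [] [Lt \<nu>] 1)"
proof -
  show "heis_scalar c = proj (sg [] [] c)"
    using sharp_words(2)[of "[]" c] by (simp add: heis_scalar_def scal_def Word_Nil)
  have "scal (\<kappa> i) * t (\<alpha> i) * e i = Poly_Mapping.single (Word [Lt (\<alpha> i), Le i]) (\<kappa> i)"
    by (simp add: gen_single scal_single mult_single Word_plus del: right_diff_distrib left_diff_distrib)
  then show "heis_eprime i = proj (sg [] [Lt (\<alpha> i), Le i] (\<kappa> i))"
    by (simp only: heis_eprime_def sharp_words)
qed (simp_all only: gen_single sharp_words)

abbreviation "Bq_gens \<equiv> range heis_scalar \<union> heis_eprime ` Ind \<union> (\<lambda>i. sharp (f i) 1) ` Ind \<union>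
         (\<lambda>\<mu>. sharp (t' \<mu>) 1) ` P_plus"

lemma gens_HC: "sg [] [] c \<in> HC" "i \<in> Ind \<Longrightarrow> sg [] [Lt (\<alpha> i), Le i] c \<in> HC"
  "i \<in> Ind \<Longrightarrow> sg [Lf i] [] c \<in> HC" "\<nu> \<in> P_plus \<Longrightarrow> sg [Lt' \<nu>] [] c \<in> HC"
  "\<nu> \<in> P_plus \<Longrightarrow> sg [] [Lt \<nu>] c \<in> HC"
  by (rule HC_single; simp add: P_plus_root)+

lemma Bq_gens_closed: "Bq_gens \<subseteq> carrier Heis"
  unfolding generators_sharp using proj_closed gens_HC by blast

lemma Bq_sub_operations: "carrier Bq_sub = generate_ring Heis Bq_gens" "mult Bq_sub = mult Heis"
  "one Bq_sub = one Heis" "zero Bq_sub = zero Heis" "add Bq_sub = add Heis"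
  by (simp_all add: Bq_sub_def extend_operations)

lemma Bq_sub_selectors: "scalar Bq_sub = heis_scalar" "eprime Bq_sub = heis_eprime"
  "torus Bq_sub = (\<lambda>\<mu>. sharp (t' \<mu>) 1)"
  by (simp_all add: Bq_sub_def fields_selectors)

text \<open>The subalgebra contains additive inverses of its elements already as multiples by the scalar \<open>- 1\<close>.\<close>

lemma Bq_sub_presentation: "boson_presentation scale brk \<hh> \<alpha> qp \<phi> Bq_sub proj"
proof -
  interpret Heis: ring Heis by (rule Heis_ring)
  interpret R: ring Bq_sub
    by (rule ring_same_operations[OF Heis.generate_ring_is_ring[OF Bq_gens_closed]])
      (simp_all only: Bq_sub_operations carrier_update_operations)
  have gens: "Bq_gens \<subseteq> carrier Bq_sub" unfolding Bq_sub_operations by (intro subsetI generate_ring.incl)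
  show ?thesis
  proof unfold_locales
    show "carrier Bq_sub \<subseteq> proj ` HC"
      using Heis.generate_ring_incl[OF Bq_gens_closed] unfolding Bq_sub_operations Heis_carrier .
    show "proj (x + y) = proj x \<oplus>\<^bsub>Bq_sub\<^esub> proj y" "proj (heis_mult x y) = proj x \<otimes>\<^bsub>Bq_sub\<^esub> proj y"
      if "x \<in> HC" "y \<in> HC" for x y
      using that by (simp_all only: Bq_sub_operations proj_add proj_mult)
    show "proj 1 = \<one>\<^bsub>Bq_sub\<^esub>" "proj 0 = \<zero>\<^bsub>Bq_sub\<^esub>" by (simp_all only: Bq_sub_operations proj_one proj_zero)
    show "proj (tens r p) = \<zero>\<^bsub>Bq_sub\<^esub>" if "r \<in> carrier Fminus" "p \<in> carrier Fplus" "radM r \<or> radP p" for r p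
      using proj_ker[OF tens_closed] heis_ker_tens that unfolding Bq_sub_operations by blast
    show "proj (sg [] [] c) \<in> carrier Bq_sub" for c using gens unfolding generators_sharp by blast
    show "proj (sg [] [Lt (\<alpha> i), Le i] (\<kappa> i)) \<in> carrier Bq_sub" "proj (sg [Lf i] [] 1) \<in> carrier Bq_sub"
      if "i \<in> Ind" for i using gens that unfolding generators_sharp by blast+
    show "proj (sg [Lt' \<nu>] [] 1) \<in> carrier Bq_sub" if "\<nu> \<in> P_plus" for \<nu>
      using gens that unfolding generators_sharp by blast
    show "carrier Bq_sub \<subseteq> S"
      if S: "range (\<lambda>c. proj (sg [] [] c)) \<subseteq> S" "(\<lambda>i. proj (sg [] [Lt (\<alpha> i), Le i] (\<kappa> i))) ` Ind \<subseteq> S"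
        "(\<lambda>i. proj (sg [Lf i] [] 1)) ` Ind \<subseteq> S" "(\<lambda>\<nu>. proj (sg [Lt' \<nu>] [] 1)) ` P_plus \<subseteq> S"
        "S \<subseteq> carrier Bq_sub" and add: "\<And>x y. x \<in> S \<Longrightarrow> y \<in> S \<Longrightarrow> x \<oplus>\<^bsub>Bq_sub\<^esub> y \<in> S"
        and mult: "\<And>x y. x \<in> S \<Longrightarrow> y \<in> S \<Longrightarrow> x \<otimes>\<^bsub>Bq_sub\<^esub> y \<in> S" for S
    proof
      fix x assume "x \<in> carrier Bq_sub"
      then show "x \<in> S"
        unfolding Bq_sub_operations
      proof (induction x rule: generate_ring.induct)
        case one
        have "proj 1 \<in> S" unfolding heis_one using S(1) by blast
        then show ?case by (simp only: proj_one)
      next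
        case (incl h)
        then show ?case
          using S(1-4) unfolding generators_sharp image_subset_iff by (elim UnE imageE) simp_all
      next
        case (a_inv h)
        then have "h \<in> carrier Heis" using Heis.generate_ring_in_carrier[OF Bq_gens_closed] by blast
        moreover have "proj (sg [] [] (- 1)) \<otimes>\<^bsub>Heis\<^esub> h \<in> S"
          using mult[of "proj (sg [] [] (- 1))" h] S(1) a_inv unfolding Bq_sub_operations by blast
        ultimately show ?case by (simp only: Heis_uminus)
      next
        case (eng_add h k)
        then show ?case using add unfolding Bq_sub_operations by blast
      next
        case (eng_mult h k)
        then show ?case using mult unfolding Bq_sub_operations by blast
      qed
    qed
    show "scalar Bq_sub c = proj (sg [] [] c)" "eprime Bq_sub i = proj (sg [] [Lt (\<alpha> i), Le i] (\<kappa> i))"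
      "torus Bq_sub \<nu> = proj (sg [Lt' \<nu>] [] 1)" for c i \<nu>
      by (simp_all only: Bq_sub_selectors generators_sharp)
  qed
qed

definition bproj :: "('g \<Rightarrow> complex) heis \<Rightarrow> ('g \<Rightarrow> complex) heis set set" where
  "bproj x = boson_ideal +>\<^bsub>Heis\<^esub> proj x"

abbreviation "boson_rels \<equiv> {sharp 1 (t \<mu>) \<ominus>\<^bsub>Heis\<^esub> sharp (t' \<mu>) 1 |\<mu>. \<mu> \<in> P_plus}"

lemma boson_rels_closed: "boson_rels \<subseteq> carrier Heis"
proof -
  interpret Heis: ring Heis by (rule Heis_ring)
  show ?thesis unfolding generators_sharp using proj_closed gens_HC by blast
qed

lemma boson_ideal_ideal: "ideal boson_ideal Heis"
  unfolding boson_ideal_def by (rule ring.genideal_ideal[OF Heis_ring boson_rels_closed])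

lemma Bq_operations: "carrier Bq = carrier (Heis Quot boson_ideal)" "mult Bq = mult (Heis Quot boson_ideal)"
  "one Bq = one (Heis Quot boson_ideal)" "zero Bq = zero (Heis Quot boson_ideal)"
  "add Bq = add (Heis Quot boson_ideal)"
  by (simp_all add: Bq_def extend_operations)

lemma Bq_selectors: "scalar Bq = (\<lambda>c. boson_ideal +>\<^bsub>Heis\<^esub> heis_scalar c)"
  "eprime Bq = (\<lambda>i. boson_ideal +>\<^bsub>Heis\<^esub> heis_eprime i)"
  "torus Bq = (\<lambda>\<mu>. boson_ideal +>\<^bsub>Heis\<^esub> sharp 1 (t \<mu>))"
  by (simp_all add: Bq_def fields_selectors)

lemma bproj_torus:
  assumes \<nu>: "\<nu> \<in> P_plus" shows "bproj (sg [] [Lt \<nu>] 1) = bproj (sg [Lt' \<nu>] [] 1)"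
proof -
  have "proj (sg [] [Lt \<nu>] 1) \<ominus>\<^bsub>Heis\<^esub> proj (sg [Lt' \<nu>] [] 1) \<in> boson_rels"
    unfolding generators_sharp using \<nu> by blast
  then have "proj (sg [] [Lt \<nu>] 1) \<ominus>\<^bsub>Heis\<^esub> proj (sg [Lt' \<nu>] [] 1) \<in> boson_ideal"
    unfolding boson_ideal_def using ring.genideal_self[OF Heis_ring boson_rels_closed] by blast
  then show ?thesis
    unfolding bproj_def
    by (rule quotient_class_eq[OF boson_ideal_ideal proj_closed[OF gens_HC(5)[OF \<nu>]] proj_closed[OF gens_HC(4)[OF \<nu>]]])
qed

lemma bproj_hom: "bproj x = boson_ideal +>\<^bsub>Heis\<^esub> proj x"
  "x \<in> HC \<Longrightarrow> bproj x \<in> carrier Bq" "x \<in> HC \<Longrightarrow> y \<in> HC \<Longrightarrow> bproj (x + y) = bproj x \<oplus>\<^bsub>Bq\<^esub> bproj y"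
  "x \<in> HC \<Longrightarrow> y \<in> HC \<Longrightarrow> bproj (heis_mult x y) = bproj x \<otimes>\<^bsub>Bq\<^esub> bproj y" "bproj 1 = \<one>\<^bsub>Bq\<^esub>"
  using ring_hom_memE[OF ideal.rcos_ring_hom[OF boson_ideal_ideal]] proj_closed
  by (simp_all only: bproj_def Bq_operations proj_add proj_mult proj_one)

text \<open>The tori are identified in \<open>Bq\<close>, and \<open>e\<^sub>i\<close> is a scalar multiple of \<open>t\<close> of \<open>- \<alpha> i\<close> times \<open>e\<^sub>i'\<close>. So the scalars
  and \<open>e\<^sub>i'\<close>, \<open>f\<^sub>i\<close>, \<open>t'\<^sub>\<nu>\<close> generate.\<close>

lemma Bq_presentation: "boson_presentation scale brk \<hh> \<alpha> qp \<phi> Bq bproj"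
proof -
  interpret Heis: ring Heis by (rule Heis_ring)
  interpret R: ring Bq
    by (rule ring_same_operations[OF ideal.quotient_is_ring[OF boson_ideal_ideal]]) (simp_all add: Bq_operations)
  have zero: "bproj 0 = \<zero>\<^bsub>Bq\<^esub>"
    using coset_eq_self_iff[OF Heis_ring ideal.axioms(1)[OF boson_ideal_ideal], of "\<zero>\<^bsub>Heis\<^esub>"]
      additive_subgroup.zero_closed[OF ideal.axioms(1)[OF boson_ideal_ideal]]
    by (simp add: bproj_def proj_zero Bq_operations FactRing_def)
  have image: "carrier Bq = bproj ` HC"
    unfolding Bq_operations FactRing_def A_RCOSETS_def RCOSETS_def bproj_def a_r_coset_def
    using Heis_carrier by auto
  have ip: "boson_image scale brk \<hh> \<alpha> qp \<phi> Bq bproj"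
  proof unfold_locales
    show "carrier Bq \<subseteq> bproj ` HC" using image by simp
    show "bproj (x + y) = bproj x \<oplus>\<^bsub>Bq\<^esub> bproj y" "bproj (heis_mult x y) = bproj x \<otimes>\<^bsub>Bq\<^esub> bproj y"
      if "x \<in> HC" "y \<in> HC" for x y using bproj_hom(3,4)[OF that] .
    show "bproj 1 = \<one>\<^bsub>Bq\<^esub>" "bproj 0 = \<zero>\<^bsub>Bq\<^esub>" by (fact bproj_hom(5) zero)+
    show "bproj (tens r p) = \<zero>\<^bsub>Bq\<^esub>" if "r \<in> carrier Fminus" "p \<in> carrier Fplus" "radM r \<or> radP p" for r p
    proof -
      have "proj (tens r p) = proj 0" using proj_ker[OF tens_closed] heis_ker_tens that proj_zero by metis
      then show ?thesis using zero by (simp add: bproj_def)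
    qed
    show "bproj (sg [] [] c) \<in> carrier Bq" for c by (rule bproj_hom(2)[OF gens_HC(1)])
    show "bproj (sg [] [Lt (\<alpha> i), Le i] (\<kappa> i)) \<in> carrier Bq" "bproj (sg [Lf i] [] 1) \<in> carrier Bq"
      if "i \<in> Ind" for i using bproj_hom(2) gens_HC(2,3)[OF that] by blast+
    show "bproj (sg [Lt' \<nu>] [] 1) \<in> carrier Bq" if "\<nu> \<in> P_plus" for \<nu>
      using bproj_hom(2) gens_HC(4)[OF that] by blast
    show "carrier Bq \<subseteq> S"
      if S: "range (\<lambda>c. bproj (sg [] [] c)) \<subseteq> S" "(\<lambda>i. bproj (sg [] [Lt (\<alpha> i), Le i] (\<kappa> i))) ` Ind \<subseteq> S"
        "(\<lambda>i. bproj (sg [Lf i] [] 1)) ` Ind \<subseteq> S" "(\<lambda>\<nu>. bproj (sg [Lt' \<nu>] [] 1)) ` P_plus \<subseteq> S"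
        "S \<subseteq> carrier Bq" and assms_add: "\<And>x y. x \<in> S \<Longrightarrow> y \<in> S \<Longrightarrow> x \<oplus>\<^bsub>Bq\<^esub> y \<in> S"
        and mult: "\<And>x y. x \<in> S \<Longrightarrow> y \<in> S \<Longrightarrow> x \<otimes>\<^bsub>Bq\<^esub> y \<in> S" for S
    proof -
      have prod: "bproj (heis_mult x y) \<in> S" if "x \<in> HC" "y \<in> HC" "bproj x \<in> S" "bproj y \<in> S" for x y
        using mult[OF that(3,4)] bproj_hom(4)[OF that(1,2)] by simp
      have sc: "bproj (sg [] [] c) \<in> S" for c using S(1) by blast
      have minus: "bproj (sg b [] 1) \<in> S" if "b \<in> WY" for b
        using that
      proof (induction b)
        case (Cons y b)
        then have b: "b \<in> WY" "[y] \<in> WY" and y: "y \<in> Lf ` Ind \<or> y \<in> Lt' ` P_plus" by auto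
        have "sg [y] [] 1 \<in> HC" "sg b [] 1 \<in> HC" by (rule HC_single[OF b(2) words_WX(1)] HC_single[OF b(1) words_WX(1)])+
        moreover have "bproj (sg [y] [] 1) \<in> S" using y S(3,4) by blast
        ultimately have "bproj (heis_mult (sg [y] [] 1) (sg b [] 1)) \<in> S" using Cons.IH[OF b(1)] by (intro prod)
        then show ?case using heis_mult_sg_left[OF b(1), of "[y]" 1 "[]" 1] by simp
      qed (rule sc)
      have t: "bproj (sg [] [Lt \<nu>] 1) \<in> S" if "\<nu> \<in> P_plus" for \<nu>
        using bproj_torus[OF that] S(4) that by blast
      have e: "bproj (sg [] [Le i] 1) \<in> S" if i: "i \<in> Ind" for i
      proof -
        have P: "\<alpha> i \<in> P_plus" "- \<alpha> i \<in> P_plus" using i P_plus_root P_plus_uminus by auto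
        have w: "[] \<in> WX" "[Lt (- \<alpha> i)] \<in> WX" "[Lt (\<alpha> i), Le i] \<in> WX" "[Le i] \<in> WX"
          "[Lt (- \<alpha> i), Lt (\<alpha> i), Le i] \<in> WX" "[] \<in> WY" using i P by auto
        \<comment> \<open>\<open>e\<^sub>i\<close> is recovered from \<open>e\<^sub>i'\<close> by removing the torus element and the factor \<open>\<kappa> i\<close>\<close>
        define c where "c = inverse (\<kappa> i)"
        have c: "c * \<kappa> i = 1" unfolding c_def using q_i_nonzero[OF i] by (rule left_inverse)
        have "bproj (heis_mult (sg [] [Lt (- \<alpha> i)] 1) (sg [] [Lt (\<alpha> i), Le i] (\<kappa> i))) \<in> S"
          using i S(2) by (intro prod gens_HC t P(2)) auto
        then have 1: "bproj (sg [] [Lt (- \<alpha> i), Lt (\<alpha> i), Le i] (\<kappa> i)) \<in> S"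
          using heis_mult_sg_right[OF w(2), of "[]" 1 "[Lt (\<alpha> i), Le i]" "\<kappa> i"] by simp
        then have "bproj (heis_mult (sg [] [] c) (sg [] [Lt (- \<alpha> i), Lt (\<alpha> i), Le i] (\<kappa> i))) \<in> S"
          using sc w by (intro prod HC_single)
        then have "bproj (sg [] [Lt (- \<alpha> i), Lt (\<alpha> i), Le i] 1) \<in> S"
          using heis_mult_sg_right[OF w(1), of "[]" c _ "\<kappa> i"] c by simp
        moreover have "bproj (sg [] [Lt (- \<alpha> i), Lt (\<alpha> i), Le i] 1) = bproj (sg [] [Le i] 1)"
        proof -
          let ?p = "Poly_Mapping.single (Word [Lt (- \<alpha> i), Lt (\<alpha> i), Le i]) 1 - Poly_Mapping.single (Word [Le i]) 1"
          have "eqP 1 [Lt (- \<alpha> i), Lt (\<alpha> i), Le i] [Le i]"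
            using eqP_append[OF eqP_inv(2)[OF P(1)] w(1) w(4)] by simp
          then have "radP ?p"
            by (simp add: radP_def lpair_def psum_diff[OF coeff_additive_times]
                psum_single[OF coeff_additive_times] eqP_def)
          moreover have "?p \<in> carrier Fplus" using w by (intro Fplus_closed) auto
          ultimately have "tens 1 ?p \<in> heis_ker" by (intro heis_ker_tens Fminus_closed) auto
          then have k: "proj (tens 1 ?p) = proj 0"
            using proj_ker[OF tens_closed[OF Fminus_closed(6) \<open>?p \<in> carrier Fplus\<close>]] proj_zero by simp
          have "sg [] [Lt (- \<alpha> i), Lt (\<alpha> i), Le i] 1 = tens 1 ?p + sg [] [Le i] 1"
            unfolding tens_one[symmetric] tens_add_right[symmetric] by simp
          then have "bproj (sg [] [Lt (- \<alpha> i), Lt (\<alpha> i), Le i] 1) = bproj (tens 1 ?p) \<oplus>\<^bsub>Bq\<^esub> bproj (sg [] [Le i] 1)"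
            using bproj_hom(3)[OF tens_closed[OF Fminus_closed(6) \<open>?p \<in> carrier Fplus\<close>] HC_single[OF w(6) w(4)]]
            by simp
          also have "bproj (tens 1 ?p) = \<zero>\<^bsub>Bq\<^esub>" using k zero by (simp add: bproj_def)
          also have "\<zero>\<^bsub>Bq\<^esub> \<oplus>\<^bsub>Bq\<^esub> bproj (sg [] [Le i] 1) = bproj (sg [] [Le i] 1)"
            by (rule R.l_zero[OF bproj_hom(2)[OF HC_single[OF w(6) w(4)]]])
          finally show ?thesis .
        qed
        ultimately show ?thesis by simp
      qed
      have plus: "bproj (sg [] a c) \<in> S" if "a \<in> WX" for a c
        using that
      proof (induction a)
        case (Cons x a)
        then have x: "[x] \<in> WX" "x \<in> Le ` Ind \<or> x \<in> Lt ` P_plus" and a: "a \<in> WX" by auto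
        have "sg [] [x] 1 \<in> HC" "sg [] a c \<in> HC" by (rule HC_single[OF words_WY(1) x(1)] HC_single[OF words_WY(1) a])+
        moreover have "bproj (sg [] [x] 1) \<in> S" using x e t by blast
        ultimately have "bproj (heis_mult (sg [] [x] 1) (sg [] a c)) \<in> S" using Cons.IH[OF a] by (intro prod)
        then show ?case using heis_mult_sg_right[OF x(1), of "[]" 1 a c] by simp
      qed (rule sc)
      have "bproj x \<in> S" if "x \<in> HC" for x
        using that
      proof (induction x rule: HC_induct)
        case zero
        show ?case using sc[of 0] by simp
      next
        case (single b a c)
        have "bproj (heis_mult (sg b [] 1) (sg [] a c)) \<in> S"
          by (rule prod[OF HC_single[OF single(1) words_WX(1)] HC_single[OF words_WY(1) single(2)]
                minus[OF single(1)] plus[OF single(2)]])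
        then show ?case using heis_mult_sg_left[OF words_WY(1), of b 1 a c] by simp
      next
        case (add x y)
        then show ?case using bproj_hom(3)[OF add.hyps] \<open>bproj x \<in> S\<close> \<open>bproj y \<in> S\<close> assms_add by simp
      qed
      then show ?thesis unfolding image by blast
    qed
  qed
  show ?thesis
  proof (intro boson_presentation.intro boson_presentation_axioms.intro ip)
    show "scalar Bq c = bproj (sg [] [] c)" "eprime Bq i = bproj (sg [] [Lt (\<alpha> i), Le i] (\<kappa> i))" for c i
      by (simp_all only: Bq_selectors generators_sharp bproj_def)
    show "torus Bq \<nu> = bproj (sg [Lt' \<nu>] [] 1)" if "\<nu> \<in> P_plus" for \<nu>
      unfolding bproj_torus[OF that, symmetric] by (simp only: Bq_selectors generators_sharp bproj_def)
  qed
qed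

end

theorem corollary5:
  fixes scale :: "complex \<Rightarrow> 'g::ab_group_add \<Rightarrow> 'g"
    and brk :: "'g \<Rightarrow> 'g \<Rightarrow> 'g"
    and \<hh> :: "'g set"
    and \<alpha> :: "nat \<Rightarrow> 'g \<Rightarrow> complex"
    and qp :: "rat \<Rightarrow> complex"
    and \<phi> :: "('g \<Rightarrow> complex) form"
    and M :: "(('g \<Rightarrow> complex) heis set set, 'm) module"
    and N :: "(('g \<Rightarrow> complex) heis set, 'n) module"
  assumes "qboson scale brk \<hh> \<alpha> qp \<phi>"
  defines "P \<equiv> quantum_datum.P scale brk \<hh>"
    and "B \<equiv> qboson.Bq scale brk \<hh> \<alpha> qp \<phi>"
    and "C \<equiv> qboson.Bq_sub scale brk \<hh> \<alpha> qp \<phi>"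
  shows "(qboson.in_O scale brk \<hh> \<alpha> qp B M \<longrightarrow>
           (simple_module B M \<longrightarrow>
              (\<exists>\<mu>\<in>P. module_iso B M (qboson.H scale brk \<hh> \<alpha> qp B \<mu>))) \<and>
           semisimple_module B M)
       \<and> (qboson.in_O scale brk \<hh> \<alpha> qp C N \<longrightarrow>
           (simple_module C N \<longrightarrow>
              (\<exists>\<mu>\<in>P. module_iso C N (qboson.H scale brk \<hh> \<alpha> qp C \<mu>))) \<and>
           semisimple_module C N)"
  using boson_presentation.category_O[OF qboson.Bq_presentation[OF assms(1)], of M]
    boson_presentation.category_O[OF qboson.Bq_sub_presentation[OF assms(1)], of N]
  unfolding P_def B_def C_def by blast

end
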